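(* Let $H$ be a Hopf algebra over a field $\Bbbk$. The following are equivalent: (i) $H$ is pointed. (ii) For any left $H$-simple left $H$-comodule algebra $A$, every object of ${}^H_A\mathfrak{M}$ is free as a (left) $A$-module. (iii) For any right $H$-simple left $H$-comodule algebra $A$, every object of ${}^H\mathfrak{M}_A$ is free as a (right) $A$-module.
   Context: Everything is over a field $\Bbbk$; $\otimes=\otimes_\Bbbk$. Neither $H$ nor $A$ is assumed finite-dimensional. A Hopf algebra is pointed if each of its simple subcoalgebras is one-dimensional. A left $H$-comodule algebra is an algebra $A$ that is a left $H$-comodule whose coaction $\rho_A\colon A\to H\otimes A$, $\rho_A(a)=a_{(-1)}\otimes a_{(0)}$, is an algebra map. $A$ is left (resp. right) $H$-simple if $A\neq 0$ and its only left (resp. right) ideals that are $H$-subcomodules are $0$ and $A$. ${}^H_A\mathfrak{M}$ is the category of left $H$-comodules $M$ that are also left $A$-modules with $\rho_M(am)=a_{(-1)}m_{(-1)}\otimes a_{(0)}m_{(0)}$; ${}^H\mathfrak{M}_A$ is the category of left $H$-comodules $M$ that are also right $A$-modules with $\rho_M(ma)=m_{(-1)}a_{(-1)}\otimes m_{(0)}a_{(0)}$. Morphisms are the $H$-comodule maps that are $A$-module maps. *)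

theory Defs
  imports "HOL-Algebra.Module" "HOL-Algebra.AbelCoset" "HOL-Algebra.RingHom" "HOL.Hull"
begin

text \<open>
  Vector spaces over a field \<open>K\<close> are modules over \<open>K\<close> in the sense of the locale \<^locale>\<open>module\<close>.
  The multiplication and unit fields of the record are relevant only for algebras.
\<close>

section \<open>Linear maps and tensor products\<close>

definition linear_map ::
    "('k, 'x) ring_scheme \<Rightarrow> ('k, 'v, 'y) module_scheme \<Rightarrow> ('k, 'w, 'z) module_scheme \<Rightarrow> ('v \<Rightarrow> 'w) \<Rightarrow> bool"
  where "linear_map K V W f \<longleftrightarrow>
    f \<in> carrier V \<rightarrow> carrier W \<and>
    (\<forall>x\<in>carrier V. \<forall>y\<in>carrier V. f (x \<oplus>\<^bsub>V\<^esub> y) = f x \<oplus>\<^bsub>W\<^esub> f y) \<and>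
    (\<forall>c\<in>carrier K. \<forall>x\<in>carrier V. f (c \<odot>\<^bsub>V\<^esub> x) = c \<odot>\<^bsub>W\<^esub> f x)"

definition bilinear_map ::
    "('k, 'x) ring_scheme \<Rightarrow> ('k, 'u, 'y) module_scheme \<Rightarrow> ('k, 'v, 'z) module_scheme
      \<Rightarrow> ('k, 'w, 'r) module_scheme \<Rightarrow> ('u \<Rightarrow> 'v \<Rightarrow> 'w) \<Rightarrow> bool"
  where "bilinear_map K U V W \<beta> \<longleftrightarrow>
    (\<forall>u\<in>carrier U. linear_map K V W (\<lambda>v. \<beta> u v)) \<and>
    (\<forall>v\<in>carrier V. linear_map K U W (\<lambda>u. \<beta> u v))"

definition linear_span :: "('k, 'x) ring_scheme \<Rightarrow> ('k, 'v, 'y) module_scheme \<Rightarrow> 'v set \<Rightarrow> 'v set"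
  where "linear_span K V X = (\<lambda>N. submodule N K V) hull X"

definition finsupp :: "('k, 'x) ring_scheme \<Rightarrow> 'b set \<Rightarrow> ('b \<Rightarrow> 'k) set"
  where "finsupp R B =
    {c. (\<forall>b\<in>B. c b \<in> carrier R) \<and> (\<forall>b. b \<notin> B \<longrightarrow> c b = \<zero>\<^bsub>R\<^esub>) \<and> finite {b. c b \<noteq> \<zero>\<^bsub>R\<^esub>}}"

definition free_module :: "('k, 'x) ring_scheme \<Rightarrow> 'b set \<Rightarrow> ('k, 'b \<Rightarrow> 'k) module"
  where "free_module R B =
    \<lparr>carrier = finsupp R B, mult = undefined, one = undefined,
     zero = (\<lambda>_. \<zero>\<^bsub>R\<^esub>), add = (\<lambda>f g b. f b \<oplus>\<^bsub>R\<^esub> g b), smult = (\<lambda>c f b. c \<otimes>\<^bsub>R\<^esub> f b)\<rparr>"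

definition single :: "('k, 'x) ring_scheme \<Rightarrow> 'b \<Rightarrow> 'b \<Rightarrow> 'k"
  where "single R b = (\<lambda>b'. if b' = b then \<one>\<^bsub>R\<^esub> else \<zero>\<^bsub>R\<^esub>)"

definition quotient_module :: "('k, 'v, 'y) module_scheme \<Rightarrow> 'v set \<Rightarrow> ('k, 'v set) module"
  where "quotient_module V N =
    \<lparr>carrier = a_rcosets\<^bsub>V\<^esub> N, mult = undefined, one = undefined,
     zero = N, add = set_add V, smult = (\<lambda>c X. \<Union>x\<in>X. N +>\<^bsub>V\<^esub> (c \<odot>\<^bsub>V\<^esub> x))\<rparr>"

text \<open>
  The tensor product is the quotient of the free vector space on \<open>V \<times> W\<close> by the subspace spanned by
  the bilinearity relations.
\<close>

definition tensor_relations ::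
    "('k, 'x) ring_scheme \<Rightarrow> ('k, 'v, 'y) module_scheme \<Rightarrow> ('k, 'w, 'z) module_scheme \<Rightarrow> ('v \<times> 'w \<Rightarrow> 'k) set"
  where "tensor_relations K V W =
    (let F = free_module K (carrier V \<times> carrier W); \<delta> = single K in
     linear_span K F
      ({\<delta> (v \<oplus>\<^bsub>V\<^esub> v', w) \<ominus>\<^bsub>F\<^esub> (\<delta> (v, w) \<oplus>\<^bsub>F\<^esub> \<delta> (v', w)) | v v' w.
          v \<in> carrier V \<and> v' \<in> carrier V \<and> w \<in> carrier W} \<union>
       {\<delta> (v, w \<oplus>\<^bsub>W\<^esub> w') \<ominus>\<^bsub>F\<^esub> (\<delta> (v, w) \<oplus>\<^bsub>F\<^esub> \<delta> (v, w')) | v w w'.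
          v \<in> carrier V \<and> w \<in> carrier W \<and> w' \<in> carrier W} \<union>
       {\<delta> (c \<odot>\<^bsub>V\<^esub> v, w) \<ominus>\<^bsub>F\<^esub> c \<odot>\<^bsub>F\<^esub> \<delta> (v, w) | c v w.
          c \<in> carrier K \<and> v \<in> carrier V \<and> w \<in> carrier W} \<union>
       {\<delta> (v, c \<odot>\<^bsub>W\<^esub> w) \<ominus>\<^bsub>F\<^esub> c \<odot>\<^bsub>F\<^esub> \<delta> (v, w) | c v w.
          c \<in> carrier K \<and> v \<in> carrier V \<and> w \<in> carrier W}))"

type_synonym ('k, 'v, 'w) tensor = "('v \<times> 'w \<Rightarrow> 'k) set"

definition tensor_space ::
    "('k, 'x) ring_scheme \<Rightarrow> ('k, 'v, 'y) module_scheme \<Rightarrow> ('k, 'w, 'z) module_scheme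
      \<Rightarrow> ('k, ('k, 'v, 'w) tensor) module"
  where "tensor_space K V W =
    quotient_module (free_module K (carrier V \<times> carrier W)) (tensor_relations K V W)"

definition pure_tensor ::
    "('k, 'x) ring_scheme \<Rightarrow> ('k, 'v, 'y) module_scheme \<Rightarrow> ('k, 'w, 'z) module_scheme
      \<Rightarrow> 'v \<Rightarrow> 'w \<Rightarrow> ('k, 'v, 'w) tensor"
  where "pure_tensor K V W v w =
    tensor_relations K V W +>\<^bsub>free_module K (carrier V \<times> carrier W)\<^esub> single K (v, w)"

text \<open>
  The linear map \<open>V \<otimes> W \<rightarrow> U\<close> with \<open>v \<otimes> w \<mapsto> \<beta> v w\<close>, for bilinear \<open>\<beta>\<close>. The value is computed from a
  representative \<open>f\<close> of the tensor \<open>t\<close>; bilinearity makes the choice irrelevant.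
\<close>

definition tensor_lift ::
    "('k, 'x) ring_scheme \<Rightarrow> ('k, 'u, 'y) module_scheme \<Rightarrow> ('v \<Rightarrow> 'w \<Rightarrow> 'u) \<Rightarrow> ('k, 'v, 'w) tensor \<Rightarrow> 'u"
  where "tensor_lift K U \<beta> t =
    (let f = (SOME f. f \<in> t) in
     \<Oplus>\<^bsub>U\<^esub> p\<in>{p. f p \<noteq> \<zero>\<^bsub>K\<^esub>}. f p \<odot>\<^bsub>U\<^esub> \<beta> (fst p) (snd p))"

text \<open>\<open>f \<otimes> g\<close>, with values in \<open>V' \<otimes> W'\<close>.\<close>

definition tensor_map ::
    "('k, 'x) ring_scheme \<Rightarrow> ('k, 'v1, 'y) module_scheme \<Rightarrow> ('k, 'w1, 'z) module_scheme
      \<Rightarrow> ('v \<Rightarrow> 'v1) \<Rightarrow> ('w \<Rightarrow> 'w1) \<Rightarrow> ('k, 'v, 'w) tensor \<Rightarrow> ('k, 'v1, 'w1) tensor"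
  where "tensor_map K V' W' f g =
    tensor_lift K (tensor_space K V' W') (\<lambda>v w. pure_tensor K V' W' (f v) (g w))"

text \<open>
  For bilinear \<open>\<beta> : V \<times> V' \<rightarrow> P\<close> and \<open>\<gamma> : W \<times> W' \<rightarrow> Q\<close>, the bilinear map
  \<open>(V \<otimes> W) \<times> (V' \<otimes> W') \<rightarrow> P \<otimes> Q\<close> with \<open>(v \<otimes> w, v' \<otimes> w') \<mapsto> \<beta> v v' \<otimes> \<gamma> w w'\<close>.
\<close>

definition tensor_bimap ::
    "('k, 'x) ring_scheme \<Rightarrow> ('k, 'p, 'y) module_scheme \<Rightarrow> ('k, 'q, 'z) module_scheme
      \<Rightarrow> ('v \<Rightarrow> 'v1 \<Rightarrow> 'p) \<Rightarrow> ('w \<Rightarrow> 'w1 \<Rightarrow> 'q)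
      \<Rightarrow> ('k, 'v, 'w) tensor \<Rightarrow> ('k, 'v1, 'w1) tensor \<Rightarrow> ('k, 'p, 'q) tensor"
  where "tensor_bimap K P Q \<beta> \<gamma> s t =
    tensor_lift K (tensor_space K P Q)
      (\<lambda>v w. tensor_lift K (tensor_space K P Q) (\<lambda>v' w'. pure_tensor K P Q (\<beta> v v') (\<gamma> w w')) t) s"

text \<open>The associator \<open>(U \<otimes> V) \<otimes> W \<rightarrow> U \<otimes> (V \<otimes> W)\<close>.\<close>

definition tensor_assoc ::
    "('k, 'x) ring_scheme \<Rightarrow> ('k, 'u, 'y) module_scheme \<Rightarrow> ('k, 'v, 'z) module_scheme
      \<Rightarrow> ('k, 'w, 'r) module_scheme
      \<Rightarrow> ('k, ('k, 'u, 'v) tensor, 'w) tensor \<Rightarrow> ('k, 'u, ('k, 'v, 'w) tensor) tensor"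
  where "tensor_assoc K U V W =
    (let T = tensor_space K U (tensor_space K V W) in
     tensor_lift K T
      (\<lambda>x w. tensor_lift K T
        (\<lambda>u v. pure_tensor K U (tensor_space K V W) u (pure_tensor K V W v w)) x))"

text \<open>The image of \<open>X \<otimes> Y\<close> in \<open>V \<otimes> W\<close>, for subspaces \<open>X \<subseteq> V\<close> and \<open>Y \<subseteq> W\<close>.\<close>

definition tensor_subspace ::
    "('k, 'x) ring_scheme \<Rightarrow> ('k, 'v, 'y) module_scheme \<Rightarrow> ('k, 'w, 'z) module_scheme
      \<Rightarrow> 'v set \<Rightarrow> 'w set \<Rightarrow> ('k, 'v, 'w) tensor set"
  where "tensor_subspace K V W X Y =
    linear_span K (tensor_space K V W) {pure_tensor K V W x y | x y. x \<in> X \<and> y \<in> Y}"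


section \<open>Algebras\<close>

text \<open>
  Associative unital algebras; the library's \<^locale>\<open>algebra\<close> is restricted to commutative ones.
\<close>

locale assoc_algebra = K?: field K + module K A + A?: ring A
  for K :: "('k, 'x) ring_scheme" (structure) and A :: "('k, 'a, 'y) module_scheme" (structure) +
  assumes mult_bilinear: "bilinear_map K A A A (mult A)"

definition algebra_hom ::
    "('k, 'x) ring_scheme \<Rightarrow> ('k, 'a, 'y) module_scheme \<Rightarrow> ('k, 'b, 'z) module_scheme \<Rightarrow> ('a \<Rightarrow> 'b) \<Rightarrow> bool"
  where "algebra_hom K A B f \<longleftrightarrow> linear_map K A B f \<and> f \<in> ring_hom A B"

definition ground_algebra :: "('k, 'x) ring_scheme \<Rightarrow> ('k, 'k) module"
  where "ground_algebra K =
    \<lparr>carrier = carrier K, mult = mult K, one = one K, zero = zero K, add = add K, smult = mult K\<rparr>"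

definition tensor_algebra ::
    "('k, 'x) ring_scheme \<Rightarrow> ('k, 'a, 'y) module_scheme \<Rightarrow> ('k, 'b, 'z) module_scheme
      \<Rightarrow> ('k, ('k, 'a, 'b) tensor) module"
  where "tensor_algebra K A B =
    (tensor_space K A B)
      \<lparr>mult := tensor_bimap K A B (mult A) (mult B), one := pure_tensor K A B \<one>\<^bsub>A\<^esub> \<one>\<^bsub>B\<^esub>\<rparr>"


section \<open>Coalgebras, Hopf algebras and comodules\<close>

record ('k, 'h) coalgebra = "('k, 'h) module" +
  comult :: "'h \<Rightarrow> ('k, 'h, 'h) tensor"
  counit :: "'h \<Rightarrow> 'k"

record ('k, 'h) hopf_algebra = "('k, 'h) coalgebra" +
  antipode :: "'h \<Rightarrow> 'h"

locale coalgebra = K?: field K + module K H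
  for K :: "('k, 'x) ring_scheme" (structure) and H :: "('k, 'h, 'y) coalgebra_scheme" (structure) +
  assumes comult_linear: "linear_map K H (tensor_space K H H) (comult H)"
    and counit_linear: "linear_map K H (ground_algebra K) (counit H)"
    and coassoc: "h \<in> carrier H \<Longrightarrow>
      tensor_assoc K H H H (tensor_map K (tensor_space K H H) H (comult H) (\<lambda>x. x) (comult H h)) =
      tensor_map K H (tensor_space K H H) (\<lambda>x. x) (comult H) (comult H h)"
    and counit_l: "h \<in> carrier H \<Longrightarrow> tensor_lift K H (\<lambda>x y. counit H x \<odot>\<^bsub>H\<^esub> y) (comult H h) = h"
    and counit_r: "h \<in> carrier H \<Longrightarrow> tensor_lift K H (\<lambda>x y. counit H y \<odot>\<^bsub>H\<^esub> x) (comult H h) = h"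

locale bialgebra = assoc_algebra K H + coalgebra K H
  for K :: "('k, 'x) ring_scheme" (structure) and H :: "('k, 'h, 'y) coalgebra_scheme" (structure) +
  assumes comult_algebra_hom: "algebra_hom K H (tensor_algebra K H H) (comult H)"
    and counit_algebra_hom: "algebra_hom K H (ground_algebra K) (counit H)"

locale hopf_algebra = bialgebra K H
  for K :: "('k, 'x) ring_scheme" (structure) and H :: "('k, 'h, 'y) hopf_algebra_scheme" (structure) +
  assumes antipode_linear: "linear_map K H H (antipode H)"
    and antipode_l: "h \<in> carrier H \<Longrightarrow>
      tensor_lift K H (\<lambda>x y. antipode H x \<otimes>\<^bsub>H\<^esub> y) (comult H h) = counit H h \<odot>\<^bsub>H\<^esub> \<one>\<^bsub>H\<^esub>"
    and antipode_r: "h \<in> carrier H \<Longrightarrow>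
      tensor_lift K H (\<lambda>x y. x \<otimes>\<^bsub>H\<^esub> antipode H y) (comult H h) = counit H h \<odot>\<^bsub>H\<^esub> \<one>\<^bsub>H\<^esub>"

definition subcoalgebra :: "('k, 'x) ring_scheme \<Rightarrow> ('k, 'h, 'y) coalgebra_scheme \<Rightarrow> 'h set \<Rightarrow> bool"
  where "subcoalgebra K H D \<longleftrightarrow>
    submodule D K H \<and> comult H ` D \<subseteq> tensor_subspace K H H D D"

definition simple_subcoalgebra :: "('k, 'x) ring_scheme \<Rightarrow> ('k, 'h, 'y) coalgebra_scheme \<Rightarrow> 'h set \<Rightarrow> bool"
  where "simple_subcoalgebra K H D \<longleftrightarrow>
    subcoalgebra K H D \<and> D \<noteq> {\<zero>\<^bsub>H\<^esub>} \<and>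
    (\<forall>E. subcoalgebra K H E \<and> E \<subseteq> D \<longrightarrow> E = {\<zero>\<^bsub>H\<^esub>} \<or> E = D)"

definition one_dimensional :: "('k, 'x) ring_scheme \<Rightarrow> ('k, 'v, 'y) module_scheme \<Rightarrow> 'v set \<Rightarrow> bool"
  where "one_dimensional K V D \<longleftrightarrow>
    (\<exists>d\<in>carrier V. d \<noteq> \<zero>\<^bsub>V\<^esub> \<and> D = {c \<odot>\<^bsub>V\<^esub> d | c. c \<in> carrier K})"

definition pointed :: "('k, 'x) ring_scheme \<Rightarrow> ('k, 'h, 'y) coalgebra_scheme \<Rightarrow> bool"
  where "pointed K H \<longleftrightarrow> (\<forall>D. simple_subcoalgebra K H D \<longrightarrow> one_dimensional K H D)"

record ('k, 'b, 'h) comodule = "('k, 'b) module" +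
  coact :: "'b \<Rightarrow> ('k, 'h, 'b) tensor"

locale left_comodule = coalgebra K H + M?: module K M
  for K :: "('k, 'x) ring_scheme" (structure) and H :: "('k, 'h, 'y) coalgebra_scheme" (structure)
    and M :: "('k, 'm, 'h, 'z) comodule_scheme" (structure) +
  assumes coact_linear: "linear_map K M (tensor_space K H M) (coact M)"
    and coact_coassoc: "m \<in> carrier M \<Longrightarrow>
      tensor_assoc K H H M (tensor_map K (tensor_space K H H) M (comult H) (\<lambda>x. x) (coact M m)) =
      tensor_map K H (tensor_space K H M) (\<lambda>x. x) (coact M) (coact M m)"
    and coact_counit: "m \<in> carrier M \<Longrightarrow>
      tensor_lift K M (\<lambda>x y. counit H x \<odot>\<^bsub>M\<^esub> y) (coact M m) = m"

definition subcomodule ::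
    "('k, 'x) ring_scheme \<Rightarrow> ('k, 'h, 'y) coalgebra_scheme \<Rightarrow> ('k, 'm, 'h, 'z) comodule_scheme
      \<Rightarrow> 'm set \<Rightarrow> bool"
  where "subcomodule K H M N \<longleftrightarrow>
    submodule N K M \<and> coact M ` N \<subseteq> tensor_subspace K H M (carrier H) N"


section \<open>Comodule algebras and relative Hopf modules\<close>

locale left_comodule_algebra = bialgebra K H + left_comodule K H A + A?: assoc_algebra K A
  for K :: "('k, 'x) ring_scheme" (structure) and H :: "('k, 'h, 'y) coalgebra_scheme" (structure)
    and A :: "('k, 'a, 'h, 'z) comodule_scheme" (structure) +
  assumes coact_algebra_hom: "algebra_hom K A (tensor_algebra K H A) (coact A)"

definition left_ideal :: "('a, 'y) ring_scheme \<Rightarrow> 'a set \<Rightarrow> bool"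
  where "left_ideal A I \<longleftrightarrow>
    additive_subgroup I A \<and> (\<forall>a\<in>carrier A. \<forall>x\<in>I. a \<otimes>\<^bsub>A\<^esub> x \<in> I)"

definition right_ideal :: "('a, 'y) ring_scheme \<Rightarrow> 'a set \<Rightarrow> bool"
  where "right_ideal A I \<longleftrightarrow>
    additive_subgroup I A \<and> (\<forall>a\<in>carrier A. \<forall>x\<in>I. x \<otimes>\<^bsub>A\<^esub> a \<in> I)"

definition left_H_simple ::
    "('k, 'x) ring_scheme \<Rightarrow> ('k, 'h, 'y) coalgebra_scheme \<Rightarrow> ('k, 'a, 'h, 'z) comodule_scheme \<Rightarrow> bool"
  where "left_H_simple K H A \<longleftrightarrow>
    carrier A \<noteq> {\<zero>\<^bsub>A\<^esub>} \<and>
    (\<forall>I. left_ideal A I \<and> subcomodule K H A I \<longrightarrow> I = {\<zero>\<^bsub>A\<^esub>} \<or> I = carrier A)"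

definition right_H_simple ::
    "('k, 'x) ring_scheme \<Rightarrow> ('k, 'h, 'y) coalgebra_scheme \<Rightarrow> ('k, 'a, 'h, 'z) comodule_scheme \<Rightarrow> bool"
  where "right_H_simple K H A \<longleftrightarrow>
    carrier A \<noteq> {\<zero>\<^bsub>A\<^esub>} \<and>
    (\<forall>I. right_ideal A I \<and> subcomodule K H A I \<longrightarrow> I = {\<zero>\<^bsub>A\<^esub>} \<or> I = carrier A)"

text \<open>
  Objects of the categories \<open>\<^sup>H\<^sub>A\<MM>\<close> and \<open>\<^sup>H\<MM>\<^sub>A\<close>. Bilinearity over \<open>K\<close> of the action says that it is
  biadditive and that the vector space structure of \<open>M\<close> is the one induced by the action of \<open>A\<close>.
\<close>

locale left_relative_hopf_module = left_comodule_algebra K H A + M?: left_comodule K H M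
  for K :: "('k, 'x) ring_scheme" (structure) and H :: "('k, 'h, 'y) coalgebra_scheme" (structure)
    and A :: "('k, 'a, 'h, 'z) comodule_scheme" (structure)
    and M :: "('k, 'm, 'h, 'r) comodule_scheme" (structure) and act :: "'a \<Rightarrow> 'm \<Rightarrow> 'm" +
  assumes act_bilinear: "bilinear_map K A M M act"
    and act_one: "m \<in> carrier M \<Longrightarrow> act \<one>\<^bsub>A\<^esub> m = m"
    and act_mult: "\<lbrakk>a \<in> carrier A; b \<in> carrier A; m \<in> carrier M\<rbrakk> \<Longrightarrow> act (a \<otimes>\<^bsub>A\<^esub> b) m = act a (act b m)"
    and coact_act: "\<lbrakk>a \<in> carrier A; m \<in> carrier M\<rbrakk> \<Longrightarrow>
      coact M (act a m) = tensor_bimap K H M (mult H) act (coact A a) (coact M m)"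

locale right_relative_hopf_module = left_comodule_algebra K H A + M?: left_comodule K H M
  for K :: "('k, 'x) ring_scheme" (structure) and H :: "('k, 'h, 'y) coalgebra_scheme" (structure)
    and A :: "('k, 'a, 'h, 'z) comodule_scheme" (structure)
    and M :: "('k, 'm, 'h, 'r) comodule_scheme" (structure) and act :: "'m \<Rightarrow> 'a \<Rightarrow> 'm" +
  assumes act_bilinear: "bilinear_map K M A M act"
    and act_one: "m \<in> carrier M \<Longrightarrow> act m \<one>\<^bsub>A\<^esub> = m"
    and act_mult: "\<lbrakk>a \<in> carrier A; b \<in> carrier A; m \<in> carrier M\<rbrakk> \<Longrightarrow> act m (a \<otimes>\<^bsub>A\<^esub> b) = act (act m a) b"
    and coact_act: "\<lbrakk>a \<in> carrier A; m \<in> carrier M\<rbrakk> \<Longrightarrow>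
      coact M (act m a) = tensor_bimap K H M (mult H) act (coact M m) (coact A a)"

text \<open>Existence of a basis: every element is a unique finite linear combination of elements of \<open>B\<close>.\<close>

definition free_left_module ::
    "('a, 'y) ring_scheme \<Rightarrow> ('m, 'z) ring_scheme \<Rightarrow> ('a \<Rightarrow> 'm \<Rightarrow> 'm) \<Rightarrow> bool"
  where "free_left_module A M act \<longleftrightarrow>
    (\<exists>B\<subseteq>carrier M. \<forall>m\<in>carrier M. \<exists>!c. c \<in> finsupp A B \<and>
      m = (\<Oplus>\<^bsub>M\<^esub> b\<in>{b. c b \<noteq> \<zero>\<^bsub>A\<^esub>}. act (c b) b))"

definition free_right_module ::
    "('a, 'y) ring_scheme \<Rightarrow> ('m, 'z) ring_scheme \<Rightarrow> ('m \<Rightarrow> 'a \<Rightarrow> 'm) \<Rightarrow> bool"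
  where "free_right_module A M act \<longleftrightarrow>
    (\<exists>B\<subseteq>carrier M. \<forall>m\<in>carrier M. \<exists>!c. c \<in> finsupp A B \<and>
      m = (\<Oplus>\<^bsub>M\<^esub> b\<in>{b. c b \<noteq> \<zero>\<^bsub>A\<^esub>}. act b (c b)))"

text \<open>
  HOL cannot quantify over types inside a formula. To quantify over all comodule algebras and relative
  Hopf modules, take their carriers to be subsets of types \<open>'a\<close> and \<open>'m\<close> that are arbitrary except
  that they are infinite and admit an injection from \<open>carrier H\<close>. Such types have room for every
  finite-dimensional vector space over the ground field of \<open>H\<close>; with smaller types a freeness
  condition could hold merely for lack of algebras or modules.
\<close>

end

theory Submission
  imports Defs
begin

text \<open>
  If \<open>H\<close> is pointed, a nonzero quotient \<open>M / N\<close> of relative Hopf modules contains a one-dimensional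
  subcomodule spanned by a semi-invariant \<open>m\<close> of some grouplike weight \<open>g\<close>. The annihilator of \<open>m\<close> in \<open>A\<close>
  is an ideal and a subcomodule, because translation by \<open>g\<close> is invertible; so it is \<open>0\<close>, the submodule
  generated by \<open>m\<close> is free, and Zorn's lemma yields a basis of \<open>M\<close>.
  Conversely, if \<open>H\<close> is not pointed, it has a simple comodule \<open>V\<close> of dimension \<open>n > 1\<close>. Choosing \<open>n\<close> minimal
  makes the dual comodule \<open>V\<^sup>*\<close> simple as well, which spares the bijectivity of the antipode. The matrix algebra
  \<open>End V\<close>, or its opposite, is then an \<open>H\<close>-simple comodule algebra, and \<open>V\<close> itself is a relative
  Hopf module that is too small to be free.
\<close>

section \<open>Vector spaces\<close>

text \<open>The tool throughout is to contract the left leg of a tensor with linear functionals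
  \<open>f\<close> on \<open>H\<close>. Functionals separate the points of any vector space, so the
  operators \<open>m \<mapsto> f(m_(-1)) m_(0)\<close> determine a coaction: comodules become
  modules over the dual algebra, subcomodules the stable subspaces, and coassociativity the rule for
  composing operators. The quotient \<open>M / N\<close> is not formed; statements about it are
  congruences modulo \<open>N\<close>, and dimension is expressed by the least size of a finite
  generating set. The two sides are treated together by making the products of \<open>H\<close> and
  \<open>A\<close> parameters, to be replaced by their opposites. In the converse this exchanges the
  roles of the two comatrices: the ideals of the matrix algebra correspond to subcomodules of
  \<open>V\<close> on one side and of its dual on the other, which is why both must be simple. The
  algebra and the module have to live in the given types, so their structure is transported from
  \<open>K^n\<close> along an injection built from the scalar multiples of the unit of
  \<open>H\<close>.\<close>

locale vspace = K?: field K + module K V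
  for K :: "('k, 'x) ring_scheme" (structure) and V :: "('k, 'v, 'y) module_scheme" (structure)

abbreviation functional ::
    "('k, 'x) ring_scheme \<Rightarrow> ('k, 'v, 'y) module_scheme \<Rightarrow> ('v \<Rightarrow> 'k) \<Rightarrow> bool"
  where "functional K V f \<equiv> linear_map K V (ground_algebra K) f"

lemma ground_algebra_simps [simp]:
  "carrier (ground_algebra K) = carrier K" "zero (ground_algebra K) = zero K"
  "add (ground_algebra K) = add K" "smult (ground_algebra K) = mult K"
  "mult (ground_algebra K) = mult K" "one (ground_algebra K) = one K"
  by (simp_all add: ground_algebra_def)

lemma finsum_ground_algebra [simp]: "finsum (ground_algebra K) = finsum K"
  by (simp add: finsum_def finprod_def ground_algebra_def fun_eq_iff)

lemma a_inv_ground [simp]: "a_inv (ground_algebra K) x = a_inv K x"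
  by (simp add: a_inv_def m_inv_def)

section \<open>Linear maps and finite sums\<close>

lemma linear_mapI:
  assumes "\<And>x. x \<in> carrier V \<Longrightarrow> f x \<in> carrier W"
    and "\<And>x y. x \<in> carrier V \<Longrightarrow> y \<in> carrier V \<Longrightarrow> f (x \<oplus>\<^bsub>V\<^esub> y) = f x \<oplus>\<^bsub>W\<^esub> f y"
    and "\<And>c x. c \<in> carrier K \<Longrightarrow> x \<in> carrier V \<Longrightarrow> f (c \<odot>\<^bsub>V\<^esub> x) = c \<odot>\<^bsub>W\<^esub> f x"
  shows "linear_map K V W f"
  using assms by (auto simp: linear_map_def)

lemma linear_mapD:
  assumes "linear_map K V W f"
  shows "\<And>x. x \<in> carrier V \<Longrightarrow> f x \<in> carrier W"
    and "\<And>x y. x \<in> carrier V \<Longrightarrow> y \<in> carrier V \<Longrightarrow> f (x \<oplus>\<^bsub>V\<^esub> y) = f x \<oplus>\<^bsub>W\<^esub> f y"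
    and "\<And>c x. c \<in> carrier K \<Longrightarrow> x \<in> carrier V \<Longrightarrow> f (c \<odot>\<^bsub>V\<^esub> x) = c \<odot>\<^bsub>W\<^esub> f x"
  using assms by (auto simp: linear_map_def)

lemma linear_map_cong:
  assumes "vspace K V" "linear_map K V W f" "\<And>x. x \<in> carrier V \<Longrightarrow> f x = g x"
  shows "linear_map K V W g"
proof -
  interpret V: vspace K V by fact
  show ?thesis using assms(2,3) unfolding linear_map_def by (auto simp: Pi_def)
qed

lemma linear_map_id: "linear_map K V V (\<lambda>x. x)"
  by (simp add: linear_map_def)

lemma linear_map_comp:
  assumes "linear_map K V W f" "linear_map K W U g"
  shows "linear_map K V U (\<lambda>x. g (f x))"
  using assms unfolding linear_map_def Pi_def by simp

lemma linear_map_zero: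
  assumes "vspace K V" "vspace K W" "linear_map K V W f"
  shows "f \<zero>\<^bsub>V\<^esub> = \<zero>\<^bsub>W\<^esub>"
proof -
  interpret V: vspace K V by fact
  interpret W: vspace K W by fact
  have "f (\<zero>\<^bsub>K\<^esub> \<odot>\<^bsub>V\<^esub> \<zero>\<^bsub>V\<^esub>) = \<zero>\<^bsub>K\<^esub> \<odot>\<^bsub>W\<^esub> f \<zero>\<^bsub>V\<^esub>"
    by (rule linear_mapD(3)[OF assms(3)]) auto
  moreover have "f \<zero>\<^bsub>V\<^esub> \<in> carrier W" by (rule linear_mapD(1)[OF assms(3)]) auto
  ultimately show ?thesis by simp
qed

lemma linear_map_neg:
  assumes "vspace K V" "vspace K W" "linear_map K V W f" "x \<in> carrier V"
  shows "f (\<ominus>\<^bsub>V\<^esub> x) = \<ominus>\<^bsub>W\<^esub> f x"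
proof -
  interpret V: vspace K V by fact
  interpret W: vspace K W by fact
  have "f (\<ominus>\<^bsub>V\<^esub> x) \<oplus>\<^bsub>W\<^esub> f x = f (\<ominus>\<^bsub>V\<^esub> x \<oplus>\<^bsub>V\<^esub> x)"
    using assms(4) by (intro linear_mapD(2)[OF assms(3), symmetric]) auto
  also have "\<dots> = \<zero>\<^bsub>W\<^esub>"
    using assms(4) linear_map_zero[OF assms(1-3)] by (simp add: V.M.l_neg)
  finally show ?thesis
    using assms(4) linear_mapD(1)[OF assms(3)] by (intro W.M.minus_equality[symmetric]) auto
qed

lemma linear_map_diff:
  assumes "vspace K V" "vspace K W" "linear_map K V W f" "x \<in> carrier V" "y \<in> carrier V"
  shows "f (x \<ominus>\<^bsub>V\<^esub> y) = f x \<ominus>\<^bsub>W\<^esub> f y"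
proof -
  interpret V: vspace K V by fact
  show ?thesis
    using assms(4,5) by (simp add: a_minus_def linear_mapD(2)[OF assms(3)] linear_map_neg[OF assms(1-3)])
qed

lemma linear_map_finsum:
  assumes "vspace K V" "vspace K W" "linear_map K V W f" "x \<in> I \<rightarrow> carrier V"
  shows "f (\<Oplus>\<^bsub>V\<^esub>i\<in>I. x i) = (\<Oplus>\<^bsub>W\<^esub>i\<in>I. f (x i))"
proof -
  interpret V: vspace K V by fact
  interpret W: vspace K W by fact
  show ?thesis
    using assms(4)
  proof (induct I rule: infinite_finite_induct)
    case (infinite A)
    then show ?case using linear_map_zero[OF assms(1-3)] by (simp add: V.finsum_infinite W.finsum_infinite)
  next
    case empty
    then show ?case using linear_map_zero[OF assms(1-3)] by simp
  next
    case (insert i F)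
    then have "(\<lambda>i. f (x i)) \<in> F \<rightarrow> carrier W" "f (x i) \<in> carrier W"
      using linear_mapD(1)[OF assms(3)] by auto
    with insert show ?case
      by (simp add: V.finsum_insert W.finsum_insert linear_mapD(2)[OF assms(3)] Pi_def)
  qed
qed

lemma (in abelian_monoid) finsum_swap:
  assumes "finite I" "finite J" "\<And>i j. i \<in> I \<Longrightarrow> j \<in> J \<Longrightarrow> f i j \<in> carrier G"
  shows "(\<Oplus>i\<in>I. \<Oplus>j\<in>J. f i j) = (\<Oplus>j\<in>J. \<Oplus>i\<in>I. f i j)"
  using assms(1,3)
proof (induct I rule: finite_induct)
  case empty
  then show ?case by simp
next
  case (insert x F)
  have "(\<Oplus>i\<in>insert x F. \<Oplus>j\<in>J. f i j) = (\<Oplus>j\<in>J. f x j) \<oplus> (\<Oplus>i\<in>F. \<Oplus>j\<in>J. f i j)"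
    using insert by (intro finsum_insert) (auto intro!: finsum_closed)
  also have "\<dots> = (\<Oplus>j\<in>J. f x j) \<oplus> (\<Oplus>j\<in>J. \<Oplus>i\<in>F. f i j)" using insert by simp
  also have "\<dots> = (\<Oplus>j\<in>J. f x j \<oplus> (\<Oplus>i\<in>F. f i j))"
    using insert by (intro finsum_addf[symmetric]) (auto intro!: finsum_closed)
  also have "\<dots> = (\<Oplus>j\<in>J. \<Oplus>i\<in>insert x F. f i j)"
    using insert by (intro finsum_cong') (auto intro!: finsum_closed)
  finally show ?case .
qed

lemma (in abelian_group) diff_swap:
  assumes "a \<in> carrier G" "b \<in> carrier G" "c \<in> carrier G" "d \<in> carrier G" "a \<oplus> b = c \<oplus> d"
  shows "a \<ominus> c = d \<ominus> b"
proof -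
  have "a \<ominus> c = (a \<oplus> b) \<oplus> (\<ominus> b \<oplus> \<ominus> c)" using assms(1-4) by (simp add: a_minus_def a_assoc r_neg1 r_neg2)
  also have "\<dots> = d \<ominus> b" unfolding assms(5) using assms(1-4)
    by (simp add: a_minus_def a_comm[of c d] a_comm[of "\<ominus> b" "\<ominus> c"] a_assoc r_neg1 r_neg2)
  finally show ?thesis .
qed

lemma (in abelian_group) diff_eq_zero_iff:
  assumes "a \<in> carrier G" "b \<in> carrier G"
  shows "a \<ominus> b = \<zero> \<longleftrightarrow> a = b"
  using assms by (metis a_minus_def add.inv_closed l_zero minus_equality minus_minus r_neg)

lemma (in field) vspace_ground_algebra: "vspace R (ground_algebra R)"
proof -
  have "abelian_group (ground_algebra R)"
    by (rule abelian_groupI) (auto simp: a_ac intro!: bexI[where x="\<ominus> x" for x] l_neg)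
  then have "module R (ground_algebra R)"
    by (intro moduleI) (auto simp: is_cring l_distr r_distr m_assoc)
  then show ?thesis by (intro vspace.intro) (simp_all add: field_axioms)
qed

section \<open>Subspaces, spans and functionals\<close>

context vspace
begin

lemma vspace_ground [simp]: "vspace K (ground_algebra K)"
  by (rule K.vspace_ground_algebra)

lemma functional_zero: "functional K V f \<Longrightarrow> f \<zero>\<^bsub>V\<^esub> = \<zero>\<^bsub>K\<^esub>"
  using linear_map_zero[OF vspace_axioms vspace_ground] by simp

lemma submodule_vspace:
  assumes "submodule N K V"
  shows "N \<subseteq> carrier V" "\<zero>\<^bsub>V\<^esub> \<in> N" "\<And>x y. x \<in> N \<Longrightarrow> y \<in> N \<Longrightarrow> x \<oplus>\<^bsub>V\<^esub> y \<in> N"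
    "\<And>c x. c \<in> carrier K \<Longrightarrow> x \<in> N \<Longrightarrow> c \<odot>\<^bsub>V\<^esub> x \<in> N"
    "\<And>x. x \<in> N \<Longrightarrow> \<ominus>\<^bsub>V\<^esub> x \<in> N" "\<And>x y. x \<in> N \<Longrightarrow> y \<in> N \<Longrightarrow> x \<ominus>\<^bsub>V\<^esub> y \<in> N"
proof -
  note E = submoduleE[OF assms]
  show "N \<subseteq> carrier V" "\<And>x y. x \<in> N \<Longrightarrow> y \<in> N \<Longrightarrow> x \<oplus>\<^bsub>V\<^esub> y \<in> N"
    "\<And>c x. c \<in> carrier K \<Longrightarrow> x \<in> N \<Longrightarrow> c \<odot>\<^bsub>V\<^esub> x \<in> N" "\<And>x. x \<in> N \<Longrightarrow> \<ominus>\<^bsub>V\<^esub> x \<in> N"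
    by (fact E)+
  show "\<And>x y. x \<in> N \<Longrightarrow> y \<in> N \<Longrightarrow> x \<ominus>\<^bsub>V\<^esub> y \<in> N"
    by (simp add: a_minus_def E(3,5))
  show "\<zero>\<^bsub>V\<^esub> \<in> N" using submodule.axioms(1)[OF assms] subgroup.one_closed by fastforce
qed

lemma submoduleI':
  assumes "N \<subseteq> carrier V" "\<zero>\<^bsub>V\<^esub> \<in> N" "\<And>x y. x \<in> N \<Longrightarrow> y \<in> N \<Longrightarrow> x \<oplus>\<^bsub>V\<^esub> y \<in> N"
    "\<And>c x. c \<in> carrier K \<Longrightarrow> x \<in> N \<Longrightarrow> c \<odot>\<^bsub>V\<^esub> x \<in> N"
  shows "submodule N K V"
proof (rule submoduleI[OF assms(1,2) _ assms(3,4)])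
  fix a assume a: "a \<in> N"
  then have "\<ominus>\<^bsub>V\<^esub> a = (\<ominus>\<^bsub>K\<^esub> \<one>\<^bsub>K\<^esub>) \<odot>\<^bsub>V\<^esub> a" using assms(1) by (subst smult_l_minus) auto
  then show "\<ominus>\<^bsub>V\<^esub> a \<in> N" using assms(4)[OF _ a] by simp
qed

lemma submodule_cancel:
  assumes "submodule N K V" "x \<in> N" "y \<in> carrier V" "x \<oplus>\<^bsub>V\<^esub> y \<in> N"
  shows "y \<in> N"
proof -
  have "\<ominus>\<^bsub>V\<^esub> x \<oplus>\<^bsub>V\<^esub> (x \<oplus>\<^bsub>V\<^esub> y) \<in> N" using submodule_vspace[OF assms(1)] assms by blast
  moreover have "x \<in> carrier V" using assms submodule_vspace by blast
  ultimately show ?thesis using assms(3) by (simp add: M.r_neg1)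
qed

lemma submodule_diff_cancel:
  assumes "submodule N K V" "x \<in> carrier V" "y \<in> N" "x \<ominus>\<^bsub>V\<^esub> y \<in> N"
  shows "x \<in> N"
  using submodule_cancel[of N "\<ominus>\<^bsub>V\<^esub> y" x] submodule_vspace[OF assms(1)] assms
  by (metis a_minus_def M.add.m_comm M.a_inv_closed subsetD)

lemma submodule_smult_cancel:
  assumes "submodule N K V" "c \<in> carrier K" "c \<noteq> \<zero>\<^bsub>K\<^esub>" "x \<in> carrier V" "c \<odot>\<^bsub>V\<^esub> x \<in> N"
  shows "x \<in> N"
proof -
  have c: "c \<in> Units K" using assms by (simp add: K.field_Units)
  then have i: "inv\<^bsub>K\<^esub> c \<in> carrier K" "inv\<^bsub>K\<^esub> c \<otimes>\<^bsub>K\<^esub> c = \<one>\<^bsub>K\<^esub>" by simp_all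
  have "inv\<^bsub>K\<^esub> c \<odot>\<^bsub>V\<^esub> (c \<odot>\<^bsub>V\<^esub> x) \<in> N" using submodule_vspace(4)[OF assms(1) i(1) assms(5)] .
  moreover have "inv\<^bsub>K\<^esub> c \<odot>\<^bsub>V\<^esub> (c \<odot>\<^bsub>V\<^esub> x) = x"
    using i assms by (simp add: smult_assoc1[symmetric])
  ultimately show ?thesis by simp
qed

lemma submodule_finsum:
  assumes "submodule N K V" "x \<in> I \<rightarrow> N"
  shows "(\<Oplus>\<^bsub>V\<^esub>i\<in>I. x i) \<in> N"
  using assms(2)
proof (induct I rule: infinite_finite_induct)
  case (insert i F)
  then have "x \<in> F \<rightarrow> carrier V" "x i \<in> carrier V" using submodule_vspace(1)[OF assms(1)] by auto
  with insert show ?case using submodule_vspace[OF assms(1)] by (simp add: M.finsum_insert Pi_def)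
qed (use submodule_vspace[OF assms(1)] in \<open>simp_all add: M.finsum_infinite\<close>)

lemma submodule_Inter:
  assumes "\<N> \<noteq> {}" "\<And>N. N \<in> \<N> \<Longrightarrow> submodule N K V"
  shows "submodule (\<Inter>\<N>) K V"
proof (rule submoduleI')
  show "\<Inter>\<N> \<subseteq> carrier V" using assms submodule_vspace(1) by blast
qed (use submodule_vspace(2-4)[OF assms(2)] in auto)

lemma submodule_Int: "submodule M K V \<Longrightarrow> submodule N K V \<Longrightarrow> submodule (M \<inter> N) K V"
  using submodule_Inter[of "{M, N}"] by auto

lemma submodule_zero: "submodule {\<zero>\<^bsub>V\<^esub>} K V"
  by (intro submoduleI') auto

lemma submodule_preimage:
  assumes "vspace K W" "linear_map K V W f" "submodule N K W" "submodule P K V"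
  shows "submodule {x \<in> P. f x \<in> N} K V"
proof -
  interpret W: vspace K W by fact
  note N = W.submodule_vspace[OF assms(3)] and P = submodule_vspace[OF assms(4)]
  show ?thesis
    using N(2-4) P linear_mapD[OF assms(2)] linear_map_zero[OF vspace_axioms assms(1,2)]
    by (intro submoduleI') (auto simp: subset_iff)
qed

lemma submodule_image:
  assumes "vspace K W" "linear_map K V W f" "submodule P K V"
  shows "submodule (f ` P) K W"
proof -
  interpret W: vspace K W by fact
  note P = submodule_vspace[OF assms(3)]
  show ?thesis
  proof (rule W.submoduleI')
    show "f ` P \<subseteq> carrier W" using P linear_mapD(1)[OF assms(2)] by auto
    show "\<zero>\<^bsub>W\<^esub> \<in> f ` P" using P linear_map_zero[OF vspace_axioms assms(1,2)] by (metis imageI)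
  next
    fix x y assume "x \<in> f ` P" "y \<in> f ` P"
    then obtain a b where ab: "a \<in> P" "b \<in> P" "x = f a" "y = f b" by blast
    then have "x \<oplus>\<^bsub>W\<^esub> y = f (a \<oplus>\<^bsub>V\<^esub> b)" using P linear_mapD(2)[OF assms(2)] by (metis subsetD)
    then show "x \<oplus>\<^bsub>W\<^esub> y \<in> f ` P" using ab P by blast
  next
    fix c x assume "c \<in> carrier K" "x \<in> f ` P"
    then obtain a where ab: "c \<in> carrier K" "a \<in> P" "x = f a" by blast
    then have "c \<odot>\<^bsub>W\<^esub> x = f (c \<odot>\<^bsub>V\<^esub> a)" using P linear_mapD(3)[OF assms(2)] by (metis subsetD)
    then show "c \<odot>\<^bsub>W\<^esub> x \<in> f ` P" using ab P by blast
  qed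
qed

lemma span_submodule: "X \<subseteq> carrier V \<Longrightarrow> submodule (linear_span K V X) K V"
  unfolding linear_span_def hull_def using carrier_is_submodule by (intro submodule_Inter) blast+

lemma span_superset: "X \<subseteq> linear_span K V X"
  unfolding linear_span_def by (rule hull_subset)

lemma span_minimal: "submodule N K V \<Longrightarrow> X \<subseteq> N \<Longrightarrow> linear_span K V X \<subseteq> N"
  unfolding linear_span_def by (rule hull_minimal)

lemma span_mono: "X \<subseteq> Y \<Longrightarrow> linear_span K V X \<subseteq> linear_span K V Y"
  unfolding linear_span_def by (rule hull_mono)

lemma span_eq: "submodule N K V \<Longrightarrow> linear_span K V N = N"
  using span_minimal span_superset by blast

lemma span_closed: "X \<subseteq> carrier V \<Longrightarrow> linear_span K V X \<subseteq> carrier V"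
  using span_submodule submodule_vspace by blast

lemma span_insert:
  assumes "X \<subseteq> carrier V" "x \<in> carrier V"
  shows "linear_span K V (insert x X) = {c \<odot>\<^bsub>V\<^esub> x \<oplus>\<^bsub>V\<^esub> y | c y. c \<in> carrier K \<and> y \<in> linear_span K V X}"
    (is "_ = ?R")
proof
  note S = submodule_vspace[OF span_submodule[OF assms(1)]]
  have "submodule ?R K V"
  proof (rule submoduleI')
    show "?R \<subseteq> carrier V" using S(1) assms by auto
    have "\<zero>\<^bsub>V\<^esub> = \<zero>\<^bsub>K\<^esub> \<odot>\<^bsub>V\<^esub> x \<oplus>\<^bsub>V\<^esub> \<zero>\<^bsub>V\<^esub>" using assms by simp
    then show "\<zero>\<^bsub>V\<^esub> \<in> ?R" using S(2) K.zero_closed by blast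
  next
    fix a b assume "a \<in> ?R" "b \<in> ?R"
    then obtain c y d z where *: "a = c \<odot>\<^bsub>V\<^esub> x \<oplus>\<^bsub>V\<^esub> y" "c \<in> carrier K" "y \<in> linear_span K V X"
      "b = d \<odot>\<^bsub>V\<^esub> x \<oplus>\<^bsub>V\<^esub> z" "d \<in> carrier K" "z \<in> linear_span K V X" by blast
    then have "y \<in> carrier V" "z \<in> carrier V" using S by auto
    with * have "a \<oplus>\<^bsub>V\<^esub> b = (c \<oplus>\<^bsub>K\<^esub> d) \<odot>\<^bsub>V\<^esub> x \<oplus>\<^bsub>V\<^esub> (y \<oplus>\<^bsub>V\<^esub> z)"
      using assms by (simp add: smult_l_distr M.a_ac)
    then show "a \<oplus>\<^bsub>V\<^esub> b \<in> ?R" using * S(3) K.a_closed by blast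
  next
    fix d a assume d: "d \<in> carrier K" and "a \<in> ?R"
    then obtain c y where *: "a = c \<odot>\<^bsub>V\<^esub> x \<oplus>\<^bsub>V\<^esub> y" "c \<in> carrier K" "y \<in> linear_span K V X" by blast
    then have "y \<in> carrier V" using S by auto
    with * d have "d \<odot>\<^bsub>V\<^esub> a = (d \<otimes>\<^bsub>K\<^esub> c) \<odot>\<^bsub>V\<^esub> x \<oplus>\<^bsub>V\<^esub> (d \<odot>\<^bsub>V\<^esub> y)"
      using assms by (simp add: smult_r_distr smult_assoc1)
    then show "d \<odot>\<^bsub>V\<^esub> a \<in> ?R" using * d S(4) K.m_closed by blast
  qed
  moreover have "insert x X \<subseteq> ?R"
  proof -
    have "x = \<one>\<^bsub>K\<^esub> \<odot>\<^bsub>V\<^esub> x \<oplus>\<^bsub>V\<^esub> \<zero>\<^bsub>V\<^esub>" using assms by simp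
    then have 1: "x \<in> ?R" using S(2) K.one_closed by blast
    have "y \<in> ?R" if "y \<in> X" for y
    proof -
      have "y = \<zero>\<^bsub>K\<^esub> \<odot>\<^bsub>V\<^esub> x \<oplus>\<^bsub>V\<^esub> y" using assms that by auto
      then show ?thesis using that span_superset K.zero_closed by blast
    qed
    with 1 show ?thesis by blast
  qed
  ultimately show "linear_span K V (insert x X) \<subseteq> ?R" by (rule span_minimal)
  have "insert x X \<subseteq> carrier V" using assms by blast
  note T = submodule_vspace[OF span_submodule[OF this]]
  have "x \<in> linear_span K V (insert x X)" "linear_span K V X \<subseteq> linear_span K V (insert x X)"
    using span_superset span_mono by blast+
  then show "?R \<subseteq> linear_span K V (insert x X)" using T by blast
qed

text \<open>By Zorn there is a subspace \<open>P\<close> that is maximal among those containing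
  \<open>N\<close> and missing \<open>v\<close>. It is a hyperplane complementary to the line of
  \<open>v\<close>, and the wanted functional reads off the coefficient of \<open>v\<close>. The
  argument works in any dimension, which matters because \<open>H\<close> may be
  infinite-dimensional.\<close>

lemma exists_functional:
  assumes "submodule N K V" "v \<in> carrier V" "v \<notin> N"
  shows "\<exists>f. functional K V f \<and> (\<forall>x\<in>N. f x = \<zero>\<^bsub>K\<^esub>) \<and> f v = \<one>\<^bsub>K\<^esub>"
proof -
  define \<A> where "\<A> = {P. submodule P K V \<and> N \<subseteq> P \<and> v \<notin> P}"
  have "\<exists>P\<in>\<A>. \<forall>Q\<in>\<A>. P \<subseteq> Q \<longrightarrow> Q = P"
  proof (rule subset_Zorn_nonempty)
    show "\<A> \<noteq> {}" using assms by (auto simp: \<A>_def)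
  next
    fix \<C> assume ne: "\<C> \<noteq> {}" and ch: "subset.chain \<A> \<C>"
    have sub: "P \<in> \<C> \<Longrightarrow> submodule P K V \<and> N \<subseteq> P \<and> v \<notin> P" for P
      using ch by (auto simp: subset.chain_def \<A>_def)
    have "submodule (\<Union>\<C>) K V"
    proof (rule submoduleI')
      fix x y assume "x \<in> \<Union>\<C>" "y \<in> \<Union>\<C>"
      then obtain P Q where "P \<in> \<C>" "Q \<in> \<C>" "x \<in> P" "y \<in> Q" by blast
      moreover then have "P \<subseteq> Q \<or> Q \<subseteq> P" using ch by (auto simp: subset.chain_def)
      ultimately obtain R where R: "R \<in> \<C>" "x \<in> R" "y \<in> R" by blast
      then show "x \<oplus>\<^bsub>V\<^esub> y \<in> \<Union>\<C>" using submodule_vspace(3)[of R x y] sub[OF R(1)] by blast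
    next
      show "\<Union>\<C> \<subseteq> carrier V" using sub submodule_vspace(1) by blast
      show "\<zero>\<^bsub>V\<^esub> \<in> \<Union>\<C>" using sub submodule_vspace(2) ne by blast
      show "\<And>c x. c \<in> carrier K \<Longrightarrow> x \<in> \<Union>\<C> \<Longrightarrow> c \<odot>\<^bsub>V\<^esub> x \<in> \<Union>\<C>"
        using sub submodule_vspace(4) by blast
    qed
    then show "\<Union>\<C> \<in> \<A>" using sub ne by (auto simp: \<A>_def)
  qed
  then obtain P where "P \<in> \<A>" and m: "\<forall>Q\<in>\<A>. P \<subseteq> Q \<longrightarrow> Q = P" by blast
  then have P: "submodule P K V" "N \<subseteq> P" "v \<notin> P" by (auto simp: \<A>_def)
  have max: "Q = P" if "submodule Q K V" "P \<subseteq> Q" "v \<notin> Q" for Q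
    using m P that by (auto simp: \<A>_def)
  note PS = submodule_vspace[OF P(1)]
  \<comment> \<open>If \<open>x\<close> is outside \<open>P\<close>, maximality puts
    \<open>v\<close> into the span of \<open>x\<close> and \<open>P\<close>. The coefficient of
    \<open>x\<close> cannot vanish, since \<open>v\<close> is not in \<open>P\<close>, and dividing
    by it solves for \<open>x\<close>.\<close>
  have ex: "\<exists>c. c \<in> carrier K \<and> (\<exists>p\<in>P. x = c \<odot>\<^bsub>V\<^esub> v \<oplus>\<^bsub>V\<^esub> p)" if x: "x \<in> carrier V" for x
  proof (cases "x \<in> P")
    case True
    then have "x = \<zero>\<^bsub>K\<^esub> \<odot>\<^bsub>V\<^esub> v \<oplus>\<^bsub>V\<^esub> x" using assms x by simp
    then show ?thesis using True by blast
  next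
    case False
    let ?Q = "linear_span K V (insert x P)"
    have 1: "submodule ?Q K V" using x PS by (intro span_submodule) auto
    have "P \<subseteq> ?Q" "x \<in> ?Q" using span_superset by blast+
    then have "v \<in> ?Q" using max[OF 1] False by blast
    then obtain c p where c: "v = c \<odot>\<^bsub>V\<^esub> x \<oplus>\<^bsub>V\<^esub> p" "c \<in> carrier K" "p \<in> P"
      using span_insert[OF PS(1) x] span_eq[OF P(1)] by auto
    have pc: "p \<in> carrier V" using c PS by auto
    have "c \<noteq> \<zero>\<^bsub>K\<^esub>"
    proof
      assume "c = \<zero>\<^bsub>K\<^esub>"
      then have "v = p" using c x pc by simp
      then show False using P c by simp
    qed
    then have u: "c \<in> Units K" using c by (simp add: K.field_Units)
    let ?d = "inv\<^bsub>K\<^esub> c"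
    have d: "?d \<in> carrier K" "?d \<otimes>\<^bsub>K\<^esub> c = \<one>\<^bsub>K\<^esub>" using u by simp_all
    have "?d \<odot>\<^bsub>V\<^esub> v = x \<oplus>\<^bsub>V\<^esub> ?d \<odot>\<^bsub>V\<^esub> p"
      using c d x pc by (simp add: smult_r_distr smult_assoc1[symmetric])
    then have "x = ?d \<odot>\<^bsub>V\<^esub> v \<oplus>\<^bsub>V\<^esub> \<ominus>\<^bsub>V\<^esub> (?d \<odot>\<^bsub>V\<^esub> p)"
      using d x pc by (simp add: M.a_assoc M.r_neg)
    moreover have "\<ominus>\<^bsub>V\<^esub> (?d \<odot>\<^bsub>V\<^esub> p) \<in> P" using PS d c by blast
    ultimately show ?thesis using d by blast
  qed
  \<comment> \<open>Otherwise a nonzero multiple of \<open>v\<close> would lie in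
    \<open>P\<close>.\<close>
  have uniq: "c = d" if "c \<in> carrier K" "d \<in> carrier K" "p \<in> P" "q \<in> P"
    "c \<odot>\<^bsub>V\<^esub> v \<oplus>\<^bsub>V\<^esub> p = d \<odot>\<^bsub>V\<^esub> v \<oplus>\<^bsub>V\<^esub> q" for c d p q
  proof (rule ccontr)
    assume "c \<noteq> d"
    then have ne: "c \<ominus>\<^bsub>K\<^esub> d \<noteq> \<zero>\<^bsub>K\<^esub>" using that by (simp add: K.diff_eq_zero_iff)
    have pq: "p \<in> carrier V" "q \<in> carrier V" using that PS by auto
    have "c \<odot>\<^bsub>V\<^esub> v \<ominus>\<^bsub>V\<^esub> d \<odot>\<^bsub>V\<^esub> v = q \<ominus>\<^bsub>V\<^esub> p"
      using that assms pq by (intro M.diff_swap) auto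
    then have "(c \<ominus>\<^bsub>K\<^esub> d) \<odot>\<^bsub>V\<^esub> v = q \<oplus>\<^bsub>V\<^esub> \<ominus>\<^bsub>V\<^esub> p"
      using that assms by (simp add: a_minus_def smult_l_distr smult_l_minus)
    moreover have "q \<oplus>\<^bsub>V\<^esub> \<ominus>\<^bsub>V\<^esub> p \<in> P" using PS that by blast
    ultimately have "v \<in> P"
      using submodule_smult_cancel[OF P(1) _ ne assms(2)] that by simp
    then show False using P by blast
  qed
  define f where "f x = (THE c. c \<in> carrier K \<and> (\<exists>p\<in>P. x = c \<odot>\<^bsub>V\<^esub> v \<oplus>\<^bsub>V\<^esub> p))" for x
  have f: "f (c \<odot>\<^bsub>V\<^esub> v \<oplus>\<^bsub>V\<^esub> p) = c" if "c \<in> carrier K" "p \<in> P" for c p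
    unfolding f_def using that uniq by (intro the_equality) blast+
  have "functional K V f"
  proof (rule linear_mapI)
    fix x assume "x \<in> carrier V"
    then obtain c p where "c \<in> carrier K" "p \<in> P" "x = c \<odot>\<^bsub>V\<^esub> v \<oplus>\<^bsub>V\<^esub> p" using ex by blast
    then show "f x \<in> carrier (ground_algebra K)" using f by simp
  next
    fix x y assume "x \<in> carrier V" "y \<in> carrier V"
    then obtain c p d q where *: "c \<in> carrier K" "p \<in> P" "x = c \<odot>\<^bsub>V\<^esub> v \<oplus>\<^bsub>V\<^esub> p"
      "d \<in> carrier K" "q \<in> P" "y = d \<odot>\<^bsub>V\<^esub> v \<oplus>\<^bsub>V\<^esub> q" using ex by meson
    then have "p \<in> carrier V" "q \<in> carrier V" using PS by auto
    then have "x \<oplus>\<^bsub>V\<^esub> y = (c \<oplus>\<^bsub>K\<^esub> d) \<odot>\<^bsub>V\<^esub> v \<oplus>\<^bsub>V\<^esub> (p \<oplus>\<^bsub>V\<^esub> q)"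
      using * assms by (simp add: smult_l_distr M.a_ac)
    then have "f (x \<oplus>\<^bsub>V\<^esub> y) = c \<oplus>\<^bsub>K\<^esub> d" using f[of "c \<oplus>\<^bsub>K\<^esub> d" "p \<oplus>\<^bsub>V\<^esub> q"] * PS by simp
    then show "f (x \<oplus>\<^bsub>V\<^esub> y) = f x \<oplus>\<^bsub>ground_algebra K\<^esub> f y" using f * by simp
  next
    fix e x assume e: "e \<in> carrier K" and "x \<in> carrier V"
    then obtain c p where *: "c \<in> carrier K" "p \<in> P" "x = c \<odot>\<^bsub>V\<^esub> v \<oplus>\<^bsub>V\<^esub> p" using ex by blast
    then have "p \<in> carrier V" using PS by auto
    then have "e \<odot>\<^bsub>V\<^esub> x = (e \<otimes>\<^bsub>K\<^esub> c) \<odot>\<^bsub>V\<^esub> v \<oplus>\<^bsub>V\<^esub> (e \<odot>\<^bsub>V\<^esub> p)"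
      using * e assms by (simp add: smult_r_distr smult_assoc1)
    then have "f (e \<odot>\<^bsub>V\<^esub> x) = e \<otimes>\<^bsub>K\<^esub> c" using f[of "e \<otimes>\<^bsub>K\<^esub> c" "e \<odot>\<^bsub>V\<^esub> p"] * e PS by simp
    then show "f (e \<odot>\<^bsub>V\<^esub> x) = e \<odot>\<^bsub>ground_algebra K\<^esub> f x" using f * by simp
  qed
  moreover have "f x = \<zero>\<^bsub>K\<^esub>" if "x \<in> N" for x
  proof -
    have x: "x \<in> P" "x \<in> carrier V" using that P PS by auto
    then have "\<zero>\<^bsub>K\<^esub> \<odot>\<^bsub>V\<^esub> v \<oplus>\<^bsub>V\<^esub> x = x" using assms by simp
    then show ?thesis using f[of "\<zero>\<^bsub>K\<^esub>" x] x by simp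
  qed
  moreover have "f v = \<one>\<^bsub>K\<^esub>"
    using f[of "\<one>\<^bsub>K\<^esub>" "\<zero>\<^bsub>V\<^esub>"] PS assms by simp
  ultimately show ?thesis by blast
qed

lemma functional_separation:
  assumes "x \<in> carrier V" "\<And>f. functional K V f \<Longrightarrow> f x = \<zero>\<^bsub>K\<^esub>"
  shows "x = \<zero>\<^bsub>V\<^esub>"
  using exists_functional[OF submodule_zero assms(1)] assms(2) K.one_not_zero by force

lemma functional_ext:
  assumes "x \<in> carrier V" "y \<in> carrier V" "\<And>f. functional K V f \<Longrightarrow> f x = f y"
  shows "x = y"
proof -
  have "x \<ominus>\<^bsub>V\<^esub> y = \<zero>\<^bsub>V\<^esub>"
  proof (rule functional_separation)
    fix f assume f: "functional K V f"
    then show "f (x \<ominus>\<^bsub>V\<^esub> y) = \<zero>\<^bsub>K\<^esub>"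
      using linear_map_diff[OF vspace_axioms vspace_ground f assms(1,2)] assms(3)[OF f]
        linear_mapD(1)[OF f assms(2)] by (simp add: a_minus_def K.r_neg)
  qed (use assms in simp)
  then show ?thesis using assms by (simp add: M.diff_eq_zero_iff)
qed

text \<open>The substitute for the dimension inequality of proper subspaces, taken modulo
  \<open>N\<close>. The induction is on \<open>S\<close>: if \<open>U\<close> is not contained in
  the span \<open>W\<close> without the new vector \<open>s\<close>, some \<open>w\<close> in
  \<open>U\<close> involves \<open>s\<close>, and \<open>U\<close> is generated by
  \<open>U \<inter> W\<close> together with \<open>w\<close>, where the induction hypothesis applies
  to \<open>U \<inter> W\<close>.\<close>

lemma span_Un_finite_proper_subspace:
  assumes "finite S" "submodule N K V" "S \<subseteq> carrier V" "submodule U K V" "N \<subseteq> U"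
    "U \<subseteq> linear_span K V (N \<union> S)" "U \<noteq> linear_span K V (N \<union> S)"
  shows "\<exists>T. finite T \<and> card T < card S \<and> T \<subseteq> U \<and> U = linear_span K V (N \<union> T)"
  using assms(1,3-)
proof (induct S arbitrary: U rule: finite_induct)
  case empty
  then show ?case using span_eq[OF assms(2)] by auto
next
  case (insert s S)
  let ?W = "linear_span K V (N \<union> S)"
  have NS: "N \<union> S \<subseteq> carrier V" "s \<in> carrier V" using submodule_vspace(1)[OF assms(2)] insert by auto
  note W = span_submodule[OF NS(1)]
  note WS = submodule_vspace[OF W] and US = submodule_vspace[OF insert.prems(2)]
  have NW: "N \<subseteq> ?W" "S \<subseteq> ?W" using span_superset by blast+
  have un: "N \<union> insert s S = insert s (N \<union> S)" by blast
  have ins: "linear_span K V (N \<union> insert s S) = {c \<odot>\<^bsub>V\<^esub> s \<oplus>\<^bsub>V\<^esub> y | c y. c \<in> carrier K \<and> y \<in> ?W}"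
    unfolding un by (rule span_insert[OF NS])
  show ?case
  proof (cases "U \<subseteq> ?W")
    case True
    show ?thesis
    proof (cases "U = ?W")
      case True
      then show ?thesis using insert NW by (intro exI[of _ S]) auto
    next
      case False
      then obtain T where "finite T" "card T < card S" "T \<subseteq> U" "U = linear_span K V (N \<union> T)"
        using insert.hyps(3)[of U] insert.prems True by auto
      then show ?thesis using insert by (intro exI[of _ T]) auto
    qed
  next
    case False
    then obtain w where w: "w \<in> U" "w \<notin> ?W" by blast
    then obtain c y where c: "w = c \<odot>\<^bsub>V\<^esub> s \<oplus>\<^bsub>V\<^esub> y" "c \<in> carrier K" "y \<in> ?W"
      using insert.prems(4) unfolding ins by blast
    have y: "y \<in> carrier V" "w \<in> carrier V" using c WS w US by auto
    have c0: "c \<noteq> \<zero>\<^bsub>K\<^esub>" using c w y NS by auto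
    have UW: "submodule (U \<inter> ?W) K V" using submodule_Int insert.prems W by blast
    \<comment> \<open>Otherwise \<open>y\<close> and then the nonzero multiple \<open>c s\<close> of
      \<open>s\<close> would lie in \<open>U\<close>, so that \<open>U\<close> would be the whole
      span.\<close>
    have "U \<inter> ?W \<noteq> ?W"
    proof
      assume eq: "U \<inter> ?W = ?W"
      then have "y \<in> U" using c by blast
      then have "y \<oplus>\<^bsub>V\<^esub> c \<odot>\<^bsub>V\<^esub> s \<in> U" using w c NS y by (simp add: M.a_comm)
      then have "c \<odot>\<^bsub>V\<^esub> s \<in> U"
        using submodule_cancel[OF insert.prems(2) \<open>y \<in> U\<close>, of "c \<odot>\<^bsub>V\<^esub> s"] c NS by blast
      then have "s \<in> U" using submodule_smult_cancel[OF insert.prems(2) c(2) c0] NS by blast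
      moreover have "?W \<subseteq> U" using eq by blast
      ultimately have "N \<union> insert s S \<subseteq> U" using NW by blast
      then have "linear_span K V (N \<union> insert s S) \<subseteq> U" using span_minimal insert.prems by blast
      then show False using insert.prems by blast
    qed
    then obtain T where T: "finite T" "card T < card S" "T \<subseteq> U \<inter> ?W" "U \<inter> ?W = linear_span K V (N \<union> T)"
      using insert.hyps(3)[OF _ UW] insert.prems(1,3) NW by (metis Int_greatest Int_lower2 insert_subset)
    have "U = linear_span K V (N \<union> insert w T)"
    proof
      show "linear_span K V (N \<union> insert w T) \<subseteq> U"
        using T w insert.prems by (intro span_minimal) auto
      show "U \<subseteq> linear_span K V (N \<union> insert w T)"
      proof
        fix u assume u: "u \<in> U"
        then obtain d z where d: "u = d \<odot>\<^bsub>V\<^esub> s \<oplus>\<^bsub>V\<^esub> z" "d \<in> carrier K" "z \<in> ?W"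
          using insert.prems(4) unfolding ins by blast
        have z: "z \<in> carrier V" "u \<in> carrier V" using d WS u US by auto
        \<comment> \<open>Chosen so that subtracting \<open>e w\<close> cancels the
          \<open>s\<close>-component of \<open>u\<close> and leaves an element of
          \<open>U \<inter> W\<close>.\<close>
        define e where "e = d \<otimes>\<^bsub>K\<^esub> inv\<^bsub>K\<^esub> c"
        have "c \<in> Units K" using c c0 by (simp add: K.field_Units)
        then have e: "e \<in> carrier K" "e \<otimes>\<^bsub>K\<^esub> c = d" using c d by (simp_all add: e_def K.m_assoc)
        have "e \<odot>\<^bsub>V\<^esub> w = d \<odot>\<^bsub>V\<^esub> s \<oplus>\<^bsub>V\<^esub> e \<odot>\<^bsub>V\<^esub> y"
          using c e y NS by (simp add: smult_r_distr smult_assoc1[symmetric])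
        then have "u \<ominus>\<^bsub>V\<^esub> e \<odot>\<^bsub>V\<^esub> w = z \<ominus>\<^bsub>V\<^esub> e \<odot>\<^bsub>V\<^esub> y"
          using c d e y z NS by (intro M.diff_swap) (auto simp: M.a_ac)
        moreover have "z \<ominus>\<^bsub>V\<^esub> e \<odot>\<^bsub>V\<^esub> y \<in> ?W" by (rule WS(6)[OF d(3) WS(4)[OF e(1) c(3)]])
        moreover have "u \<ominus>\<^bsub>V\<^esub> e \<odot>\<^bsub>V\<^esub> w \<in> U" by (rule US(6)[OF u US(4)[OF e(1) w(1)]])
        ultimately have r: "u \<ominus>\<^bsub>V\<^esub> e \<odot>\<^bsub>V\<^esub> w \<in> linear_span K V (N \<union> T)" using T by auto
        have NT: "N \<union> insert w T \<subseteq> carrier V" using NS T y US by blast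
        note L = submodule_vspace[OF span_submodule[OF NT]]
        have "w \<in> linear_span K V (N \<union> insert w T)" by (rule subsetD[OF span_superset]) simp
        then have "e \<odot>\<^bsub>V\<^esub> w \<in> linear_span K V (N \<union> insert w T)" by (rule L(4)[OF e(1)])
        moreover have "u \<ominus>\<^bsub>V\<^esub> e \<odot>\<^bsub>V\<^esub> w \<in> linear_span K V (N \<union> insert w T)"
          using r span_mono[of "N \<union> T" "N \<union> insert w T"] by blast
        ultimately show "u \<in> linear_span K V (N \<union> insert w T)"
          by (rule submodule_diff_cancel[OF span_submodule[OF NT] z(2)])
      qed
    qed
    moreover have "card (insert w T) < card (insert s S)"
      using T insert card_insert_le_m1[of "card (insert s S)" T w] by (simp add: card_insert_if)
    ultimately show ?thesis using T w by (intro exI[of _ "insert w T"]) auto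
  qed
qed

end

section \<open>Free modules, quotients and tensor products\<close>

lemma free_module_simps [simp]:
  "carrier (free_module K B) = finsupp K B" "zero (free_module K B) = (\<lambda>_. \<zero>\<^bsub>K\<^esub>)"
  "add (free_module K B) = (\<lambda>f g b. f b \<oplus>\<^bsub>K\<^esub> g b)" "smult (free_module K B) = (\<lambda>c f b. c \<otimes>\<^bsub>K\<^esub> f b)"
  by (simp_all add: free_module_def)

section \<open>Finitely supported functions and free modules\<close>

context abelian_group
begin

lemma finsuppD:
  assumes "f \<in> finsupp G B"
  shows "f b \<in> carrier G" "b \<notin> B \<Longrightarrow> f b = \<zero>" "finite {b. f b \<noteq> \<zero>}" "{b. f b \<noteq> \<zero>} \<subseteq> B"
  using assms by (auto simp: finsupp_def)

lemma finsupp_finiteI: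
  assumes "finite B" "\<And>b. b \<in> B \<Longrightarrow> f b \<in> carrier G" "\<And>b. b \<notin> B \<Longrightarrow> f b = \<zero>"
  shows "f \<in> finsupp G B"
  using assms by (auto simp: finsupp_def intro: finite_subset[of _ B])

lemma finsupp_add: "f \<in> finsupp G B \<Longrightarrow> g \<in> finsupp G B \<Longrightarrow> (\<lambda>b. f b \<oplus> g b) \<in> finsupp G B"
  by (auto simp: finsupp_def intro: finite_subset[of _ "{b. f b \<noteq> \<zero>} \<union> {b. g b \<noteq> \<zero>}"])

lemma finsupp_zero: "(\<lambda>_. \<zero>) \<in> finsupp G B"
  by (auto simp: finsupp_def)

end

context field
begin

lemma finsupp_smult: "c \<in> carrier R \<Longrightarrow> f \<in> finsupp R B \<Longrightarrow> (\<lambda>b. c \<otimes> f b) \<in> finsupp R B"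
  by (auto simp: finsupp_def intro: finite_subset[of _ "{b. f b \<noteq> \<zero>}"])

lemma single_finsupp: "b \<in> B \<Longrightarrow> single R b \<in> finsupp R B"
  by (auto simp: finsupp_def single_def)

lemma vspace_free_module: "vspace R (free_module R B)"
proof -
  have "abelian_group (free_module R B)"
  proof (rule abelian_groupI, simp_all)
    fix f assume f: "f \<in> finsupp R B"
    show "\<exists>g\<in>finsupp R B. (\<lambda>b. g b \<oplus> f b) = (\<lambda>_. \<zero>)"
    proof (intro bexI)
      show "(\<lambda>b. (\<ominus> \<one> \<otimes> f b) \<oplus> f b) = (\<lambda>_. \<zero>)"
        using finsuppD(1)[OF f] by (simp add: l_minus l_neg)
      show "(\<lambda>b. \<ominus> \<one> \<otimes> f b) \<in> finsupp R B" by (intro finsupp_smult f) simp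
    qed
  qed (auto simp: finsupp_add finsupp_zero finsuppD a_ac)
  then have "module R (free_module R B)"
    by (intro moduleI) (auto simp: is_cring finsupp_smult finsuppD l_distr r_distr m_assoc)
  then show ?thesis by (intro vspace.intro field_axioms)
qed

text \<open>Every finitely supported function is a finite combination of the \<open>single\<close>
  functions; the induction removes one point of the support at a time.\<close>

lemma free_module_generated:
  assumes N: "submodule N R (free_module R B)" and s: "\<And>b. b \<in> B \<Longrightarrow> single R b \<in> N"
    and f: "f \<in> finsupp R B"
  shows "f \<in> N"
proof -
  interpret F: vspace R "free_module R B" by (rule vspace_free_module)
  note NS = F.submodule_vspace[OF N]
  have "f \<in> N" if "finite S" "f \<in> finsupp R B" "{b. f b \<noteq> \<zero>} \<subseteq> S" for S f
    using that
  proof (induct S arbitrary: f rule: finite_induct)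
    case empty
    then have "f = \<zero>\<^bsub>free_module R B\<^esub>" by auto
    then show ?case using NS(2) by simp
  next
    case (insert s S)
    show ?case
    proof (cases "f s = \<zero>")
      case True
      then have "{b. f b \<noteq> \<zero>} \<subseteq> S" using insert by auto
      then show ?thesis using insert by blast
    next
      case False
      then have sB: "s \<in> B" using finsuppD(2)[OF insert.prems(1)] by blast
      define g where "g b = (if b = s then \<zero> else f b)" for b
      have "{b. g b \<noteq> \<zero>} \<subseteq> {b. f b \<noteq> \<zero>}" by (auto simp: g_def)
      then have g: "g \<in> finsupp R B"
        using finsuppD[OF insert.prems(1)] by (auto simp: finsupp_def g_def intro: finite_subset)
      have "{b. g b \<noteq> \<zero>} \<subseteq> S" using insert.prems by (auto simp: g_def)
      then have "g \<in> N" using g insert by blast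
      moreover have "f s \<odot>\<^bsub>free_module R B\<^esub> single R s \<in> N"
        using NS(4)[OF _ s[OF sB]] finsuppD(1)[OF insert.prems(1)] by blast
      ultimately have "g \<oplus>\<^bsub>free_module R B\<^esub> (f s \<odot>\<^bsub>free_module R B\<^esub> single R s) \<in> N"
        using NS(3) by blast
      also have "g \<oplus>\<^bsub>free_module R B\<^esub> (f s \<odot>\<^bsub>free_module R B\<^esub> single R s) = f"
        using finsuppD(1)[OF insert.prems(1)] by (auto simp: g_def single_def)
      finally show ?thesis .
    qed
  qed
  then show ?thesis using finsuppD(3)[OF f] f by blast
qed

end

definition linear_extension ::
    "('k, 'x) ring_scheme \<Rightarrow> ('k, 'u, 'y) module_scheme \<Rightarrow> ('b \<Rightarrow> 'u) \<Rightarrow> ('b \<Rightarrow> 'k) \<Rightarrow> 'u"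
  where "linear_extension K U e f = (\<Oplus>\<^bsub>U\<^esub> b\<in>{b. f b \<noteq> \<zero>\<^bsub>K\<^esub>}. f b \<odot>\<^bsub>U\<^esub> e b)"

context vspace
begin

lemma linear_extension_superset:
  assumes "f \<in> finsupp K B" "e \<in> B \<rightarrow> carrier V" "finite S" "{b. f b \<noteq> \<zero>\<^bsub>K\<^esub>} \<subseteq> S" "S \<subseteq> B"
  shows "linear_extension K V e f = (\<Oplus>\<^bsub>V\<^esub> b\<in>S. f b \<odot>\<^bsub>V\<^esub> e b)"
  unfolding linear_extension_def
  using assms K.finsuppD(1)[OF assms(1)]
  by (intro M.add.finprod_mono_neutral_cong_left) (auto simp: Pi_def subset_iff)

lemma linear_extension_linear:
  assumes "e \<in> B \<rightarrow> carrier V"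
  shows "linear_map K (free_module K B) V (linear_extension K V e)"
proof (rule linear_mapI, simp_all)
  fix f assume f: "f \<in> finsupp K B"
  show "linear_extension K V e f \<in> carrier V"
    unfolding linear_extension_def using assms K.finsuppD[OF f]
    by (intro M.finsum_closed) (auto simp: Pi_def)
  fix g assume g: "g \<in> finsupp K B"
  let ?S = "{b. f b \<noteq> \<zero>\<^bsub>K\<^esub>} \<union> {b. g b \<noteq> \<zero>\<^bsub>K\<^esub>}"
  have S: "finite ?S" "?S \<subseteq> B" "{b. f b \<oplus>\<^bsub>K\<^esub> g b \<noteq> \<zero>\<^bsub>K\<^esub>} \<subseteq> ?S"
    using K.finsuppD(3,4)[OF f] K.finsuppD(3,4)[OF g] by auto
  have c: "f b \<in> carrier K" "g b \<in> carrier K" for b by (rule K.finsuppD(1)[OF f], rule K.finsuppD(1)[OF g])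
  have e: "b \<in> ?S \<Longrightarrow> e b \<in> carrier V" for b using assms S by auto
  have "linear_extension K V e (\<lambda>b. f b \<oplus>\<^bsub>K\<^esub> g b) = (\<Oplus>\<^bsub>V\<^esub> b\<in>?S. (f b \<oplus>\<^bsub>K\<^esub> g b) \<odot>\<^bsub>V\<^esub> e b)"
    by (rule linear_extension_superset[OF K.finsupp_add[OF f g] assms S(1,3,2)])
  also have "\<dots> = (\<Oplus>\<^bsub>V\<^esub> b\<in>?S. f b \<odot>\<^bsub>V\<^esub> e b \<oplus>\<^bsub>V\<^esub> g b \<odot>\<^bsub>V\<^esub> e b)"
    using c e by (intro M.finsum_cong') (auto simp: smult_l_distr Pi_def simp del: Un_iff)
  also have "\<dots> = (\<Oplus>\<^bsub>V\<^esub> b\<in>?S. f b \<odot>\<^bsub>V\<^esub> e b) \<oplus>\<^bsub>V\<^esub> (\<Oplus>\<^bsub>V\<^esub> b\<in>?S. g b \<odot>\<^bsub>V\<^esub> e b)"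
    using c e by (intro M.finsum_addf) (auto simp del: Un_iff)
  also have "(\<Oplus>\<^bsub>V\<^esub> b\<in>?S. f b \<odot>\<^bsub>V\<^esub> e b) = linear_extension K V e f"
    by (rule linear_extension_superset[OF f assms S(1) _ S(2), symmetric]) auto
  also have "(\<Oplus>\<^bsub>V\<^esub> b\<in>?S. g b \<odot>\<^bsub>V\<^esub> e b) = linear_extension K V e g"
    by (rule linear_extension_superset[OF g assms S(1) _ S(2), symmetric]) auto
  finally show "linear_extension K V e (\<lambda>b. f b \<oplus>\<^bsub>K\<^esub> g b) =
      linear_extension K V e f \<oplus>\<^bsub>V\<^esub> linear_extension K V e g" .
next
  fix d f assume d: "d \<in> carrier K" and f: "f \<in> finsupp K B"
  let ?S = "{b. f b \<noteq> \<zero>\<^bsub>K\<^esub>}"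
  have S: "finite ?S" "?S \<subseteq> B" "{b. d \<otimes>\<^bsub>K\<^esub> f b \<noteq> \<zero>\<^bsub>K\<^esub>} \<subseteq> ?S" using K.finsuppD(3,4)[OF f] d by auto
  have c: "f b \<in> carrier K" for b by (rule K.finsuppD(1)[OF f])
  have e: "b \<in> ?S \<Longrightarrow> e b \<in> carrier V" for b using assms S by auto
  have "linear_extension K V e (\<lambda>b. d \<otimes>\<^bsub>K\<^esub> f b) = (\<Oplus>\<^bsub>V\<^esub> b\<in>?S. (d \<otimes>\<^bsub>K\<^esub> f b) \<odot>\<^bsub>V\<^esub> e b)"
    by (rule linear_extension_superset[OF K.finsupp_smult[OF d f] assms S(1,3,2)])
  also have "\<dots> = (\<Oplus>\<^bsub>V\<^esub> b\<in>?S. d \<odot>\<^bsub>V\<^esub> (f b \<odot>\<^bsub>V\<^esub> e b))"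
    using c d e by (intro M.finsum_cong') (auto simp: smult_assoc1 Pi_def)
  also have "\<dots> = d \<odot>\<^bsub>V\<^esub> linear_extension K V e f"
    unfolding linear_extension_def using c d e S by (intro finsum_smult_ldistr[symmetric]) auto
  finally show "linear_extension K V e (\<lambda>b. d \<otimes>\<^bsub>K\<^esub> f b) = d \<odot>\<^bsub>V\<^esub> linear_extension K V e f" .
qed

lemma linear_extension_single:
  assumes "e b \<in> carrier V"
  shows "linear_extension K V e (single K b) = e b"
proof -
  have "{b'. single K b b' \<noteq> \<zero>\<^bsub>K\<^esub>} = {b}" by (auto simp: single_def)
  then show ?thesis unfolding linear_extension_def using assms by (simp add: single_def)
qed

section \<open>Quotient spaces\<close>

lemma quotient_carrier: "carrier (quotient_module V N) = {N +>\<^bsub>V\<^esub> v | v. v \<in> carrier V}"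
  by (auto simp: quotient_module_def A_RCOSETS_def')

lemma quotient_eq_iff:
  assumes "submodule N K V" "v \<in> carrier V" "w \<in> carrier V"
  shows "N +>\<^bsub>V\<^esub> v = N +>\<^bsub>V\<^esub> w \<longleftrightarrow> v \<ominus>\<^bsub>V\<^esub> w \<in> N"
proof -
  have N: "subgroup N (add_monoid V)" using assms(1) submodule.axioms(1) by blast
  note NS = submodule_vspace[OF assms(1)]
  show ?thesis
  proof
    assume "N +>\<^bsub>V\<^esub> v = N +>\<^bsub>V\<^esub> w"
    then have "N +>\<^bsub>V\<^esub> (v \<oplus>\<^bsub>V\<^esub> \<ominus>\<^bsub>V\<^esub> w) = N" using assms NS by (intro M.a_coset_add_inv2) auto
    then show "v \<ominus>\<^bsub>V\<^esub> w \<in> N" using M.a_coset_join1[OF _ _ N] assms by (simp add: a_minus_def)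
  next
    assume "v \<ominus>\<^bsub>V\<^esub> w \<in> N"
    then have "N +>\<^bsub>V\<^esub> (v \<oplus>\<^bsub>V\<^esub> \<ominus>\<^bsub>V\<^esub> w) = N"
      using M.a_coset_join2[OF _ N] assms by (simp add: a_minus_def)
    then show "N +>\<^bsub>V\<^esub> v = N +>\<^bsub>V\<^esub> w" using assms NS by (intro M.a_coset_add_inv1) auto
  qed
qed

lemma mem_coset_iff:
  assumes "submodule N K V" "v \<in> carrier V"
  shows "x \<in> N +>\<^bsub>V\<^esub> v \<longleftrightarrow> x \<in> carrier V \<and> x \<ominus>\<^bsub>V\<^esub> v \<in> N"
proof
  note NS = submodule_vspace[OF assms(1)]
  assume "x \<in> N +>\<^bsub>V\<^esub> v"
  then obtain n where n: "n \<in> N" "x = n \<oplus>\<^bsub>V\<^esub> v" by (auto simp: a_r_coset_def')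
  then have "n \<in> carrier V" using NS by auto
  then show "x \<in> carrier V \<and> x \<ominus>\<^bsub>V\<^esub> v \<in> N"
    using n assms by (simp add: a_minus_def M.a_assoc M.r_neg)
next
  assume *: "x \<in> carrier V \<and> x \<ominus>\<^bsub>V\<^esub> v \<in> N"
  then have "x = (x \<ominus>\<^bsub>V\<^esub> v) \<oplus>\<^bsub>V\<^esub> v" using assms by (simp add: a_minus_def M.a_assoc M.l_neg)
  then show "x \<in> N +>\<^bsub>V\<^esub> v" using * unfolding a_r_coset_def' by blast
qed

lemma quotient_add:
  assumes "submodule N K V" "v \<in> carrier V" "w \<in> carrier V"
  shows "(N +>\<^bsub>V\<^esub> v) \<oplus>\<^bsub>quotient_module V N\<^esub> (N +>\<^bsub>V\<^esub> w) = N +>\<^bsub>V\<^esub> (v \<oplus>\<^bsub>V\<^esub> w)"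
proof -
  have "additive_subgroup N V" using assms(1) submodule.axioms(1) additive_subgroupI by blast
  then interpret N: abelian_subgroup N V by (intro abelian_subgroupI3 M.abelian_group_axioms)
  show ?thesis using N.a_rcos_sum assms by (simp add: quotient_module_def)
qed

lemma quotient_smult:
  assumes "submodule N K V" "v \<in> carrier V" "c \<in> carrier K"
  shows "c \<odot>\<^bsub>quotient_module V N\<^esub> (N +>\<^bsub>V\<^esub> v) = N +>\<^bsub>V\<^esub> (c \<odot>\<^bsub>V\<^esub> v)"
proof -
  note NS = submodule_vspace[OF assms(1)]
  have "N +>\<^bsub>V\<^esub> (c \<odot>\<^bsub>V\<^esub> x) = N +>\<^bsub>V\<^esub> (c \<odot>\<^bsub>V\<^esub> v)" if "x \<in> N +>\<^bsub>V\<^esub> v" for x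
  proof -
    have x: "x \<in> carrier V" "x \<ominus>\<^bsub>V\<^esub> v \<in> N" using that mem_coset_iff[OF assms(1,2)] by auto
    have "c \<odot>\<^bsub>V\<^esub> x \<ominus>\<^bsub>V\<^esub> c \<odot>\<^bsub>V\<^esub> v = c \<odot>\<^bsub>V\<^esub> (x \<ominus>\<^bsub>V\<^esub> v)"
      using x assms by (simp add: a_minus_def smult_r_distr smult_r_minus)
    then show ?thesis using quotient_eq_iff[OF assms(1)] x assms NS by simp
  qed
  moreover have "v \<in> N +>\<^bsub>V\<^esub> v" using mem_coset_iff[OF assms(1,2)] NS assms by (simp add: a_minus_def M.r_neg)
  ultimately have "(\<Union>x\<in>N +>\<^bsub>V\<^esub> v. N +>\<^bsub>V\<^esub> (c \<odot>\<^bsub>V\<^esub> x)) = N +>\<^bsub>V\<^esub> (c \<odot>\<^bsub>V\<^esub> v)"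
    by (intro SUP_eq_const) (blast, assumption)
  then show ?thesis by (simp add: quotient_module_def)
qed

lemma quotient_zero: "submodule N K V \<Longrightarrow> \<zero>\<^bsub>quotient_module V N\<^esub> = N +>\<^bsub>V\<^esub> \<zero>\<^bsub>V\<^esub>"
  using submodule_vspace(1) by (simp add: quotient_module_def)

lemma vspace_quotient:
  assumes N: "submodule N K V"
  shows "vspace K (quotient_module V N)"
proof -
  let ?Q = "quotient_module V N" and ?p = "\<lambda>v. N +>\<^bsub>V\<^esub> v"
  note q = quotient_add[OF N] quotient_smult[OF N] quotient_zero[OF N]
  have ex: "x \<in> carrier ?Q \<Longrightarrow> \<exists>v\<in>carrier V. x = ?p v" for x by (auto simp: quotient_carrier)
  have cl: "v \<in> carrier V \<Longrightarrow> ?p v \<in> carrier ?Q" for v by (auto simp: quotient_carrier)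
  have "abelian_group ?Q"
  proof (rule abelian_groupI)
    fix x y assume "x \<in> carrier ?Q" "y \<in> carrier ?Q"
    then obtain v w where *: "v \<in> carrier V" "w \<in> carrier V" "x = ?p v" "y = ?p w" using ex by blast
    then show "x \<oplus>\<^bsub>?Q\<^esub> y \<in> carrier ?Q" "x \<oplus>\<^bsub>?Q\<^esub> y = y \<oplus>\<^bsub>?Q\<^esub> x"
      by (auto simp: q cl M.a_comm)
    fix z assume "z \<in> carrier ?Q"
    then obtain u where "u \<in> carrier V" "z = ?p u" using ex by blast
    with * show "x \<oplus>\<^bsub>?Q\<^esub> y \<oplus>\<^bsub>?Q\<^esub> z = x \<oplus>\<^bsub>?Q\<^esub> (y \<oplus>\<^bsub>?Q\<^esub> z)" by (simp add: q M.a_assoc)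
  next
    fix x assume "x \<in> carrier ?Q"
    then obtain v where *: "v \<in> carrier V" "x = ?p v" using ex by blast
    then show "\<zero>\<^bsub>?Q\<^esub> \<oplus>\<^bsub>?Q\<^esub> x = x" by (simp add: q)
    have "?p (\<ominus>\<^bsub>V\<^esub> v) \<oplus>\<^bsub>?Q\<^esub> x = \<zero>\<^bsub>?Q\<^esub>" using * by (simp add: q M.l_neg)
    then show "\<exists>y\<in>carrier ?Q. y \<oplus>\<^bsub>?Q\<^esub> x = \<zero>\<^bsub>?Q\<^esub>" using * cl by blast
  qed (simp add: q cl)
  then have "module K ?Q"
  proof (rule moduleI[OF K.is_cring])
    fix a x assume a: "a \<in> carrier K" and "x \<in> carrier ?Q"
    then obtain v where v: "v \<in> carrier V" "x = ?p v" using ex by blast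
    with a show "a \<odot>\<^bsub>?Q\<^esub> x \<in> carrier ?Q" by (simp add: q cl)
    fix b assume "b \<in> carrier K"
    with a v show "(a \<oplus>\<^bsub>K\<^esub> b) \<odot>\<^bsub>?Q\<^esub> x = a \<odot>\<^bsub>?Q\<^esub> x \<oplus>\<^bsub>?Q\<^esub> b \<odot>\<^bsub>?Q\<^esub> x"
      "(a \<otimes>\<^bsub>K\<^esub> b) \<odot>\<^bsub>?Q\<^esub> x = a \<odot>\<^bsub>?Q\<^esub> (b \<odot>\<^bsub>?Q\<^esub> x)"
      by (simp_all add: q smult_l_distr smult_assoc1)
  next
    fix a x y assume a: "a \<in> carrier K" and "x \<in> carrier ?Q" "y \<in> carrier ?Q"
    then obtain v w where "v \<in> carrier V" "w \<in> carrier V" "x = ?p v" "y = ?p w" using ex by blast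
    with a show "a \<odot>\<^bsub>?Q\<^esub> (x \<oplus>\<^bsub>?Q\<^esub> y) = a \<odot>\<^bsub>?Q\<^esub> x \<oplus>\<^bsub>?Q\<^esub> a \<odot>\<^bsub>?Q\<^esub> y"
      by (simp add: q smult_r_distr)
  next
    fix x assume "x \<in> carrier ?Q"
    then obtain v where v: "v \<in> carrier V" "x = ?p v" using ex by blast
    then show "\<one>\<^bsub>K\<^esub> \<odot>\<^bsub>?Q\<^esub> x = x" by (simp add: q)
  qed
  then show ?thesis by (intro vspace.intro K.field_axioms)
qed

lemma quotient_projection_linear:
  assumes "submodule N K V"
  shows "linear_map K V (quotient_module V N) (\<lambda>v. N +>\<^bsub>V\<^esub> v)"
  using assms by (intro linear_mapI) (auto simp: quotient_carrier quotient_add quotient_smult)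

end

section \<open>Bilinear maps and the universal property of the tensor product\<close>

lemma bilinear_mapI:
  assumes "\<And>u v. u \<in> carrier U \<Longrightarrow> v \<in> carrier V \<Longrightarrow> \<beta> u v \<in> carrier W"
    and "\<And>u u' v. u \<in> carrier U \<Longrightarrow> u' \<in> carrier U \<Longrightarrow> v \<in> carrier V \<Longrightarrow> \<beta> (u \<oplus>\<^bsub>U\<^esub> u') v = \<beta> u v \<oplus>\<^bsub>W\<^esub> \<beta> u' v"
    and "\<And>u v v'. u \<in> carrier U \<Longrightarrow> v \<in> carrier V \<Longrightarrow> v' \<in> carrier V \<Longrightarrow> \<beta> u (v \<oplus>\<^bsub>V\<^esub> v') = \<beta> u v \<oplus>\<^bsub>W\<^esub> \<beta> u v'"
    and "\<And>c u v. c \<in> carrier K \<Longrightarrow> u \<in> carrier U \<Longrightarrow> v \<in> carrier V \<Longrightarrow> \<beta> (c \<odot>\<^bsub>U\<^esub> u) v = c \<odot>\<^bsub>W\<^esub> \<beta> u v"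
    and "\<And>c u v. c \<in> carrier K \<Longrightarrow> u \<in> carrier U \<Longrightarrow> v \<in> carrier V \<Longrightarrow> \<beta> u (c \<odot>\<^bsub>V\<^esub> v) = c \<odot>\<^bsub>W\<^esub> \<beta> u v"
  shows "bilinear_map K U V W \<beta>"
  using assms by (auto simp: bilinear_map_def intro!: linear_mapI)

lemma bilinear_mapD:
  assumes "bilinear_map K U V W \<beta>"
  shows "\<And>u v. u \<in> carrier U \<Longrightarrow> v \<in> carrier V \<Longrightarrow> \<beta> u v \<in> carrier W"
    and "\<And>u u' v. u \<in> carrier U \<Longrightarrow> u' \<in> carrier U \<Longrightarrow> v \<in> carrier V \<Longrightarrow> \<beta> (u \<oplus>\<^bsub>U\<^esub> u') v = \<beta> u v \<oplus>\<^bsub>W\<^esub> \<beta> u' v"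
    and "\<And>u v v'. u \<in> carrier U \<Longrightarrow> v \<in> carrier V \<Longrightarrow> v' \<in> carrier V \<Longrightarrow> \<beta> u (v \<oplus>\<^bsub>V\<^esub> v') = \<beta> u v \<oplus>\<^bsub>W\<^esub> \<beta> u v'"
    and "\<And>c u v. c \<in> carrier K \<Longrightarrow> u \<in> carrier U \<Longrightarrow> v \<in> carrier V \<Longrightarrow> \<beta> (c \<odot>\<^bsub>U\<^esub> u) v = c \<odot>\<^bsub>W\<^esub> \<beta> u v"
    and "\<And>c u v. c \<in> carrier K \<Longrightarrow> u \<in> carrier U \<Longrightarrow> v \<in> carrier V \<Longrightarrow> \<beta> u (c \<odot>\<^bsub>V\<^esub> v) = c \<odot>\<^bsub>W\<^esub> \<beta> u v"
  using assms by (auto simp: bilinear_map_def dest: linear_mapD)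

lemma bilinear_map_linear:
  assumes "bilinear_map K U V W \<beta>"
  shows "u \<in> carrier U \<Longrightarrow> linear_map K V W (\<lambda>v. \<beta> u v)" "v \<in> carrier V \<Longrightarrow> linear_map K U W (\<lambda>u. \<beta> u v)"
  using assms by (auto simp: bilinear_map_def)

lemma bilinear_map_comp:
  assumes "bilinear_map K U V W \<beta>" "linear_map K U' U f" "linear_map K V' V g" "linear_map K W W' h"
  shows "bilinear_map K U' V' W' (\<lambda>u v. h (\<beta> (f u) (g v)))"
  using bilinear_mapD[OF assms(1)] linear_mapD[OF assms(2)] linear_mapD[OF assms(3)] linear_mapD[OF assms(4)]
  by (intro bilinear_mapI) simp_all

lemma bilinear_map_swap: "bilinear_map K U V W \<beta> \<Longrightarrow> bilinear_map K V U W (\<lambda>v u. \<beta> u v)"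
  by (auto simp: bilinear_map_def)

lemma bilinear_map_smult: "vspace K V \<Longrightarrow> bilinear_map K (ground_algebra K) V V (\<lambda>c v. c \<odot>\<^bsub>V\<^esub> v)"
proof -
  assume "vspace K V"
  then interpret V: vspace K V .
  show ?thesis
    by (rule bilinear_mapI) (auto simp: V.smult_l_distr V.smult_r_distr V.smult_assoc1[symmetric] V.K.m_comm)
qed

locale vspace_pair = V?: vspace K V + W?: vspace K W
  for K :: "('k, 'x) ring_scheme" (structure) and V :: "('k, 'v, 'y) module_scheme" (structure)
    and W :: "('k, 'w, 'z) module_scheme" (structure)
begin

abbreviation "FVW \<equiv> free_module K (carrier V \<times> carrier W)"
abbreviation "RVW \<equiv> tensor_relations K V W"
abbreviation "TVW \<equiv> tensor_space K V W"
abbreviation "pure \<equiv> pure_tensor K V W"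

sublocale F: vspace K FVW by (rule K.vspace_free_module)

lemma single_closed: "v \<in> carrier V \<Longrightarrow> w \<in> carrier W \<Longrightarrow> single K (v, w) \<in> carrier FVW"
  using K.single_finsupp[of "(v, w)" "carrier V \<times> carrier W"] by simp

text \<open>Together these facts characterize the relations as the least subspace containing the
  four families of generators; they are proved jointly so that the generating set is unfolded
  once.\<close>

lemma relations_submodule: "submodule RVW K FVW"
  and relations_generators:
    "\<lbrakk>v \<in> carrier V; v' \<in> carrier V; w \<in> carrier W\<rbrakk> \<Longrightarrow>
      single K (v \<oplus>\<^bsub>V\<^esub> v', w) \<ominus>\<^bsub>FVW\<^esub> (single K (v, w) \<oplus>\<^bsub>FVW\<^esub> single K (v', w)) \<in> RVW"
    "\<lbrakk>v \<in> carrier V; w \<in> carrier W; w' \<in> carrier W\<rbrakk> \<Longrightarrow>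
      single K (v, w \<oplus>\<^bsub>W\<^esub> w') \<ominus>\<^bsub>FVW\<^esub> (single K (v, w) \<oplus>\<^bsub>FVW\<^esub> single K (v, w')) \<in> RVW"
    "\<lbrakk>c \<in> carrier K; v \<in> carrier V; w \<in> carrier W\<rbrakk> \<Longrightarrow>
      single K (c \<odot>\<^bsub>V\<^esub> v, w) \<ominus>\<^bsub>FVW\<^esub> c \<odot>\<^bsub>FVW\<^esub> single K (v, w) \<in> RVW"
    "\<lbrakk>c \<in> carrier K; v \<in> carrier V; w \<in> carrier W\<rbrakk> \<Longrightarrow>
      single K (v, c \<odot>\<^bsub>W\<^esub> w) \<ominus>\<^bsub>FVW\<^esub> c \<odot>\<^bsub>FVW\<^esub> single K (v, w) \<in> RVW"
  and relations_minimal: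
    "\<lbrakk>submodule N K FVW;
      \<And>v v' w. \<lbrakk>v \<in> carrier V; v' \<in> carrier V; w \<in> carrier W\<rbrakk> \<Longrightarrow>
        single K (v \<oplus>\<^bsub>V\<^esub> v', w) \<ominus>\<^bsub>FVW\<^esub> (single K (v, w) \<oplus>\<^bsub>FVW\<^esub> single K (v', w)) \<in> N;
      \<And>v w w'. \<lbrakk>v \<in> carrier V; w \<in> carrier W; w' \<in> carrier W\<rbrakk> \<Longrightarrow>
        single K (v, w \<oplus>\<^bsub>W\<^esub> w') \<ominus>\<^bsub>FVW\<^esub> (single K (v, w) \<oplus>\<^bsub>FVW\<^esub> single K (v, w')) \<in> N;
      \<And>c v w. \<lbrakk>c \<in> carrier K; v \<in> carrier V; w \<in> carrier W\<rbrakk> \<Longrightarrow>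
        single K (c \<odot>\<^bsub>V\<^esub> v, w) \<ominus>\<^bsub>FVW\<^esub> c \<odot>\<^bsub>FVW\<^esub> single K (v, w) \<in> N;
      \<And>c v w. \<lbrakk>c \<in> carrier K; v \<in> carrier V; w \<in> carrier W\<rbrakk> \<Longrightarrow>
        single K (v, c \<odot>\<^bsub>W\<^esub> w) \<ominus>\<^bsub>FVW\<^esub> c \<odot>\<^bsub>FVW\<^esub> single K (v, w) \<in> N\<rbrakk> \<Longrightarrow> RVW \<subseteq> N"
proof -
  let ?F = FVW and ?d = "single K"
  let ?A = "{?d (v \<oplus>\<^bsub>V\<^esub> v', w) \<ominus>\<^bsub>?F\<^esub> (?d (v, w) \<oplus>\<^bsub>?F\<^esub> ?d (v', w)) | v v' w.
          v \<in> carrier V \<and> v' \<in> carrier V \<and> w \<in> carrier W}"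
  let ?B = "{?d (v, w \<oplus>\<^bsub>W\<^esub> w') \<ominus>\<^bsub>?F\<^esub> (?d (v, w) \<oplus>\<^bsub>?F\<^esub> ?d (v, w')) | v w w'.
          v \<in> carrier V \<and> w \<in> carrier W \<and> w' \<in> carrier W}"
  let ?C = "{?d (c \<odot>\<^bsub>V\<^esub> v, w) \<ominus>\<^bsub>?F\<^esub> c \<odot>\<^bsub>?F\<^esub> ?d (v, w) | c v w.
          c \<in> carrier K \<and> v \<in> carrier V \<and> w \<in> carrier W}"
  let ?D = "{?d (v, c \<odot>\<^bsub>W\<^esub> w) \<ominus>\<^bsub>?F\<^esub> c \<odot>\<^bsub>?F\<^esub> ?d (v, w) | c v w.
          c \<in> carrier K \<and> v \<in> carrier V \<and> w \<in> carrier W}"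
  let ?G = "?A \<union> ?B \<union> ?C \<union> ?D"
  have R: "RVW = linear_span K ?F ?G"
    unfolding tensor_relations_def Let_def ..
  note sc = single_closed
  have cl: "?A \<subseteq> carrier ?F" "?B \<subseteq> carrier ?F" "?C \<subseteq> carrier ?F" "?D \<subseteq> carrier ?F"
    by (auto simp del: free_module_simps intro!: F.M.minus_closed F.M.a_closed F.smult_closed sc)
  then show "submodule RVW K FVW" unfolding R by (intro F.span_submodule Un_least)
  have sup: "?A \<subseteq> RVW" "?B \<subseteq> RVW" "?C \<subseteq> RVW" "?D \<subseteq> RVW"
    unfolding R using F.span_superset[of ?G] by (simp_all only: Un_subset_iff)
  show "\<lbrakk>v \<in> carrier V; v' \<in> carrier V; w \<in> carrier W\<rbrakk> \<Longrightarrow>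
      single K (v \<oplus>\<^bsub>V\<^esub> v', w) \<ominus>\<^bsub>FVW\<^esub> (single K (v, w) \<oplus>\<^bsub>FVW\<^esub> single K (v', w)) \<in> RVW" for v v' w
    by (rule subsetD[OF sup(1)]) blast
  show "\<lbrakk>v \<in> carrier V; w \<in> carrier W; w' \<in> carrier W\<rbrakk> \<Longrightarrow>
      single K (v, w \<oplus>\<^bsub>W\<^esub> w') \<ominus>\<^bsub>FVW\<^esub> (single K (v, w) \<oplus>\<^bsub>FVW\<^esub> single K (v, w')) \<in> RVW" for v w w'
    by (rule subsetD[OF sup(2)]) blast
  show "\<lbrakk>c \<in> carrier K; v \<in> carrier V; w \<in> carrier W\<rbrakk> \<Longrightarrow>
      single K (c \<odot>\<^bsub>V\<^esub> v, w) \<ominus>\<^bsub>FVW\<^esub> c \<odot>\<^bsub>FVW\<^esub> single K (v, w) \<in> RVW" for c v w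
    by (rule subsetD[OF sup(3)]) blast
  show "\<lbrakk>c \<in> carrier K; v \<in> carrier V; w \<in> carrier W\<rbrakk> \<Longrightarrow>
      single K (v, c \<odot>\<^bsub>W\<^esub> w) \<ominus>\<^bsub>FVW\<^esub> c \<odot>\<^bsub>FVW\<^esub> single K (v, w) \<in> RVW" for c v w
    by (rule subsetD[OF sup(4)]) blast
  assume N: "submodule N K FVW"
    and A: "\<And>v v' w. \<lbrakk>v \<in> carrier V; v' \<in> carrier V; w \<in> carrier W\<rbrakk> \<Longrightarrow>
        single K (v \<oplus>\<^bsub>V\<^esub> v', w) \<ominus>\<^bsub>FVW\<^esub> (single K (v, w) \<oplus>\<^bsub>FVW\<^esub> single K (v', w)) \<in> N"
    and B: "\<And>v w w'. \<lbrakk>v \<in> carrier V; w \<in> carrier W; w' \<in> carrier W\<rbrakk> \<Longrightarrow>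
        single K (v, w \<oplus>\<^bsub>W\<^esub> w') \<ominus>\<^bsub>FVW\<^esub> (single K (v, w) \<oplus>\<^bsub>FVW\<^esub> single K (v, w')) \<in> N"
    and C: "\<And>c v w. \<lbrakk>c \<in> carrier K; v \<in> carrier V; w \<in> carrier W\<rbrakk> \<Longrightarrow>
        single K (c \<odot>\<^bsub>V\<^esub> v, w) \<ominus>\<^bsub>FVW\<^esub> c \<odot>\<^bsub>FVW\<^esub> single K (v, w) \<in> N"
    and D: "\<And>c v w. \<lbrakk>c \<in> carrier K; v \<in> carrier V; w \<in> carrier W\<rbrakk> \<Longrightarrow>
        single K (v, c \<odot>\<^bsub>W\<^esub> w) \<ominus>\<^bsub>FVW\<^esub> c \<odot>\<^bsub>FVW\<^esub> single K (v, w) \<in> N"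
  have "?A \<subseteq> N" using A by blast
  moreover have "?B \<subseteq> N" using B by blast
  moreover have "?C \<subseteq> N" using C by blast
  moreover have "?D \<subseteq> N" using D by blast
  ultimately show "RVW \<subseteq> N" unfolding R by (intro F.span_minimal[OF N] Un_least)
qed

sublocale T: vspace K TVW
  unfolding tensor_space_def by (rule F.vspace_quotient[OF relations_submodule])

lemma pure_bilinear: "bilinear_map K V W TVW pure"
  unfolding tensor_space_def
proof (rule bilinear_mapI)
  note q = F.quotient_add[OF relations_submodule, symmetric] F.quotient_smult[OF relations_submodule, symmetric]
  note e = F.quotient_eq_iff[OF relations_submodule, THEN iffD2]
  fix v w assume v: "v \<in> carrier V" and w: "w \<in> carrier W"
  show "pure v w \<in> carrier (quotient_module FVW RVW)"
    unfolding pure_tensor_def F.quotient_carrier using single_closed v w by blast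
  fix v' assume v': "v' \<in> carrier V"
  have "pure (v \<oplus>\<^bsub>V\<^esub> v') w = RVW +>\<^bsub>FVW\<^esub> (single K (v, w) \<oplus>\<^bsub>FVW\<^esub> single K (v', w))"
    unfolding pure_tensor_def
    using v v' w V.M.a_closed[OF v v'] by (intro e relations_generators F.M.a_closed single_closed)
  also have "\<dots> = pure v w \<oplus>\<^bsub>quotient_module FVW RVW\<^esub> pure v' w"
    unfolding pure_tensor_def by (intro F.quotient_add[OF relations_submodule, symmetric] single_closed v v' w)
  finally show "pure (v \<oplus>\<^bsub>V\<^esub> v') w = pure v w \<oplus>\<^bsub>quotient_module FVW RVW\<^esub> pure v' w" .
next
  note e = F.quotient_eq_iff[OF relations_submodule, THEN iffD2]
  fix v w w' assume v: "v \<in> carrier V" and w: "w \<in> carrier W" and w': "w' \<in> carrier W"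
  have "pure v (w \<oplus>\<^bsub>W\<^esub> w') = RVW +>\<^bsub>FVW\<^esub> (single K (v, w) \<oplus>\<^bsub>FVW\<^esub> single K (v, w'))"
    unfolding pure_tensor_def
    using v w w' W.M.a_closed[OF w w'] by (intro e relations_generators F.M.a_closed single_closed)
  also have "\<dots> = pure v w \<oplus>\<^bsub>quotient_module FVW RVW\<^esub> pure v w'"
    unfolding pure_tensor_def by (intro F.quotient_add[OF relations_submodule, symmetric] single_closed v w' w)
  finally show "pure v (w \<oplus>\<^bsub>W\<^esub> w') = pure v w \<oplus>\<^bsub>quotient_module FVW RVW\<^esub> pure v w'" .
next
  note e = F.quotient_eq_iff[OF relations_submodule, THEN iffD2]
  fix c v w assume c: "c \<in> carrier K" and v: "v \<in> carrier V" and w: "w \<in> carrier W"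
  have q: "RVW +>\<^bsub>FVW\<^esub> (c \<odot>\<^bsub>FVW\<^esub> single K (v, w)) = c \<odot>\<^bsub>quotient_module FVW RVW\<^esub> pure v w"
    unfolding pure_tensor_def by (intro F.quotient_smult[OF relations_submodule, symmetric] single_closed c v w)
  have "pure (c \<odot>\<^bsub>V\<^esub> v) w = RVW +>\<^bsub>FVW\<^esub> (c \<odot>\<^bsub>FVW\<^esub> single K (v, w))"
    unfolding pure_tensor_def
    by (intro e relations_generators F.smult_closed V.smult_closed single_closed c v w)
  then show "pure (c \<odot>\<^bsub>V\<^esub> v) w = c \<odot>\<^bsub>quotient_module FVW RVW\<^esub> pure v w" unfolding q .
  have "pure v (c \<odot>\<^bsub>W\<^esub> w) = RVW +>\<^bsub>FVW\<^esub> (c \<odot>\<^bsub>FVW\<^esub> single K (v, w))"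
    unfolding pure_tensor_def
    by (intro e relations_generators F.smult_closed W.smult_closed single_closed c v w)
  then show "pure v (c \<odot>\<^bsub>W\<^esub> w) = c \<odot>\<^bsub>quotient_module FVW RVW\<^esub> pure v w" unfolding q .
qed

lemmas pure_simps = bilinear_mapD[OF pure_bilinear]

text \<open>The preimage of \<open>N\<close> in the free module contains all \<open>single\<close>
  functions, hence is everything.\<close>

lemma tensor_generated:
  assumes "submodule N K TVW" "\<And>v w. v \<in> carrier V \<Longrightarrow> w \<in> carrier W \<Longrightarrow> pure v w \<in> N" "t \<in> carrier TVW"
  shows "t \<in> N"
proof -
  have lin: "linear_map K FVW TVW (\<lambda>f. RVW +>\<^bsub>FVW\<^esub> f)"
    unfolding tensor_space_def by (rule F.quotient_projection_linear[OF relations_submodule])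
  obtain f where f: "f \<in> carrier FVW" "t = RVW +>\<^bsub>FVW\<^esub> f"
    using assms(3) unfolding tensor_space_def F.quotient_carrier by blast
  have "submodule {f \<in> carrier FVW. RVW +>\<^bsub>FVW\<^esub> f \<in> N} K FVW"
    by (rule F.submodule_preimage[OF T.vspace_axioms lin assms(1) F.carrier_is_submodule])
  then have "f \<in> {f \<in> carrier FVW. RVW +>\<^bsub>FVW\<^esub> f \<in> N}"
  proof (rule K.free_module_generated)
    show "f \<in> finsupp K (carrier V \<times> carrier W)" using f by simp
    fix b assume "b \<in> carrier V \<times> carrier W"
    then obtain v w where b: "b = (v, w)" "v \<in> carrier V" "w \<in> carrier W" by blast
    show "single K b \<in> {f \<in> carrier FVW. RVW +>\<^bsub>FVW\<^esub> f \<in> N}"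
      using assms(2)[OF b(2,3)] single_closed[OF b(2,3)] b(1) by (simp add: pure_tensor_def)
  qed
  then show ?thesis using f by simp
qed

text \<open>\<open>tensor_lift\<close> evaluates an arbitrarily chosen representative. The linear
  extension of \<open>\<beta>\<close> kills the generators of the relations, so any representative
  \<open>f\<close> of the coset gives the same value.\<close>

lemma tensor_lift_eq:
  assumes U: "vspace K U" and \<beta>: "bilinear_map K V W U \<beta>" and f: "f \<in> carrier FVW"
  shows "tensor_lift K U \<beta> (RVW +>\<^bsub>FVW\<^esub> f) = linear_extension K U (\<lambda>p. \<beta> (fst p) (snd p)) f"
proof -
  interpret U: vspace K U by fact
  let ?e = "\<lambda>p. \<beta> (fst p) (snd p)"
  note b = bilinear_mapD[OF \<beta>]
  have e: "?e \<in> carrier V \<times> carrier W \<rightarrow> carrier U" using b by auto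
  let ?L = "linear_extension K U ?e"
  have L: "linear_map K FVW U ?L" by (rule U.linear_extension_linear[OF e])
  note LD = linear_mapD[OF L] linear_map_diff[OF F.vspace_axioms U L]
  have Ls: "?L (single K (v, w)) = \<beta> v w" if "v \<in> carrier V" "w \<in> carrier W" for v w
    using U.linear_extension_single[of ?e "(v, w)"] b that by simp
  have "RVW \<subseteq> {f \<in> carrier FVW. ?L f \<in> {\<zero>\<^bsub>U\<^esub>}}"
  proof (rule relations_minimal)
    show "submodule {f \<in> carrier FVW. ?L f \<in> {\<zero>\<^bsub>U\<^esub>}} K FVW"
      by (rule F.submodule_preimage[OF U L U.submodule_zero F.carrier_is_submodule])
  qed (use b in \<open>simp_all add: LD Ls single_closed U.M.diff_eq_zero_iff del: free_module_simps\<close>)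
  then have ker: "r \<in> RVW \<Longrightarrow> ?L r = \<zero>\<^bsub>U\<^esub>" for r by blast
  have "f \<in> RVW +>\<^bsub>FVW\<^esub> f"
    using F.mem_coset_iff[OF relations_submodule f] f F.submodule_vspace(2)[OF relations_submodule]
    by (simp add: a_minus_def F.M.r_neg del: free_module_simps)
  then have "(SOME g. g \<in> RVW +>\<^bsub>FVW\<^esub> f) \<in> RVW +>\<^bsub>FVW\<^esub> f" by (rule someI[where P = "\<lambda>g. g \<in> RVW +>\<^bsub>FVW\<^esub> f"])
  then obtain g where g: "g = (SOME g. g \<in> RVW +>\<^bsub>FVW\<^esub> f)" "g \<in> carrier FVW" "g \<ominus>\<^bsub>FVW\<^esub> f \<in> RVW"
    using F.mem_coset_iff[OF relations_submodule f] by blast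
  then have "?L g \<ominus>\<^bsub>U\<^esub> ?L f = \<zero>\<^bsub>U\<^esub>" using ker[OF g(3)] LD(4)[OF g(2) f] by simp
  then have "?L g = ?L f" using LD(1) g f U.M.diff_eq_zero_iff by blast
  then show ?thesis unfolding tensor_lift_def Let_def g(1)[symmetric] by (simp add: linear_extension_def)
qed

lemma tensor_lift_linear:
  assumes U: "vspace K U" and \<beta>: "bilinear_map K V W U \<beta>"
  shows "linear_map K TVW U (tensor_lift K U \<beta>)"
proof -
  interpret U: vspace K U by fact
  let ?e = "\<lambda>p. \<beta> (fst p) (snd p)"
  have e: "?e \<in> carrier V \<times> carrier W \<rightarrow> carrier U" using bilinear_mapD[OF \<beta>] by auto
  note L = linear_mapD[OF U.linear_extension_linear[OF e]]
  have ex: "t \<in> carrier TVW \<Longrightarrow> \<exists>f\<in>carrier FVW. t = RVW +>\<^bsub>FVW\<^esub> f" for t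
    unfolding tensor_space_def F.quotient_carrier by blast
  note eq = tensor_lift_eq[OF U \<beta>]
  show ?thesis
  proof (rule linear_mapI)
    fix s assume "s \<in> carrier TVW"
    then obtain f where f: "f \<in> carrier FVW" "s = RVW +>\<^bsub>FVW\<^esub> f" using ex by blast
    then show "tensor_lift K U \<beta> s \<in> carrier U" using L(1) eq by simp
    fix t assume "t \<in> carrier TVW"
    then obtain g where g: "g \<in> carrier FVW" "t = RVW +>\<^bsub>FVW\<^esub> g" using ex by blast
    have "s \<oplus>\<^bsub>TVW\<^esub> t = RVW +>\<^bsub>FVW\<^esub> (f \<oplus>\<^bsub>FVW\<^esub> g)"
      unfolding tensor_space_def f g using F.quotient_add[OF relations_submodule] f g by blast
    then show "tensor_lift K U \<beta> (s \<oplus>\<^bsub>TVW\<^esub> t) = tensor_lift K U \<beta> s \<oplus>\<^bsub>U\<^esub> tensor_lift K U \<beta> t"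
      using eq[OF F.M.a_closed[OF f(1) g(1)]] eq[OF f(1)] eq[OF g(1)] L(2)[OF f(1) g(1)] f(2) g(2)
      by (simp del: free_module_simps)
  next
    fix c s assume c: "c \<in> carrier K" and "s \<in> carrier TVW"
    then obtain f where f: "f \<in> carrier FVW" "s = RVW +>\<^bsub>FVW\<^esub> f" using ex by blast
    have "c \<odot>\<^bsub>TVW\<^esub> s = RVW +>\<^bsub>FVW\<^esub> (c \<odot>\<^bsub>FVW\<^esub> f)"
      unfolding tensor_space_def f using F.quotient_smult[OF relations_submodule] f c by blast
    then show "tensor_lift K U \<beta> (c \<odot>\<^bsub>TVW\<^esub> s) = c \<odot>\<^bsub>U\<^esub> tensor_lift K U \<beta> s"
      using eq[OF F.smult_closed[OF c f(1)]] eq[OF f(1)] L(3)[OF c f(1)] f(2)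
      by (simp del: free_module_simps)
  qed
qed

lemma tensor_lift_pure:
  assumes U: "vspace K U" and \<beta>: "bilinear_map K V W U \<beta>" and v: "v \<in> carrier V" and w: "w \<in> carrier W"
  shows "tensor_lift K U \<beta> (pure v w) = \<beta> v w"
proof -
  interpret U: vspace K U by fact
  show ?thesis
    unfolding pure_tensor_def tensor_lift_eq[OF U \<beta> single_closed[OF v w]]
    using U.linear_extension_single[of "\<lambda>p. \<beta> (fst p) (snd p)" "(v, w)"] bilinear_mapD(1)[OF \<beta> v w] by simp
qed

lemma tensor_map_ext:
  assumes U: "vspace K U" and "linear_map K TVW U f" "linear_map K TVW U g"
    and eq: "\<And>v w. v \<in> carrier V \<Longrightarrow> w \<in> carrier W \<Longrightarrow> f (pure v w) = g (pure v w)"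
    and t: "t \<in> carrier TVW"
  shows "f t = g t"
proof -
  interpret U: vspace K U by fact
  note f = linear_mapD[OF assms(2)] and g = linear_mapD[OF assms(3)]
  have z: "f \<zero>\<^bsub>TVW\<^esub> = \<zero>\<^bsub>U\<^esub>" "g \<zero>\<^bsub>TVW\<^esub> = \<zero>\<^bsub>U\<^esub>"
    using linear_map_zero[OF T.vspace_axioms U] assms(2,3) by blast+
  have "submodule {t \<in> carrier TVW. f t = g t} K TVW"
    by (rule T.submoduleI') (auto simp: f g z)
  then have "t \<in> {t \<in> carrier TVW. f t = g t}"
    by (rule tensor_generated) (use eq t pure_simps in auto)
  then show ?thesis by blast
qed

end

lemma vspace_tensor [simp]: "vspace K V \<Longrightarrow> vspace K W \<Longrightarrow> vspace K (tensor_space K V W)"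
proof -
  assume "vspace K V" "vspace K W"
  then interpret vspace_pair K V W by (rule vspace_pair.intro)
  show ?thesis by (rule T.vspace_axioms)
qed

lemma pure_tensor_bilinear: "vspace K V \<Longrightarrow> vspace K W \<Longrightarrow> bilinear_map K V W (tensor_space K V W) (pure_tensor K V W)"
  using vspace_pair.pure_bilinear vspace_pair.intro by blast

lemma pure_tensor_closed [simp]:
  "\<lbrakk>vspace K V; vspace K W; v \<in> carrier V; w \<in> carrier W\<rbrakk> \<Longrightarrow> pure_tensor K V W v w \<in> carrier (tensor_space K V W)"
  by (rule bilinear_mapD(1)[OF pure_tensor_bilinear])

lemma tensor_lift_is_linear:
  "\<lbrakk>vspace K V; vspace K W; vspace K U; bilinear_map K V W U \<beta>\<rbrakk> \<Longrightarrow>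
    linear_map K (tensor_space K V W) U (tensor_lift K U \<beta>)"
  using vspace_pair.tensor_lift_linear vspace_pair.intro by blast

lemma tensor_lift_pure_tensor:
  "\<lbrakk>vspace K V; vspace K W; vspace K U; bilinear_map K V W U \<beta>; v \<in> carrier V; w \<in> carrier W\<rbrakk> \<Longrightarrow>
    tensor_lift K U \<beta> (pure_tensor K V W v w) = \<beta> v w"
  by (rule vspace_pair.tensor_lift_pure) (auto intro: vspace_pair.intro)

lemma tensor_ext:
  assumes "vspace K V" "vspace K W" "vspace K U"
    "linear_map K (tensor_space K V W) U f" "linear_map K (tensor_space K V W) U g"
    "\<And>v w. v \<in> carrier V \<Longrightarrow> w \<in> carrier W \<Longrightarrow> f (pure_tensor K V W v w) = g (pure_tensor K V W v w)"
    "t \<in> carrier (tensor_space K V W)"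
  shows "f t = g t"
  by (rule vspace_pair.tensor_map_ext[OF vspace_pair.intro[OF assms(1,2)] assms(3-7)])

lemma linear_map_sum:
  assumes W: "vspace K W" and "linear_map K V W f" "linear_map K V W g"
  shows "linear_map K V W (\<lambda>x. f x \<oplus>\<^bsub>W\<^esub> g x)"
proof -
  interpret W: vspace K W by fact
  note f = linear_mapD[OF assms(2)] and g = linear_mapD[OF assms(3)]
  show ?thesis
    by (rule linear_mapI) (auto simp: f g W.smult_r_distr W.M.a_ac)
qed

lemma linear_map_scale:
  assumes W: "vspace K W" and "linear_map K V W f" "c \<in> carrier K"
  shows "linear_map K V W (\<lambda>x. c \<odot>\<^bsub>W\<^esub> f x)"
proof -
  interpret W: vspace K W by fact
  note f = linear_mapD[OF assms(2)]
  show ?thesis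
    using assms(3)
    by (intro linear_mapI) (auto simp: f W.smult_r_distr W.smult_assoc1[symmetric] W.K.m_comm)
qed

text \<open>For each law in the parameter, both sides are linear in the tensor and agree on pure
  tensors. This is what makes the nested lifts in \<open>tensor_bimap\<close> and
  \<open>tensor_assoc\<close> bilinear.\<close>

lemma tensor_lift_parametric:
  assumes U: "vspace K U" and V: "vspace K V" and W: "vspace K W" and P: "vspace K P"
    and b: "\<And>u. u \<in> carrier U \<Longrightarrow> bilinear_map K V W P (\<Phi> u)"
    and l: "\<And>v w. v \<in> carrier V \<Longrightarrow> w \<in> carrier W \<Longrightarrow> linear_map K U P (\<lambda>u. \<Phi> u v w)"
  shows "bilinear_map K U (tensor_space K V W) P (\<lambda>u. tensor_lift K P (\<Phi> u))"
proof -
  interpret U: vspace K U by fact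
  interpret P: vspace K P by fact
  note lin = tensor_lift_is_linear[OF V W P b]
  note [simp] = tensor_lift_pure_tensor[OF V W P b]
  have "linear_map K U P (\<lambda>u. tensor_lift K P (\<Phi> u) t)" if t: "t \<in> carrier (tensor_space K V W)" for t
  proof (rule linear_mapI)
    fix u assume u: "u \<in> carrier U"
    show "tensor_lift K P (\<Phi> u) t \<in> carrier P" using linear_mapD(1)[OF lin[OF u]] t .
    fix u' assume u': "u' \<in> carrier U"
    show "tensor_lift K P (\<Phi> (u \<oplus>\<^bsub>U\<^esub> u')) t = tensor_lift K P (\<Phi> u) t \<oplus>\<^bsub>P\<^esub> tensor_lift K P (\<Phi> u') t"
      using u u' linear_mapD(2)[OF l]
      by (intro tensor_ext[OF V W P lin linear_map_sum[OF P lin lin] _ t]) auto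
  next
    fix c u assume u: "u \<in> carrier U" and c: "c \<in> carrier K"
    show "tensor_lift K P (\<Phi> (c \<odot>\<^bsub>U\<^esub> u)) t = c \<odot>\<^bsub>P\<^esub> tensor_lift K P (\<Phi> u) t"
      using u c linear_mapD(3)[OF l]
      by (intro tensor_ext[OF V W P lin linear_map_scale[OF P lin c] _ t]) auto
  qed
  then show ?thesis using lin by (simp add: bilinear_map_def)
qed

lemma bilinear_comp_id:
  assumes "bilinear_map K U V W \<beta>" "linear_map K U' U f" "linear_map K V' V g"
  shows "bilinear_map K U' V' W (\<lambda>u v. \<beta> (f u) (g v))"
  using bilinear_map_comp[OF assms linear_map_id] .

lemma tensor_map_bilinear:
  assumes "vspace K V'" "vspace K W'" "linear_map K V V' f" "linear_map K W W' g"
  shows "bilinear_map K V W (tensor_space K V' W') (\<lambda>v w. pure_tensor K V' W' (f v) (g w))"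
  by (rule bilinear_comp_id[OF pure_tensor_bilinear[OF assms(1,2)] assms(3,4)])

lemma tensor_map_linear:
  assumes "vspace K V" "vspace K W" "vspace K V'" "vspace K W'" "linear_map K V V' f" "linear_map K W W' g"
  shows "linear_map K (tensor_space K V W) (tensor_space K V' W') (tensor_map K V' W' f g)"
  unfolding tensor_map_def using assms
  by (intro tensor_lift_is_linear[OF assms(1,2) _ tensor_map_bilinear[OF assms(3-6)]]) simp

lemma tensor_map_pure:
  assumes "vspace K V" "vspace K W" "vspace K V'" "vspace K W'" "linear_map K V V' f" "linear_map K W W' g"
    "v \<in> carrier V" "w \<in> carrier W"
  shows "tensor_map K V' W' f g (pure_tensor K V W v w) = pure_tensor K V' W' (f v) (g w)"
  unfolding tensor_map_def using assms
  by (intro tensor_lift_pure_tensor[OF assms(1,2) _ tensor_map_bilinear[OF assms(3-6)]]) simp_all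

section \<open>Products of bilinear maps, and the associator\<close>

context
  fixes K :: "('k, 'x) ring_scheme" and V V1 W W1 P Q and \<beta> \<gamma>
  assumes V: "vspace K V" and V1: "vspace K V1" and W: "vspace K W" and W1: "vspace K W1"
    and P: "vspace K P" and Q: "vspace K Q"
    and \<beta>: "bilinear_map K V V1 P \<beta>" and \<gamma>: "bilinear_map K W W1 Q \<gamma>"
begin

private abbreviation "\<Phi> \<equiv> \<lambda>v w v' w'. pure_tensor K P Q (\<beta> v v') (\<gamma> w w')"
private abbreviation "PQ \<equiv> tensor_space K P Q"

private lemma PQ: "vspace K PQ" using P Q by simp

private lemma bimap_inner:
  assumes "v \<in> carrier V" "w \<in> carrier W"
  shows "bilinear_map K V1 W1 PQ (\<Phi> v w)"
  by (rule bilinear_comp_id[OF pure_tensor_bilinear[OF P Q]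
    bilinear_map_linear(1)[OF \<beta> assms(1)] bilinear_map_linear(1)[OF \<gamma> assms(2)]])

private lemma bimap_middle:
  assumes t: "t \<in> carrier (tensor_space K V1 W1)"
  shows "bilinear_map K V W PQ (\<lambda>v w. tensor_lift K PQ (\<Phi> v w) t)"
  unfolding bilinear_map_def
proof (intro conjI ballI)
  fix v assume v: "v \<in> carrier V"
  have "bilinear_map K W (tensor_space K V1 W1) PQ (\<lambda>w. tensor_lift K PQ (\<Phi> v w))"
  proof (rule tensor_lift_parametric[OF W V1 W1 PQ bimap_inner[OF v]])
    fix v' w' assume *: "v' \<in> carrier V1" "w' \<in> carrier W1"
    show "linear_map K W PQ (\<lambda>w. \<Phi> v w v' w')"
      by (rule linear_map_comp[OF bilinear_map_linear(2)[OF \<gamma> *(2)]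
        bilinear_map_linear(1)[OF pure_tensor_bilinear[OF P Q] bilinear_mapD(1)[OF \<beta> v *(1)]]])
  qed
  then show "linear_map K W PQ (\<lambda>w. tensor_lift K PQ (\<Phi> v w) t)" using t by (simp add: bilinear_map_def)
next
  fix w assume w: "w \<in> carrier W"
  have "bilinear_map K V (tensor_space K V1 W1) PQ (\<lambda>v. tensor_lift K PQ (\<Phi> v w))"
  proof (rule tensor_lift_parametric[OF V V1 W1 PQ bimap_inner[OF _ w]])
    fix v' w' assume *: "v' \<in> carrier V1" "w' \<in> carrier W1"
    show "linear_map K V PQ (\<lambda>v. \<Phi> v w v' w')"
      by (rule linear_map_comp[OF bilinear_map_linear(2)[OF \<beta> *(1)]
        bilinear_map_linear(2)[OF pure_tensor_bilinear[OF P Q] bilinear_mapD(1)[OF \<gamma> w *(2)]]])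
  qed
  then show "linear_map K V PQ (\<lambda>v. tensor_lift K PQ (\<Phi> v w) t)" using t by (simp add: bilinear_map_def)
qed

text \<open>The definition lifts twice, in the second tensor for fixed \<open>v\<close> and
  \<open>w\<close> and then in the first. Linearity in the outer variables comes from
  \<open>tensor_lift_parametric\<close> at each stage.\<close>

lemma tensor_bimap_bilinear:
  "bilinear_map K (tensor_space K V W) (tensor_space K V1 W1) PQ (tensor_bimap K P Q \<beta> \<gamma>)"
proof -
  have "bilinear_map K (tensor_space K V1 W1) (tensor_space K V W) PQ
      (\<lambda>t. tensor_lift K PQ (\<lambda>v w. tensor_lift K PQ (\<Phi> v w) t))"
    by (rule tensor_lift_parametric[OF _ V W PQ bimap_middle])
      (use V1 W1 tensor_lift_is_linear[OF V1 W1 PQ bimap_inner] in auto)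
  from bilinear_map_swap[OF this] show ?thesis
    unfolding tensor_bimap_def[abs_def] .
qed

lemma tensor_bimap_pure:
  assumes "v \<in> carrier V" "w \<in> carrier W" "v' \<in> carrier V1" "w' \<in> carrier W1"
  shows "tensor_bimap K P Q \<beta> \<gamma> (pure_tensor K V W v w) (pure_tensor K V1 W1 v' w') =
    pure_tensor K P Q (\<beta> v v') (\<gamma> w w')"
  unfolding tensor_bimap_def
  using tensor_lift_pure_tensor[OF V W PQ bimap_middle assms(1,2)] tensor_lift_pure_tensor[OF V1 W1 PQ bimap_inner assms(3,4)]
    assms V1 W1 by simp

end

lemma tensor_ext2:
  assumes V: "vspace K V" and W: "vspace K W" and V1: "vspace K V1" and W1: "vspace K W1" and U: "vspace K U"
    and f: "bilinear_map K (tensor_space K V W) (tensor_space K V1 W1) U f"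
    and g: "bilinear_map K (tensor_space K V W) (tensor_space K V1 W1) U g"
    and eq: "\<And>v w v' w'. \<lbrakk>v \<in> carrier V; w \<in> carrier W; v' \<in> carrier V1; w' \<in> carrier W1\<rbrakk> \<Longrightarrow>
      f (pure_tensor K V W v w) (pure_tensor K V1 W1 v' w') = g (pure_tensor K V W v w) (pure_tensor K V1 W1 v' w')"
    and s: "s \<in> carrier (tensor_space K V W)" and t: "t \<in> carrier (tensor_space K V1 W1)"
  shows "f s t = g s t"
proof (rule tensor_ext[OF V W U bilinear_map_linear(2)[OF f t] bilinear_map_linear(2)[OF g t] _ s])
  fix v w assume *: "v \<in> carrier V" "w \<in> carrier W"
  then have p: "pure_tensor K V W v w \<in> carrier (tensor_space K V W)" using V W by simp
  show "f (pure_tensor K V W v w) t = g (pure_tensor K V W v w) t"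
    by (rule tensor_ext[OF V1 W1 U bilinear_map_linear(1)[OF f p] bilinear_map_linear(1)[OF g p] _ t]) (rule eq[OF *])
qed

text \<open>On pure tensors both sides are the same pure tensor. The use: exchanging the two
  arguments amounts to taking the opposite pairing in both legs, and this reduces right modules to
  left modules over opposite products.\<close>

lemma tensor_bimap_flip:
  assumes V: "vspace K V" and V1: "vspace K V1" and W: "vspace K W" and W1: "vspace K W1"
    and P: "vspace K P" and Q: "vspace K Q"
    and \<beta>: "bilinear_map K V V1 P \<beta>" and \<gamma>: "bilinear_map K W W1 Q \<gamma>"
    and s: "s \<in> carrier (tensor_space K V W)" and t: "t \<in> carrier (tensor_space K V1 W1)"
  shows "tensor_bimap K P Q \<beta> \<gamma> s t = tensor_bimap K P Q (\<lambda>x y. \<beta> y x) (\<lambda>x y. \<gamma> y x) t s"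
proof (rule tensor_ext2[OF V W V1 W1 _ _ bilinear_map_swap _ s t])
  show "vspace K (tensor_space K P Q)" using P Q by simp
  show "bilinear_map K (tensor_space K V W) (tensor_space K V1 W1) (tensor_space K P Q) (tensor_bimap K P Q \<beta> \<gamma>)"
    by (rule tensor_bimap_bilinear[OF V V1 W W1 P Q \<beta> \<gamma>])
  show "bilinear_map K (tensor_space K V1 W1) (tensor_space K V W) (tensor_space K P Q)
      (tensor_bimap K P Q (\<lambda>x y. \<beta> y x) (\<lambda>x y. \<gamma> y x))"
    by (rule tensor_bimap_bilinear[OF V1 V W1 W P Q bilinear_map_swap[OF \<beta>] bilinear_map_swap[OF \<gamma>]])
qed (simp add: tensor_bimap_pure[OF V V1 W W1 P Q \<beta> \<gamma>]
    tensor_bimap_pure[OF V1 V W1 W P Q bilinear_map_swap[OF \<beta>] bilinear_map_swap[OF \<gamma>]])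

context
  fixes K :: "('k, 'x) ring_scheme" and U V W
  assumes U: "vspace K U" and V: "vspace K V" and W: "vspace K W"
begin

private abbreviation "VW \<equiv> tensor_space K V W"
private abbreviation "UVW \<equiv> tensor_space K U VW"
private abbreviation "\<Psi> \<equiv> \<lambda>w u v. pure_tensor K U VW u (pure_tensor K V W v w)"

private lemma sp: "vspace K VW" "vspace K UVW" "vspace K (tensor_space K U V)" using U V W by simp_all

private lemma assoc_inner: "w \<in> carrier W \<Longrightarrow> bilinear_map K U V UVW (\<Psi> w)"
  by (rule bilinear_comp_id[OF pure_tensor_bilinear[OF U sp(1)] linear_map_id
    bilinear_map_linear(2)[OF pure_tensor_bilinear[OF V W]]])

private lemma assoc_outer: "bilinear_map K (tensor_space K U V) W UVW (\<lambda>x w. tensor_lift K UVW (\<Psi> w) x)"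
proof (rule bilinear_map_swap[OF tensor_lift_parametric[OF W U V sp(2) assoc_inner]])
  fix u v assume *: "u \<in> carrier U" "v \<in> carrier V"
  show "linear_map K W UVW (\<lambda>w. \<Psi> w u v)"
    by (rule linear_map_comp[OF bilinear_map_linear(1)[OF pure_tensor_bilinear[OF V W] *(2)]
      bilinear_map_linear(1)[OF pure_tensor_bilinear[OF U sp(1)] *(1)]])
qed

lemma tensor_assoc_linear: "linear_map K (tensor_space K (tensor_space K U V) W) UVW (tensor_assoc K U V W)"
  unfolding tensor_assoc_def[abs_def] Let_def by (rule tensor_lift_is_linear[OF sp(3) W sp(2) assoc_outer])

lemma tensor_assoc_pure:
  assumes "u \<in> carrier U" "v \<in> carrier V" "w \<in> carrier W"
  shows "tensor_assoc K U V W (pure_tensor K (tensor_space K U V) W (pure_tensor K U V u v) w) =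
    pure_tensor K U VW u (pure_tensor K V W v w)"
  unfolding tensor_assoc_def[abs_def] Let_def
  using tensor_lift_pure_tensor[OF sp(3) W sp(2) assoc_outer _ assms(3)]
    tensor_lift_pure_tensor[OF U V sp(2) assoc_inner assms(1,2)] assms U V W by simp

end

section \<open>Slices of tensors\<close>

text \<open>The map \<open>f \<otimes> id\<close> followed by the identification of
  \<open>K \<otimes> W\<close> with \<open>W\<close>; \<open>slice_r\<close> is its mirror image
  \<open>id \<otimes> p\<close>.\<close>

definition slice_l ::
    "('k, 'x) ring_scheme \<Rightarrow> ('k, 'w, 'z) module_scheme \<Rightarrow> ('v \<Rightarrow> 'k) \<Rightarrow> ('k, 'v, 'w) tensor \<Rightarrow> 'w"
  where "slice_l K W f = tensor_lift K W (\<lambda>v w. f v \<odot>\<^bsub>W\<^esub> w)"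

definition slice_r ::
    "('k, 'x) ring_scheme \<Rightarrow> ('k, 'v, 'z) module_scheme \<Rightarrow> ('w \<Rightarrow> 'k) \<Rightarrow> ('k, 'v, 'w) tensor \<Rightarrow> 'v"
  where "slice_r K V p = tensor_lift K V (\<lambda>v w. p w \<odot>\<^bsub>V\<^esub> v)"

lemma slice_l_bilinear: "vspace K W \<Longrightarrow> functional K V f \<Longrightarrow> bilinear_map K V W W (\<lambda>v w. f v \<odot>\<^bsub>W\<^esub> w)"
  by (rule bilinear_comp_id[OF bilinear_map_smult _ linear_map_id])

lemma slice_r_bilinear: "vspace K V \<Longrightarrow> functional K W p \<Longrightarrow> bilinear_map K V W V (\<lambda>v w. p w \<odot>\<^bsub>V\<^esub> v)"
  by (rule bilinear_comp_id[OF bilinear_map_swap[OF bilinear_map_smult] linear_map_id])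

lemma slice_l_linear: "vspace K V \<Longrightarrow> vspace K W \<Longrightarrow> functional K V f \<Longrightarrow> linear_map K (tensor_space K V W) W (slice_l K W f)"
  unfolding slice_l_def by (intro tensor_lift_is_linear slice_l_bilinear)

lemma slice_r_linear: "vspace K V \<Longrightarrow> vspace K W \<Longrightarrow> functional K W p \<Longrightarrow> linear_map K (tensor_space K V W) V (slice_r K V p)"
  unfolding slice_r_def by (intro tensor_lift_is_linear slice_r_bilinear)

lemma slice_l_pure:
  "\<lbrakk>vspace K V; vspace K W; functional K V f; v \<in> carrier V; w \<in> carrier W\<rbrakk> \<Longrightarrow>
    slice_l K W f (pure_tensor K V W v w) = f v \<odot>\<^bsub>W\<^esub> w"
  unfolding slice_l_def by (rule tensor_lift_pure_tensor) (auto intro: slice_l_bilinear)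

lemma slice_r_pure:
  "\<lbrakk>vspace K V; vspace K W; functional K W p; v \<in> carrier V; w \<in> carrier W\<rbrakk> \<Longrightarrow>
    slice_r K V p (pure_tensor K V W v w) = p w \<odot>\<^bsub>V\<^esub> v"
  unfolding slice_r_def by (rule tensor_lift_pure_tensor) (auto intro: slice_r_bilinear)

lemma functional_smult: "functional K V f \<Longrightarrow> c \<in> carrier K \<Longrightarrow> x \<in> carrier V \<Longrightarrow> f (c \<odot>\<^bsub>V\<^esub> x) = c \<otimes>\<^bsub>K\<^esub> f x"
  using linear_mapD(3) by fastforce

lemma functional_add: "functional K V f \<Longrightarrow> x \<in> carrier V \<Longrightarrow> y \<in> carrier V \<Longrightarrow> f (x \<oplus>\<^bsub>V\<^esub> y) = f x \<oplus>\<^bsub>K\<^esub> f y"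
  using linear_mapD(2) by fastforce

lemma functional_closed: "functional K V f \<Longrightarrow> x \<in> carrier V \<Longrightarrow> f x \<in> carrier K"
  using linear_mapD(1) by fastforce

text \<open>Both sides are \<open>(f \<otimes> p)(t)\<close>, as is seen on pure tensors.\<close>

lemma slice_exchange:
  assumes V: "vspace K V" and W: "vspace K W" and f: "functional K V f" and p: "functional K W p"
    and t: "t \<in> carrier (tensor_space K V W)"
  shows "p (slice_l K W f t) = f (slice_r K V p t)"
proof -
  interpret V: vspace K V by fact
  interpret W: vspace K W by fact
  show ?thesis
    by (rule tensor_ext[OF V W V.vspace_ground linear_map_comp[OF slice_l_linear[OF V W f] p]
        linear_map_comp[OF slice_r_linear[OF V W p] f] _ t])
      (simp add: slice_l_pure[OF V W f] slice_r_pure[OF V W p] functional_smult[OF f] functional_smult[OF p]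
        functional_closed[OF f] functional_closed[OF p] V.K.m_comm)
qed

section \<open>Subspaces of tensor products, tested by slices\<close>

context vspace_pair
begin

lemma tensor_subspace_submodule:
  assumes "X \<subseteq> carrier V" "Y \<subseteq> carrier W"
  shows "submodule (tensor_subspace K V W X Y) K TVW"
  unfolding tensor_subspace_def using assms pure_simps(1) by (intro T.span_submodule) blast

lemma tensor_subspace_closed:
  "X \<subseteq> carrier V \<Longrightarrow> Y \<subseteq> carrier W \<Longrightarrow> tensor_subspace K V W X Y \<subseteq> carrier TVW"
  using T.submodule_vspace(1)[OF tensor_subspace_submodule] .

lemma pure_in_tensor_subspace: "x \<in> X \<Longrightarrow> y \<in> Y \<Longrightarrow> pure x y \<in> tensor_subspace K V W X Y"
  unfolding tensor_subspace_def by (rule subsetD[OF T.span_superset]) blast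

lemma tensor_subspace_minimal:
  "submodule N K TVW \<Longrightarrow> (\<And>x y. x \<in> X \<Longrightarrow> y \<in> Y \<Longrightarrow> pure x y \<in> N) \<Longrightarrow> tensor_subspace K V W X Y \<subseteq> N"
  unfolding tensor_subspace_def by (rule T.span_minimal) blast+

lemma tensor_subspace_mono: "X \<subseteq> X' \<Longrightarrow> Y \<subseteq> Y' \<Longrightarrow> tensor_subspace K V W X Y \<subseteq> tensor_subspace K V W X' Y'"
  unfolding tensor_subspace_def by (intro T.span_mono) blast

lemma tensor_subspace_top: "t \<in> carrier TVW \<Longrightarrow> t \<in> tensor_subspace K V W (carrier V) (carrier W)"
  by (rule tensor_generated[OF tensor_subspace_submodule]) (auto intro: pure_in_tensor_subspace)

lemma slice_l_mem:
  assumes f: "functional K V f" and X: "X \<subseteq> carrier V" and Y: "submodule Y K W"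
    and t: "t \<in> tensor_subspace K V W X Y"
  shows "slice_l K W f t \<in> Y"
proof -
  note lin = slice_l_linear[OF V.vspace_axioms W.vspace_axioms f]
  note YS = W.submodule_vspace[OF Y]
  have "tensor_subspace K V W X Y \<subseteq> {t \<in> carrier TVW. slice_l K W f t \<in> Y}"
  proof (rule tensor_subspace_minimal)
    show "submodule {t \<in> carrier TVW. slice_l K W f t \<in> Y} K TVW"
      by (rule T.submodule_preimage[OF W.vspace_axioms lin Y T.carrier_is_submodule])
    fix x y assume "x \<in> X" "y \<in> Y"
    moreover then have "x \<in> carrier V" "y \<in> carrier W" using X YS(1) by auto
    ultimately show "pure x y \<in> {t \<in> carrier TVW. slice_l K W f t \<in> Y}"
      using slice_l_pure[OF V.vspace_axioms W.vspace_axioms f] pure_simps(1) YS(4) functional_closed[OF f] by simp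
  qed
  then show ?thesis using t by blast
qed

lemma slice_r_vanishes:
  assumes p: "functional K W p" and X: "X \<subseteq> carrier V" and Y: "Y \<subseteq> carrier W" and "\<forall>y\<in>Y. p y = \<zero>\<^bsub>K\<^esub>"
    and t: "t \<in> tensor_subspace K V W X Y"
  shows "slice_r K V p t = \<zero>\<^bsub>V\<^esub>"
proof -
  note lin = slice_r_linear[OF V.vspace_axioms W.vspace_axioms p]
  have "tensor_subspace K V W X Y \<subseteq> {t \<in> carrier TVW. slice_r K V p t \<in> {\<zero>\<^bsub>V\<^esub>}}"
  proof (rule tensor_subspace_minimal)
    show "submodule {t \<in> carrier TVW. slice_r K V p t \<in> {\<zero>\<^bsub>V\<^esub>}} K TVW"
      by (rule T.submodule_preimage[OF V.vspace_axioms lin V.submodule_zero T.carrier_is_submodule])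
    fix x y assume *: "x \<in> X" "y \<in> Y"
    moreover then have "x \<in> carrier V" "y \<in> carrier W" using X Y by auto
    ultimately show "pure x y \<in> {t \<in> carrier TVW. slice_r K V p t \<in> {\<zero>\<^bsub>V\<^esub>}}"
      using slice_r_pure[OF V.vspace_axioms W.vspace_axioms p] pure_simps(1) assms(4) by simp
  qed
  then show ?thesis using t by blast
qed

text \<open>A tensor is a finite sum of pure tensors, so finitely many right factors suffice.
  Formally, the tensors with this property form a subspace that contains the pure ones.\<close>

lemma tensor_subspace_finite_support:
  assumes X: "submodule X K V" and t: "t \<in> tensor_subspace K V W X (carrier W)"
  shows "\<exists>S. finite S \<and> S \<subseteq> carrier W \<and> t \<in> tensor_subspace K V W X (linear_span K W S)"
proof -
  note XS = V.submodule_vspace[OF X]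
  let ?P = "\<lambda>t. \<exists>S. finite S \<and> S \<subseteq> carrier W \<and> t \<in> tensor_subspace K V W X (linear_span K W S)"
  have sub: "submodule (tensor_subspace K V W X (linear_span K W S)) K TVW" if "S \<subseteq> carrier W" for S
    by (rule tensor_subspace_submodule[OF XS(1) W.span_closed[OF that]])
  have mono: "tensor_subspace K V W X (linear_span K W S) \<subseteq> tensor_subspace K V W X (linear_span K W S')"
    if "S \<subseteq> S'" for S S'
    by (rule tensor_subspace_mono[OF subset_refl W.span_mono[OF that]])
  have "submodule {t \<in> carrier TVW. ?P t} K TVW"
  proof (rule T.submoduleI')
    show "\<zero>\<^bsub>TVW\<^esub> \<in> {t \<in> carrier TVW. ?P t}"
      using T.submodule_vspace(2)[OF sub[of "{}"]] by auto
  next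
    fix s t assume "s \<in> {t \<in> carrier TVW. ?P t}" "t \<in> {t \<in> carrier TVW. ?P t}"
    then obtain S S' where st: "s \<in> carrier TVW" "t \<in> carrier TVW"
      and S: "finite S" "S \<subseteq> carrier W" "s \<in> tensor_subspace K V W X (linear_span K W S)"
      "finite S'" "S' \<subseteq> carrier W" "t \<in> tensor_subspace K V W X (linear_span K W S')" by blast
    have "s \<in> tensor_subspace K V W X (linear_span K W (S \<union> S'))"
      "t \<in> tensor_subspace K V W X (linear_span K W (S \<union> S'))"
      using S mono[of S "S \<union> S'"] mono[of S' "S \<union> S'"] by blast+
    then have "s \<oplus>\<^bsub>TVW\<^esub> t \<in> tensor_subspace K V W X (linear_span K W (S \<union> S'))"
      using T.submodule_vspace(3)[OF sub[of "S \<union> S'"]] S by blast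
    then have "?P (s \<oplus>\<^bsub>TVW\<^esub> t)" using S by (intro exI[of _ "S \<union> S'"]) auto
    then show "s \<oplus>\<^bsub>TVW\<^esub> t \<in> {t \<in> carrier TVW. ?P t}" using st by blast
  next
    fix c s assume c: "c \<in> carrier K" and "s \<in> {t \<in> carrier TVW. ?P t}"
    then obtain S where st: "s \<in> carrier TVW"
      and S: "finite S" "S \<subseteq> carrier W" "s \<in> tensor_subspace K V W X (linear_span K W S)" by blast
    then have "?P (c \<odot>\<^bsub>TVW\<^esub> s)" using T.submodule_vspace(4)[OF sub[OF S(2)] c S(3)] by blast
    then show "c \<odot>\<^bsub>TVW\<^esub> s \<in> {t \<in> carrier TVW. ?P t}" using st c by blast
  qed blast
  then have "tensor_subspace K V W X (carrier W) \<subseteq> {t \<in> carrier TVW. ?P t}"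
  proof (rule tensor_subspace_minimal)
    fix x y assume *: "x \<in> X" "y \<in> carrier W"
    have "y \<in> linear_span K W {y}" by (rule subsetD[OF W.span_superset]) simp
    then have "?P (pure x y)" using * pure_in_tensor_subspace[of x X y] by (intro exI[of _ "{y}"]) auto
    then show "pure x y \<in> {t \<in> carrier TVW. ?P t}" using * XS(1) pure_simps(1) by blast
  qed
  then show ?thesis using t by blast
qed

text \<open>The sums of the displayed form are a subspace, and they contain the generators because
  \<open>x \<otimes> (c w + z)\<close> is \<open>c x \<otimes> w + x \<otimes> z\<close>.\<close>

lemma tensor_subspace_insert:
  assumes X: "submodule X K V" and Y: "Y \<subseteq> carrier W" and w: "w \<in> carrier W"
    and t: "t \<in> tensor_subspace K V W X (linear_span K W (insert w Y))"
  shows "\<exists>x\<in>X. \<exists>s\<in>tensor_subspace K V W X (linear_span K W Y). t = pure x w \<oplus>\<^bsub>TVW\<^esub> s"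
proof -
  note XS = V.submodule_vspace[OF X]
  let ?T = "tensor_subspace K V W X (linear_span K W Y)"
  note TS = T.submodule_vspace[OF tensor_subspace_submodule[OF XS(1) W.span_closed[OF Y]]]
  let ?R = "{pure x w \<oplus>\<^bsub>TVW\<^esub> s | x s. x \<in> X \<and> s \<in> ?T}"
  have cl: "x \<in> X \<Longrightarrow> x \<in> carrier V" "s \<in> ?T \<Longrightarrow> s \<in> carrier TVW" for x s
    by (erule subsetD[OF XS(1)], erule subsetD[OF TS(1)])
  have "submodule ?R K TVW"
  proof (rule T.submoduleI')
    show "?R \<subseteq> carrier TVW" using cl pure_simps(1) w by auto
    have "pure \<zero>\<^bsub>V\<^esub> w = \<zero>\<^bsub>TVW\<^esub>"
      using linear_map_zero[OF V.vspace_axioms T.vspace_axioms bilinear_map_linear(2)[OF pure_bilinear w]] .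
    then have "\<zero>\<^bsub>TVW\<^esub> = pure \<zero>\<^bsub>V\<^esub> w \<oplus>\<^bsub>TVW\<^esub> \<zero>\<^bsub>TVW\<^esub>" by simp
    then show "\<zero>\<^bsub>TVW\<^esub> \<in> ?R" using XS(2) TS(2) by blast
  next
    fix a b assume "a \<in> ?R" "b \<in> ?R"
    then obtain x s y r where *: "x \<in> X" "s \<in> ?T" "a = pure x w \<oplus>\<^bsub>TVW\<^esub> s" "y \<in> X" "r \<in> ?T" "b = pure y w \<oplus>\<^bsub>TVW\<^esub> r"
      by blast
    then have "a \<oplus>\<^bsub>TVW\<^esub> b = pure (x \<oplus>\<^bsub>V\<^esub> y) w \<oplus>\<^bsub>TVW\<^esub> (s \<oplus>\<^bsub>TVW\<^esub> r)"
      using cl w by (simp add: pure_simps T.M.a_ac)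
    then show "a \<oplus>\<^bsub>TVW\<^esub> b \<in> ?R" using XS(3)[of x y] TS(3)[of s r] * by blast
  next
    fix c a assume c: "c \<in> carrier K" and "a \<in> ?R"
    then obtain x s where *: "x \<in> X" "s \<in> ?T" "a = pure x w \<oplus>\<^bsub>TVW\<^esub> s" by blast
    then have "c \<odot>\<^bsub>TVW\<^esub> a = pure (c \<odot>\<^bsub>V\<^esub> x) w \<oplus>\<^bsub>TVW\<^esub> (c \<odot>\<^bsub>TVW\<^esub> s)"
      using cl w c by (simp add: pure_simps T.smult_r_distr)
    then show "c \<odot>\<^bsub>TVW\<^esub> a \<in> ?R" using XS(4)[of c x] TS(4)[of c s] * c by blast
  qed
  then have "tensor_subspace K V W X (linear_span K W (insert w Y)) \<subseteq> ?R"
  proof (rule tensor_subspace_minimal)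
    fix x y assume x: "x \<in> X" and "y \<in> linear_span K W (insert w Y)"
    then obtain c z where cz: "y = c \<odot>\<^bsub>W\<^esub> w \<oplus>\<^bsub>W\<^esub> z" "c \<in> carrier K" "z \<in> linear_span K W Y"
      using W.span_insert[OF Y w] by blast
    have z: "z \<in> carrier W" using cz W.span_closed[OF Y] by blast
    have "pure x y = pure (c \<odot>\<^bsub>V\<^esub> x) w \<oplus>\<^bsub>TVW\<^esub> pure x z"
      using cl(1)[OF x] cz(2) w z unfolding cz(1) by (simp add: pure_simps)
    then show "pure x y \<in> ?R" using XS(4)[OF cz(2) x] pure_in_tensor_subspace[OF x cz(3)] by blast
  qed
  then show ?thesis using t by blast
qed

text \<open>A form of exactness of the tensor product over a field: functionals that kill
  \<open>N\<close> detect whether the right leg lies in \<open>N\<close>. The extra vectors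
  \<open>S\<close> are removed one at a time. If \<open>w\<close> is independent of the rest, a
  functional \<open>p\<close> dual to \<open>w\<close> extracts its left factor \<open>x\<close> as
  the slice of \<open>t\<close>, and this slice vanishes by assumption.\<close>

lemma tensor_subspace_sliceI:
  assumes X: "submodule X K V" and N: "submodule N K W" and t: "t \<in> tensor_subspace K V W X (carrier W)"
    and z: "\<And>p. functional K W p \<Longrightarrow> \<forall>y\<in>N. p y = \<zero>\<^bsub>K\<^esub> \<Longrightarrow> slice_r K V p t = \<zero>\<^bsub>V\<^esub>"
  shows "t \<in> tensor_subspace K V W X N"
proof -
  note XS = V.submodule_vspace[OF X] and NS = W.submodule_vspace[OF N]
  have "t \<in> tensor_subspace K V W X N"
    if "finite S" "S \<subseteq> carrier W" "t \<in> tensor_subspace K V W X (linear_span K W (N \<union> S))" for S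
    using that
  proof (induct S rule: finite_induct)
    case empty
    then show ?case using W.span_eq[OF N] by simp
  next
    case (insert w S)
    have NS': "N \<union> S \<subseteq> carrier W" and w: "w \<in> carrier W" using NS(1) insert by auto
    have un: "N \<union> insert w S = insert w (N \<union> S)" by blast
    obtain x s where xs: "x \<in> X" "s \<in> tensor_subspace K V W X (linear_span K W (N \<union> S))"
      "t = pure x w \<oplus>\<^bsub>TVW\<^esub> s"
      using tensor_subspace_insert[OF X NS' w] insert.prems(2) unfolding un by blast
    have xV: "x \<in> carrier V" using xs XS(1) by blast
    have sT: "s \<in> carrier TVW" using xs tensor_subspace_closed[OF XS(1) W.span_closed[OF NS']] by blast
    note sub = tensor_subspace_submodule[OF XS(1) W.span_closed[OF NS']]
    have "t \<in> tensor_subspace K V W X (linear_span K W (N \<union> S))"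
    proof (cases "w \<in> linear_span K W (N \<union> S)")
      case True
      show ?thesis
        unfolding xs(3) using pure_in_tensor_subspace[OF xs(1) True] xs(2) by (rule T.submodule_vspace(3)[OF sub])
    next
      case False
      then obtain p where p: "functional K W p" "\<forall>y\<in>linear_span K W (N \<union> S). p y = \<zero>\<^bsub>K\<^esub>" "p w = \<one>\<^bsub>K\<^esub>"
        using W.exists_functional[OF W.span_submodule[OF NS'] w] by blast
      have "\<forall>y\<in>N. p y = \<zero>\<^bsub>K\<^esub>" using p(2) W.span_superset[of "N \<union> S"] by blast
      then have "slice_r K V p t = \<zero>\<^bsub>V\<^esub>" using z p by blast
      moreover have "slice_r K V p t = slice_r K V p (pure x w) \<oplus>\<^bsub>V\<^esub> slice_r K V p s"
        unfolding xs(3)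
        by (rule linear_mapD(2)[OF slice_r_linear[OF V.vspace_axioms W.vspace_axioms p(1)] pure_simps(1)[OF xV w] sT])
      moreover have "slice_r K V p s = \<zero>\<^bsub>V\<^esub>"
        by (rule slice_r_vanishes[OF p(1) XS(1) W.span_closed[OF NS'] p(2) xs(2)])
      moreover have "slice_r K V p (pure x w) = x"
        using slice_r_pure[OF V.vspace_axioms W.vspace_axioms p(1) xV w] p(3) xV by simp
      ultimately have "x = \<zero>\<^bsub>V\<^esub>" using xV by simp
      moreover have "pure \<zero>\<^bsub>V\<^esub> w = \<zero>\<^bsub>TVW\<^esub>"
        using linear_map_zero[OF V.vspace_axioms T.vspace_axioms bilinear_map_linear(2)[OF pure_bilinear w]] .
      ultimately show ?thesis using xs sT by simp
    qed
    then show ?case using insert by blast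
  qed
  moreover obtain S where S: "finite S" "S \<subseteq> carrier W" "t \<in> tensor_subspace K V W X (linear_span K W S)"
    using tensor_subspace_finite_support[OF X t] by blast
  moreover have "t \<in> tensor_subspace K V W X (linear_span K W (N \<union> S))"
    using S(3) tensor_subspace_mono[OF subset_refl W.span_mono[of S "N \<union> S"]] by blast
  ultimately show ?thesis by blast
qed

lemma tensor_eq_zero_slice_r:
  assumes t: "t \<in> carrier TVW" and "\<And>p. functional K W p \<Longrightarrow> slice_r K V p t = \<zero>\<^bsub>V\<^esub>"
  shows "t = \<zero>\<^bsub>TVW\<^esub>"
proof -
  have "t \<in> tensor_subspace K V W (carrier V) {\<zero>\<^bsub>W\<^esub>}"
    by (rule tensor_subspace_sliceI[OF V.carrier_is_submodule W.submodule_zero tensor_subspace_top[OF t] assms(2)])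
  moreover have "tensor_subspace K V W (carrier V) {\<zero>\<^bsub>W\<^esub>} \<subseteq> {\<zero>\<^bsub>TVW\<^esub>}"
    using linear_map_zero[OF W.vspace_axioms T.vspace_axioms bilinear_map_linear(1)[OF pure_bilinear]]
    by (intro tensor_subspace_minimal T.submodule_zero) auto
  ultimately show ?thesis by blast
qed

text \<open>By \<open>slice_exchange\<close>, functionals applied to a right slice of the difference
  are functionals applied to a left slice, which is zero. Hence all right slices vanish.\<close>

lemma tensor_eq_slice_l:
  assumes s: "s \<in> carrier TVW" and t: "t \<in> carrier TVW"
    and eq: "\<And>f. functional K V f \<Longrightarrow> slice_l K W f s = slice_l K W f t"
  shows "s = t"
proof -
  have st: "s \<ominus>\<^bsub>TVW\<^esub> t \<in> carrier TVW" using s t by simp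
  have "s \<ominus>\<^bsub>TVW\<^esub> t = \<zero>\<^bsub>TVW\<^esub>"
  proof (rule tensor_eq_zero_slice_r[OF st])
    fix p assume p: "functional K W p"
    note sr = slice_r_linear[OF V.vspace_axioms W.vspace_axioms p]
    show "slice_r K V p (s \<ominus>\<^bsub>TVW\<^esub> t) = \<zero>\<^bsub>V\<^esub>"
    proof (rule V.functional_separation)
      show "slice_r K V p (s \<ominus>\<^bsub>TVW\<^esub> t) \<in> carrier V" by (rule linear_mapD(1)[OF sr st])
      fix f assume f: "functional K V f"
      note sl = slice_l_linear[OF V.vspace_axioms W.vspace_axioms f]
      have "f (slice_r K V p (s \<ominus>\<^bsub>TVW\<^esub> t)) = p (slice_l K W f (s \<ominus>\<^bsub>TVW\<^esub> t))"
        by (rule slice_exchange[OF V.vspace_axioms W.vspace_axioms f p st, symmetric])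
      also have "slice_l K W f (s \<ominus>\<^bsub>TVW\<^esub> t) = \<zero>\<^bsub>W\<^esub>"
        using linear_map_diff[OF T.vspace_axioms W.vspace_axioms sl s t] eq[OF f] linear_mapD(1)[OF sl t]
        by (simp add: a_minus_def W.M.r_neg)
      also have "p \<zero>\<^bsub>W\<^esub> = \<zero>\<^bsub>K\<^esub>" by (rule W.functional_zero[OF p])
      finally show "f (slice_r K V p (s \<ominus>\<^bsub>TVW\<^esub> t)) = \<zero>\<^bsub>K\<^esub>" .
    qed
  qed
  then show ?thesis using T.M.diff_eq_zero_iff s t by blast
qed

text \<open>For the nontrivial direction, a functional \<open>p\<close> that kills \<open>N\<close>
  kills every left slice, so \<open>slice_r\<close> along \<open>p\<close> is zero by
  \<open>slice_exchange\<close>. This is the bridge from coactions to the dual algebra: lying in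
  \<open>V \<otimes> N\<close> is tested one functional at a time.\<close>

lemma tensor_subspace_slice_l_iff:
  assumes N: "submodule N K W" and t: "t \<in> carrier TVW"
  shows "t \<in> tensor_subspace K V W (carrier V) N \<longleftrightarrow> (\<forall>f. functional K V f \<longrightarrow> slice_l K W f t \<in> N)"
proof
  assume "t \<in> tensor_subspace K V W (carrier V) N"
  then show "\<forall>f. functional K V f \<longrightarrow> slice_l K W f t \<in> N" using slice_l_mem[OF _ subset_refl N] by blast
next
  assume sl: "\<forall>f. functional K V f \<longrightarrow> slice_l K W f t \<in> N"
  show "t \<in> tensor_subspace K V W (carrier V) N"
  proof (rule tensor_subspace_sliceI[OF V.carrier_is_submodule N tensor_subspace_top[OF t]])
    fix p assume p: "functional K W p" "\<forall>y\<in>N. p y = \<zero>\<^bsub>K\<^esub>"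
    show "slice_r K V p t = \<zero>\<^bsub>V\<^esub>"
    proof (rule V.functional_separation)
      show "slice_r K V p t \<in> carrier V"
        by (rule linear_mapD(1)[OF slice_r_linear[OF V.vspace_axioms W.vspace_axioms p(1)] t])
      fix f assume f: "functional K V f"
      show "f (slice_r K V p t) = \<zero>\<^bsub>K\<^esub>"
        using slice_exchange[OF V.vspace_axioms W.vspace_axioms f p(1) t] p(2) sl f by simp
    qed
  qed
qed

end

section \<open>Slices of tensor maps, of the associator and of products\<close>

lemma slice_l_tensor_map:
  assumes V: "vspace K V" and W: "vspace K W" and V': "vspace K V'" and W': "vspace K W'"
    and f: "linear_map K V V' f" and g: "linear_map K W W' g" and F: "functional K V' F"
    and t: "t \<in> carrier (tensor_space K V W)"
  shows "slice_l K W' F (tensor_map K V' W' f g t) = g (slice_l K W (\<lambda>x. F (f x)) t)"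
proof -
  note Ff = linear_map_comp[OF f F]
  show ?thesis
  proof (rule tensor_ext[OF V W W' linear_map_comp[OF tensor_map_linear[OF V W V' W' f g] slice_l_linear[OF V' W' F]]
      linear_map_comp[OF slice_l_linear[OF V W Ff] g] _ t])
    fix v w assume *: "v \<in> carrier V" "w \<in> carrier W"
    then show "slice_l K W' F (tensor_map K V' W' f g (pure_tensor K V W v w)) =
        g (slice_l K W (\<lambda>x. F (f x)) (pure_tensor K V W v w))"
      using linear_mapD(1)[OF f] linear_mapD(1)[OF g]
      by (simp add: tensor_map_pure[OF V W V' W' f g] slice_l_pure[OF V' W' F] slice_l_pure[OF V W Ff]
        linear_mapD(3)[OF g] functional_closed[OF F])
  qed
qed

text \<open>\<open>\<lambda>x. g (slice_l K V f x)\<close> is the functional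
  \<open>f \<otimes> g\<close> on \<open>U \<otimes> V\<close>, so both sides contract the first two
  legs with \<open>f\<close> and \<open>g\<close>.\<close>

lemma slice_l_tensor_assoc:
  assumes U: "vspace K U" and V: "vspace K V" and W: "vspace K W"
    and f: "functional K U f" and g: "functional K V g"
    and t: "t \<in> carrier (tensor_space K (tensor_space K U V) W)"
  shows "slice_l K W g (slice_l K (tensor_space K V W) f (tensor_assoc K U V W t)) =
    slice_l K W (\<lambda>x. g (slice_l K V f x)) t"
proof -
  interpret W: vspace K W by fact
  have UV: "vspace K (tensor_space K U V)" and VW: "vspace K (tensor_space K V W)" using U V W by simp_all
  note sf = slice_l_linear[OF U VW f] and sg = slice_l_linear[OF V W g]
  note gf = linear_map_comp[OF slice_l_linear[OF U V f] g]
  note L = linear_map_comp[OF linear_map_comp[OF tensor_assoc_linear[OF U V W] sf] sg]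
  note R = slice_l_linear[OF UV W gf]
  show ?thesis
  proof (rule tensor_ext[OF UV W W L R _ t])
    fix x w assume x: "x \<in> carrier (tensor_space K U V)" and w: "w \<in> carrier W"
    note pl = bilinear_map_linear(2)[OF pure_tensor_bilinear[OF UV W] w]
    show "slice_l K W g (slice_l K (tensor_space K V W) f (tensor_assoc K U V W (pure_tensor K (tensor_space K U V) W x w))) =
      slice_l K W (\<lambda>x. g (slice_l K V f x)) (pure_tensor K (tensor_space K U V) W x w)"
    proof (rule tensor_ext[OF U V W linear_map_comp[OF pl L] linear_map_comp[OF pl R] _ x])
      fix u v assume u: "u \<in> carrier U" and v: "v \<in> carrier V"
      have fu: "f u \<in> carrier K" and gv: "g v \<in> carrier K" by (rule functional_closed[OF f u], rule functional_closed[OF g v])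
      have "slice_l K W g (slice_l K (tensor_space K V W) f
          (tensor_assoc K U V W (pure_tensor K (tensor_space K U V) W (pure_tensor K U V u v) w))) =
        f u \<odot>\<^bsub>W\<^esub> (g v \<odot>\<^bsub>W\<^esub> w)"
        using u v w V W fu
        by (simp add: tensor_assoc_pure[OF U V W] slice_l_pure[OF U VW f] linear_mapD(3)[OF sg] slice_l_pure[OF V W g])
      also have "\<dots> = slice_l K W (\<lambda>x. g (slice_l K V f x)) (pure_tensor K (tensor_space K U V) W (pure_tensor K U V u v) w)"
        using u v w U V fu gv
        by (simp add: slice_l_pure[OF UV W gf] slice_l_pure[OF U V f] functional_smult[OF g] W.smult_assoc1)
      finally show "slice_l K W g (slice_l K (tensor_space K V W) f
          (tensor_assoc K U V W (pure_tensor K (tensor_space K U V) W (pure_tensor K U V u v) w))) =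
        slice_l K W (\<lambda>x. g (slice_l K V f x)) (pure_tensor K (tensor_space K U V) W (pure_tensor K U V u v) w)" .
    qed
  qed
qed

text \<open>With a pure second tensor, contracting the product with \<open>f\<close> is contracting
  the first tensor with the translated functional \<open>\<lambda>x. f (\<beta> x h)\<close>. This
  is the source of the translations by a grouplike element later on.\<close>

lemma slice_l_tensor_bimap:
  assumes V: "vspace K V" and V1: "vspace K V1" and W: "vspace K W" and W1: "vspace K W1"
    and P: "vspace K P" and Q: "vspace K Q"
    and \<beta>: "bilinear_map K V V1 P \<beta>" and \<gamma>: "bilinear_map K W W1 Q \<gamma>" and f: "functional K P f"
    and s: "s \<in> carrier (tensor_space K V W)" and h: "h \<in> carrier V1" and m: "m \<in> carrier W1"
  shows "slice_l K Q f (tensor_bimap K P Q \<beta> \<gamma> s (pure_tensor K V1 W1 h m)) =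
    \<gamma> (slice_l K W (\<lambda>x. f (\<beta> x h)) s) m"
proof -
  interpret Q: vspace K Q by fact
  note fb = linear_map_comp[OF bilinear_map_linear(2)[OF \<beta> h] f]
  have p: "pure_tensor K V1 W1 h m \<in> carrier (tensor_space K V1 W1)" using V1 W1 h m by simp
  note L = linear_map_comp[OF bilinear_map_linear(2)[OF tensor_bimap_bilinear[OF V V1 W W1 P Q \<beta> \<gamma>] p] slice_l_linear[OF P Q f]]
  note R = linear_map_comp[OF slice_l_linear[OF V W fb] bilinear_map_linear(2)[OF \<gamma> m]]
  show ?thesis
    by (rule tensor_ext[OF V W Q L R _ s])
      (use h m in \<open>simp add: tensor_bimap_pure[OF V V1 W W1 P Q \<beta> \<gamma>] slice_l_pure[OF P Q f]
        bilinear_mapD[OF \<beta>] bilinear_mapD[OF \<gamma>] slice_l_pure[OF V W fb] functional_closed[OF f]\<close>)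
qed

context vspace
begin

lemmas top_submodule = carrier_is_submodule
lemmas sum_cong = M.finsum_cong'
lemmas sum_closed = M.finsum_closed
lemmas sum_add = M.finsum_addf
lemmas sum_insert = M.finsum_insert
lemmas sum_zero = M.add.finprod_one_eqI
lemmas sum_single = M.finsum_singleton
lemmas sum_swap = M.finsum_swap
lemmas sum_smult = finsum_smult_ldistr
lemmas add_assoc = M.a_assoc
lemmas add_comm = M.a_comm
lemmas add_ac = M.a_ac
lemmas left_neg = M.l_neg
lemmas right_neg = M.r_neg
lemmas diff_eq_zero = M.diff_eq_zero_iff
lemmas diff_exchange = M.diff_swap
lemmas add_closed = M.a_closed
lemmas diff_closed = M.minus_closed
lemmas scale_closed = smult_closed
lemmas scale_add = smult_r_distr
lemmas add_scale = smult_l_distr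
lemmas scale_scale = smult_assoc1
lemmas neg_scale = smult_l_minus
lemmas scale_neg = smult_r_minus
lemmas neg_closed = M.a_inv_closed

section \<open>Spans and bases modulo a subspace\<close>

lemma span_singleton: "x \<in> carrier V \<Longrightarrow> linear_span K V {x} = {c \<odot>\<^bsub>V\<^esub> x | c. c \<in> carrier K}"
proof -
  assume x: "x \<in> carrier V"
  have e: "linear_span K V {} = {\<zero>\<^bsub>V\<^esub>}"
    using span_minimal[OF submodule_zero, of "{}"] submodule_vspace(2)[OF span_submodule[of "{}"]] by auto
  have "linear_span K V {x} = {c \<odot>\<^bsub>V\<^esub> x \<oplus>\<^bsub>V\<^esub> y | c y. c \<in> carrier K \<and> y = \<zero>\<^bsub>V\<^esub>}"
    using span_insert[of "{}" x] x e by auto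
  also have "\<dots> = {c \<odot>\<^bsub>V\<^esub> x | c. c \<in> carrier K}" 
    by (rule Collect_cong) (metis M.r_zero smult_closed x)
  finally show ?thesis .
qed

lemma span_zero_Un: "X \<subseteq> carrier V \<Longrightarrow> linear_span K V ({\<zero>\<^bsub>V\<^esub>} \<union> X) = linear_span K V X"
proof (rule equalityI)
  assume X: "X \<subseteq> carrier V"
  show "linear_span K V ({\<zero>\<^bsub>V\<^esub>} \<union> X) \<subseteq> linear_span K V X"
    using submodule_vspace(2)[OF span_submodule[OF X]] span_superset[of X] by (intro span_minimal span_submodule X) auto
qed (rule span_mono, blast)

lemma span_empty: "linear_span K V {} = {\<zero>\<^bsub>V\<^esub>}"
  using span_minimal[OF submodule_zero, of "{}"] submodule_vspace(2)[OF span_submodule[of "{}"]] by auto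

lemma span_Un:
  assumes A: "submodule A K V" and X: "X \<subseteq> carrier V" and z: "z \<in> linear_span K V (A \<union> X)"
  shows "\<exists>a\<in>A. \<exists>x\<in>linear_span K V X. z = a \<oplus>\<^bsub>V\<^esub> x"
proof -
  note AS = submodule_vspace[OF A] and XS = submodule_vspace[OF span_submodule[OF X]]
  let ?R = "{a \<oplus>\<^bsub>V\<^esub> x | a x. a \<in> A \<and> x \<in> linear_span K V X}"
  have "submodule ?R K V"
  proof (rule submoduleI')
    show "?R \<subseteq> carrier V" using AS(1) XS(1) by auto
    have "\<zero>\<^bsub>V\<^esub> = \<zero>\<^bsub>V\<^esub> \<oplus>\<^bsub>V\<^esub> \<zero>\<^bsub>V\<^esub>" by simp
    then show "\<zero>\<^bsub>V\<^esub> \<in> ?R" using AS(2) XS(2) by blast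
  next
    fix u v assume "u \<in> ?R" "v \<in> ?R"
    then obtain a x b y where *: "u = a \<oplus>\<^bsub>V\<^esub> x" "a \<in> A" "x \<in> linear_span K V X"
      "v = b \<oplus>\<^bsub>V\<^esub> y" "b \<in> A" "y \<in> linear_span K V X" by blast
    then have "a \<in> carrier V" "x \<in> carrier V" "b \<in> carrier V" "y \<in> carrier V" using AS(1) XS(1) by auto
    then have "u \<oplus>\<^bsub>V\<^esub> v = (a \<oplus>\<^bsub>V\<^esub> b) \<oplus>\<^bsub>V\<^esub> (x \<oplus>\<^bsub>V\<^esub> y)" using * by (simp add: M.a_ac)
    then show "u \<oplus>\<^bsub>V\<^esub> v \<in> ?R" using AS(3)[of a b] XS(3)[of x y] * by blast
  next
    fix c u assume c: "c \<in> carrier K" and "u \<in> ?R"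
    then obtain a x where *: "u = a \<oplus>\<^bsub>V\<^esub> x" "a \<in> A" "x \<in> linear_span K V X" by blast
    then have "a \<in> carrier V" "x \<in> carrier V" using AS(1) XS(1) by auto
    then have "c \<odot>\<^bsub>V\<^esub> u = (c \<odot>\<^bsub>V\<^esub> a) \<oplus>\<^bsub>V\<^esub> (c \<odot>\<^bsub>V\<^esub> x)" using * c by (simp add: smult_r_distr)
    then show "c \<odot>\<^bsub>V\<^esub> u \<in> ?R" using AS(4)[of c a] XS(4)[of c x] * c by blast
  qed
  moreover have "A \<union> X \<subseteq> ?R"
  proof
    fix y assume "y \<in> A \<union> X"
    then consider "y \<in> A" | "y \<in> X" by blast
    then show "y \<in> ?R"
    proof cases
      case 1
      then have "y = y \<oplus>\<^bsub>V\<^esub> \<zero>\<^bsub>V\<^esub>" using AS(1) by auto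
      then show ?thesis using 1 XS(2) by blast
    next
      case 2
      then have "y = \<zero>\<^bsub>V\<^esub> \<oplus>\<^bsub>V\<^esub> y" using X by auto
      then show ?thesis using 2 span_superset[of X] AS(2) by blast
    qed
  qed
  ultimately show ?thesis using span_minimal z by blast
qed

text \<open>Says that the images of \<open>S\<close> in \<open>V / N\<close> are distinct and
  linearly independent, without forming the quotient.\<close>

definition independent_mod :: "'v set \<Rightarrow> 'v set \<Rightarrow> bool"
  where "independent_mod N S \<longleftrightarrow> (\<forall>s\<in>S. s \<notin> linear_span K V (N \<union> (S - {s})))"

text \<open>Each coordinate functional separates one vector of \<open>S\<close> from
  \<open>N\<close> and the other vectors.\<close>

lemma dual_basis:
  assumes N: "submodule N K V" and S: "S \<subseteq> carrier V" "independent_mod N S"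
  shows "\<exists>p. \<forall>s\<in>S. functional K V (p s) \<and> (\<forall>x\<in>N. p s x = \<zero>\<^bsub>K\<^esub>) \<and>
    (\<forall>t\<in>S. p s t = (if t = s then \<one>\<^bsub>K\<^esub> else \<zero>\<^bsub>K\<^esub>))"
proof -
  have "\<exists>p. functional K V p \<and> (\<forall>x\<in>N. p x = \<zero>\<^bsub>K\<^esub>) \<and>
    (\<forall>t\<in>S. p t = (if t = s then \<one>\<^bsub>K\<^esub> else \<zero>\<^bsub>K\<^esub>))" if s: "s \<in> S" for s
  proof -
    have NS: "N \<union> (S - {s}) \<subseteq> carrier V" using submodule_vspace(1)[OF N] S by blast
    obtain p where p: "functional K V p" "\<forall>x\<in>linear_span K V (N \<union> (S - {s})). p x = \<zero>\<^bsub>K\<^esub>" "p s = \<one>\<^bsub>K\<^esub>"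
      using exists_functional[OF span_submodule[OF NS]] S s unfolding independent_mod_def by blast
    then have "\<forall>x\<in>N \<union> (S - {s}). p x = \<zero>\<^bsub>K\<^esub>" using span_superset[of "N \<union> (S - {s})"] by blast
    then show ?thesis using p by (intro exI[of _ p]) auto
  qed
  then show ?thesis by metis
qed

text \<open>The defect \<open>F v\<close> between \<open>v\<close> and its expansion is linear in
  \<open>v\<close>. It lies in \<open>N\<close> for \<open>v\<close> in \<open>N\<close>, because
  the functionals vanish there, and it is zero on \<open>S\<close> by duality.\<close>

lemma dual_basis_expansion:
  assumes N: "submodule N K V" and S: "S \<subseteq> carrier V" "finite S"
    and p: "\<And>s. s \<in> S \<Longrightarrow> functional K V (p s)" "\<And>s x. s \<in> S \<Longrightarrow> x \<in> N \<Longrightarrow> p s x = \<zero>\<^bsub>K\<^esub>"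
      "\<And>s t. s \<in> S \<Longrightarrow> t \<in> S \<Longrightarrow> p s t = (if t = s then \<one>\<^bsub>K\<^esub> else \<zero>\<^bsub>K\<^esub>)"
    and v: "v \<in> linear_span K V (N \<union> S)"
  shows "v \<ominus>\<^bsub>V\<^esub> (\<Oplus>\<^bsub>V\<^esub>s\<in>S. p s v \<odot>\<^bsub>V\<^esub> s) \<in> N"
proof -
  have SS: "S \<rightarrow> carrier V = {f. \<forall>s\<in>S. f s \<in> carrier V}" by auto
  note NS = submodule_vspace[OF N]
  define F where "F v = v \<ominus>\<^bsub>V\<^esub> (\<Oplus>\<^bsub>V\<^esub>s\<in>S. p s v \<odot>\<^bsub>V\<^esub> s)" for v
  have sv: "s \<in> S \<Longrightarrow> s \<in> carrier V" for s using S by blast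
  note pc = functional_closed[OF p(1)]
  have cl: "(\<lambda>s. p s v \<odot>\<^bsub>V\<^esub> s) \<in> S \<rightarrow> carrier V" if "v \<in> carrier V" for v using pc sv that by auto
  have "linear_map K V V (\<lambda>v. \<Oplus>\<^bsub>V\<^esub>s\<in>S. p s v \<odot>\<^bsub>V\<^esub> s)"
  proof (rule linear_mapI)
    fix x assume x: "x \<in> carrier V"
    then show "(\<Oplus>\<^bsub>V\<^esub>s\<in>S. p s x \<odot>\<^bsub>V\<^esub> s) \<in> carrier V" using cl by simp
    fix y assume y: "y \<in> carrier V"
    have "(\<Oplus>\<^bsub>V\<^esub>s\<in>S. p s (x \<oplus>\<^bsub>V\<^esub> y) \<odot>\<^bsub>V\<^esub> s) = (\<Oplus>\<^bsub>V\<^esub>s\<in>S. p s x \<odot>\<^bsub>V\<^esub> s \<oplus>\<^bsub>V\<^esub> p s y \<odot>\<^bsub>V\<^esub> s)"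
      using x y sv pc by (intro M.finsum_cong') (auto simp: functional_add[OF p(1)] smult_l_distr)
    then show "(\<Oplus>\<^bsub>V\<^esub>s\<in>S. p s (x \<oplus>\<^bsub>V\<^esub> y) \<odot>\<^bsub>V\<^esub> s) =
        (\<Oplus>\<^bsub>V\<^esub>s\<in>S. p s x \<odot>\<^bsub>V\<^esub> s) \<oplus>\<^bsub>V\<^esub> (\<Oplus>\<^bsub>V\<^esub>s\<in>S. p s y \<odot>\<^bsub>V\<^esub> s)"
      using M.finsum_addf[OF cl[OF x] cl[OF y]] by simp
  next
    fix c x assume c: "c \<in> carrier K" and x: "x \<in> carrier V"
    have "(\<Oplus>\<^bsub>V\<^esub>s\<in>S. p s (c \<odot>\<^bsub>V\<^esub> x) \<odot>\<^bsub>V\<^esub> s) = (\<Oplus>\<^bsub>V\<^esub>s\<in>S. c \<odot>\<^bsub>V\<^esub> (p s x \<odot>\<^bsub>V\<^esub> s))"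
      using c x sv pc by (intro M.finsum_cong') (auto simp: functional_smult[OF p(1)] smult_assoc1)
    then show "(\<Oplus>\<^bsub>V\<^esub>s\<in>S. p s (c \<odot>\<^bsub>V\<^esub> x) \<odot>\<^bsub>V\<^esub> s) = c \<odot>\<^bsub>V\<^esub> (\<Oplus>\<^bsub>V\<^esub>s\<in>S. p s x \<odot>\<^bsub>V\<^esub> s)"
      using finsum_smult_ldistr[OF S(2) c cl[OF x]] by simp
  qed
  then have lin: "linear_map K V V F"
    unfolding F_def a_minus_def
  proof (intro linear_map_sum[OF vspace_axioms linear_map_id])
    assume L: "linear_map K V V (\<lambda>v. \<Oplus>\<^bsub>V\<^esub>s\<in>S. p s v \<odot>\<^bsub>V\<^esub> s)"
    have "linear_map K V V (\<lambda>v. (\<ominus>\<^bsub>K\<^esub> \<one>\<^bsub>K\<^esub>) \<odot>\<^bsub>V\<^esub> (\<Oplus>\<^bsub>V\<^esub>s\<in>S. p s v \<odot>\<^bsub>V\<^esub> s))"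
      by (rule linear_map_scale[OF vspace_axioms L]) simp
    then show "linear_map K V V (\<lambda>v. \<ominus>\<^bsub>V\<^esub> (\<Oplus>\<^bsub>V\<^esub>s\<in>S. p s v \<odot>\<^bsub>V\<^esub> s))"
      by (rule linear_map_cong[OF vspace_axioms]) (simp add: smult_l_minus cl)
  qed
  have "linear_span K V (N \<union> S) \<subseteq> {v \<in> carrier V. F v \<in> N}"
  proof (rule span_minimal[OF submodule_preimage[OF vspace_axioms lin N carrier_is_submodule]])
    have "F x \<in> N" if x: "x \<in> N" for x
    proof -
      have "(\<Oplus>\<^bsub>V\<^esub>s\<in>S. p s x \<odot>\<^bsub>V\<^esub> s) = \<zero>\<^bsub>V\<^esub>"
        using p(2) x sv by (intro M.add.finprod_one_eqI) simp
      then show ?thesis unfolding F_def using submodule_vspace(6)[OF N x NS(2)] by simp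
    qed
    moreover have "F x \<in> N" if x: "x \<in> S" for x
    proof -
      have "(\<Oplus>\<^bsub>V\<^esub>s\<in>S. p s x \<odot>\<^bsub>V\<^esub> s) = (\<Oplus>\<^bsub>V\<^esub>s\<in>S. if x = s then s else \<zero>\<^bsub>V\<^esub>)"
        using p(3) x sv by (intro M.finsum_cong') auto
      also have "\<dots> = x" using x S sv by (intro M.finsum_singleton) auto
      finally show ?thesis unfolding F_def using sv[OF x] NS(2) by (simp add: a_minus_def M.r_neg)
    qed
    ultimately show "N \<union> S \<subseteq> {v \<in> carrier V. F v \<in> N}" using NS(1) S by auto
  qed
  then show ?thesis using v unfolding F_def by blast
qed

end

section \<open>Comodules as modules over the dual algebra\<close>

text \<open>The operator \<open>m \<mapsto> f(m_(-1)) m_(0)\<close> by which the dual algebra of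
  \<open>H\<close> acts on a left comodule.\<close>

definition dual_act ::
    "('k, 'x) ring_scheme \<Rightarrow> ('k, 'm, 'h, 'z) comodule_scheme \<Rightarrow> ('h \<Rightarrow> 'k) \<Rightarrow> 'm \<Rightarrow> 'm"
  where "dual_act K M f m = slice_l K M f (coact M m)"

text \<open>The product \<open>h \<mapsto> f(h_(1)) g(h_(2))\<close> of the dual algebra.\<close>

definition convolution ::
    "('k, 'x) ring_scheme \<Rightarrow> ('k, 'h, 'y) coalgebra_scheme \<Rightarrow> ('h \<Rightarrow> 'k) \<Rightarrow> ('h \<Rightarrow> 'k) \<Rightarrow> 'h \<Rightarrow> 'k"
  where "convolution K H f g h = g (slice_l K H f (comult H h))"

text \<open>A multiplicative matrix: the coefficients of a comodule with basis \<open>e_i\<close>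
  and coaction \<open>e_i \<mapsto> \<Sum>_j c_ij \<otimes> e_j\<close>. The two equations are
  coassociativity and the counit law in coordinates.\<close>

definition comatrix ::
    "('k, 'x) ring_scheme \<Rightarrow> ('k, 'h, 'y) coalgebra_scheme \<Rightarrow> 'i set \<Rightarrow> ('i \<Rightarrow> 'i \<Rightarrow> 'h) \<Rightarrow> bool"
  where "comatrix K H I c \<longleftrightarrow> finite I \<and> (\<forall>i\<in>I. \<forall>j\<in>I. c i j \<in> carrier H \<and>
    comult H (c i j) = (\<Oplus>\<^bsub>tensor_space K H H\<^esub>k\<in>I. pure_tensor K H H (c i k) (c k j)) \<and>
    counit H (c i j) = (if i = j then \<one>\<^bsub>K\<^esub> else \<zero>\<^bsub>K\<^esub>))"

definition grouplike :: "('k, 'x) ring_scheme \<Rightarrow> ('k, 'h, 'y) coalgebra_scheme \<Rightarrow> 'h \<Rightarrow> bool"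
  where "grouplike K H g \<longleftrightarrow> g \<in> carrier H \<and> comult H g = pure_tensor K H H g g \<and> counit H g = \<one>\<^bsub>K\<^esub>"

context coalgebra
begin

lemma vspace_H: "vspace K H" by unfold_locales

lemma functional_convolution: "functional K H f \<Longrightarrow> functional K H g \<Longrightarrow> functional K H (convolution K H f g)"
  unfolding convolution_def[abs_def]
  by (rule linear_map_comp[OF linear_map_comp[OF comult_linear slice_l_linear[OF vspace_H vspace_H]]])

end

context left_comodule
begin

lemma vspace_M: "vspace K M" by unfold_locales

lemma coact_closed: "m \<in> carrier M \<Longrightarrow> coact M m \<in> carrier (tensor_space K H M)"
  using linear_mapD(1)[OF coact_linear] .

lemma dual_act_linear: "functional K H f \<Longrightarrow> linear_map K M M (dual_act K M f)"
  unfolding dual_act_def[abs_def]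
  by (rule linear_map_comp[OF coact_linear slice_l_linear[OF vspace_H vspace_M]])

lemmas dual_act_closed = linear_mapD(1)[OF dual_act_linear]

lemma dual_act_counit: "m \<in> carrier M \<Longrightarrow> dual_act K M (counit H) m = m"
  unfolding dual_act_def slice_l_def by (rule coact_counit)

text \<open>Coassociativity, contracted with \<open>f\<close> on the first leg and \<open>g\<close>
  on the second. The operator of \<open>f\<close> acts first because it consumes the outermost left
  leg, so the dual algebra acts from the right.\<close>

lemma dual_act_comp:
  assumes f: "functional K H f" and g: "functional K H g" and m: "m \<in> carrier M"
  shows "dual_act K M g (dual_act K M f m) = dual_act K M (convolution K H f g) m"
proof -
  have HH: "vspace K (tensor_space K H H)" and HM: "vspace K (tensor_space K H M)"
    using vspace_H vspace_M by simp_all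
  note t = coact_closed[OF m]
  note gf = linear_map_comp[OF slice_l_linear[OF vspace_H vspace_H f] g]
  have m': "tensor_map K (tensor_space K H H) M (comult H) (\<lambda>x. x) (coact M m)
      \<in> carrier (tensor_space K (tensor_space K H H) M)"
    by (rule linear_mapD(1)[OF tensor_map_linear[OF vspace_H vspace_M HH vspace_M comult_linear linear_map_id] t])
  have "slice_l K M g (slice_l K (tensor_space K H M) f
      (tensor_map K H (tensor_space K H M) (\<lambda>x. x) (coact M) (coact M m))) =
    slice_l K M g (coact M (slice_l K M f (coact M m)))"
    using slice_l_tensor_map[OF vspace_H vspace_M vspace_H HM linear_map_id coact_linear f t] by simp
  moreover have "slice_l K M g (slice_l K (tensor_space K H M) f (tensor_assoc K H H M
      (tensor_map K (tensor_space K H H) M (comult H) (\<lambda>x. x) (coact M m)))) =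
    slice_l K M (\<lambda>x. g (slice_l K H f x)) (tensor_map K (tensor_space K H H) M (comult H) (\<lambda>x. x) (coact M m))"
    by (rule slice_l_tensor_assoc[OF vspace_H vspace_H vspace_M f g m'])
  moreover have "\<dots> = slice_l K M (\<lambda>h. g (slice_l K H f (comult H h))) (coact M m)"
    by (rule slice_l_tensor_map[OF vspace_H vspace_M HH vspace_M comult_linear linear_map_id gf t])
  ultimately show ?thesis
    using coact_coassoc[OF m] by (simp add: dual_act_def convolution_def[abs_def])
qed

text \<open>\<open>coact M n\<close> lies in \<open>H \<otimes> N\<close> exactly when all its left
  slices lie in \<open>N\<close>. From here on subcomodules are handled as subspaces stable under
  the dual action.\<close>

lemma subcomodule_iff:
  "subcomodule K H M N \<longleftrightarrow> submodule N K M \<and> (\<forall>f. functional K H f \<longrightarrow> (\<forall>n\<in>N. dual_act K M f n \<in> N))"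
proof -
  interpret HM: vspace_pair K H M by (intro vspace_pair.intro vspace_H vspace_M)
  have "coact M ` N \<subseteq> tensor_subspace K H M (carrier H) N \<longleftrightarrow>
      (\<forall>f. functional K H f \<longrightarrow> (\<forall>n\<in>N. dual_act K M f n \<in> N))" if N: "submodule N K M"
  proof -
    have "coact M n \<in> tensor_subspace K H M (carrier H) N \<longleftrightarrow>
        (\<forall>f. functional K H f \<longrightarrow> dual_act K M f n \<in> N)" if "n \<in> N" for n
      unfolding dual_act_def using HM.W.submodule_vspace(1)[OF N] that
      by (intro HM.tensor_subspace_slice_l_iff[OF N] coact_closed) blast
    then show ?thesis by blast
  qed
  then show ?thesis unfolding subcomodule_def by blast
qed

lemma subcomoduleD:
  assumes "subcomodule K H M N"
  shows "submodule N K M" "functional K H f \<Longrightarrow> n \<in> N \<Longrightarrow> dual_act K M f n \<in> N"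
  using assms subcomodule_iff by auto

lemma subcomoduleI:
  assumes "submodule N K M" "\<And>f n. functional K H f \<Longrightarrow> n \<in> N \<Longrightarrow> dual_act K M f n \<in> N"
  shows "subcomodule K H M N"
  using assms subcomodule_iff by auto

lemma subcomodule_span:
  assumes X: "X \<subseteq> carrier M"
    and st: "\<And>f x. functional K H f \<Longrightarrow> x \<in> X \<Longrightarrow> dual_act K M f x \<in> linear_span K M X"
  shows "subcomodule K H M (linear_span K M X)"
proof -
  interpret MM: vspace K M by (rule vspace_M)
  show ?thesis
  proof (rule subcomoduleI[OF MM.span_submodule[OF X]])
    fix f n assume f: "functional K H f" and n: "n \<in> linear_span K M X"
    have "linear_span K M X \<subseteq> {m \<in> carrier M. dual_act K M f m \<in> linear_span K M X}"
      by (rule MM.span_minimal[OF MM.submodule_preimage[OF vspace_M dual_act_linear[OF f]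
            MM.span_submodule[OF X] MM.top_submodule]]) (use X st[OF f] in auto)
    then show "dual_act K M f n \<in> linear_span K M X" using n by blast
  qed
qed

lemma subcomodule_carrier: "subcomodule K H M (carrier M)"
  by (rule subcomoduleI[OF carrier_is_submodule dual_act_closed])

lemma subcomodule_zero: "subcomodule K H M {\<zero>\<^bsub>M\<^esub>}"
proof -
  interpret MM: vspace K M by (rule vspace_M)
  show ?thesis
    using linear_map_zero[OF vspace_M vspace_M dual_act_linear]
    by (intro subcomoduleI[OF MM.submodule_zero]) auto
qed

text \<open>Local finiteness of comodules. The orbit \<open>X\<close> of \<open>m\<close> under the
  dual algebra contains \<open>m\<close> by the counit law and is closed under the action because
  functionals can be convolved. Its span is finite-dimensional because \<open>coact M m\<close>
  involves only finitely many vectors of \<open>M\<close>.\<close>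

lemma finite_subcomodule:
  assumes P: "subcomodule K H M P" and m: "m \<in> P"
  shows "\<exists>S. finite S \<and> S \<subseteq> P \<and> m \<in> linear_span K M S \<and> subcomodule K H M (linear_span K M S)"
proof -
  interpret HM: vspace_pair K H M by (intro vspace_pair.intro vspace_H vspace_M)
  note PS = HM.W.submodule_vspace[OF subcomoduleD(1)[OF P]]
  have mM: "m \<in> carrier M" using m PS(1) by blast
  define X where "X = {dual_act K M f m | f. functional K H f}"
  have X: "X \<subseteq> carrier M" unfolding X_def using dual_act_closed mM by blast
  have XP: "X \<subseteq> P" unfolding X_def using subcomoduleD(2)[OF P] m by blast
  have sub: "subcomodule K H M (linear_span K M X)"
  proof (rule subcomodule_span[OF X])
    fix f x assume f: "functional K H f" and "x \<in> X"
    then obtain g where g: "functional K H g" "x = dual_act K M g m" by (auto simp: X_def)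
    then have "dual_act K M f x = dual_act K M (convolution K H g f) m"
      using dual_act_comp[OF g(1) f mM] by simp
    then have "dual_act K M f x \<in> X" using functional_convolution[OF g(1) f] unfolding X_def by blast
    then show "dual_act K M f x \<in> linear_span K M X" by (rule subsetD[OF HM.W.span_superset])
  qed
  have "m \<in> X" using dual_act_counit[OF mM] counit_linear unfolding X_def by force
  then have mX: "m \<in> linear_span K M X" by (rule subsetD[OF HM.W.span_superset])
  \<comment> \<open>Any finite set of right factors of \<open>coact M m\<close> bounds the orbit,
    whose elements are slices of this one tensor.\<close>
  obtain S where S: "finite S" "S \<subseteq> carrier M" "coact M m \<in> tensor_subspace K H M (carrier H) (linear_span K M S)"
    using HM.tensor_subspace_finite_support[OF HM.V.top_submodule
        HM.tensor_subspace_top[OF coact_closed[OF mM]]] by blast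
  have "X \<subseteq> linear_span K M S"
    unfolding X_def dual_act_def
    using HM.slice_l_mem[OF _ subset_refl HM.W.span_submodule[OF S(2)] S(3)] by blast
  then have XS: "linear_span K M X \<subseteq> linear_span K M S" by (rule HM.W.span_minimal[OF HM.W.span_submodule[OF S(2)]])
  note zS = HM.W.span_zero_Un[OF S(2)]
  \<comment> \<open>The set \<open>S\<close> need not lie in the span of the orbit, so it is
    exchanged for generators inside that span; these then lie in \<open>P\<close>.\<close>
  have "\<exists>T. finite T \<and> T \<subseteq> linear_span K M X \<and> linear_span K M X = linear_span K M T"
  proof (cases "linear_span K M X = linear_span K M S")
    case True
    then show ?thesis using S(1) HM.W.span_superset[of S] by blast
  next
    case False
    have z: "{\<zero>\<^bsub>M\<^esub>} \<subseteq> linear_span K M X" using HM.W.submodule_vspace(2)[OF subcomoduleD(1)[OF sub]] by blast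
    have "\<exists>T. finite T \<and> card T < card S \<and> T \<subseteq> linear_span K M X \<and>
        linear_span K M X = linear_span K M ({\<zero>\<^bsub>M\<^esub>} \<union> T)"
      by (rule HM.W.span_Un_finite_proper_subspace[OF S(1) HM.W.submodule_zero S(2) subcomoduleD(1)[OF sub] z])
        (use XS False in \<open>simp_all only: zS not_False_eq_True\<close>)
    then obtain T where T: "finite T" "T \<subseteq> linear_span K M X"
      "linear_span K M X = linear_span K M ({\<zero>\<^bsub>M\<^esub>} \<union> T)" by blast
    moreover have "T \<subseteq> carrier M" using T HM.W.span_closed[OF X] by blast
    ultimately show ?thesis using HM.W.span_zero_Un by auto
  qed
  then obtain T where T: "finite T" "T \<subseteq> linear_span K M X" "linear_span K M X = linear_span K M T" by blast
  have "linear_span K M X \<subseteq> P" by (rule HM.W.span_minimal[OF subcomoduleD(1)[OF P] XP])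
  then have "T \<subseteq> P" using T(2) by blast
  then show ?thesis using T mX sub by (intro exI[of _ T]) auto
qed

text \<open>Take \<open>S\<close> of least size among the finite subsets of \<open>P\<close> that
  enlarge \<open>N\<close> to a strictly larger subcomodule; such sets exist by local finiteness.
  Leastness gives independence modulo \<open>N\<close> and the size bound, and also simplicity over
  \<open>N\<close>, since a proper intermediate subcomodule would have fewer generators.\<close>

lemma minimal_subcomodule:
  assumes N: "subcomodule K H M N" and P: "subcomodule K H M P" and NP: "N \<subseteq> P" "N \<noteq> P"
  obtains S where "finite S" "S \<subseteq> P" "vspace.independent_mod K M N S"
    "subcomodule K H M (linear_span K M (N \<union> S))" "linear_span K M (N \<union> S) \<subseteq> P" "linear_span K M (N \<union> S) \<noteq> N"
    "\<And>U. \<lbrakk>subcomodule K H M U; N \<subseteq> U; U \<subseteq> linear_span K M (N \<union> S)\<rbrakk> \<Longrightarrow>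
      U = N \<or> U = linear_span K M (N \<union> S)"
    "\<And>T. \<lbrakk>finite T; T \<subseteq> P; linear_span K M (N \<union> T) = linear_span K M (N \<union> S)\<rbrakk> \<Longrightarrow> card S \<le> card T"
proof -
  interpret M: vspace K M by (rule vspace_M)
  note NS = M.submodule_vspace[OF subcomoduleD(1)[OF N]]
  note PS = M.submodule_vspace[OF subcomoduleD(1)[OF P]]
  define Q where "Q S \<longleftrightarrow> finite S \<and> S \<subseteq> P \<and> subcomodule K H M (linear_span K M (N \<union> S)) \<and> linear_span K M (N \<union> S) \<noteq> N" for S
  obtain m where m: "m \<in> P" "m \<notin> N" using NP by blast
  obtain S0 where S0: "finite S0" "S0 \<subseteq> P" "m \<in> linear_span K M S0" "subcomodule K H M (linear_span K M S0)"
    using finite_subcomodule[OF P m(1)] by blast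
  have NS0: "N \<union> S0 \<subseteq> carrier M" using NS(1) PS(1) S0 by blast
  have "subcomodule K H M (linear_span K M (N \<union> S0))"
  proof (rule subcomodule_span[OF NS0])
    fix f x assume f: "functional K H f" and x: "x \<in> N \<union> S0"
    have "x \<in> S0 \<Longrightarrow> dual_act K M f x \<in> linear_span K M S0"
      using subcomoduleD(2)[OF S0(4) f] M.span_superset[of S0] by blast
    then have "dual_act K M f x \<in> N \<union> linear_span K M S0" using x subcomoduleD(2)[OF N f] by blast
    then show "dual_act K M f x \<in> linear_span K M (N \<union> S0)"
      using M.span_superset[of "N \<union> S0"] M.span_mono[of S0 "N \<union> S0"] by blast
  qed
  moreover have "linear_span K M (N \<union> S0) \<noteq> N" using S0 m M.span_mono[of S0 "N \<union> S0"] by blast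
  ultimately have "Q S0" using S0 unfolding Q_def by blast
  then obtain S where QS: "Q S" and min: "\<And>T. Q T \<Longrightarrow> card S \<le> card T"
    using ex_has_least_nat[of Q S0 card] by blast
  then have S: "finite S" "S \<subseteq> P" "subcomodule K H M (linear_span K M (N \<union> S))" "linear_span K M (N \<union> S) \<noteq> N"
    unfolding Q_def by blast+
  have NSc: "N \<union> S \<subseteq> carrier M" using NS(1) PS(1) S by blast
  have "M.independent_mod N S"
    unfolding M.independent_mod_def
  proof (intro ballI notI)
    fix s assume s: "s \<in> S" and d: "s \<in> linear_span K M (N \<union> (S - {s}))"
    have sub: "N \<union> (S - {s}) \<subseteq> carrier M" using NSc by blast
    have "linear_span K M (N \<union> S) \<subseteq> linear_span K M (N \<union> (S - {s}))"
      using d M.span_superset[of "N \<union> (S - {s})"] by (intro M.span_minimal[OF M.span_submodule[OF sub]]) blast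
    moreover have "linear_span K M (N \<union> (S - {s})) \<subseteq> linear_span K M (N \<union> S)" by (rule M.span_mono) blast
    ultimately have "Q (S - {s})" using S unfolding Q_def by auto
    then show False using min[of "S - {s}"] s S(1) by (meson card_Diff1_less leD)
  qed
  moreover have "linear_span K M (N \<union> S) \<subseteq> P" using NP S by (intro M.span_minimal[OF subcomoduleD(1)[OF P]]) blast
  moreover have "U = N \<or> U = linear_span K M (N \<union> S)"
    if U: "subcomodule K H M U" "N \<subseteq> U" "U \<subseteq> linear_span K M (N \<union> S)" for U
  proof (rule ccontr)
    assume *: "\<not> ?thesis"
    have "S \<subseteq> carrier M" using NSc by blast
    then obtain T where T: "finite T" "card T < card S" "T \<subseteq> U" "U = linear_span K M (N \<union> T)"
      using M.span_Un_finite_proper_subspace[OF S(1) subcomoduleD(1)[OF N] _ subcomoduleD(1)[OF U(1)] U(2,3)] * by blast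
    then have "Q T" unfolding Q_def using * U \<open>linear_span K M (N \<union> S) \<subseteq> P\<close> by auto
    then show False using min T(2) by force
  qed
  moreover have "card S \<le> card T"
    if "finite T" "T \<subseteq> P" "linear_span K M (N \<union> T) = linear_span K M (N \<union> S)" for T
    by (rule min) (use that S in \<open>simp add: Q_def\<close>)
  ultimately show ?thesis using that[OF S(1,2) _ S(3) _ S(4)] by blast
qed

text \<open>The matrix coefficient \<open>m_(-1) p(m_(0))\<close> of \<open>m\<close> and
  \<open>p\<close>.\<close>

definition coefficient :: "('m \<Rightarrow> 'k) \<Rightarrow> 'm \<Rightarrow> 'h"
  where "coefficient p m = slice_r K H p (coact M m)"

lemma coefficient_linear: "functional K M p \<Longrightarrow> linear_map K M H (coefficient p)"
  unfolding coefficient_def[abs_def]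
  by (rule linear_map_comp[OF coact_linear slice_r_linear[OF vspace_H vspace_M]])

lemmas coefficient_closed = linear_mapD(1)[OF coefficient_linear]

lemma functional_coefficient:
  "\<lbrakk>functional K M p; functional K H f; m \<in> carrier M\<rbrakk> \<Longrightarrow> f (coefficient p m) = p (dual_act K M f m)"
  unfolding coefficient_def dual_act_def
  by (rule slice_exchange[OF vspace_H vspace_M _ _ coact_closed, symmetric])

text \<open>Pairing with a functional \<open>g\<close> reduces this to \<open>dual_act_comp\<close>.
  It makes \<open>coefficient p\<close> a homomorphism of comodules from \<open>M\<close> to
  \<open>H\<close>, where \<open>H\<close> coacts on itself by its comultiplication.\<close>

lemma coefficient_comult:
  assumes p: "functional K M p" and f: "functional K H f" and m: "m \<in> carrier M"
  shows "slice_l K H f (comult H (coefficient p m)) = coefficient p (dual_act K M f m)"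
proof -
  interpret H: vspace K H by (rule vspace_H)
  have c: "coefficient p m \<in> carrier H" by (rule coefficient_closed[OF p m])
  have fm: "dual_act K M f m \<in> carrier M" by (rule dual_act_closed[OF f m])
  show ?thesis
  proof (rule H.functional_ext)
    show "slice_l K H f (comult H (coefficient p m)) \<in> carrier H"
      by (rule linear_mapD(1)[OF slice_l_linear[OF vspace_H vspace_H f] linear_mapD(1)[OF comult_linear c]])
    show "coefficient p (dual_act K M f m) \<in> carrier H" by (rule coefficient_closed[OF p fm])
    fix g assume g: "functional K H g"
    have "g (slice_l K H f (comult H (coefficient p m))) = p (dual_act K M (convolution K H f g) m)"
      using functional_coefficient[OF p functional_convolution[OF f g] m] by (simp add: convolution_def)
    also have "\<dots> = g (coefficient p (dual_act K M f m))"
      using functional_coefficient[OF p g fm] dual_act_comp[OF f g m] by simp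
    finally show "g (slice_l K H f (comult H (coefficient p m))) = g (coefficient p (dual_act K M f m))" .
  qed
qed

lemma coefficient_vanishes:
  assumes N: "subcomodule K H M N" and p: "functional K M p" "\<And>x. x \<in> N \<Longrightarrow> p x = \<zero>\<^bsub>K\<^esub>" and n: "n \<in> N"
  shows "coefficient p n = \<zero>\<^bsub>H\<^esub>"
proof -
  interpret H: vspace K H by (rule vspace_H)
  interpret M: vspace K M by (rule vspace_M)
  have nM: "n \<in> carrier M" using n M.submodule_vspace(1)[OF subcomoduleD(1)[OF N]] by blast
  show ?thesis
    by (rule H.functional_separation[OF coefficient_closed[OF p(1) nM]])
      (use functional_coefficient[OF p(1) _ nM] p(2) subcomoduleD(2)[OF N _ n] in simp)
qed

text \<open>The coefficient matrix of the quotient of the span of \<open>N\<close> and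
  \<open>S\<close> by \<open>N\<close>, in the basis \<open>S\<close>. Representatives in
  \<open>M\<close> suffice because the functionals \<open>p s\<close> vanish on the subcomodule
  \<open>N\<close>, and hence so do their coefficients there.\<close>

lemma comatrix_coefficients:
  assumes N: "subcomodule K H M N" and V: "subcomodule K H M (linear_span K M (N \<union> S))"
    and S: "finite S" "S \<subseteq> carrier M"
    and p: "\<And>s. s \<in> S \<Longrightarrow> functional K M (p s)" "\<And>s x. s \<in> S \<Longrightarrow> x \<in> N \<Longrightarrow> p s x = \<zero>\<^bsub>K\<^esub>"
      "\<And>s t. s \<in> S \<Longrightarrow> t \<in> S \<Longrightarrow> p s t = (if t = s then \<one>\<^bsub>K\<^esub> else \<zero>\<^bsub>K\<^esub>)"
  shows "comatrix K H S (\<lambda>s t. coefficient (p t) s)"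
    and "\<And>f s. functional K H f \<Longrightarrow> s \<in> S \<Longrightarrow>
      dual_act K M f s \<ominus>\<^bsub>M\<^esub> (\<Oplus>\<^bsub>M\<^esub>t\<in>S. f (coefficient (p t) s) \<odot>\<^bsub>M\<^esub> t) \<in> N"
proof -
  interpret HM: vspace_pair K H M by (intro vspace_pair.intro vspace_H vspace_M)
  interpret HH: vspace_pair K H H by (intro vspace_pair.intro vspace_H)
  note NS = HM.W.submodule_vspace[OF subcomoduleD(1)[OF N]]
  have sM: "s \<in> S \<Longrightarrow> s \<in> carrier M" for s using S by blast
  note cc = coefficient_closed[OF p(1) sM]
  have exp: "dual_act K M f s \<ominus>\<^bsub>M\<^esub> (\<Oplus>\<^bsub>M\<^esub>t\<in>S. f (coefficient (p t) s) \<odot>\<^bsub>M\<^esub> t) \<in> N"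
    if f: "functional K H f" and s: "s \<in> S" for f s
  proof -
    have "s \<in> linear_span K M (N \<union> S)" by (rule subsetD[OF HM.W.span_superset]) (use s in simp)
    then have v: "dual_act K M f s \<in> linear_span K M (N \<union> S)" by (rule subcomoduleD(2)[OF V f])
    have "(\<Oplus>\<^bsub>M\<^esub>t\<in>S. f (coefficient (p t) s) \<odot>\<^bsub>M\<^esub> t) = (\<Oplus>\<^bsub>M\<^esub>t\<in>S. p t (dual_act K M f s) \<odot>\<^bsub>M\<^esub> t)"
      using functional_coefficient[OF p(1) f sM[OF s]] functional_closed[OF p(1)] dual_act_closed[OF f sM[OF s]] sM
      by (intro HM.W.sum_cong) auto
    then show ?thesis
      using HM.W.dual_basis_expansion[OF subcomoduleD(1)[OF N] S(2,1) p v] by simp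
  qed
  then show "\<And>f s. functional K H f \<Longrightarrow> s \<in> S \<Longrightarrow>
      dual_act K M f s \<ominus>\<^bsub>M\<^esub> (\<Oplus>\<^bsub>M\<^esub>t\<in>S. f (coefficient (p t) s) \<odot>\<^bsub>M\<^esub> t) \<in> N" .
  show "comatrix K H S (\<lambda>s t. coefficient (p t) s)"
    unfolding comatrix_def
  proof (intro conjI ballI S(1))
    fix s t assume s: "s \<in> S" and t: "t \<in> S"
    show "coefficient (p t) s \<in> carrier H" by (rule cc[OF t s])
    show "counit H (coefficient (p t) s) = (if s = t then \<one>\<^bsub>K\<^esub> else \<zero>\<^bsub>K\<^esub>)"
      using functional_coefficient[OF p(1)[OF t] counit_linear sM[OF s]] dual_act_counit[OF sM[OF s]] p(3)[OF t s] by simp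
    let ?c = "\<lambda>s t. coefficient (p t) s"
    have pc: "(\<lambda>u. pure_tensor K H H (?c s u) (?c u t)) \<in> S \<rightarrow> carrier (tensor_space K H H)"
      using cc s t vspace_H by auto
    show "comult H (?c s t) = (\<Oplus>\<^bsub>tensor_space K H H\<^esub>u\<in>S. pure_tensor K H H (?c s u) (?c u t))"
    proof (rule HH.tensor_eq_slice_l)
      show "comult H (?c s t) \<in> carrier (tensor_space K H H)" by (rule linear_mapD(1)[OF comult_linear cc[OF t s]])
      show "(\<Oplus>\<^bsub>tensor_space K H H\<^esub>u\<in>S. pure_tensor K H H (?c s u) (?c u t)) \<in> carrier (tensor_space K H H)"
        by (rule HH.T.M.finsum_closed[OF pc])
      fix f assume f: "functional K H f"
      note sl = slice_l_linear[OF vspace_H vspace_H f]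
      have fc: "u \<in> S \<Longrightarrow> f (?c s u) \<in> carrier K" for u by (rule functional_closed[OF f cc[OF _ s]])
      have su: "(\<lambda>u. f (?c s u) \<odot>\<^bsub>M\<^esub> u) \<in> S \<rightarrow> carrier M" using fc sM by auto
      \<comment> \<open>The part of the result that the expansion in \<open>S\<close> misses. It
        lies in \<open>N\<close>, where \<open>coefficient (p t)\<close> is zero.\<close>
      define n where "n = dual_act K M f s \<ominus>\<^bsub>M\<^esub> (\<Oplus>\<^bsub>M\<^esub>u\<in>S. f (?c s u) \<odot>\<^bsub>M\<^esub> u)"
      have n: "n \<in> N" unfolding n_def by (rule exp[OF f s])
      have nM: "n \<in> carrier M" using n NS(1) by blast
      have "dual_act K M f s = n \<oplus>\<^bsub>M\<^esub> (\<Oplus>\<^bsub>M\<^esub>u\<in>S. f (?c s u) \<odot>\<^bsub>M\<^esub> u)"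
        unfolding n_def using dual_act_closed[OF f sM[OF s]] HM.W.sum_closed[OF su]
        by (simp add: a_minus_def HM.W.add_assoc HM.W.left_neg)
      moreover have "coefficient (p t) n = \<zero>\<^bsub>H\<^esub>"
        by (rule coefficient_vanishes[OF N p(1)[OF t] p(2)[OF t] n])
      ultimately have "coefficient (p t) (dual_act K M f s) = coefficient (p t) (\<Oplus>\<^bsub>M\<^esub>u\<in>S. f (?c s u) \<odot>\<^bsub>M\<^esub> u)"
        using linear_mapD(2)[OF coefficient_linear[OF p(1)[OF t]] nM HM.W.sum_closed[OF su]]
          coefficient_closed[OF p(1)[OF t] HM.W.sum_closed[OF su]] by simp
      also have "\<dots> = (\<Oplus>\<^bsub>H\<^esub>u\<in>S. coefficient (p t) (f (?c s u) \<odot>\<^bsub>M\<^esub> u))"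
        by (rule linear_map_finsum[OF vspace_M vspace_H coefficient_linear[OF p(1)[OF t]] su])
      also have "\<dots> = (\<Oplus>\<^bsub>H\<^esub>u\<in>S. slice_l K H f (pure_tensor K H H (?c s u) (?c u t)))"
        using fc sM cc s t
        by (intro HM.V.sum_cong)
          (auto simp: slice_l_pure[OF vspace_H vspace_H f] linear_mapD(3)[OF coefficient_linear[OF p(1)]])
      also have "\<dots> = slice_l K H f (\<Oplus>\<^bsub>tensor_space K H H\<^esub>u\<in>S. pure_tensor K H H (?c s u) (?c u t))"
        by (rule linear_map_finsum[OF HH.T.vspace_axioms vspace_H sl pc, symmetric])
      finally show "slice_l K H f (comult H (?c s t)) =
          slice_l K H f (\<Oplus>\<^bsub>tensor_space K H H\<^esub>u\<in>S. pure_tensor K H H (?c s u) (?c u t))"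
        using coefficient_comult[OF p(1)[OF t] f sM[OF s]] by simp
    qed
  qed
qed

end

section \<open>Simple subcoalgebras and grouplike elements\<close>

context coalgebra
begin

lemma slice_l_counit: "h \<in> carrier H \<Longrightarrow> slice_l K H (counit H) (comult H h) = h"
  unfolding slice_l_def by (rule counit_l)

text \<open>Take a spanning set of least size among those of the nonzero subcoalgebras inside the
  given one; a smaller nonzero subcoalgebra would need fewer generators.\<close>

lemma simple_subcoalgebra_exists:
  assumes "finite T" "T \<subseteq> carrier H" "subcoalgebra K H (linear_span K H T)" "linear_span K H T \<noteq> {\<zero>\<^bsub>H\<^esub>}"
  shows "\<exists>E. simple_subcoalgebra K H E \<and> E \<subseteq> linear_span K H T"
proof -
  interpret H: vspace K H by (rule vspace_H)
  define Q where "Q S \<longleftrightarrow> finite S \<and> S \<subseteq> carrier H \<and> linear_span K H S \<subseteq> linear_span K H T \<and>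
    subcoalgebra K H (linear_span K H S) \<and> linear_span K H S \<noteq> {\<zero>\<^bsub>H\<^esub>}" for S
  have "Q T" using assms unfolding Q_def by blast
  then obtain S where QS: "Q S" and min: "\<And>S'. Q S' \<Longrightarrow> card S \<le> card S'"
    using ex_has_least_nat[of Q T card] by blast
  then have S: "finite S" "S \<subseteq> carrier H" "linear_span K H S \<subseteq> linear_span K H T"
    "subcoalgebra K H (linear_span K H S)" "linear_span K H S \<noteq> {\<zero>\<^bsub>H\<^esub>}" unfolding Q_def by blast+
  have "E = {\<zero>\<^bsub>H\<^esub>} \<or> E = linear_span K H S" if E: "subcoalgebra K H E" "E \<subseteq> linear_span K H S" for E
  proof (rule ccontr)
    assume *: "\<not> ?thesis"
    have Es: "submodule E K H" using E unfolding subcoalgebra_def by blast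
    note z = H.span_zero_Un[OF S(2)]
    have "\<exists>S'. finite S' \<and> card S' < card S \<and> S' \<subseteq> E \<and> E = linear_span K H ({\<zero>\<^bsub>H\<^esub>} \<union> S')"
      by (rule H.span_Un_finite_proper_subspace[OF S(1) H.submodule_zero S(2) Es])
        (use E(2) * H.submodule_vspace(2)[OF Es] in \<open>simp_all only: z, simp_all\<close>)
    then obtain S' where S': "finite S'" "card S' < card S" "S' \<subseteq> E" "E = linear_span K H ({\<zero>\<^bsub>H\<^esub>} \<union> S')" by blast
    have c: "S' \<subseteq> carrier H" using S' H.submodule_vspace(1)[OF Es] by blast
    have "Q S'" unfolding Q_def using S' c E * S(3) H.span_zero_Un[OF c] by auto
    then show False using min S'(2) by force
  qed
  then show ?thesis using S unfolding simple_subcoalgebra_def by blast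
qed

text \<open>If \<open>d\<close> spans the simple subcoalgebra, its comultiplication is a multiple
  \<open>l\<close> of \<open>d \<otimes> d\<close>. The counit law gives
  \<open>l \<epsilon>(d) = 1\<close>, so that \<open>l d\<close> is grouplike.\<close>

lemma pointed_grouplike:
  assumes E: "simple_subcoalgebra K H E" and pt: "pointed K H"
  shows "\<exists>g\<in>E. grouplike K H g"
proof -
  interpret HH: vspace_pair K H H by (intro vspace_pair.intro vspace_H)
  obtain d where d: "d \<in> carrier H" "d \<noteq> \<zero>\<^bsub>H\<^esub>" "E = {c \<odot>\<^bsub>H\<^esub> d | c. c \<in> carrier K}"
    using pt E unfolding pointed_def one_dimensional_def by blast
  have "d = \<one>\<^bsub>K\<^esub> \<odot>\<^bsub>H\<^esub> d" using d(1) by simp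
  then have dE: "d \<in> E" using d(3) by blast
  have dd: "pure_tensor K H H d d \<in> carrier (tensor_space K H H)" using vspace_H d(1) by simp
  have "tensor_subspace K H H E E \<subseteq> linear_span K (tensor_space K H H) {pure_tensor K H H d d}"
  proof (rule HH.tensor_subspace_minimal)
    show sub: "submodule (linear_span K (tensor_space K H H) {pure_tensor K H H d d}) K (tensor_space K H H)"
      by (rule HH.T.span_submodule) (use dd in simp)
    fix x y assume "x \<in> E" "y \<in> E"
    then obtain a b where ab: "a \<in> carrier K" "b \<in> carrier K" "x = a \<odot>\<^bsub>H\<^esub> d" "y = b \<odot>\<^bsub>H\<^esub> d" using d(3) by blast
    then have "pure_tensor K H H x y = b \<odot>\<^bsub>tensor_space K H H\<^esub> (a \<odot>\<^bsub>tensor_space K H H\<^esub> pure_tensor K H H d d)"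
      using d(1) by (simp add: HH.pure_simps)
    moreover have "pure_tensor K H H d d \<in> linear_span K (tensor_space K H H) {pure_tensor K H H d d}"
      by (rule subsetD[OF HH.T.span_superset]) simp
    ultimately show "pure_tensor K H H x y \<in> linear_span K (tensor_space K H H) {pure_tensor K H H d d}"
      using HH.T.submodule_vspace(4)[OF sub] ab(1,2) by simp
  qed
  moreover have "comult H d \<in> tensor_subspace K H H E E"
    using E dE unfolding simple_subcoalgebra_def subcoalgebra_def by blast
  ultimately obtain l where l: "l \<in> carrier K" "comult H d = l \<odot>\<^bsub>tensor_space K H H\<^esub> pure_tensor K H H d d"
    unfolding HH.T.span_singleton[OF dd] by blast
  have ed: "counit H d \<in> carrier K" by (rule functional_closed[OF counit_linear d(1)])
  \<comment> \<open>A functional with \<open>f d = 1\<close> turns the identity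
    \<open>d = l \<epsilon>(d) d\<close> into one of scalars.\<close>
  obtain f where f: "functional K H f" "f d = \<one>\<^bsub>K\<^esub>"
    using HH.V.exists_functional[OF HH.V.submodule_zero d(1)] d(2) by blast
  have "d = l \<odot>\<^bsub>H\<^esub> (counit H d \<odot>\<^bsub>H\<^esub> d)"
    using slice_l_counit[OF d(1)] l d(1) dd
    by (simp add: linear_mapD(3)[OF slice_l_linear[OF vspace_H vspace_H counit_linear]]
      slice_l_pure[OF vspace_H vspace_H counit_linear])
  then have "f d = f (l \<odot>\<^bsub>H\<^esub> (counit H d \<odot>\<^bsub>H\<^esub> d))" by simp
  then have le: "l \<otimes>\<^bsub>K\<^esub> counit H d = \<one>\<^bsub>K\<^esub>"
    using f l ed d(1) by (simp add: functional_smult[OF f(1)])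
  let ?g = "l \<odot>\<^bsub>H\<^esub> d"
  have "comult H ?g = pure_tensor K H H ?g ?g"
    using l d(1) by (simp add: linear_mapD(3)[OF comult_linear] HH.pure_simps)
  moreover have "counit H ?g = \<one>\<^bsub>K\<^esub>" using functional_smult[OF counit_linear l(1) d(1)] le by simp
  moreover have "?g \<in> carrier H" "?g \<in> E" using l d by auto
  ultimately show ?thesis unfolding grouplike_def by blast
qed

lemma grouplike_nonzero: "grouplike K H g \<Longrightarrow> g \<noteq> \<zero>\<^bsub>H\<^esub>"
proof
  interpret H: vspace K H by (rule vspace_H)
  assume "grouplike K H g" "g = \<zero>\<^bsub>H\<^esub>"
  then show False using H.functional_zero[OF counit_linear] by (simp add: grouplike_def)
qed

text \<open>In the comatrix formula for the comultiplication of an entry, both legs of every summand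
  are entries again.\<close>

lemma comatrix_subcoalgebra:
  assumes c: "comatrix K H I c"
  shows "subcoalgebra K H (linear_span K H {c i j | i j. i \<in> I \<and> j \<in> I})"
proof -
  interpret HH: vspace_pair K H H by (intro vspace_pair.intro vspace_H)
  let ?X = "{c i j | i j. i \<in> I \<and> j \<in> I}"
  let ?D = "linear_span K H ?X"
  have X: "?X \<subseteq> carrier H" using c unfolding comatrix_def by blast
  have Dc: "?D \<subseteq> carrier H" by (rule HH.V.span_closed[OF X])
  have sub: "submodule (tensor_subspace K H H ?D ?D) K (tensor_space K H H)"
    by (rule HH.tensor_subspace_submodule[OF Dc Dc])
  have "?D \<subseteq> {h \<in> carrier H. comult H h \<in> tensor_subspace K H H ?D ?D}"
  proof (rule HH.V.span_minimal[OF HH.V.submodule_preimage[OF HH.T.vspace_axioms comult_linear sub HH.V.top_submodule]])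
    show "?X \<subseteq> {h \<in> carrier H. comult H h \<in> tensor_subspace K H H ?D ?D}"
    proof
      fix x assume x: "x \<in> ?X"
      then obtain i j where ij: "i \<in> I" "j \<in> I" "x = c i j" by blast
      have "comult H x = (\<Oplus>\<^bsub>tensor_space K H H\<^esub>k\<in>I. pure_tensor K H H (c i k) (c k j))"
        using c ij unfolding comatrix_def by simp
      also have "\<dots> \<in> tensor_subspace K H H ?D ?D"
      proof (rule HH.T.submodule_finsum[OF sub], rule Pi_I, rule HH.pure_in_tensor_subspace)
        fix k assume "k \<in> I"
        then show "c i k \<in> ?D" "c k j \<in> ?D"
          using ij HH.V.span_superset[of ?X] by blast+
      qed
      finally show "x \<in> {h \<in> carrier H. comult H h \<in> tensor_subspace K H H ?D ?D}" using x X by blast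
    qed
  qed
  then show ?thesis unfolding subcoalgebra_def using HH.V.span_submodule[OF X] by blast
qed

end

section \<open>Semi-invariants over a pointed coalgebra\<close>

context left_comodule
begin

text \<open>
  Modulo \<open>N\<close>, a simple subcomodule \<open>V\<close> has coefficient space \<open>D = \<Sum>\<^sub>t \<phi>\<^sub>t(V)\<close>, a sum of comodule
  images of \<open>V\<close>; a grouplike element of \<open>D\<close> therefore spans a comodule isomorphic to \<open>V / N\<close>.
\<close>

lemma pointed_semi_invariant:
  assumes pt: "pointed K H" and N: "subcomodule K H M N" and ne: "N \<noteq> carrier M"
  shows "\<exists>g n. grouplike K H g \<and> n \<in> carrier M \<and> n \<notin> N \<and>
    (\<forall>f. functional K H f \<longrightarrow> dual_act K M f n \<ominus>\<^bsub>M\<^esub> f g \<odot>\<^bsub>M\<^esub> n \<in> N)"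
proof -
  interpret HM: vspace_pair K H M by (intro vspace_pair.intro vspace_H vspace_M)
  note NS = HM.W.submodule_vspace[OF subcomoduleD(1)[OF N]]
  obtain S where S: "finite S" "S \<subseteq> carrier M" "vspace.independent_mod K M N S"
    "subcomodule K H M (linear_span K M (N \<union> S))" "linear_span K M (N \<union> S) \<subseteq> carrier M" "linear_span K M (N \<union> S) \<noteq> N"
    and simple: "\<And>U. \<lbrakk>subcomodule K H M U; N \<subseteq> U; U \<subseteq> linear_span K M (N \<union> S)\<rbrakk> \<Longrightarrow>
      U = N \<or> U = linear_span K M (N \<union> S)"
    by (rule minimal_subcomodule[OF N subcomodule_carrier NS(1) ne]) (rule that)
  define V where "V = linear_span K M (N \<union> S)"
  have V: "subcomodule K H M V" using S V_def by simp
  note VS = HM.W.submodule_vspace[OF subcomoduleD(1)[OF V]]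
  have NV: "N \<subseteq> V" "S \<subseteq> V" unfolding V_def using HM.W.span_superset[of "N \<union> S"] by blast+
  have "S \<noteq> {}" using S(6) HM.W.span_eq[OF subcomoduleD(1)[OF N]] by (metis Un_empty_right)
  obtain p where p': "\<forall>s\<in>S. functional K M (p s) \<and> (\<forall>x\<in>N. p s x = \<zero>\<^bsub>K\<^esub>) \<and>
    (\<forall>t\<in>S. p s t = (if t = s then \<one>\<^bsub>K\<^esub> else \<zero>\<^bsub>K\<^esub>))"
    using HM.W.dual_basis[OF subcomoduleD(1)[OF N] S(2,3)] by (rule exE)
  have p: "\<And>s. s \<in> S \<Longrightarrow> functional K M (p s)" "\<And>s x. s \<in> S \<Longrightarrow> x \<in> N \<Longrightarrow> p s x = \<zero>\<^bsub>K\<^esub>"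
      "\<And>s t. s \<in> S \<Longrightarrow> t \<in> S \<Longrightarrow> p s t = (if t = s then \<one>\<^bsub>K\<^esub> else \<zero>\<^bsub>K\<^esub>)"
    using p' by blast+
  let ?c = "\<lambda>s t. coefficient (p t) s"
  have cm: "comatrix K H S ?c" by (rule comatrix_coefficients(1)[OF N S(4,1,2) p])
  let ?X = "{?c s t | s t. s \<in> S \<and> t \<in> S}"
  have X: "?X \<subseteq> carrier H" using cm unfolding comatrix_def by blast
  have "?X = (\<lambda>(s, t). ?c s t) ` (S \<times> S)" by auto
  then have fX: "finite ?X" using S(1) by simp
  have sub: "subcoalgebra K H (linear_span K H ?X)" by (rule comatrix_subcoalgebra[OF cm])
  have "linear_span K H ?X \<noteq> {\<zero>\<^bsub>H\<^esub>}"
  proof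
    assume z: "linear_span K H ?X = {\<zero>\<^bsub>H\<^esub>}"
    obtain s where s: "s \<in> S" using \<open>S \<noteq> {}\<close> by blast
    have "?c s s \<in> ?X" using s by blast
    then have "?c s s = \<zero>\<^bsub>H\<^esub>" using z HM.V.span_superset[of ?X] by blast
    moreover have "counit H (?c s s) = \<one>\<^bsub>K\<^esub>" using cm s unfolding comatrix_def by simp
    ultimately show False using HM.V.functional_zero[OF counit_linear] by simp
  qed
  \<comment> \<open>This is where pointedness enters: the coefficient coalgebra contains a simple
    subcoalgebra, and hence a grouplike \<open>g\<close>.\<close>
  then obtain E where E: "simple_subcoalgebra K H E" "E \<subseteq> linear_span K H ?X"
    using simple_subcoalgebra_exists[OF fX X sub] by blast
  then obtain g where g: "grouplike K H g" "g \<in> linear_span K H ?X" using pointed_grouplike[OF _ pt] by blast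
  have gH: "g \<in> carrier H" and gd: "comult H g = pure_tensor K H H g g" using g(1) unfolding grouplike_def by auto
  \<comment> \<open>Partial sums of the comodule images of \<open>V\<close> in \<open>H\<close>,
    indexed by subsets \<open>T\<close> of the basis. Each is stable under the dual action, and
    \<open>Q S\<close> contains the coefficient space, hence \<open>g\<close>.\<close>
  define Q where "Q T = linear_span K H (\<Union>t\<in>T. coefficient (p t) ` V)" for T
  have UT: "(\<Union>t\<in>T. coefficient (p t) ` V) \<subseteq> carrier H" if "T \<subseteq> S" for T
    using coefficient_closed[OF p(1)] VS(1) that by blast
  have Qsub: "submodule (Q T) K H" if "T \<subseteq> S" for T
    unfolding Q_def by (rule HM.V.span_submodule[OF UT[OF that]])
  have Qst: "slice_l K H f (comult H q) \<in> Q T" if T: "T \<subseteq> S" and f: "functional K H f" and q: "q \<in> Q T" for T f q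
  proof -
    have lin: "linear_map K H H (\<lambda>q. slice_l K H f (comult H q))"
      by (rule linear_map_comp[OF comult_linear slice_l_linear[OF vspace_H vspace_H f]])
    have "Q T \<subseteq> {q \<in> carrier H. slice_l K H f (comult H q) \<in> Q T}"
      unfolding Q_def
    proof (rule HM.V.span_minimal[OF HM.V.submodule_preimage[OF vspace_H lin Qsub[OF T, unfolded Q_def] HM.V.top_submodule]], rule subsetI)
      fix q assume "q \<in> (\<Union>t\<in>T. coefficient (p t) ` V)"
      then obtain t v where tv: "t \<in> T" "v \<in> V" "q = coefficient (p t) v" by blast
      have t: "functional K M (p t)" and v: "v \<in> carrier M" using p(1) T tv VS(1) by auto
      have "slice_l K H f (comult H q) = coefficient (p t) (dual_act K M f v)"
        unfolding tv(3) by (rule coefficient_comult[OF t f v])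
      also have "\<dots> \<in> (\<Union>t\<in>T. coefficient (p t) ` V)" using subcomoduleD(2)[OF V f tv(2)] tv(1) by blast
      finally have "slice_l K H f (comult H q) \<in> linear_span K H (\<Union>t\<in>T. coefficient (p t) ` V)"
        by (rule subsetD[OF HM.V.span_superset])
      then show "q \<in> {q \<in> carrier H. slice_l K H f (comult H q) \<in> linear_span K H (\<Union>t\<in>T. coefficient (p t) ` V)}"
        using coefficient_closed[OF t v] tv(3) by simp
    qed
    then show ?thesis using q by blast
  qed
  have "linear_span K H ?X \<subseteq> Q S"
    unfolding Q_def using NV(2) by (intro HM.V.span_mono) blast
  then have gQ: "g \<in> Q S" using g by blast
  \<comment> \<open>The images are added one at a time. At the stage where \<open>g\<close> enters,
    \<open>g = \<phi> v + q\<close> with \<open>q\<close> in \<open>Q T\<close>, while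
    \<open>g\<close> itself is not in \<open>Q T\<close>.\<close>
  have claim: "\<exists>n. n \<in> carrier M \<and> n \<notin> N \<and>
    (\<forall>f. functional K H f \<longrightarrow> dual_act K M f n \<ominus>\<^bsub>M\<^esub> f g \<odot>\<^bsub>M\<^esub> n \<in> N)" if "finite T" "T \<subseteq> S" "g \<in> Q T" for T
    using that
  proof (induct T rule: finite_induct)
    case empty
    then have "g \<in> {\<zero>\<^bsub>H\<^esub>}" unfolding Q_def using HM.V.span_empty by simp
    then show ?case using grouplike_nonzero[OF g(1)] by blast
  next
    case (insert t T)
    have T: "T \<subseteq> S" and t: "t \<in> S" using insert by auto
    note QS = HM.V.submodule_vspace[OF Qsub[OF T]]
    show ?case
    proof (cases "g \<in> Q T")
      case True
      then show ?thesis using insert T by blast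
    next
      case False
      have "submodule (coefficient (p t) ` V) K H"
        by (rule HM.W.submodule_image[OF vspace_H coefficient_linear[OF p(1)[OF t]] subcomoduleD(1)[OF V]])
      moreover have "g \<in> linear_span K H (coefficient (p t) ` V \<union> (\<Union>t\<in>T. coefficient (p t) ` V))"
        using insert.prems(2) unfolding Q_def by simp
      ultimately obtain v q where v: "v \<in> V" and q: "q \<in> Q T" and gvq: "g = coefficient (p t) v \<oplus>\<^bsub>H\<^esub> q"
        using HM.V.span_Un[OF _ UT[OF T]] unfolding Q_def by blast
      have vM: "v \<in> carrier M" and qH: "q \<in> carrier H" using v VS(1) q QS(1) by auto
      define \<phi> where "\<phi> = coefficient (p t)"
      note lin = coefficient_linear[OF p(1)[OF t], folded \<phi>_def]
      have \<phi>v: "\<phi> v \<in> carrier H" by (rule linear_mapD(1)[OF lin vM])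
      have gv: "\<phi> v = g \<ominus>\<^bsub>H\<^esub> q" unfolding gvq \<phi>_def[symmetric] using \<phi>v qH
        by (simp add: a_minus_def HM.V.add_assoc HM.V.right_neg)
      \<comment> \<open>The kernel of the map from \<open>V\<close> to \<open>H / Q T\<close>
        induced by \<open>\<phi>\<close>. It is a subcomodule between \<open>N\<close> and
        \<open>V\<close> that misses \<open>v\<close>, so simplicity forces it to be
        \<open>N\<close>. The congruence for \<open>v\<close> modulo \<open>N\<close> can therefore
        be checked after applying \<open>\<phi>\<close>, modulo \<open>Q T\<close>.\<close>
      let ?W = "{x \<in> V. \<phi> x \<in> Q T}"
      have "subcomodule K H M ?W"
      proof (rule subcomoduleI)
        show "submodule ?W K M" by (rule HM.W.submodule_preimage[OF vspace_H lin Qsub[OF T] subcomoduleD(1)[OF V]])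
        fix f x assume f: "functional K H f" and x: "x \<in> ?W"
        have xM: "x \<in> carrier M" using x VS(1) by blast
        have "\<phi> (dual_act K M f x) = slice_l K H f (comult H (\<phi> x))"
          unfolding \<phi>_def by (rule coefficient_comult[OF p(1)[OF t] f xM, symmetric])
        then show "dual_act K M f x \<in> ?W" using Qst[OF T f] x subcomoduleD(2)[OF V f] by simp
      qed
      moreover have "N \<subseteq> ?W"
        using NV(1) coefficient_vanishes[OF N p(1)[OF t] p(2)[OF t]] QS(2) unfolding \<phi>_def by auto
      moreover have "v \<notin> ?W"
      proof
        assume "v \<in> ?W"
        then have "g \<in> Q T" using QS(3)[of "\<phi> v" q] q gvq unfolding \<phi>_def by simp
        then show False using False by blast
      qed
      ultimately have W: "?W = N" using simple[of ?W] v unfolding V_def by blast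
      have "dual_act K M f v \<ominus>\<^bsub>M\<^esub> f g \<odot>\<^bsub>M\<^esub> v \<in> N" if f: "functional K H f" for f
      proof -
        have fg: "f g \<in> carrier K" by (rule functional_closed[OF f gH])
        have fv: "dual_act K M f v \<in> V" by (rule subcomoduleD(2)[OF V f v])
        have fgv: "f g \<odot>\<^bsub>M\<^esub> v \<in> V" by (rule VS(4)[OF fg v])
        have c: "dual_act K M f v \<in> carrier M" "f g \<odot>\<^bsub>M\<^esub> v \<in> carrier M" using fv fgv VS(1) by auto
        define q' where "q' = slice_l K H f (comult H q)"
        have q': "q' \<in> Q T" unfolding q'_def by (rule Qst[OF T f q])
        have q'H: "q' \<in> carrier H" using q' QS(1) by blast
        note lf = linear_map_comp[OF comult_linear slice_l_linear[OF vspace_H vspace_H f]]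
        have "\<phi> (dual_act K M f v) = slice_l K H f (comult H (\<phi> v))"
          unfolding \<phi>_def by (rule coefficient_comult[OF p(1)[OF t] f vM, symmetric])
        also have "\<dots> = slice_l K H f (comult H g) \<ominus>\<^bsub>H\<^esub> q'"
          unfolding gv q'_def by (rule linear_map_diff[OF vspace_H vspace_H lf gH qH])
        also have "slice_l K H f (comult H g) = f g \<odot>\<^bsub>H\<^esub> g"
          unfolding gd by (rule slice_l_pure[OF vspace_H vspace_H f gH gH])
        finally have 1: "\<phi> (dual_act K M f v) = f g \<odot>\<^bsub>H\<^esub> g \<ominus>\<^bsub>H\<^esub> q'" .
        have 2: "\<phi> (f g \<odot>\<^bsub>M\<^esub> v) = f g \<odot>\<^bsub>H\<^esub> g \<ominus>\<^bsub>H\<^esub> f g \<odot>\<^bsub>H\<^esub> q"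
          using linear_mapD(3)[OF lin fg vM] gv fg gH qH
          by (simp add: a_minus_def HM.V.scale_add HM.V.scale_neg)
        \<comment> \<open>Both sides equal \<open>f(g) g\<close>: the operator of \<open>f\<close>
          multiplies the grouplike \<open>g\<close> by \<open>f(g)\<close>, and the correction terms
          stay in \<open>Q T\<close>.\<close>
        have "\<phi> (dual_act K M f v) \<oplus>\<^bsub>H\<^esub> q' = \<phi> (f g \<odot>\<^bsub>M\<^esub> v) \<oplus>\<^bsub>H\<^esub> f g \<odot>\<^bsub>H\<^esub> q"
          unfolding 1 2 using fg gH qH q'H by (simp add: a_minus_def HM.V.add_assoc HM.V.left_neg)
        then have "\<phi> (dual_act K M f v) \<ominus>\<^bsub>H\<^esub> \<phi> (f g \<odot>\<^bsub>M\<^esub> v) = f g \<odot>\<^bsub>H\<^esub> q \<ominus>\<^bsub>H\<^esub> q'"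
          using linear_mapD(1)[OF lin] c fg qH q'H by (intro HM.V.diff_exchange) auto
        then have "\<phi> (dual_act K M f v \<ominus>\<^bsub>M\<^esub> f g \<odot>\<^bsub>M\<^esub> v) = f g \<odot>\<^bsub>H\<^esub> q \<ominus>\<^bsub>H\<^esub> q'"
          using linear_map_diff[OF vspace_M vspace_H lin c] by simp
        also have "\<dots> \<in> Q T" by (rule QS(6)[OF QS(4)[OF fg q] q'])
        finally have "dual_act K M f v \<ominus>\<^bsub>M\<^esub> f g \<odot>\<^bsub>M\<^esub> v \<in> ?W" using VS(6)[OF fv fgv] by blast
        then show ?thesis unfolding W .
      qed
      moreover have "v \<notin> N" using W \<open>v \<notin> ?W\<close> by blast
      ultimately show ?thesis using vM by blast
    qed
  qed
  show ?thesis using claim[OF S(1) subset_refl gQ] g(1) by blast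
qed

end

section \<open>Freeness over simple comodule algebras\<close>

definition action_sum ::
    "('a, 'y) ring_scheme \<Rightarrow> ('m, 'z) ring_scheme \<Rightarrow> ('a \<Rightarrow> 'm \<Rightarrow> 'm) \<Rightarrow> ('m \<Rightarrow> 'a) \<Rightarrow> 'm"
  where "action_sum A M act c = (\<Oplus>\<^bsub>M\<^esub> b\<in>{b. c b \<noteq> \<zero>\<^bsub>A\<^esub>}. act (c b) b)"

text \<open>
  The left and the right version of relative Hopf modules are both instances of the following
  situation, in which \<open>\<mu>\<close> is the multiplication of \<open>H\<close> or its opposite, and likewise for \<open>A\<close>.
\<close>

locale generic_relative_hopf_module = coalgebra K H + A: left_comodule K H A + M: left_comodule K H M
  for K :: "('k, 'x) ring_scheme" (structure) and H :: "('k, 'h, 'y) coalgebra_scheme" (structure)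
    and A :: "('k, 'a, 'h, 'z) comodule_scheme" and M :: "('k, 'm, 'h, 'r) comodule_scheme"
    and act :: "'a \<Rightarrow> 'm \<Rightarrow> 'm" and \<mu> :: "'h \<Rightarrow> 'h \<Rightarrow> 'h" and \<nu> :: "'a \<Rightarrow> 'a \<Rightarrow> 'a" and u :: 'a +
  assumes mu_bilinear: "bilinear_map K H H H \<mu>"
    and act_bilinear: "bilinear_map K A M M act"
    and unit_closed: "u \<in> carrier A"
    and act_unit: "m \<in> carrier M \<Longrightarrow> act u m = m"
    and nu_closed: "a \<in> carrier A \<Longrightarrow> b \<in> carrier A \<Longrightarrow> \<nu> a b \<in> carrier A"
    and act_assoc: "\<lbrakk>a \<in> carrier A; b \<in> carrier A; m \<in> carrier M\<rbrakk> \<Longrightarrow> act (\<nu> a b) m = act a (act b m)"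
    and coact_action: "\<lbrakk>a \<in> carrier A; m \<in> carrier M\<rbrakk> \<Longrightarrow>
      coact M (act a m) = tensor_bimap K H M \<mu> act (coact A a) (coact M m)"
begin

lemma vspaces: "vspace K H" "vspace K A" "vspace K M"
  using vspace_H A.vspace_M M.vspace_M .

lemmas mu = bilinear_mapD[OF mu_bilinear]
lemmas act = bilinear_mapD[OF act_bilinear]

text \<open>\<open>f (a m) = ((f \<circ> (\<cdot> g)) a) m\<close> modulo \<open>N\<close> if \<open>m\<close> is semi-invariant of weight \<open>g\<close> modulo \<open>N\<close>.\<close>

lemma dual_act_action:
  assumes N: "subcomodule K H M N" and AN: "\<And>a n. a \<in> carrier A \<Longrightarrow> n \<in> N \<Longrightarrow> act a n \<in> N"
    and g: "g \<in> carrier H" and m: "m \<in> carrier M"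
    and semi: "\<And>f. functional K H f \<Longrightarrow> dual_act K M f m \<ominus>\<^bsub>M\<^esub> f g \<odot>\<^bsub>M\<^esub> m \<in> N"
    and f: "functional K H f" and a: "a \<in> carrier A"
  shows "dual_act K M f (act a m) \<ominus>\<^bsub>M\<^esub> act (dual_act K A (\<lambda>x. f (\<mu> x g)) a) m \<in> N"
proof -
  interpret HM: vspace_pair K H M by (intro vspace_pair.intro vspaces)
  interpret HA: vspace_pair K H A by (intro vspace_pair.intro vspaces)
  note NS = HM.W.submodule_vspace[OF M.subcomoduleD(1)[OF N]]
  have ra: "coact A a \<in> carrier (tensor_space K H A)" by (rule A.coact_closed[OF a])
  have rm: "coact M m \<in> carrier (tensor_space K H M)" by (rule M.coact_closed[OF m])
  have gm: "pure_tensor K H M g m \<in> carrier (tensor_space K H M)" using vspaces g m by simp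
  \<comment> \<open>Contracts the product of \<open>coact A a\<close> with a variable tensor. The
    claim becomes that \<open>L\<close> takes the difference of \<open>coact M m\<close> and
    \<open>g \<otimes> m\<close> into \<open>N\<close>.\<close>
  define L where "L t = slice_l K M f (tensor_bimap K H M \<mu> act (coact A a) t)" for t
  note bl = tensor_bimap_bilinear[OF vspaces(1,1,2,3,1,3) mu_bilinear act_bilinear]
  have Llin: "linear_map K (tensor_space K H M) M L"
    unfolding L_def[abs_def]
    by (rule linear_map_comp[OF bilinear_map_linear(1)[OF bl ra] slice_l_linear[OF vspaces(1,3) f]])
  have fh: "functional K H (\<lambda>x. f (\<mu> x h))" if "h \<in> carrier H" for h
    by (rule linear_map_comp[OF bilinear_map_linear(2)[OF mu_bilinear that] f])
  have Lp: "L (pure_tensor K H M h n) = act (dual_act K A (\<lambda>x. f (\<mu> x h)) a) n"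
    if "h \<in> carrier H" "n \<in> carrier M" for h n
    unfolding L_def dual_act_def
    by (rule slice_l_tensor_bimap[OF vspaces(1,1,2,3,1,3) mu_bilinear act_bilinear f ra that])
  have "tensor_subspace K H M (carrier H) N \<subseteq> {t \<in> carrier (tensor_space K H M). L t \<in> N}"
  proof (rule HM.tensor_subspace_minimal[OF HM.T.submodule_preimage[OF vspaces(3) Llin M.subcomoduleD(1)[OF N] HM.T.top_submodule]])
    fix h n assume h: "h \<in> carrier H" and n: "n \<in> N"
    then have "L (pure_tensor K H M h n) \<in> N"
      using Lp[OF h] NS(1) AN A.dual_act_closed[OF fh[OF h] a] by auto
    then show "pure_tensor K H M h n \<in> {t \<in> carrier (tensor_space K H M). L t \<in> N}" using h n NS(1) vspaces by auto
  qed
  \<comment> \<open>Semi-invariance says that all left slices of this difference lie in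
    \<open>N\<close>, hence that it lies in \<open>H \<otimes> N\<close>.\<close>
  moreover have "coact M m \<ominus>\<^bsub>tensor_space K H M\<^esub> pure_tensor K H M g m \<in> tensor_subspace K H M (carrier H) N"
  proof (subst HM.tensor_subspace_slice_l_iff[OF M.subcomoduleD(1)[OF N] HM.T.diff_closed[OF rm gm]], intro allI impI)
    fix f assume f: "functional K H f"
    have "slice_l K M f (coact M m \<ominus>\<^bsub>tensor_space K H M\<^esub> pure_tensor K H M g m) =
        dual_act K M f m \<ominus>\<^bsub>M\<^esub> f g \<odot>\<^bsub>M\<^esub> m"
      using linear_map_diff[OF HM.T.vspace_axioms vspaces(3) slice_l_linear[OF vspaces(1,3) f] rm gm]
        slice_l_pure[OF vspaces(1,3) f g m] by (simp add: dual_act_def)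
    then show "slice_l K M f (coact M m \<ominus>\<^bsub>tensor_space K H M\<^esub> pure_tensor K H M g m) \<in> N" using semi[OF f] by simp
  qed
  ultimately have "L (coact M m \<ominus>\<^bsub>tensor_space K H M\<^esub> pure_tensor K H M g m) \<in> N" by blast
  then show ?thesis
    using linear_map_diff[OF HM.T.vspace_axioms vspaces(3) Llin rm gm] Lp[OF g m] coact_action[OF a m]
    by (simp add: L_def dual_act_def)
qed

end

text \<open>Functionals are total functions of which only the values on the carrier count; the twice
  translated functionals met below agree with the original only there.\<close>

lemma slice_l_cong:
  assumes V: "vspace K V" and W: "vspace K W" and f: "functional K V f"
    and eq: "\<And>x. x \<in> carrier V \<Longrightarrow> f x = g x" and t: "t \<in> carrier (tensor_space K V W)"
  shows "slice_l K W f t = slice_l K W g t"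
proof -
  have g: "functional K V g" using linear_map_cong[OF V f eq] .
  show ?thesis
    by (rule tensor_ext[OF V W W slice_l_linear[OF V W f] slice_l_linear[OF V W g] _ t])
      (simp add: slice_l_pure[OF V W f] slice_l_pure[OF V W g] eq)
qed

context left_comodule
begin

lemma dual_act_cong:
  "\<lbrakk>functional K H f; \<And>x. x \<in> carrier H \<Longrightarrow> f x = g x; m \<in> carrier M\<rbrakk> \<Longrightarrow> dual_act K M f m = dual_act K M g m"
  unfolding dual_act_def by (rule slice_l_cong[OF vspace_H vspace_M _ _ coact_closed])

end

section \<open>Annihilators of semi-invariants\<close>

context generic_relative_hopf_module
begin

text \<open>The set \<open>?I\<close> is the annihilator of the class of \<open>n\<close> modulo
  \<open>N\<close>. To see that the operator of \<open>f\<close> preserves it,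
  \<open>dual_act_action\<close> is applied to the functional
  \<open>\<lambda>x. f (\<mu> x g')\<close>: the translation by \<open>g\<close> in that lemma turns
  it back into \<open>f\<close>. Since \<open>n\<close> is outside \<open>N\<close>, the unit is not
  in \<open>?I\<close>, and simplicity leaves only zero.\<close>

lemma annihilator_trivial:
  assumes simple: "\<And>I. \<lbrakk>subcomodule K H A I; \<And>a x. a \<in> carrier A \<Longrightarrow> x \<in> I \<Longrightarrow> \<nu> a x \<in> I\<rbrakk> \<Longrightarrow>
      I = {\<zero>\<^bsub>A\<^esub>} \<or> I = carrier A"
    and N: "subcomodule K H M N" and AN: "\<And>a n. a \<in> carrier A \<Longrightarrow> n \<in> N \<Longrightarrow> act a n \<in> N"
    and g: "g \<in> carrier H" and g': "g' \<in> carrier H" "\<And>x. x \<in> carrier H \<Longrightarrow> \<mu> (\<mu> x g) g' = x"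
    and n: "n \<in> carrier M" "n \<notin> N"
    and semi: "\<And>f. functional K H f \<Longrightarrow> dual_act K M f n \<ominus>\<^bsub>M\<^esub> f g \<odot>\<^bsub>M\<^esub> n \<in> N"
    and a: "a \<in> carrier A" "act a n \<in> N"
  shows "a = \<zero>\<^bsub>A\<^esub>"
proof -
  interpret MM: vspace K M by (rule vspaces)
  interpret AA: vspace K A by (rule vspaces)
  note Ns = M.subcomoduleD(1)[OF N]
  note NS = MM.submodule_vspace[OF Ns]
  let ?I = "{a \<in> carrier A. act a n \<in> N}"
  have sub: "submodule ?I K A"
    by (rule AA.submodule_preimage[OF vspaces(3) bilinear_map_linear(2)[OF act_bilinear n(1)] Ns AA.top_submodule])
  have "subcomodule K H A ?I"
  proof (rule A.subcomoduleI[OF sub])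
    fix f b assume f: "functional K H f" and "b \<in> ?I"
    then have b: "b \<in> carrier A" "act b n \<in> N" by auto
    have f': "functional K H (\<lambda>x. f (\<mu> x g'))"
      by (rule linear_map_comp[OF bilinear_map_linear(2)[OF mu_bilinear g'(1)] f])
    have c: "dual_act K A f b \<in> carrier A" by (rule A.dual_act_closed[OF f b(1)])
    have "dual_act K A (\<lambda>x. f (\<mu> (\<mu> x g) g')) b = dual_act K A f b"
      by (rule A.dual_act_cong[OF f _ b(1), symmetric]) (simp add: g'(2))
    then have "dual_act K M (\<lambda>x. f (\<mu> x g')) (act b n) \<ominus>\<^bsub>M\<^esub> act (dual_act K A f b) n \<in> N"
      using dual_act_action[OF N AN g n(1) semi f' b(1)] by simp
    moreover have d: "dual_act K M (\<lambda>x. f (\<mu> x g')) (act b n) \<in> N" by (rule M.subcomoduleD(2)[OF N f' b(2)])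
    ultimately have "\<ominus>\<^bsub>M\<^esub> act (dual_act K A f b) n \<in> N"
      using MM.submodule_cancel[OF Ns d] act(1)[OF c n(1)] MM.neg_closed by (simp add: a_minus_def)
    then have "\<ominus>\<^bsub>M\<^esub> (\<ominus>\<^bsub>M\<^esub> act (dual_act K A f b) n) \<in> N" by (rule NS(5))
    then show "dual_act K A f b \<in> ?I" using c act(1)[OF c n(1)] by simp
  qed
  moreover have "\<nu> b x \<in> ?I" if "b \<in> carrier A" "x \<in> ?I" for b x
    using that nu_closed act_assoc n(1) AN by auto
  ultimately have "?I = {\<zero>\<^bsub>A\<^esub>} \<or> ?I = carrier A" by (rule simple)
  moreover have "u \<notin> ?I" using act_unit[OF n(1)] n(2) by simp
  ultimately have "?I = {\<zero>\<^bsub>A\<^esub>}" using unit_closed by metis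
  then show ?thesis using a by blast
qed

text \<open>By \<open>dual_act_action\<close> the operator of \<open>f\<close> maps
  \<open>a n\<close> to \<open>b n\<close> modulo \<open>N\<close>, where \<open>b\<close> is the
  result of the translated functional acting on \<open>a\<close>.\<close>

lemma subcomodule_extend:
  assumes N: "subcomodule K H M N" and AN: "\<And>a n. a \<in> carrier A \<Longrightarrow> n \<in> N \<Longrightarrow> act a n \<in> N"
    and g: "g \<in> carrier H" and n: "n \<in> carrier M"
    and semi: "\<And>f. functional K H f \<Longrightarrow> dual_act K M f n \<ominus>\<^bsub>M\<^esub> f g \<odot>\<^bsub>M\<^esub> n \<in> N"
    and U: "submodule {act a n \<oplus>\<^bsub>M\<^esub> x | a x. a \<in> carrier A \<and> x \<in> N} K M"
  shows "subcomodule K H M {act a n \<oplus>\<^bsub>M\<^esub> x | a x. a \<in> carrier A \<and> x \<in> N}"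
proof (rule M.subcomoduleI[OF U])
  interpret MM: vspace K M by (rule vspaces)
  note NS = MM.submodule_vspace[OF M.subcomoduleD(1)[OF N]]
  fix f y assume f: "functional K H f" and "y \<in> {act a n \<oplus>\<^bsub>M\<^esub> x | a x. a \<in> carrier A \<and> x \<in> N}"
  then obtain a x where ax: "a \<in> carrier A" "x \<in> N" "y = act a n \<oplus>\<^bsub>M\<^esub> x" by blast
  have x: "x \<in> carrier M" and an: "act a n \<in> carrier M" using ax NS(1) act(1) n by auto
  have fg: "functional K H (\<lambda>x. f (\<mu> x g))"
    by (rule linear_map_comp[OF bilinear_map_linear(2)[OF mu_bilinear g] f])
  define b where "b = dual_act K A (\<lambda>x. f (\<mu> x g)) a"
  have b: "b \<in> carrier A" unfolding b_def by (rule A.dual_act_closed[OF fg ax(1)])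
  define z where "z = dual_act K M f (act a n) \<ominus>\<^bsub>M\<^esub> act b n"
  have z: "z \<in> N" unfolding z_def b_def by (rule dual_act_action[OF N AN g n semi f ax(1)])
  have fx: "dual_act K M f x \<in> N" by (rule M.subcomoduleD(2)[OF N f ax(2)])
  have c: "dual_act K M f (act a n) \<in> carrier M" "act b n \<in> carrier M" "z \<in> carrier M" "dual_act K M f x \<in> carrier M"
    using M.dual_act_closed[OF f an] act(1)[OF b n] z fx NS(1) by auto
  have "dual_act K M f y = dual_act K M f (act a n) \<oplus>\<^bsub>M\<^esub> dual_act K M f x"
    unfolding ax(3) by (rule linear_mapD(2)[OF M.dual_act_linear[OF f] an x])
  also have "dual_act K M f (act a n) = act b n \<oplus>\<^bsub>M\<^esub> z"
    unfolding z_def using c(1,2)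
    by (simp add: a_minus_def MM.add_comm[of "dual_act K M f (act a n)"] MM.add_assoc[symmetric] MM.right_neg)
  finally have "dual_act K M f y = act b n \<oplus>\<^bsub>M\<^esub> (z \<oplus>\<^bsub>M\<^esub> dual_act K M f x)" using c by (simp add: MM.add_assoc)
  then show "dual_act K M f y \<in> {act a n \<oplus>\<^bsub>M\<^esub> x | a x. a \<in> carrier A \<and> x \<in> N}"
    using b NS(3)[OF z fx] by blast
qed

section \<open>Linear combinations with coefficients in the algebra\<close>

lemma action_sum_superset:
  assumes B: "B \<subseteq> carrier M" and c: "c \<in> finsupp A B" and S: "finite S" "{b. c b \<noteq> \<zero>\<^bsub>A\<^esub>} \<subseteq> S" "S \<subseteq> B"
  shows "action_sum A M act c = (\<Oplus>\<^bsub>M\<^esub> b\<in>S. act (c b) b)"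
proof -
  interpret MM: vspace K M by (rule vspaces)
  have cA: "c b \<in> carrier A" for b by (rule A.M.finsuppD(1)[OF c])
  have z: "act \<zero>\<^bsub>A\<^esub> b = \<zero>\<^bsub>M\<^esub>" if "b \<in> carrier M" for b
    using linear_map_zero[OF vspaces(2,3) bilinear_map_linear(2)[OF act_bilinear that]] .
  show ?thesis
    unfolding action_sum_def using S B cA act(1) z
    by (intro M.M.add.finprod_mono_neutral_cong_left) (auto simp: Pi_def subset_iff)
qed

lemma action_sum_closed:
  assumes B: "B \<subseteq> carrier M" and c: "c \<in> finsupp A B"
  shows "action_sum A M act c \<in> carrier M"
  unfolding action_sum_def
  using A.M.finsuppD[OF c] B act(1) by (intro M.M.finsum_closed) auto

lemma action_sum_add:
  assumes B: "B \<subseteq> carrier M" and c: "c \<in> finsupp A B" and d: "d \<in> finsupp A B"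
  shows "action_sum A M act (\<lambda>b. c b \<oplus>\<^bsub>A\<^esub> d b) = action_sum A M act c \<oplus>\<^bsub>M\<^esub> action_sum A M act d"
proof -
  let ?S = "{b. c b \<noteq> \<zero>\<^bsub>A\<^esub>} \<union> {b. d b \<noteq> \<zero>\<^bsub>A\<^esub>}"
  have S: "finite ?S" "?S \<subseteq> B" "{b. c b \<oplus>\<^bsub>A\<^esub> d b \<noteq> \<zero>\<^bsub>A\<^esub>} \<subseteq> ?S"
    using A.M.finsuppD(3,4)[OF c] A.M.finsuppD(3,4)[OF d] by auto
  have cA: "c b \<in> carrier A" "d b \<in> carrier A" for b by (rule A.M.finsuppD(1)[OF c], rule A.M.finsuppD(1)[OF d])
  have e: "b \<in> ?S \<Longrightarrow> b \<in> carrier M" for b using B S by blast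
  have "action_sum A M act (\<lambda>b. c b \<oplus>\<^bsub>A\<^esub> d b) = (\<Oplus>\<^bsub>M\<^esub> b\<in>?S. act (c b \<oplus>\<^bsub>A\<^esub> d b) b)"
    by (rule action_sum_superset[OF B A.M.finsupp_add[OF c d] S(1,3,2)])
  also have "\<dots> = (\<Oplus>\<^bsub>M\<^esub> b\<in>?S. act (c b) b \<oplus>\<^bsub>M\<^esub> act (d b) b)"
  proof (rule M.M.finsum_cong'[OF refl])
    show "(\<lambda>b. act (c b) b \<oplus>\<^bsub>M\<^esub> act (d b) b) \<in> ?S \<rightarrow> carrier M"
      by (rule Pi_I, intro M.M.a_closed act(1) cA e)
    show "act (c b \<oplus>\<^bsub>A\<^esub> d b) b = act (c b) b \<oplus>\<^bsub>M\<^esub> act (d b) b" if "b \<in> ?S" for b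
      by (rule act(2)[OF cA e[OF that]])
  qed
  also have "\<dots> = (\<Oplus>\<^bsub>M\<^esub> b\<in>?S. act (c b) b) \<oplus>\<^bsub>M\<^esub> (\<Oplus>\<^bsub>M\<^esub> b\<in>?S. act (d b) b)"
    by (intro M.M.finsum_addf Pi_I act(1) cA e)
  also have "(\<Oplus>\<^bsub>M\<^esub> b\<in>?S. act (c b) b) = action_sum A M act c"
    by (rule action_sum_superset[OF B c S(1) _ S(2), symmetric]) auto
  also have "(\<Oplus>\<^bsub>M\<^esub> b\<in>?S. act (d b) b) = action_sum A M act d"
    by (rule action_sum_superset[OF B d S(1) _ S(2), symmetric]) auto
  finally show ?thesis .
qed

text \<open>Covers at once scalar multiplication and the action of an element of \<open>A\<close>:
  each is a pair of compatible linear maps on coefficients and on \<open>M\<close>.\<close>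

lemma action_sum_map:
  assumes B: "B \<subseteq> carrier M" and c: "c \<in> finsupp A B"
    and \<phi>: "linear_map K A A \<phi>" and \<psi>: "linear_map K M M \<psi>"
    and eq: "\<And>a b. a \<in> carrier A \<Longrightarrow> b \<in> carrier M \<Longrightarrow> act (\<phi> a) b = \<psi> (act a b)"
  shows "(\<lambda>b. \<phi> (c b)) \<in> finsupp A B" "action_sum A M act (\<lambda>b. \<phi> (c b)) = \<psi> (action_sum A M act c)"
proof -
  let ?S = "{b. c b \<noteq> \<zero>\<^bsub>A\<^esub>}"
  have z: "\<phi> \<zero>\<^bsub>A\<^esub> = \<zero>\<^bsub>A\<^esub>" by (rule linear_map_zero[OF vspaces(2,2) \<phi>])
  have S: "finite ?S" "?S \<subseteq> B" "{b. \<phi> (c b) \<noteq> \<zero>\<^bsub>A\<^esub>} \<subseteq> ?S"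
    using A.M.finsuppD(3,4)[OF c] z by auto
  have cA: "c b \<in> carrier A" for b by (rule A.M.finsuppD(1)[OF c])
  have e: "b \<in> ?S \<Longrightarrow> b \<in> carrier M" for b using B S by blast
  show fs: "(\<lambda>b. \<phi> (c b)) \<in> finsupp A B"
    using S linear_mapD(1)[OF \<phi> cA] finite_subset[OF S(3,1)] by (auto simp: finsupp_def)
  have "action_sum A M act (\<lambda>b. \<phi> (c b)) = (\<Oplus>\<^bsub>M\<^esub> b\<in>?S. act (\<phi> (c b)) b)"
    by (rule action_sum_superset[OF B fs S(1,3,2)])
  also have "\<dots> = (\<Oplus>\<^bsub>M\<^esub> b\<in>?S. \<psi> (act (c b) b))"
    using cA e eq act(1) linear_mapD(1)[OF \<psi>] by (intro M.M.finsum_cong') auto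
  also have "\<dots> = \<psi> (\<Oplus>\<^bsub>M\<^esub> b\<in>?S. act (c b) b)"
    using cA e act(1) by (intro linear_map_finsum[OF vspaces(3,3) \<psi>, symmetric]) auto
  finally show "action_sum A M act (\<lambda>b. \<phi> (c b)) = \<psi> (action_sum A M act c)" unfolding action_sum_def .
qed

lemma action_sum_scale:
  assumes B: "B \<subseteq> carrier M" and c: "c \<in> finsupp A B" and k: "k \<in> carrier K"
  shows "(\<lambda>b. k \<odot>\<^bsub>A\<^esub> c b) \<in> finsupp A B"
    "action_sum A M act (\<lambda>b. k \<odot>\<^bsub>A\<^esub> c b) = k \<odot>\<^bsub>M\<^esub> action_sum A M act c"
  using action_sum_map[OF B c linear_map_scale[OF vspaces(2) linear_map_id k] linear_map_scale[OF vspaces(3) linear_map_id k]]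
    act(4)[OF k] by blast+

definition action_span :: "'m set \<Rightarrow> 'm set"
  where "action_span B = action_sum A M act ` finsupp A B"

lemma action_spanI: "c \<in> finsupp A B \<Longrightarrow> action_sum A M act c \<in> action_span B"
  unfolding action_span_def by blast

lemma action_span_submodule:
  assumes B: "B \<subseteq> carrier M"
  shows "submodule (action_span B) K M"
proof -
  interpret MM: vspace K M by (rule vspaces)
  show ?thesis
  proof (rule MM.submoduleI')
    show "action_span B \<subseteq> carrier M" using action_sum_closed[OF B] unfolding action_span_def by blast
    have "action_sum A M act (\<lambda>_. \<zero>\<^bsub>A\<^esub>) = \<zero>\<^bsub>M\<^esub>" unfolding action_sum_def by simp
    then show "\<zero>\<^bsub>M\<^esub> \<in> action_span B" unfolding action_span_def using A.M.finsupp_zero by (metis imageI)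
  next
    fix x y assume "x \<in> action_span B" "y \<in> action_span B"
    then obtain c d where *: "c \<in> finsupp A B" "d \<in> finsupp A B" "x = action_sum A M act c" "y = action_sum A M act d"
      unfolding action_span_def by (elim imageE)
    show "x \<oplus>\<^bsub>M\<^esub> y \<in> action_span B"
      unfolding *(3,4) action_sum_add[OF B *(1,2), symmetric] by (rule action_spanI[OF A.M.finsupp_add[OF *(1,2)]])
  next
    fix k x assume "k \<in> carrier K" "x \<in> action_span B"
    then obtain c where *: "k \<in> carrier K" "c \<in> finsupp A B" "x = action_sum A M act c"
      unfolding action_span_def by (elim imageE)
    show "k \<odot>\<^bsub>M\<^esub> x \<in> action_span B"
      unfolding *(3) action_sum_scale(2)[OF B *(2,1), symmetric] by (rule action_spanI[OF action_sum_scale(1)[OF B *(2,1)]])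
  qed
qed

lemma action_span_action:
  assumes nu: "\<And>a. a \<in> carrier A \<Longrightarrow> linear_map K A A (\<nu> a)"
    and B: "B \<subseteq> carrier M" and a: "a \<in> carrier A" and x: "x \<in> action_span B"
  shows "act a x \<in> action_span B"
proof -
  obtain c where c: "c \<in> finsupp A B" "x = action_sum A M act c" using x unfolding action_span_def by blast
  show ?thesis
    using action_sum_map[OF B c(1) nu[OF a] bilinear_map_linear(1)[OF act_bilinear a] act_assoc[OF a]] c(2)
    unfolding action_span_def by (metis imageI)
qed

lemma action_sum_insert:
  assumes B: "B \<subseteq> carrier M" and n: "n \<in> carrier M" "n \<notin> B" and c: "c \<in> finsupp A (insert n B)"
  shows "c(n := \<zero>\<^bsub>A\<^esub>) \<in> finsupp A B"
    "action_sum A M act c = act (c n) n \<oplus>\<^bsub>M\<^esub> action_sum A M act (c(n := \<zero>\<^bsub>A\<^esub>))"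
proof -
  interpret MM: vspace K M by (rule vspaces)
  let ?d = "c(n := \<zero>\<^bsub>A\<^esub>)"
  let ?S = "{b. c b \<noteq> \<zero>\<^bsub>A\<^esub>}"
  have cA: "c b \<in> carrier A" for b by (rule A.M.finsuppD(1)[OF c])
  have S: "finite ?S" "?S \<subseteq> insert n B" using A.M.finsuppD(3,4)[OF c] by auto
  have "{b. ?d b \<noteq> \<zero>\<^bsub>A\<^esub>} \<subseteq> ?S" by auto
  then have fin: "finite {b. ?d b \<noteq> \<zero>\<^bsub>A\<^esub>}" using S(1) by (rule finite_subset)
  then show d: "?d \<in> finsupp A B"
    using cA S(2) by (auto simp: finsupp_def)
  let ?T = "?S - {n}"
  have T: "finite ?T" "?T \<subseteq> B" "n \<notin> ?T" using S by auto
  have tM: "b \<in> insert n ?T \<Longrightarrow> b \<in> carrier M" for b using T B n by auto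
  have nB: "insert n B \<subseteq> carrier M" using n B by blast
  have "action_sum A M act c = (\<Oplus>\<^bsub>M\<^esub> b\<in>insert n ?T. act (c b) b)"
    by (rule action_sum_superset[OF nB c]) (use S in auto)
  also have "\<dots> = act (c n) n \<oplus>\<^bsub>M\<^esub> (\<Oplus>\<^bsub>M\<^esub> b\<in>?T. act (c b) b)"
    using T tM cA act(1) by (intro M.M.finsum_insert) auto
  also have "(\<Oplus>\<^bsub>M\<^esub> b\<in>?T. act (c b) b) = (\<Oplus>\<^bsub>M\<^esub> b\<in>?T. act (?d b) b)"
    using tM cA act(1) by (intro M.M.finsum_cong') auto
  also have "\<dots> = action_sum A M act ?d"
    by (rule action_sum_superset[OF B d T(1) _ T(2), symmetric]) auto
  finally show "action_sum A M act c = act (c n) n \<oplus>\<^bsub>M\<^esub> action_sum A M act ?d" .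
qed

text \<open>The sets to which Zorn's lemma is applied. Besides independence over \<open>A\<close>,
  the span has to be a subcomodule, so that a semi-invariant modulo the span can be found.\<close>

definition admissible :: "'m set \<Rightarrow> bool"
  where "admissible B \<longleftrightarrow> B \<subseteq> carrier M \<and> subcomodule K H M (action_span B) \<and>
    (\<forall>c\<in>finsupp A B. action_sum A M act c = \<zero>\<^bsub>M\<^esub> \<longrightarrow> c = (\<lambda>_. \<zero>\<^bsub>A\<^esub>))"

text \<open>A coefficient function on the union of a chain has finite support and hence lives on a
  single member of the chain; this passes both conditions to the union.\<close>

lemma admissible_maximal: "\<exists>B. admissible B \<and> (\<forall>B'. admissible B' \<longrightarrow> B \<subseteq> B' \<longrightarrow> B' = B)"
proof -
  have "\<exists>B\<in>Collect admissible. \<forall>B'\<in>Collect admissible. B \<subseteq> B' \<longrightarrow> B' = B"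
  proof (rule subset_Zorn_nonempty)
    have "finsupp A {} = {\<lambda>_::'m. \<zero>\<^bsub>A\<^esub>}" by (auto simp: finsupp_def)
    moreover have "action_sum A M act (\<lambda>_. \<zero>\<^bsub>A\<^esub>) = \<zero>\<^bsub>M\<^esub>" unfolding action_sum_def by simp
    ultimately have "admissible {}"
      unfolding admissible_def action_span_def using M.subcomodule_zero by simp
    then show "Collect admissible \<noteq> {}" by blast
  next
    fix C assume ne: "C \<noteq> {}" and ch: "subset.chain (Collect admissible) C"
    have adm: "B \<in> C \<Longrightarrow> admissible B" for B using ch by (auto simp: subset.chain_def)
    have UM: "\<Union>C \<subseteq> carrier M" using adm unfolding admissible_def by blast
    have red: "\<exists>B\<in>C. c \<in> finsupp A B" if c: "c \<in> finsupp A (\<Union>C)" for c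
    proof -
      note D = A.M.finsuppD[OF c]
      obtain B where B: "B \<in> C" "{b. c b \<noteq> \<zero>\<^bsub>A\<^esub>} \<subseteq> B"
        using finite_subset_Union_chain[OF D(3,4) ne] ch by (auto simp: subset.chain_def)
      have "c \<in> finsupp A B" using D B(2) by (auto simp: finsupp_def)
      then show ?thesis using B by blast
    qed
    have "subcomodule K H M (action_span (\<Union>C))"
    proof (rule M.subcomoduleI[OF action_span_submodule[OF UM]])
      fix f x assume f: "functional K H f" and "x \<in> action_span (\<Union>C)"
      then obtain B where B: "B \<in> C" "x \<in> action_span B" unfolding action_span_def using red by blast
      then have "dual_act K M f x \<in> action_span B"
        using adm M.subcomoduleD(2)[OF _ f] unfolding admissible_def by blast
      moreover have "finsupp A B \<subseteq> finsupp A (\<Union>C)"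
        using B(1) A.M.finsuppD by (auto simp: finsupp_def)
      ultimately show "dual_act K M f x \<in> action_span (\<Union>C)" unfolding action_span_def by blast
    qed
    moreover have "c = (\<lambda>_. \<zero>\<^bsub>A\<^esub>)" if "c \<in> finsupp A (\<Union>C)" "action_sum A M act c = \<zero>\<^bsub>M\<^esub>" for c
      using red[OF that(1)] that(2) adm unfolding admissible_def by blast
    ultimately show "\<Union>C \<in> Collect admissible" using UM unfolding admissible_def by blast
  qed
  then show ?thesis by blast
qed

theorem free_of_pointed:
  assumes pt: "pointed K H"
    and simple: "\<And>I. \<lbrakk>subcomodule K H A I; \<And>a x. a \<in> carrier A \<Longrightarrow> x \<in> I \<Longrightarrow> \<nu> a x \<in> I\<rbrakk> \<Longrightarrow>
      I = {\<zero>\<^bsub>A\<^esub>} \<or> I = carrier A"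
    and nu: "\<And>a. a \<in> carrier A \<Longrightarrow> linear_map K A A (\<nu> a)"
    and inv: "\<And>g. grouplike K H g \<Longrightarrow> \<exists>g'\<in>carrier H. \<forall>x\<in>carrier H. \<mu> (\<mu> x g) g' = x"
  shows "\<exists>B\<subseteq>carrier M. \<forall>m\<in>carrier M. \<exists>!c. c \<in> finsupp A B \<and> m = action_sum A M act c"
proof -
  interpret MM: vspace K M by (rule vspaces)
  interpret AA: vspace K A by (rule vspaces)
  obtain B where adm: "admissible B" and max: "\<And>B'. admissible B' \<Longrightarrow> B \<subseteq> B' \<Longrightarrow> B' = B"
    using admissible_maximal by blast
  have B: "B \<subseteq> carrier M" and sub: "subcomodule K H M (action_span B)"
    and ind: "\<And>c. c \<in> finsupp A B \<Longrightarrow> action_sum A M act c = \<zero>\<^bsub>M\<^esub> \<Longrightarrow> c = (\<lambda>_. \<zero>\<^bsub>A\<^esub>)"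
    using adm unfolding admissible_def by blast+
  have stable: "\<And>a n. a \<in> carrier A \<Longrightarrow> n \<in> action_span B \<Longrightarrow> act a n \<in> action_span B"
    by (rule action_span_action[OF nu B])
  have all: "action_span B = carrier M"
  proof (rule ccontr)
    assume "action_span B \<noteq> carrier M"
    then obtain g n where g: "grouplike K H g" and n: "n \<in> carrier M" "n \<notin> action_span B"
      and semi: "\<forall>f. functional K H f \<longrightarrow> dual_act K M f n \<ominus>\<^bsub>M\<^esub> f g \<odot>\<^bsub>M\<^esub> n \<in> action_span B"
      using M.pointed_semi_invariant[OF pt sub] by blast
    have semi': "\<And>f. functional K H f \<Longrightarrow> dual_act K M f n \<ominus>\<^bsub>M\<^esub> f g \<odot>\<^bsub>M\<^esub> n \<in> action_span B" using semi by blast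
    have gH: "g \<in> carrier H" using g unfolding grouplike_def by blast
    obtain g' where g': "g' \<in> carrier H" "\<And>x. x \<in> carrier H \<Longrightarrow> \<mu> (\<mu> x g) g' = x" using inv[OF g] by blast
    have triv: "a = \<zero>\<^bsub>A\<^esub>" if "a \<in> carrier A" "act a n \<in> action_span B" for a
      by (rule annihilator_trivial[OF simple sub stable gH g' n semi' that])
    have nB: "n \<notin> B"
    proof
      assume nB: "n \<in> B"
      let ?c = "\<lambda>b. if b = n then u else \<zero>\<^bsub>A\<^esub>"
      have c: "?c \<in> finsupp A B" using nB unit_closed by (auto simp: finsupp_def)
      have "action_sum A M act ?c = (\<Oplus>\<^bsub>M\<^esub> b\<in>{n}. act (?c b) b)"
        by (rule action_sum_superset[OF B c]) (use nB in auto)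
      also have "\<dots> = n" using act_unit[OF n(1)] n(1) by simp
      finally show False using n(2) c unfolding action_span_def by (metis imageI)
    qed
    have iB: "insert n B \<subseteq> carrier M" using n B by blast
    have sp: "action_span (insert n B) = {act a n \<oplus>\<^bsub>M\<^esub> x | a x. a \<in> carrier A \<and> x \<in> action_span B}" (is "?L = ?R")
    proof
      show "?L \<subseteq> ?R"
      proof
        fix x assume "x \<in> ?L"
        then obtain c where c: "c \<in> finsupp A (insert n B)" "x = action_sum A M act c" unfolding action_span_def by blast
        show "x \<in> ?R"
          using action_sum_insert[OF B n(1) nB c(1)] A.M.finsuppD(1)[OF c(1)] c(2) unfolding action_span_def by blast
      qed
      show "?R \<subseteq> ?L"
      proof
        fix y assume "y \<in> ?R"
        then obtain a c where ac: "a \<in> carrier A" "c \<in> finsupp A B" "y = act a n \<oplus>\<^bsub>M\<^esub> action_sum A M act c"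
          unfolding action_span_def by blast
        have cn: "c n = \<zero>\<^bsub>A\<^esub>" using A.M.finsuppD(2)[OF ac(2) nB] .
        let ?c = "c(n := a)"
        have "{b. ?c b \<noteq> \<zero>\<^bsub>A\<^esub>} \<subseteq> insert n {b. c b \<noteq> \<zero>\<^bsub>A\<^esub>}" by auto
        then have "finite {b. ?c b \<noteq> \<zero>\<^bsub>A\<^esub>}" using A.M.finsuppD(3)[OF ac(2)] finite_subset by blast
        then have c: "?c \<in> finsupp A (insert n B)"
          using ac(1) A.M.finsuppD(1,2)[OF ac(2)] by (auto simp: finsupp_def)
        have "?c(n := \<zero>\<^bsub>A\<^esub>) = c" using cn by auto
        then have "y = action_sum A M act ?c" using action_sum_insert(2)[OF B n(1) nB c] ac(3) by simp
        then show "y \<in> ?L" using c unfolding action_span_def by blast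
      qed
    qed
    have "subcomodule K H M (action_span (insert n B))"
      unfolding sp
      by (rule subcomodule_extend[OF sub stable gH n(1) semi' action_span_submodule[OF iB, unfolded sp]])
    moreover have "c = (\<lambda>_. \<zero>\<^bsub>A\<^esub>)" if c: "c \<in> finsupp A (insert n B)" and z: "action_sum A M act c = \<zero>\<^bsub>M\<^esub>" for c
    proof -
      let ?d = "c(n := \<zero>\<^bsub>A\<^esub>)"
      note ins = action_sum_insert[OF B n(1) nB c]
      have cn: "c n \<in> carrier A" by (rule A.M.finsuppD(1)[OF c])
      have an: "act (c n) n \<in> carrier M" by (rule act(1)[OF cn n(1)])
      have d: "action_sum A M act ?d \<in> action_span B" unfolding action_span_def using ins(1) by blast
      have dM: "action_sum A M act ?d \<in> carrier M" by (rule action_sum_closed[OF B ins(1)])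
      \<comment> \<open>If the whole combination vanishes, its term at \<open>n\<close> lies in the
        span of \<open>B\<close>. The coefficient of \<open>n\<close> then annihilates
        \<open>n\<close> modulo that span and is zero.\<close>
      have "action_sum A M act ?d \<oplus>\<^bsub>M\<^esub> act (c n) n \<in> action_span B"
        using ins(2) z an dM MM.submodule_vspace(2)[OF action_span_submodule[OF B]] by (simp add: MM.add_comm)
      then have "act (c n) n \<in> action_span B" by (rule MM.submodule_cancel[OF action_span_submodule[OF B] d an])
      then have c0: "c n = \<zero>\<^bsub>A\<^esub>" by (rule triv[OF cn])
      have "act \<zero>\<^bsub>A\<^esub> n = \<zero>\<^bsub>M\<^esub>"
        using linear_map_zero[OF vspaces(2,3) bilinear_map_linear(2)[OF act_bilinear n(1)]] .
      then have "action_sum A M act ?d = \<zero>\<^bsub>M\<^esub>" using ins(2) z c0 dM by simp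
      then have "?d = (\<lambda>_. \<zero>\<^bsub>A\<^esub>)" by (rule ind[OF ins(1)])
      then show ?thesis using c0 by (metis fun_upd_triv)
    qed
    ultimately have "admissible (insert n B)" using iB unfolding admissible_def by blast
    then have "insert n B = B" by (rule max) blast
    then show False using nB by blast
  qed
  have "\<exists>!c. c \<in> finsupp A B \<and> m = action_sum A M act c" if m: "m \<in> carrier M" for m
  proof -
    obtain c where c: "c \<in> finsupp A B" "m = action_sum A M act c" using m all unfolding action_span_def by blast
    moreover have "d = c" if d: "d \<in> finsupp A B" "m = action_sum A M act d" for d
    proof -
      \<comment> \<open>Uniqueness is independence applied to the difference of \<open>c\<close> and
        \<open>d\<close>; the negative is formed with the scalar \<open>-1\<close> of
        \<open>K\<close>, so that \<open>action_sum_scale\<close> applies.\<close>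
      have k: "\<ominus>\<^bsub>K\<^esub> \<one>\<^bsub>K\<^esub> \<in> carrier K" by simp
      let ?d = "\<lambda>b. (\<ominus>\<^bsub>K\<^esub> \<one>\<^bsub>K\<^esub>) \<odot>\<^bsub>A\<^esub> d b"
      note s = action_sum_scale[OF B d(1) k]
      have "action_sum A M act (\<lambda>b. c b \<oplus>\<^bsub>A\<^esub> ?d b) = m \<oplus>\<^bsub>M\<^esub> (\<ominus>\<^bsub>K\<^esub> \<one>\<^bsub>K\<^esub>) \<odot>\<^bsub>M\<^esub> m"
        using action_sum_add[OF B c(1) s(1)] s(2) c(2) d(2) by simp
      also have "\<dots> = \<zero>\<^bsub>M\<^esub>" using m by (simp add: MM.neg_scale MM.right_neg)
      finally have "(\<lambda>b. c b \<oplus>\<^bsub>A\<^esub> ?d b) = (\<lambda>_. \<zero>\<^bsub>A\<^esub>)" by (rule ind[OF A.M.finsupp_add[OF c(1) s(1)]])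
      then have "c b \<oplus>\<^bsub>A\<^esub> (\<ominus>\<^bsub>K\<^esub> \<one>\<^bsub>K\<^esub>) \<odot>\<^bsub>A\<^esub> d b = \<zero>\<^bsub>A\<^esub>" for b by metis
      then have "c b \<ominus>\<^bsub>A\<^esub> d b = \<zero>\<^bsub>A\<^esub>" for b
        using A.M.finsuppD(1)[OF d(1)] by (simp add: AA.neg_scale a_minus_def)
      then have "c b = d b" for b
        using AA.diff_eq_zero A.M.finsuppD(1)[OF c(1)] A.M.finsuppD(1)[OF d(1)] by blast
      then show ?thesis by auto
    qed
    ultimately show ?thesis by blast
  qed
  then show ?thesis using B by blast
qed

end

section \<open>Freeness over a pointed Hopf algebra, on both sides\<close>

context hopf_algebra
begin

lemma antipode_grouplike:
  assumes "grouplike K H g"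
  shows "antipode H g \<in> carrier H" "g \<otimes>\<^bsub>H\<^esub> antipode H g = \<one>\<^bsub>H\<^esub>" "antipode H g \<otimes>\<^bsub>H\<^esub> g = \<one>\<^bsub>H\<^esub>"
proof -
  have g: "g \<in> carrier H" "comult H g = pure_tensor K H H g g" "counit H g = \<one>\<^bsub>K\<^esub>"
    using assms unfolding grouplike_def by auto
  show "antipode H g \<in> carrier H" using linear_mapD(1)[OF antipode_linear g(1)] .
  note b1 = bilinear_comp_id[OF mult_bilinear linear_map_id antipode_linear]
  note b2 = bilinear_comp_id[OF mult_bilinear antipode_linear linear_map_id]
  interpret HH: vspace K H by (rule vspace_H)
  have one: "\<one>\<^bsub>K\<^esub> \<odot>\<^bsub>H\<^esub> \<one>\<^bsub>H\<^esub> = \<one>\<^bsub>H\<^esub>" by (rule smult_one) simp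
  show "g \<otimes>\<^bsub>H\<^esub> antipode H g = \<one>\<^bsub>H\<^esub>"
    using antipode_r[OF g(1)] tensor_lift_pure_tensor[OF vspace_H vspace_H vspace_H b1 g(1,1)] g one by simp
  show "antipode H g \<otimes>\<^bsub>H\<^esub> g = \<one>\<^bsub>H\<^esub>"
    using antipode_l[OF g(1)] tensor_lift_pure_tensor[OF vspace_H vspace_H vspace_H b2 g(1,1)] g one by simp
qed

end

lemma pointed_imp_free_left:
  assumes H: "hopf_algebra K H" and M: "left_relative_hopf_module K H A M act"
    and simple: "left_H_simple K H A" and pt: "pointed K H"
  shows "free_left_module A M act"
proof -
  interpret H: hopf_algebra K H by fact
  interpret M: left_relative_hopf_module K H A M act by fact
  have comA: "left_comodule K H A" and comM: "left_comodule K H M" by unfold_locales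
  have alg: "assoc_algebra K A" and rA: "ring A" by unfold_locales
  note mb = assoc_algebra.mult_bilinear[OF alg]
  note ring = ring.is_monoid[OF rA]
  interpret G: generic_relative_hopf_module K H A M act "mult H" "mult A" "\<one>\<^bsub>A\<^esub>"
    by (intro generic_relative_hopf_module.intro comA comM H.coalgebra_axioms generic_relative_hopf_module_axioms.intro
      H.mult_bilinear M.act_bilinear monoid.one_closed[OF ring] M.act_one bilinear_mapD(1)[OF mb] M.act_mult M.coact_act)
  have "\<exists>B\<subseteq>carrier M. \<forall>m\<in>carrier M. \<exists>!c. c \<in> finsupp A B \<and> m = action_sum A M act c"
  proof (rule G.free_of_pointed[OF pt])
    fix I assume I: "subcomodule K H A I" "\<And>a x. a \<in> carrier A \<Longrightarrow> x \<in> I \<Longrightarrow> a \<otimes>\<^bsub>A\<^esub> x \<in> I"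
    have "additive_subgroup I A"
      using I(1) unfolding subcomodule_def by (intro additive_subgroupI) (auto dest: submodule.axioms(1))
    then have "left_ideal A I" using I(2) unfolding left_ideal_def by blast
    then show "I = {\<zero>\<^bsub>A\<^esub>} \<or> I = carrier A" using simple I(1) unfolding left_H_simple_def by blast
  next
    show "linear_map K A A (mult A a)" if "a \<in> carrier A" for a using bilinear_map_linear(1)[OF mb that] .
    fix g assume g: "grouplike K H g"
    then have gH: "g \<in> carrier H" unfolding grouplike_def by blast
    note S = H.antipode_grouplike[OF g]
    show "\<exists>g'\<in>carrier H. \<forall>x\<in>carrier H. x \<otimes>\<^bsub>H\<^esub> g \<otimes>\<^bsub>H\<^esub> g' = x"
      using S gH by (intro bexI[OF _ S(1)]) (simp add: H.A.m_assoc)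
  qed
  then show ?thesis unfolding free_left_module_def action_sum_def .
qed

text \<open>The generic argument is applied to the opposite products of \<open>H\<close> and
  \<open>A\<close>, and \<open>tensor_bimap_flip\<close> rewrites the coaction law accordingly. The
  antipode of a grouplike element is a two-sided inverse, so the cancellation condition holds for
  the opposite product as well.\<close>

lemma pointed_imp_free_right:
  assumes H: "hopf_algebra K H" and M: "right_relative_hopf_module K H A M act"
    and simple: "right_H_simple K H A" and pt: "pointed K H"
  shows "free_right_module A M act"
proof -
  interpret H: hopf_algebra K H by fact
  interpret M: right_relative_hopf_module K H A M act by fact
  have comA: "left_comodule K H A" and comM: "left_comodule K H M" by unfold_locales
  have alg: "assoc_algebra K A" and rA: "ring A" by unfold_locales
  note mb = assoc_algebra.mult_bilinear[OF alg]
  note ring = ring.is_monoid[OF rA]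
  note vs = H.vspace_H left_comodule.vspace_M[OF comA] left_comodule.vspace_M[OF comM]
  interpret G: generic_relative_hopf_module K H A M "\<lambda>a m. act m a" "\<lambda>x y. y \<otimes>\<^bsub>H\<^esub> x" "\<lambda>x y. y \<otimes>\<^bsub>A\<^esub> x" "\<one>\<^bsub>A\<^esub>"
  proof (intro generic_relative_hopf_module.intro comA comM H.coalgebra_axioms generic_relative_hopf_module_axioms.intro)
    show "bilinear_map K H H H (\<lambda>x y. y \<otimes>\<^bsub>H\<^esub> x)" by (rule bilinear_map_swap[OF H.mult_bilinear])
    show "bilinear_map K A M M (\<lambda>a m. act m a)" by (rule bilinear_map_swap[OF M.act_bilinear])
    show "\<one>\<^bsub>A\<^esub> \<in> carrier A" by (rule monoid.one_closed[OF ring])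
    show "act m \<one>\<^bsub>A\<^esub> = m" if "m \<in> carrier M" for m using M.act_one[OF that] .
    show "b \<otimes>\<^bsub>A\<^esub> a \<in> carrier A" if "a \<in> carrier A" "b \<in> carrier A" for a b using bilinear_mapD(1)[OF mb that(2,1)] .
    show "act m (b \<otimes>\<^bsub>A\<^esub> a) = act (act m b) a" if "a \<in> carrier A" "b \<in> carrier A" "m \<in> carrier M" for a b m
      using M.act_mult[OF that(2,1,3)] .
    show "coact M (act m a) = tensor_bimap K H M (\<lambda>x y. y \<otimes>\<^bsub>H\<^esub> x) (\<lambda>a m. act m a) (coact A a) (coact M m)"
      if "a \<in> carrier A" "m \<in> carrier M" for a m
      unfolding M.coact_act[OF that]
      by (rule tensor_bimap_flip[OF vs(1,1,3,2,1,3) H.mult_bilinear M.act_bilinear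
        left_comodule.coact_closed[OF comM that(2)] left_comodule.coact_closed[OF comA that(1)]])
  qed
  have "\<exists>B\<subseteq>carrier M. \<forall>m\<in>carrier M. \<exists>!c. c \<in> finsupp A B \<and> m = action_sum A M (\<lambda>a m. act m a) c"
  proof (rule G.free_of_pointed[OF pt])
    fix I assume I: "subcomodule K H A I" "\<And>a x. a \<in> carrier A \<Longrightarrow> x \<in> I \<Longrightarrow> x \<otimes>\<^bsub>A\<^esub> a \<in> I"
    have "additive_subgroup I A"
      using I(1) unfolding subcomodule_def by (intro additive_subgroupI) (auto dest: submodule.axioms(1))
    then have "right_ideal A I" using I(2) unfolding right_ideal_def by blast
    then show "I = {\<zero>\<^bsub>A\<^esub>} \<or> I = carrier A" using simple I(1) unfolding right_H_simple_def by blast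
  next
    show "linear_map K A A (\<lambda>x. x \<otimes>\<^bsub>A\<^esub> a)" if "a \<in> carrier A" for a using bilinear_map_linear(2)[OF mb that] .
    fix g assume g: "grouplike K H g"
    then have gH: "g \<in> carrier H" unfolding grouplike_def by blast
    note S = H.antipode_grouplike[OF g]
    show "\<exists>g'\<in>carrier H. \<forall>x\<in>carrier H. g' \<otimes>\<^bsub>H\<^esub> (g \<otimes>\<^bsub>H\<^esub> x) = x"
      using S gH by (intro bexI[OF _ S(1)]) (simp add: H.A.m_assoc[symmetric])
  qed
  then show ?thesis unfolding free_right_module_def action_sum_def .
qed

section \<open>Comodules defined by comatrices\<close>

text \<open>Equips a vector space with a coaction and keeps its product and unit, so that it serves
  for comodules and for comodule algebras alike.\<close>

definition as_comodule :: "('k, 'b, 'y) module_scheme \<Rightarrow> ('b \<Rightarrow> ('k, 'h, 'b) tensor) \<Rightarrow> ('k, 'b, 'h) comodule"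
  where "as_comodule Y \<rho> = \<lparr>carrier = carrier Y, mult = mult Y, one = one Y, zero = zero Y,
    add = add Y, smult = smult Y, coact = \<rho>\<rparr>"

lemma as_comodule_simps [simp]:
  "carrier (as_comodule Y \<rho>) = carrier Y" "mult (as_comodule Y \<rho>) = mult Y" "one (as_comodule Y \<rho>) = one Y"
  "zero (as_comodule Y \<rho>) = zero Y" "add (as_comodule Y \<rho>) = add Y" "smult (as_comodule Y \<rho>) = smult Y"
  "coact (as_comodule Y \<rho>) = \<rho>"
  by (simp_all add: as_comodule_def)

lemma finsum_as_comodule [simp]: "finsum (as_comodule Y \<rho>) = finsum Y"
  by (simp add: finsum_def finprod_def fun_eq_iff)

lemma linear_map_from_as_comodule [simp]: "linear_map K (as_comodule Y \<rho>) W f = linear_map K Y W f"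
  by (simp add: linear_map_def)

lemma linear_map_to_as_comodule [simp]: "linear_map K W (as_comodule Y \<rho>) f = linear_map K W Y f"
  by (simp add: linear_map_def)

lemma vspace_as_comodule [simp]: "vspace K Y \<Longrightarrow> vspace K (as_comodule Y \<rho>)"
proof -
  assume "vspace K Y"
  then interpret Y: vspace K Y .
  have "abelian_group (as_comodule Y \<rho>)"
    by (rule abelian_groupI) (auto simp: Y.M.a_ac intro!: bexI[where x="\<ominus>\<^bsub>Y\<^esub> x" for x] Y.M.l_neg)
  then have "module K (as_comodule Y \<rho>)"
    by (intro moduleI) (auto simp: Y.K.is_cring Y.smult_l_distr Y.smult_r_distr Y.smult_assoc1)
  then show ?thesis by (intro vspace.intro Y.K.field_axioms)
qed

lemma submodule_as_comodule [simp]: "submodule N K (as_comodule Y \<rho>) = submodule N K Y"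
  by (simp add: submodule_def submodule_axioms_def subgroup_def m_inv_def)

lemma tensor_relations_as_comodule [simp]: "tensor_relations K U (as_comodule Y \<rho>) = tensor_relations K U Y"
  by (simp add: tensor_relations_def)

lemma tensor_space_as_comodule [simp]: "tensor_space K U (as_comodule Y \<rho>) = tensor_space K U Y"
  by (simp add: tensor_space_def)

lemma pure_tensor_as_comodule [simp]: "pure_tensor K U (as_comodule Y \<rho>) = pure_tensor K U Y"
  by (simp add: pure_tensor_def fun_eq_iff)

lemma tensor_lift_as_comodule [simp]: "tensor_lift K (as_comodule Y \<rho>) = tensor_lift K Y"
  by (simp add: tensor_lift_def fun_eq_iff)

lemma tensor_map_as_comodule [simp]: "tensor_map K U (as_comodule Y \<rho>) = tensor_map K U Y"
  by (simp add: tensor_map_def fun_eq_iff)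

lemma tensor_assoc_as_comodule [simp]: "tensor_assoc K U V (as_comodule Y \<rho>) = tensor_assoc K U V Y"
  by (simp add: tensor_assoc_def fun_eq_iff)

lemma tensor_bimap_as_comodule [simp]: "tensor_bimap K U (as_comodule Y \<rho>) = tensor_bimap K U Y"
  by (simp add: tensor_bimap_def fun_eq_iff)

lemma slice_l_as_comodule [simp]: "slice_l K (as_comodule Y \<rho>) = slice_l K Y"
  by (simp add: slice_l_def fun_eq_iff)

lemma dual_act_as_comodule [simp]: "dual_act K (as_comodule Y \<rho>) f y = slice_l K Y f (\<rho> y)"
  by (simp add: dual_act_def)

section \<open>Comodule axioms tested by functionals\<close>

context coalgebra
begin

lemma regular_comodule: "left_comodule K H (as_comodule H (comult H))"
  by (intro left_comodule.intro coalgebra_axioms vspace.axioms(2)[OF vspace_as_comodule[OF vspace_H]]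
    left_comodule_axioms.intro) (simp_all add: comult_linear coassoc counit_l)

text \<open>The converse of \<open>dual_act_comp\<close> and \<open>dual_act_counit\<close>:
  coassociativity is an identity in \<open>H \<otimes> (H \<otimes> Y)\<close>, which may be tested
  by contracting the two left legs with functionals \<open>f\<close> and \<open>g\<close>.\<close>

lemma left_comoduleI:
  assumes Y: "vspace K Y" and \<rho>: "linear_map K Y (tensor_space K H Y) \<rho>"
    and comp: "\<And>f g y. \<lbrakk>functional K H f; functional K H g; y \<in> carrier Y\<rbrakk> \<Longrightarrow>
      slice_l K Y g (\<rho> (slice_l K Y f (\<rho> y))) = slice_l K Y (convolution K H f g) (\<rho> y)"
    and cou: "\<And>y. y \<in> carrier Y \<Longrightarrow> slice_l K Y (counit H) (\<rho> y) = y"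
  shows "left_comodule K H (as_comodule Y \<rho>)"
proof -
  interpret HY: vspace_pair K H Y by (intro vspace_pair.intro vspace_H Y)
  have HH: "vspace K (tensor_space K H H)" and HTY: "vspace K (tensor_space K H Y)" using vspace_H Y by simp_all
  interpret HHY: vspace_pair K H "tensor_space K H Y" by (intro vspace_pair.intro vspace_H HTY)
  have coas: "tensor_assoc K H H Y (tensor_map K (tensor_space K H H) Y (comult H) (\<lambda>x. x) (\<rho> y)) =
      tensor_map K H (tensor_space K H Y) (\<lambda>x. x) \<rho> (\<rho> y)" if y: "y \<in> carrier Y" for y
  proof -
    have t: "\<rho> y \<in> carrier (tensor_space K H Y)" by (rule linear_mapD(1)[OF \<rho> y])
    have t': "tensor_map K (tensor_space K H H) Y (comult H) (\<lambda>x. x) (\<rho> y) \<in> carrier (tensor_space K (tensor_space K H H) Y)"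
      by (rule linear_mapD(1)[OF tensor_map_linear[OF vspace_H Y HH Y comult_linear linear_map_id] t])
    have L: "tensor_assoc K H H Y (tensor_map K (tensor_space K H H) Y (comult H) (\<lambda>x. x) (\<rho> y))
        \<in> carrier (tensor_space K H (tensor_space K H Y))"
      by (rule linear_mapD(1)[OF tensor_assoc_linear[OF vspace_H vspace_H Y] t'])
    have R: "tensor_map K H (tensor_space K H Y) (\<lambda>x. x) \<rho> (\<rho> y) \<in> carrier (tensor_space K H (tensor_space K H Y))"
      by (rule linear_mapD(1)[OF tensor_map_linear[OF vspace_H Y vspace_H HTY linear_map_id \<rho>] t])
    show ?thesis
    proof (rule HHY.tensor_eq_slice_l[OF L R])
      fix f assume f: "functional K H f"
      note sf = slice_l_linear[OF vspace_H HTY f]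
      show "slice_l K (tensor_space K H Y) f (tensor_assoc K H H Y (tensor_map K (tensor_space K H H) Y (comult H) (\<lambda>x. x) (\<rho> y))) =
        slice_l K (tensor_space K H Y) f (tensor_map K H (tensor_space K H Y) (\<lambda>x. x) \<rho> (\<rho> y))"
      proof (rule HY.tensor_eq_slice_l[OF linear_mapD(1)[OF sf L] linear_mapD(1)[OF sf R]])
        fix g assume g: "functional K H g"
        note gf = linear_map_comp[OF slice_l_linear[OF vspace_H vspace_H f] g]
        have "slice_l K Y g (slice_l K (tensor_space K H Y) f (tensor_assoc K H H Y
            (tensor_map K (tensor_space K H H) Y (comult H) (\<lambda>x. x) (\<rho> y)))) =
          slice_l K Y (\<lambda>x. g (slice_l K H f x)) (tensor_map K (tensor_space K H H) Y (comult H) (\<lambda>x. x) (\<rho> y))"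
          by (rule slice_l_tensor_assoc[OF vspace_H vspace_H Y f g t'])
        also have "\<dots> = slice_l K Y (convolution K H f g) (\<rho> y)"
          unfolding convolution_def[abs_def]
          by (rule slice_l_tensor_map[OF vspace_H Y HH Y comult_linear linear_map_id gf t])
        also have "\<dots> = slice_l K Y g (\<rho> (slice_l K Y f (\<rho> y)))" by (rule comp[OF f g y, symmetric])
        also have "\<rho> (slice_l K Y f (\<rho> y)) = slice_l K (tensor_space K H Y) f (tensor_map K H (tensor_space K H Y) (\<lambda>x. x) \<rho> (\<rho> y))"
          by (rule slice_l_tensor_map[OF vspace_H Y vspace_H HTY linear_map_id \<rho> f t, symmetric])
        finally show "slice_l K Y g (slice_l K (tensor_space K H Y) f (tensor_assoc K H H Y
            (tensor_map K (tensor_space K H H) Y (comult H) (\<lambda>x. x) (\<rho> y)))) =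
          slice_l K Y g (slice_l K (tensor_space K H Y) f (tensor_map K H (tensor_space K H Y) (\<lambda>x. x) \<rho> (\<rho> y)))" .
      qed
    qed
  qed
  show ?thesis
    by (intro left_comodule.intro coalgebra_axioms vspace.axioms(2)[OF vspace_as_comodule[OF Y]]
      left_comodule_axioms.intro) (simp_all add: \<rho> coas cou[unfolded slice_l_def])
qed

end

text \<open>A finite basis given together with its coordinate functionals. The index set is
  arbitrary because matrix units and tensor products of comodules are indexed by pairs.\<close>

locale finite_basis = vspace K Y
  for K :: "('k, 'x) ring_scheme" (structure) and Y :: "('k, 'b, 'y) module_scheme" (structure)
    and I :: "'i set" and e :: "'i \<Rightarrow> 'b" and p :: "'i \<Rightarrow> 'b \<Rightarrow> 'k" +
  assumes finite_index: "finite I"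
    and basis_closed: "i \<in> I \<Longrightarrow> e i \<in> carrier Y"
    and coord_functional: "i \<in> I \<Longrightarrow> functional K Y (p i)"
    and coord_basis: "i \<in> I \<Longrightarrow> j \<in> I \<Longrightarrow> p i (e j) = (if i = j then \<one>\<^bsub>K\<^esub> else \<zero>\<^bsub>K\<^esub>)"
    and expansion: "y \<in> carrier Y \<Longrightarrow> (\<Oplus>\<^bsub>Y\<^esub>i\<in>I. p i y \<odot>\<^bsub>Y\<^esub> e i) = y"
begin

definition extend :: "('k, 'w, 'z) module_scheme \<Rightarrow> ('i \<Rightarrow> 'w) \<Rightarrow> 'b \<Rightarrow> 'w"
  where "extend W w y = (\<Oplus>\<^bsub>W\<^esub>i\<in>I. p i y \<odot>\<^bsub>W\<^esub> w i)"

lemma coord_closed: "i \<in> I \<Longrightarrow> y \<in> carrier Y \<Longrightarrow> p i y \<in> carrier K"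
  using functional_closed[OF coord_functional] .

lemma extend_linear:
  assumes W: "vspace K W" and w: "\<And>i. i \<in> I \<Longrightarrow> w i \<in> carrier W"
  shows "linear_map K Y W (extend W w)"
proof -
  interpret W: vspace K W by fact
  have cl: "(\<lambda>i. p i y \<odot>\<^bsub>W\<^esub> w i) \<in> I \<rightarrow> carrier W" if "y \<in> carrier Y" for y
    using that w coord_closed by auto
  show ?thesis
    unfolding extend_def[abs_def]
  proof (rule linear_mapI)
    fix x assume x: "x \<in> carrier Y"
    show "(\<Oplus>\<^bsub>W\<^esub>i\<in>I. p i x \<odot>\<^bsub>W\<^esub> w i) \<in> carrier W" by (rule W.sum_closed[OF cl[OF x]])
    fix y assume y: "y \<in> carrier Y"
    have "(\<Oplus>\<^bsub>W\<^esub>i\<in>I. p i (x \<oplus>\<^bsub>Y\<^esub> y) \<odot>\<^bsub>W\<^esub> w i) = (\<Oplus>\<^bsub>W\<^esub>i\<in>I. p i x \<odot>\<^bsub>W\<^esub> w i \<oplus>\<^bsub>W\<^esub> p i y \<odot>\<^bsub>W\<^esub> w i)"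
      using x y w coord_closed
      by (intro W.sum_cong) (auto simp: functional_add[OF coord_functional] W.add_scale)
    then show "(\<Oplus>\<^bsub>W\<^esub>i\<in>I. p i (x \<oplus>\<^bsub>Y\<^esub> y) \<odot>\<^bsub>W\<^esub> w i) =
        (\<Oplus>\<^bsub>W\<^esub>i\<in>I. p i x \<odot>\<^bsub>W\<^esub> w i) \<oplus>\<^bsub>W\<^esub> (\<Oplus>\<^bsub>W\<^esub>i\<in>I. p i y \<odot>\<^bsub>W\<^esub> w i)"
      using W.sum_add[OF cl[OF x] cl[OF y]] by simp
  next
    fix c x assume c: "c \<in> carrier K" and x: "x \<in> carrier Y"
    have "(\<Oplus>\<^bsub>W\<^esub>i\<in>I. p i (c \<odot>\<^bsub>Y\<^esub> x) \<odot>\<^bsub>W\<^esub> w i) = (\<Oplus>\<^bsub>W\<^esub>i\<in>I. c \<odot>\<^bsub>W\<^esub> (p i x \<odot>\<^bsub>W\<^esub> w i))"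
      using c x w coord_closed
      by (intro W.sum_cong) (auto simp: functional_smult[OF coord_functional] W.scale_scale)
    then show "(\<Oplus>\<^bsub>W\<^esub>i\<in>I. p i (c \<odot>\<^bsub>Y\<^esub> x) \<odot>\<^bsub>W\<^esub> w i) = c \<odot>\<^bsub>W\<^esub> (\<Oplus>\<^bsub>W\<^esub>i\<in>I. p i x \<odot>\<^bsub>W\<^esub> w i)"
      using W.sum_smult[OF finite_index c cl[OF x]] by simp
  qed
qed

lemma extend_basis:
  assumes W: "vspace K W" and w: "\<And>i. i \<in> I \<Longrightarrow> w i \<in> carrier W" and j: "j \<in> I"
  shows "extend W w (e j) = w j"
proof -
  interpret W: vspace K W by fact
  have "extend W w (e j) = (\<Oplus>\<^bsub>W\<^esub>i\<in>I. if j = i then w i else \<zero>\<^bsub>W\<^esub>)"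
    unfolding extend_def using w j by (intro W.sum_cong) (auto simp: coord_basis)
  also have "\<dots> = w j" using w j finite_index by (intro W.sum_single) auto
  finally show ?thesis .
qed

lemma linear_eqI:
  assumes W: "vspace K W" and f: "linear_map K Y W f" and g: "linear_map K Y W g"
    and eq: "\<And>i. i \<in> I \<Longrightarrow> f (e i) = g (e i)" and y: "y \<in> carrier Y"
  shows "f y = g y"
proof -
  interpret W: vspace K W by fact
  have cl: "(\<lambda>i. p i y \<odot>\<^bsub>Y\<^esub> e i) \<in> I \<rightarrow> carrier Y" using y basis_closed coord_closed by auto
  have "f (\<Oplus>\<^bsub>Y\<^esub>i\<in>I. p i y \<odot>\<^bsub>Y\<^esub> e i) = (\<Oplus>\<^bsub>W\<^esub>i\<in>I. f (p i y \<odot>\<^bsub>Y\<^esub> e i))"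
    by (rule linear_map_finsum[OF vspace_axioms W f cl])
  also have "\<dots> = (\<Oplus>\<^bsub>W\<^esub>i\<in>I. g (p i y \<odot>\<^bsub>Y\<^esub> e i))"
    using eq y basis_closed coord_closed linear_mapD(1)[OF g]
    by (intro W.sum_cong) (auto simp: linear_mapD(3)[OF f] linear_mapD(3)[OF g])
  also have "\<dots> = g (\<Oplus>\<^bsub>Y\<^esub>i\<in>I. p i y \<odot>\<^bsub>Y\<^esub> e i)"
    by (rule linear_map_finsum[OF vspace_axioms W g cl, symmetric])
  finally show ?thesis using expansion[OF y] by simp
qed

lemma submodule_all:
  assumes N: "submodule N K Y" and "\<And>i. i \<in> I \<Longrightarrow> e i \<in> N"
  shows "N = carrier Y"
proof
  note NS = submodule_vspace[OF N]
  show "N \<subseteq> carrier Y" by (rule NS(1))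
  show "carrier Y \<subseteq> N"
  proof
    fix y assume y: "y \<in> carrier Y"
    have "(\<Oplus>\<^bsub>Y\<^esub>i\<in>I. p i y \<odot>\<^bsub>Y\<^esub> e i) \<in> N"
      using NS(4) assms(2) coord_closed y by (intro submodule_finsum[OF N]) auto
    then show "y \<in> N" using expansion[OF y] by simp
  qed
qed

lemma coord_zeroI:
  assumes "y \<in> carrier Y" "\<And>i. i \<in> I \<Longrightarrow> p i y = \<zero>\<^bsub>K\<^esub>"
  shows "y = \<zero>\<^bsub>Y\<^esub>"
proof -
  have "(\<Oplus>\<^bsub>Y\<^esub>i\<in>I. p i y \<odot>\<^bsub>Y\<^esub> e i) = \<zero>\<^bsub>Y\<^esub>"
    using assms basis_closed by (intro sum_zero) auto
  then show ?thesis using expansion[OF assms(1)] by simp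
qed

end

lemma bilinear_eq_on_bases:
  assumes Y: "finite_basis K Y I e p" and Z: "finite_basis K Z J e' p'" and W: "vspace K W"
    and f: "bilinear_map K Y Z W f" and g: "bilinear_map K Y Z W g"
    and eq: "\<And>i j. i \<in> I \<Longrightarrow> j \<in> J \<Longrightarrow> f (e i) (e' j) = g (e i) (e' j)"
    and y: "y \<in> carrier Y" and z: "z \<in> carrier Z"
  shows "f y z = g y z"
proof (rule finite_basis.linear_eqI[OF Y W bilinear_map_linear(2)[OF f z] bilinear_map_linear(2)[OF g z] _ y])
  fix i assume i: "i \<in> I"
  have ei: "e i \<in> carrier Y" by (rule finite_basis.basis_closed[OF Y i])
  show "f (e i) z = g (e i) z"
    by (rule finite_basis.linear_eqI[OF Z W bilinear_map_linear(1)[OF f ei] bilinear_map_linear(1)[OF g ei] eq[OF i] z])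
qed

text \<open>Extends linearly in one variable after the other. It supplies the product of matrix
  units and their action on vectors.\<close>

lemma bilinear_extension:
  assumes Y: "finite_basis K Y I e p" and Z: "finite_basis K Z J e' p'" and W: "vspace K W"
    and w: "\<And>i j. i \<in> I \<Longrightarrow> j \<in> J \<Longrightarrow> w i j \<in> carrier W"
  shows "\<exists>\<beta>. bilinear_map K Y Z W \<beta> \<and> (\<forall>i\<in>I. \<forall>j\<in>J. \<beta> (e i) (e' j) = w i j)"
proof -
  interpret Y: finite_basis K Y I e p by fact
  interpret Z: finite_basis K Z J e' p' by fact
  interpret W: vspace K W by fact
  define \<beta> where "\<beta> y z = Y.extend W (\<lambda>i. Z.extend W (w i) z) y" for y z
  note Zl = Z.extend_linear[OF W w]
  have Zc: "Z.extend W (w i) z \<in> carrier W" if "i \<in> I" "z \<in> carrier Z" for i z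
    by (rule linear_mapD(1)[OF Zl[OF that(1)] that(2)])
  have l1: "linear_map K Y W (\<lambda>y. \<beta> y z)" if "z \<in> carrier Z" for z
    unfolding \<beta>_def by (rule Y.extend_linear[OF W Zc[OF _ that]])
  have cl: "(\<lambda>i. p i y \<odot>\<^bsub>W\<^esub> Z.extend W (w i) z) \<in> I \<rightarrow> carrier W" if "y \<in> carrier Y" "z \<in> carrier Z" for y z
    using that Zc Y.coord_closed by auto
  have l2: "linear_map K Z W (\<lambda>z. \<beta> y z)" if y: "y \<in> carrier Y" for y
  proof (rule linear_mapI)
    fix z assume z: "z \<in> carrier Z"
    show "\<beta> y z \<in> carrier W" by (rule linear_mapD(1)[OF l1[OF z] y])
    fix z' assume z': "z' \<in> carrier Z"
    have "\<beta> y (z \<oplus>\<^bsub>Z\<^esub> z') = (\<Oplus>\<^bsub>W\<^esub>i\<in>I. p i y \<odot>\<^bsub>W\<^esub> Z.extend W (w i) z \<oplus>\<^bsub>W\<^esub> p i y \<odot>\<^bsub>W\<^esub> Z.extend W (w i) z')"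
      unfolding \<beta>_def Y.extend_def using y z z' Zc Y.coord_closed
      by (intro W.sum_cong) (auto simp: linear_mapD(2)[OF Zl] W.scale_add)
    also have "\<dots> = \<beta> y z \<oplus>\<^bsub>W\<^esub> \<beta> y z'"
      unfolding \<beta>_def Y.extend_def by (rule W.sum_add[OF cl[OF y z] cl[OF y z']])
    finally show "\<beta> y (z \<oplus>\<^bsub>Z\<^esub> z') = \<beta> y z \<oplus>\<^bsub>W\<^esub> \<beta> y z'" .
  next
    fix c z assume c: "c \<in> carrier K" and z: "z \<in> carrier Z"
    have "\<beta> y (c \<odot>\<^bsub>Z\<^esub> z) = (\<Oplus>\<^bsub>W\<^esub>i\<in>I. c \<odot>\<^bsub>W\<^esub> (p i y \<odot>\<^bsub>W\<^esub> Z.extend W (w i) z))"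
      unfolding \<beta>_def Y.extend_def using c y z Zc Y.coord_closed
      by (intro W.sum_cong) (auto simp: linear_mapD(3)[OF Zl] W.scale_scale[symmetric] Y.K.m_comm)
    also have "\<dots> = c \<odot>\<^bsub>W\<^esub> \<beta> y z"
      unfolding \<beta>_def Y.extend_def by (rule W.sum_smult[OF Y.finite_index c cl[OF y z], symmetric])
    finally show "\<beta> y (c \<odot>\<^bsub>Z\<^esub> z) = c \<odot>\<^bsub>W\<^esub> \<beta> y z" .
  qed
  have "bilinear_map K Y Z W \<beta>" using l1 l2 unfolding bilinear_map_def by simp
  moreover have "\<beta> (e i) (e' j) = w i j" if i: "i \<in> I" and j: "j \<in> J" for i j
  proof -
    have "\<beta> (e i) (e' j) = Z.extend W (w i) (e' j)"
      unfolding \<beta>_def by (rule Y.extend_basis[OF W Zc[OF _ Z.basis_closed[OF j]] i])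
    also have "\<dots> = w i j" by (rule Z.extend_basis[OF W w[OF i] j])
    finally show ?thesis .
  qed
  ultimately show ?thesis by blast
qed

locale comatrix_comodule = coalgebra K H + finite_basis K Y I e p
  for K :: "('k, 'x) ring_scheme" (structure) and H :: "('k, 'h, 'z) coalgebra_scheme" (structure)
    and Y :: "('k, 'b, 'y) module_scheme" and I :: "'i set" and e p +
  fixes c :: "'i \<Rightarrow> 'i \<Rightarrow> 'h"
  assumes comatrix: "comatrix K H I c"
begin

definition coaction :: "'b \<Rightarrow> ('k, 'h, 'b) tensor"
  where "coaction = extend (tensor_space K H Y) (\<lambda>i. \<Oplus>\<^bsub>tensor_space K H Y\<^esub>j\<in>I. pure_tensor K H Y (c i j) (e j))"

lemma vspace_Y: "vspace K Y" by unfold_locales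

lemma entry_closed: "i \<in> I \<Longrightarrow> j \<in> I \<Longrightarrow> c i j \<in> carrier H"
  using comatrix unfolding comatrix_def by blast

lemma vspace_HY: "vspace K (tensor_space K H Y)" using vspace_H vspace_Y by simp

lemma row_closed: "i \<in> I \<Longrightarrow> (\<lambda>j. pure_tensor K H Y (c i j) (e j)) \<in> I \<rightarrow> carrier (tensor_space K H Y)"
  using entry_closed basis_closed vspace_H vspace_Y by auto

lemma row_sum_closed: "i \<in> I \<Longrightarrow> (\<Oplus>\<^bsub>tensor_space K H Y\<^esub>j\<in>I. pure_tensor K H Y (c i j) (e j)) \<in> carrier (tensor_space K H Y)"
  by (rule vspace.sum_closed[OF vspace_HY row_closed])

lemma coaction_linear: "linear_map K Y (tensor_space K H Y) coaction"
  unfolding coaction_def by (rule extend_linear[OF vspace_HY row_sum_closed])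

lemma coaction_basis: "i \<in> I \<Longrightarrow> coaction (e i) = (\<Oplus>\<^bsub>tensor_space K H Y\<^esub>j\<in>I. pure_tensor K H Y (c i j) (e j))"
  unfolding coaction_def by (rule extend_basis[OF vspace_HY row_sum_closed])

lemma slice_coaction_basis:
  assumes f: "functional K H f" and i: "i \<in> I"
  shows "slice_l K Y f (coaction (e i)) = (\<Oplus>\<^bsub>Y\<^esub>j\<in>I. f (c i j) \<odot>\<^bsub>Y\<^esub> e j)"
proof -
  have "slice_l K Y f (coaction (e i)) = (\<Oplus>\<^bsub>Y\<^esub>j\<in>I. slice_l K Y f (pure_tensor K H Y (c i j) (e j)))"
    unfolding coaction_basis[OF i]
    by (rule linear_map_finsum[OF vspace_HY vspace_Y slice_l_linear[OF vspace_H vspace_Y f] row_closed[OF i]])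
  also have "\<dots> = (\<Oplus>\<^bsub>Y\<^esub>j\<in>I. f (c i j) \<odot>\<^bsub>Y\<^esub> e j)"
    using functional_closed[OF f entry_closed[OF i]] basis_closed entry_closed[OF i]
    by (intro sum_cong) (auto simp: slice_l_pure[OF vspace_H vspace_Y f] intro!: scale_closed)
  finally show ?thesis .
qed

lemma slice_coaction_linear: "functional K H f \<Longrightarrow> linear_map K Y Y (\<lambda>y. slice_l K Y f (coaction y))"
  by (rule linear_map_comp[OF coaction_linear slice_l_linear[OF vspace_H vspace_Y]])

lemma functional_comult_entry:
  assumes f: "functional K H f" and g: "functional K H g" and i: "i \<in> I" and j: "j \<in> I"
  shows "convolution K H f g (c i j) = (\<Oplus>\<^bsub>K\<^esub>k\<in>I. f (c i k) \<otimes>\<^bsub>K\<^esub> g (c k j))"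
proof -
  interpret HH: vspace_pair K H H by (intro vspace_pair.intro vspace_H)
  note gf = linear_map_comp[OF slice_l_linear[OF vspace_H vspace_H f] g]
  have pc: "(\<lambda>k. pure_tensor K H H (c i k) (c k j)) \<in> I \<rightarrow> carrier (tensor_space K H H)"
    using entry_closed i j vspace_H by auto
  have "convolution K H f g (c i j) = g (slice_l K H f (\<Oplus>\<^bsub>tensor_space K H H\<^esub>k\<in>I. pure_tensor K H H (c i k) (c k j)))"
    using comatrix i j unfolding comatrix_def convolution_def by simp
  also have "\<dots> = (\<Oplus>\<^bsub>K\<^esub>k\<in>I. g (slice_l K H f (pure_tensor K H H (c i k) (c k j))))"
    using linear_map_finsum[OF HH.T.vspace_axioms HH.V.vspace_ground gf pc] by simp
  also have "\<dots> = (\<Oplus>\<^bsub>K\<^esub>k\<in>I. f (c i k) \<otimes>\<^bsub>K\<^esub> g (c k j))"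
    using entry_closed i j functional_closed[OF f] functional_closed[OF g]
    by (intro K.add.finprod_cong') (auto simp: slice_l_pure[OF vspace_H vspace_H f] functional_smult[OF g])
  finally show ?thesis .
qed

text \<open>On basis vectors, composing the operators of \<open>f\<close> and \<open>g\<close>
  multiplies the scalar matrices \<open>f(c_ik)\<close> and \<open>g(c_kj)\<close>, and the comatrix
  formula says that the product is the matrix of the convolution.\<close>

lemma comodule: "left_comodule K H (as_comodule Y coaction)"
proof (rule left_comoduleI[OF vspace_Y coaction_linear])
  fix y assume y: "y \<in> carrier Y"
  show "slice_l K Y (counit H) (coaction y) = y"
  proof (rule linear_eqI[OF vspace_Y slice_coaction_linear[OF counit_linear] linear_map_id _ y])
    fix i assume i: "i \<in> I"
    have "slice_l K Y (counit H) (coaction (e i)) = (\<Oplus>\<^bsub>Y\<^esub>j\<in>I. if i = j then e j else \<zero>\<^bsub>Y\<^esub>)"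
      unfolding slice_coaction_basis[OF counit_linear i]
      using comatrix i basis_closed unfolding comatrix_def by (intro sum_cong) auto
    also have "\<dots> = e i" using i finite_index basis_closed by (intro sum_single) auto
    finally show "slice_l K Y (counit H) (coaction (e i)) = e i" .
  qed
  fix f g assume f: "functional K H f" and g: "functional K H g"
  note fg = functional_convolution[OF f g]
  show "slice_l K Y g (coaction (slice_l K Y f (coaction y))) = slice_l K Y (convolution K H f g) (coaction y)"
  proof (rule linear_eqI[OF vspace_Y linear_map_comp[OF slice_coaction_linear[OF f] slice_coaction_linear[OF g]]
        slice_coaction_linear[OF fg] _ y])
    fix i assume i: "i \<in> I"
    have fc: "f (c j k) \<in> carrier K" "g (c j k) \<in> carrier K" if "j \<in> I" "k \<in> I" for j k
      by (rule functional_closed[OF f entry_closed[OF that]], rule functional_closed[OF g entry_closed[OF that]])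
    have cl: "(\<lambda>j. f (c i j) \<odot>\<^bsub>Y\<^esub> e j) \<in> I \<rightarrow> carrier Y" using fc i basis_closed by (auto intro!: scale_closed)
    define L where "L y = slice_l K Y g (coaction y)" for y
    have L: "linear_map K Y Y L" unfolding L_def[abs_def] by (rule slice_coaction_linear[OF g])
    have Lc: "k \<in> I \<Longrightarrow> L (e k) \<in> carrier Y" for k by (rule linear_mapD(1)[OF L basis_closed])
    have "L (\<Oplus>\<^bsub>Y\<^esub>k\<in>I. f (c i k) \<odot>\<^bsub>Y\<^esub> e k) = slice_l K Y (convolution K H f g) (coaction (e i))"
    \<comment> \<open>Applying a functional \<open>q\<close> moves the double sum into the field,
      where distributivity and exchange of summation are available.\<close>
    proof (rule functional_ext)
      show 1: "L (\<Oplus>\<^bsub>Y\<^esub>k\<in>I. f (c i k) \<odot>\<^bsub>Y\<^esub> e k) \<in> carrier Y" by (rule linear_mapD(1)[OF L sum_closed[OF cl]])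
      show "slice_l K Y (convolution K H f g) (coaction (e i)) \<in> carrier Y"
        by (rule linear_mapD(1)[OF slice_coaction_linear[OF fg] basis_closed[OF i]])
      fix q assume q: "functional K Y q"
      have qe: "j \<in> I \<Longrightarrow> q (e j) \<in> carrier K" for j by (rule functional_closed[OF q basis_closed])
      have cl2: "(\<lambda>j. h (c k j) \<odot>\<^bsub>Y\<^esub> e j) \<in> I \<rightarrow> carrier Y" if "functional K H h" "k \<in> I" for h k
        using functional_closed[OF that(1) entry_closed[OF that(2)]] basis_closed by (auto intro!: scale_closed)
      have qs: "q (slice_l K Y h (coaction (e k))) = (\<Oplus>\<^bsub>K\<^esub>j\<in>I. h (c k j) \<otimes>\<^bsub>K\<^esub> q (e j))"
        if h: "functional K H h" and k: "k \<in> I" for h k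
      proof -
        have "q (slice_l K Y h (coaction (e k))) = (\<Oplus>\<^bsub>K\<^esub>j\<in>I. q (h (c k j) \<odot>\<^bsub>Y\<^esub> e j))"
          unfolding slice_coaction_basis[OF h k]
          using linear_map_finsum[OF vspace_Y vspace_ground q cl2[OF h k]] by simp
        also have "\<dots> = (\<Oplus>\<^bsub>K\<^esub>j\<in>I. h (c k j) \<otimes>\<^bsub>K\<^esub> q (e j))"
          using functional_closed[OF h entry_closed[OF k]] basis_closed qe
          by (intro K.add.finprod_cong') (auto simp: functional_smult[OF q])
        finally show ?thesis .
      qed
      have "q (L (\<Oplus>\<^bsub>Y\<^esub>k\<in>I. f (c i k) \<odot>\<^bsub>Y\<^esub> e k)) = (\<Oplus>\<^bsub>K\<^esub>k\<in>I. q (L (f (c i k) \<odot>\<^bsub>Y\<^esub> e k)))"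
        using linear_map_finsum[OF vspace_Y vspace_ground linear_map_comp[OF L q] cl] by simp
      also have "\<dots> = (\<Oplus>\<^bsub>K\<^esub>k\<in>I. f (c i k) \<otimes>\<^bsub>K\<^esub> (\<Oplus>\<^bsub>K\<^esub>j\<in>I. g (c k j) \<otimes>\<^bsub>K\<^esub> q (e j)))"
        using fc i basis_closed Lc qe qs[OF g, folded L_def]
        by (intro K.add.finprod_cong') (auto simp: linear_mapD(3)[OF L] functional_smult[OF q])
      also have "\<dots> = (\<Oplus>\<^bsub>K\<^esub>k\<in>I. (\<Oplus>\<^bsub>K\<^esub>j\<in>I. (f (c i k) \<otimes>\<^bsub>K\<^esub> g (c k j)) \<otimes>\<^bsub>K\<^esub> q (e j)))"
      proof (rule K.add.finprod_cong'[OF refl])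
        show "(\<lambda>k. \<Oplus>\<^bsub>K\<^esub>j\<in>I. (f (c i k) \<otimes>\<^bsub>K\<^esub> g (c k j)) \<otimes>\<^bsub>K\<^esub> q (e j)) \<in> I \<rightarrow> carrier K"
          using fc i qe by (auto intro!: K.add.finprod_closed)
        fix k assume k: "k \<in> I"
        have "f (c i k) \<otimes>\<^bsub>K\<^esub> (\<Oplus>\<^bsub>K\<^esub>j\<in>I. g (c k j) \<otimes>\<^bsub>K\<^esub> q (e j)) =
            (\<Oplus>\<^bsub>K\<^esub>j\<in>I. f (c i k) \<otimes>\<^bsub>K\<^esub> (g (c k j) \<otimes>\<^bsub>K\<^esub> q (e j)))"
          using fc i k qe finite_index by (intro K.finsum_rdistr) auto
        also have "\<dots> = (\<Oplus>\<^bsub>K\<^esub>j\<in>I. (f (c i k) \<otimes>\<^bsub>K\<^esub> g (c k j)) \<otimes>\<^bsub>K\<^esub> q (e j))"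
          using fc i k qe by (intro K.add.finprod_cong') (auto simp: K.m_assoc)
        finally show "f (c i k) \<otimes>\<^bsub>K\<^esub> (\<Oplus>\<^bsub>K\<^esub>j\<in>I. g (c k j) \<otimes>\<^bsub>K\<^esub> q (e j)) =
            (\<Oplus>\<^bsub>K\<^esub>j\<in>I. (f (c i k) \<otimes>\<^bsub>K\<^esub> g (c k j)) \<otimes>\<^bsub>K\<^esub> q (e j))" .
      qed
      also have "\<dots> = (\<Oplus>\<^bsub>K\<^esub>j\<in>I. (\<Oplus>\<^bsub>K\<^esub>k\<in>I. (f (c i k) \<otimes>\<^bsub>K\<^esub> g (c k j)) \<otimes>\<^bsub>K\<^esub> q (e j)))"
        using fc i qe finite_index by (intro K.finsum_swap) auto
      also have "\<dots> = (\<Oplus>\<^bsub>K\<^esub>j\<in>I. convolution K H f g (c i j) \<otimes>\<^bsub>K\<^esub> q (e j))"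
      proof (rule K.add.finprod_cong'[OF refl])
        show "(\<lambda>j. convolution K H f g (c i j) \<otimes>\<^bsub>K\<^esub> q (e j)) \<in> I \<rightarrow> carrier K"
          using functional_closed[OF fg entry_closed[OF i]] qe by auto
        fix j assume j: "j \<in> I"
        show "(\<Oplus>\<^bsub>K\<^esub>k\<in>I. (f (c i k) \<otimes>\<^bsub>K\<^esub> g (c k j)) \<otimes>\<^bsub>K\<^esub> q (e j)) = convolution K H f g (c i j) \<otimes>\<^bsub>K\<^esub> q (e j)"
          unfolding functional_comult_entry[OF f g i j]
          using fc i j qe finite_index by (intro K.finsum_ldistr[symmetric]) auto
      qed
      also have "\<dots> = q (slice_l K Y (convolution K H f g) (coaction (e i)))" by (rule qs[OF fg i, symmetric])
      finally show "q (L (\<Oplus>\<^bsub>Y\<^esub>k\<in>I. f (c i k) \<odot>\<^bsub>Y\<^esub> e k)) = q (slice_l K Y (convolution K H f g) (coaction (e i)))" .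
    qed
    then show "slice_l K Y g (coaction (slice_l K Y f (coaction (e i)))) = slice_l K Y (convolution K H f g) (coaction (e i))"
      unfolding slice_coaction_basis[OF f i] L_def .
  qed
qed

end

section \<open>Comatrices and the antipode\<close>

lemma (in abelian_monoid) finsum_Times:
  assumes "finite I" "finite J" "\<And>i j. i \<in> I \<Longrightarrow> j \<in> J \<Longrightarrow> f i j \<in> carrier G"
  shows "(\<Oplus>i\<in>I. \<Oplus>j\<in>J. f i j) = (\<Oplus>x\<in>I \<times> J. f (fst x) (snd x))"
  using assms(1,3)
proof (induct I rule: finite_induct)
  case empty
  then show ?case by simp
next
  case (insert x F)
  have eq: "insert x F \<times> J = (\<lambda>j. (x, j)) ` J \<union> F \<times> J" by auto
  have "(\<Oplus>y\<in>(\<lambda>j. (x, j)) ` J \<union> F \<times> J. f (fst y) (snd y)) =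
      (\<Oplus>y\<in>(\<lambda>j. (x, j)) ` J. f (fst y) (snd y)) \<oplus> (\<Oplus>y\<in>F \<times> J. f (fst y) (snd y))"
    using insert assms(2) by (intro finsum_Un_disjoint) auto
  also have "(\<Oplus>y\<in>(\<lambda>j. (x, j)) ` J. f (fst y) (snd y)) = (\<Oplus>j\<in>J. f x j)"
    using insert by (subst finsum_reindex) (auto simp: inj_on_def)
  also have "(\<Oplus>y\<in>F \<times> J. f (fst y) (snd y)) = (\<Oplus>i\<in>F. \<Oplus>j\<in>J. f i j)"
    using insert by simp
  also have "(\<Oplus>j\<in>J. f x j) \<oplus> (\<Oplus>i\<in>F. \<Oplus>j\<in>J. f i j) = (\<Oplus>i\<in>insert x F. \<Oplus>j\<in>J. f i j)"
    using insert by (intro finsum_insert[symmetric]) (auto intro!: finsum_closed)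
  finally show ?case unfolding eq by simp
qed

lemma bilinear_finsum_l:
  assumes "vspace K U" "vspace K W" "bilinear_map K U V W \<beta>" "u \<in> I \<rightarrow> carrier U" "v \<in> carrier V"
  shows "\<beta> (\<Oplus>\<^bsub>U\<^esub>i\<in>I. u i) v = (\<Oplus>\<^bsub>W\<^esub>i\<in>I. \<beta> (u i) v)"
  by (rule linear_map_finsum[OF assms(1,2) bilinear_map_linear(2)[OF assms(3,5)] assms(4)])

lemma bilinear_finsum_r:
  assumes "vspace K V" "vspace K W" "bilinear_map K U V W \<beta>" "v \<in> I \<rightarrow> carrier V" "u \<in> carrier U"
  shows "\<beta> u (\<Oplus>\<^bsub>V\<^esub>i\<in>I. v i) = (\<Oplus>\<^bsub>W\<^esub>i\<in>I. \<beta> u (v i))"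
  by (rule linear_map_finsum[OF assms(1,2) bilinear_map_linear(1)[OF assms(3,5)] assms(4)])

lemma bilinear_finsum2:
  assumes U: "vspace K U" and V: "vspace K V" and W: "vspace K W" and b: "bilinear_map K U V W \<beta>"
    and u: "u \<in> I \<rightarrow> carrier U" and v: "v \<in> J \<rightarrow> carrier V" and fin: "finite I" "finite J"
  shows "\<beta> (\<Oplus>\<^bsub>U\<^esub>i\<in>I. u i) (\<Oplus>\<^bsub>V\<^esub>j\<in>J. v j) = (\<Oplus>\<^bsub>W\<^esub>i\<in>I. \<Oplus>\<^bsub>W\<^esub>j\<in>J. \<beta> (u i) (v j))"
proof -
  interpret W: vspace K W by fact
  have vc: "(\<Oplus>\<^bsub>V\<^esub>j\<in>J. v j) \<in> carrier V" by (rule vspace.sum_closed[OF V v])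
  have "\<beta> (\<Oplus>\<^bsub>U\<^esub>i\<in>I. u i) (\<Oplus>\<^bsub>V\<^esub>j\<in>J. v j) = (\<Oplus>\<^bsub>W\<^esub>i\<in>I. \<beta> (u i) (\<Oplus>\<^bsub>V\<^esub>j\<in>J. v j))"
    by (rule bilinear_finsum_l[OF U W b u vc])
  also have "\<dots> = (\<Oplus>\<^bsub>W\<^esub>i\<in>I. \<Oplus>\<^bsub>W\<^esub>j\<in>J. \<beta> (u i) (v j))"
    using u v bilinear_mapD(1)[OF b]
    by (intro W.sum_cong) (auto intro!: W.sum_closed bilinear_finsum_r[OF V W b])
  finally show ?thesis .
qed

text \<open>The usual \<open>L = L (D X) = (L D) X = X\<close>, for square matrices over the
  associative algebra on \<open>T\<close> with product \<open>\<beta>\<close> and unit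
  \<open>u\<close>.\<close>

lemma matrix_inverse_unique:
  assumes T: "vspace K T" and b: "bilinear_map K T T T \<beta>"
    and assoc: "\<And>x y z. \<lbrakk>x \<in> carrier T; y \<in> carrier T; z \<in> carrier T\<rbrakk> \<Longrightarrow> \<beta> (\<beta> x y) z = \<beta> x (\<beta> y z)"
    and u: "u \<in> carrier T" "\<And>x. x \<in> carrier T \<Longrightarrow> \<beta> u x = x" "\<And>x. x \<in> carrier T \<Longrightarrow> \<beta> x u = x"
    and I: "finite I"
    and c: "\<And>i j. \<lbrakk>i \<in> I; j \<in> I\<rbrakk> \<Longrightarrow> L i j \<in> carrier T" "\<And>i j. \<lbrakk>i \<in> I; j \<in> I\<rbrakk> \<Longrightarrow> D i j \<in> carrier T"
      "\<And>i j. \<lbrakk>i \<in> I; j \<in> I\<rbrakk> \<Longrightarrow> X i j \<in> carrier T"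
    and LD: "\<And>i j. \<lbrakk>i \<in> I; j \<in> I\<rbrakk> \<Longrightarrow> (\<Oplus>\<^bsub>T\<^esub>k\<in>I. \<beta> (L i k) (D k j)) = (if i = j then u else \<zero>\<^bsub>T\<^esub>)"
    and DX: "\<And>i j. \<lbrakk>i \<in> I; j \<in> I\<rbrakk> \<Longrightarrow> (\<Oplus>\<^bsub>T\<^esub>k\<in>I. \<beta> (D i k) (X k j)) = (if i = j then u else \<zero>\<^bsub>T\<^esub>)"
    and i: "i \<in> I" and j: "j \<in> I"
  shows "L i j = X i j"
proof -
  interpret T: vspace K T by fact
  note bc = bilinear_mapD(1)[OF b]
  have z: "\<beta> x \<zero>\<^bsub>T\<^esub> = \<zero>\<^bsub>T\<^esub>" "\<beta> \<zero>\<^bsub>T\<^esub> x = \<zero>\<^bsub>T\<^esub>" if "x \<in> carrier T" for x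
    using linear_map_zero[OF T T bilinear_map_linear(1)[OF b that]] linear_map_zero[OF T T bilinear_map_linear(2)[OF b that]] .
  have cl: "(\<lambda>l. \<beta> (D k l) (X l j)) \<in> I \<rightarrow> carrier T" if "k \<in> I" for k using that j c bc by auto
  have cl': "(\<lambda>k. \<beta> (L i k) (D k l)) \<in> I \<rightarrow> carrier T" if "l \<in> I" for l using that i c bc by auto
  have "L i j = (\<Oplus>\<^bsub>T\<^esub>k\<in>I. if j = k then L i k else \<zero>\<^bsub>T\<^esub>)"
    using i j I c by (intro T.sum_single[symmetric]) auto
  also have "\<dots> = (\<Oplus>\<^bsub>T\<^esub>k\<in>I. \<beta> (L i k) (\<Oplus>\<^bsub>T\<^esub>l\<in>I. \<beta> (D k l) (X l j)))"
    using i j c u z DX by (intro T.sum_cong) (auto simp: DX intro!: bc)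
  also have "\<dots> = (\<Oplus>\<^bsub>T\<^esub>k\<in>I. \<Oplus>\<^bsub>T\<^esub>l\<in>I. \<beta> (\<beta> (L i k) (D k l)) (X l j))"
  proof (rule T.sum_cong[OF refl])
    show "(\<lambda>k. \<Oplus>\<^bsub>T\<^esub>l\<in>I. \<beta> (\<beta> (L i k) (D k l)) (X l j)) \<in> I \<rightarrow> carrier T"
      using i j c bc by (auto intro!: T.sum_closed)
    fix k assume k: "k \<in> I"
    have "\<beta> (L i k) (\<Oplus>\<^bsub>T\<^esub>l\<in>I. \<beta> (D k l) (X l j)) = (\<Oplus>\<^bsub>T\<^esub>l\<in>I. \<beta> (L i k) (\<beta> (D k l) (X l j)))"
      by (rule bilinear_finsum_r[OF T T b cl[OF k] c(1)[OF i k]])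
    also have "\<dots> = (\<Oplus>\<^bsub>T\<^esub>l\<in>I. \<beta> (\<beta> (L i k) (D k l)) (X l j))"
      using i j k c bc by (intro T.sum_cong) (auto simp: assoc)
    finally show "\<beta> (L i k) (\<Oplus>\<^bsub>T\<^esub>l\<in>I. \<beta> (D k l) (X l j)) = (\<Oplus>\<^bsub>T\<^esub>l\<in>I. \<beta> (\<beta> (L i k) (D k l)) (X l j))" .
  qed
  also have "\<dots> = (\<Oplus>\<^bsub>T\<^esub>l\<in>I. \<Oplus>\<^bsub>T\<^esub>k\<in>I. \<beta> (\<beta> (L i k) (D k l)) (X l j))"
    using i j c bc I by (intro T.M.finsum_swap) auto
  also have "\<dots> = (\<Oplus>\<^bsub>T\<^esub>l\<in>I. if i = l then X l j else \<zero>\<^bsub>T\<^esub>)"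
  proof (rule T.sum_cong[OF refl])
    show "(\<lambda>l. if i = l then X l j else \<zero>\<^bsub>T\<^esub>) \<in> I \<rightarrow> carrier T" using j c by auto
    fix l assume l: "l \<in> I"
    have "(\<Oplus>\<^bsub>T\<^esub>k\<in>I. \<beta> (\<beta> (L i k) (D k l)) (X l j)) = \<beta> (\<Oplus>\<^bsub>T\<^esub>k\<in>I. \<beta> (L i k) (D k l)) (X l j)"
      by (rule bilinear_finsum_l[OF T T b cl'[OF l] c(3)[OF l j], symmetric])
    then show "(\<Oplus>\<^bsub>T\<^esub>k\<in>I. \<beta> (\<beta> (L i k) (D k l)) (X l j)) = (if i = l then X l j else \<zero>\<^bsub>T\<^esub>)"
      using LD[OF i l] u(2) z(2) c(3)[OF l j] by simp
  qed
  also have "\<dots> = X i j" using i j I c by (intro T.sum_single) auto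
  finally show ?thesis .
qed

text \<open>A bialgebra structure whose product is a parameter, because the right-hand version of
  the converse uses the opposite product with the same comultiplication.\<close>

locale bialgebra_multiplication = coalgebra K H
  for K :: "('k, 'x) ring_scheme" (structure) and H :: "('k, 'h, 'y) coalgebra_scheme" (structure) +
  fixes \<mu> :: "'h \<Rightarrow> 'h \<Rightarrow> 'h" and \<eta> :: 'h
  assumes mu_bilinear: "bilinear_map K H H H \<mu>"
    and mu_assoc: "\<lbrakk>x \<in> carrier H; y \<in> carrier H; z \<in> carrier H\<rbrakk> \<Longrightarrow> \<mu> (\<mu> x y) z = \<mu> x (\<mu> y z)"
    and eta_closed: "\<eta> \<in> carrier H"
    and mu_unit_l: "x \<in> carrier H \<Longrightarrow> \<mu> \<eta> x = x"
    and mu_unit_r: "x \<in> carrier H \<Longrightarrow> \<mu> x \<eta> = x"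
    and comult_mu: "\<lbrakk>x \<in> carrier H; y \<in> carrier H\<rbrakk> \<Longrightarrow>
      comult H (\<mu> x y) = tensor_bimap K H H \<mu> \<mu> (comult H x) (comult H y)"
    and comult_eta: "comult H \<eta> = pure_tensor K H H \<eta> \<eta>"
    and counit_mu: "\<lbrakk>x \<in> carrier H; y \<in> carrier H\<rbrakk> \<Longrightarrow> counit H (\<mu> x y) = counit H x \<otimes>\<^bsub>K\<^esub> counit H y"
    and counit_eta: "counit H \<eta> = \<one>\<^bsub>K\<^esub>"
begin

lemmas mu_closed = bilinear_mapD(1)[OF mu_bilinear]

abbreviation HH where "HH \<equiv> tensor_space K H H"

lemma vspace_HH: "vspace K HH" using vspace_H by simp

abbreviation bimu where "bimu \<equiv> tensor_bimap K H H \<mu> \<mu>"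

lemma bimu_bilinear: "bilinear_map K HH HH HH bimu"
  by (rule tensor_bimap_bilinear[OF vspace_H vspace_H vspace_H vspace_H vspace_H vspace_H mu_bilinear mu_bilinear])

lemma bimu_pure: "\<lbrakk>a \<in> carrier H; b \<in> carrier H; a' \<in> carrier H; b' \<in> carrier H\<rbrakk> \<Longrightarrow>
    bimu (pure_tensor K H H a b) (pure_tensor K H H a' b') = pure_tensor K H H (\<mu> a a') (\<mu> b b')"
  by (rule tensor_bimap_pure[OF vspace_H vspace_H vspace_H vspace_H vspace_H vspace_H mu_bilinear mu_bilinear])

text \<open>The coefficient matrix of the tensor product of two comodules, in the basis of pairs.
  Multiplicativity of the comultiplication combines the two sums over inner indices into one sum
  over pairs.\<close>

lemma comatrix_product:
  assumes c: "comatrix K H I c" and d: "comatrix K H J d"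
  shows "comatrix K H (I \<times> J) (\<lambda>x y. \<mu> (c (fst x) (fst y)) (d (snd x) (snd y)))"
  unfolding comatrix_def
proof (intro conjI ballI)
  have I: "finite I" "finite J" using c d unfolding comatrix_def by auto
  then show "finite (I \<times> J)" by simp
  have cc: "i \<in> I \<Longrightarrow> k \<in> I \<Longrightarrow> c i k \<in> carrier H" "j \<in> J \<Longrightarrow> l \<in> J \<Longrightarrow> d j l \<in> carrier H" for i k j l
    using c d unfolding comatrix_def by auto
  fix x y assume x: "x \<in> I \<times> J" and y: "y \<in> I \<times> J"
  obtain i j k l where xy: "x = (i, j)" "y = (k, l)" and m: "i \<in> I" "j \<in> J" "k \<in> I" "l \<in> J" using x y by auto
  show "\<mu> (c (fst x) (fst y)) (d (snd x) (snd y)) \<in> carrier H" using xy m cc mu_closed by simp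
  show "counit H (\<mu> (c (fst x) (fst y)) (d (snd x) (snd y))) = (if x = y then \<one>\<^bsub>K\<^esub> else \<zero>\<^bsub>K\<^esub>)"
    using xy m cc c d unfolding comatrix_def by (simp add: counit_mu)
  interpret T: vspace K HH by (rule vspace_HH)
  have p: "(\<lambda>p. pure_tensor K H H (c i p) (c p k)) \<in> I \<rightarrow> carrier HH" using cc m vspace_H by auto
  have q: "(\<lambda>q. pure_tensor K H H (d j q) (d q l)) \<in> J \<rightarrow> carrier HH" using cc m vspace_H by auto
  have "comult H (\<mu> (c i k) (d j l)) = bimu (comult H (c i k)) (comult H (d j l))"
    using cc m by (simp add: comult_mu)
  also have "\<dots> = bimu (\<Oplus>\<^bsub>HH\<^esub>p\<in>I. pure_tensor K H H (c i p) (c p k)) (\<Oplus>\<^bsub>HH\<^esub>q\<in>J. pure_tensor K H H (d j q) (d q l))"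
    using m c d unfolding comatrix_def by simp
  also have "\<dots> = (\<Oplus>\<^bsub>HH\<^esub>p\<in>I. \<Oplus>\<^bsub>HH\<^esub>q\<in>J.
      bimu (pure_tensor K H H (c i p) (c p k)) (pure_tensor K H H (d j q) (d q l)))"
    by (rule bilinear_finsum2[OF vspace_HH vspace_HH vspace_HH bimu_bilinear p q I])
  also have "\<dots> = (\<Oplus>\<^bsub>HH\<^esub>z\<in>I \<times> J.
      bimu (pure_tensor K H H (c i (fst z)) (c (fst z) k)) (pure_tensor K H H (d j (snd z)) (d (snd z) l)))"
    using p q bilinear_mapD(1)[OF bimu_bilinear] by (intro T.M.finsum_Times[OF I]) auto
  also have "\<dots> = (\<Oplus>\<^bsub>HH\<^esub>z\<in>I \<times> J.
      pure_tensor K H H (\<mu> (c i (fst z)) (d j (snd z))) (\<mu> (c (fst z) k) (d (snd z) l)))"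
    using cc m vspace_H mu_closed by (intro T.sum_cong) (auto simp: bimu_pure)
  finally show "comult H (\<mu> (c (fst x) (fst y)) (d (snd x) (snd y))) =
    (\<Oplus>\<^bsub>HH\<^esub>z\<in>I \<times> J. pure_tensor K H H (\<mu> (c (fst x) (fst z)) (d (snd x) (snd z))) (\<mu> (c (fst z) (fst y)) (d (snd z) (snd y))))"
    using xy by simp
qed

lemma bimu_assoc:
  assumes "r \<in> carrier HH" "s \<in> carrier HH" "t \<in> carrier HH"
  shows "bimu (bimu r s) t = bimu r (bimu s t)"
proof (rule tensor_ext[OF vspace_H vspace_H vspace_HH _ _ _ assms(1)])
  note b = bimu_bilinear and bl = bilinear_map_linear[OF bimu_bilinear]
  note st = bilinear_mapD(1)[OF b assms(2,3)]
  show "linear_map K HH HH (\<lambda>r. bimu (bimu r s) t)" by (rule linear_map_comp[OF bl(2)[OF assms(2)] bl(2)[OF assms(3)]])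
  show "linear_map K HH HH (\<lambda>r. bimu r (bimu s t))" by (rule bl(2)[OF st])
  fix x y assume xy: "x \<in> carrier H" "y \<in> carrier H"
  then have p: "pure_tensor K H H x y \<in> carrier HH" using vspace_H by simp
  have "bilinear_map K HH HH HH (\<lambda>s t. bimu (bimu (pure_tensor K H H x y) s) t)"
    by (rule bilinear_comp_id[OF b bl(1)[OF p] linear_map_id])
  moreover have "bilinear_map K HH HH HH (\<lambda>s t. bimu (pure_tensor K H H x y) (bimu s t))"
    by (rule bilinear_map_comp[OF b linear_map_id linear_map_id bl(1)[OF p]])
  ultimately show "bimu (bimu (pure_tensor K H H x y) s) t = bimu (pure_tensor K H H x y) (bimu s t)"
    by (rule tensor_ext2[OF vspace_H vspace_H vspace_H vspace_H vspace_HH _ _ _ assms(2,3)])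
      (simp add: xy bimu_pure mu_closed mu_assoc)
qed

lemma bimu_unit:
  assumes t: "t \<in> carrier HH"
  shows "bimu (pure_tensor K H H \<eta> \<eta>) t = t" "bimu t (pure_tensor K H H \<eta> \<eta>) = t"
proof -
  have p: "pure_tensor K H H \<eta> \<eta> \<in> carrier HH" using eta_closed vspace_H by simp
  show "bimu (pure_tensor K H H \<eta> \<eta>) t = t"
    by (rule tensor_ext[OF vspace_H vspace_H vspace_HH bilinear_map_linear(1)[OF bimu_bilinear p] linear_map_id _ t])
      (simp add: bimu_pure eta_closed mu_unit_l)
  show "bimu t (pure_tensor K H H \<eta> \<eta>) = t"
    by (rule tensor_ext[OF vspace_H vspace_H vspace_HH bilinear_map_linear(2)[OF bimu_bilinear p] linear_map_id _ t])
      (simp add: bimu_pure eta_closed mu_unit_r)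
qed

end

lemma (in bialgebra) bialgebra_multiplication_mult: "bialgebra_multiplication K H (mult H) \<one>\<^bsub>H\<^esub>"
proof -
  have c: "comult H \<in> ring_hom H (tensor_algebra K H H)" "counit H \<in> ring_hom H (ground_algebra K)"
    using comult_algebra_hom counit_algebra_hom unfolding algebra_hom_def by auto
  show ?thesis
  proof (intro bialgebra_multiplication.intro coalgebra_axioms bialgebra_multiplication_axioms.intro mult_bilinear)
    show "comult H (x \<otimes>\<^bsub>H\<^esub> y) = tensor_bimap K H H (mult H) (mult H) (comult H x) (comult H y)"
      if "x \<in> carrier H" "y \<in> carrier H" for x y
      using ring_hom_mult[OF c(1) that] by (simp add: tensor_algebra_def)
    show "comult H \<one>\<^bsub>H\<^esub> = pure_tensor K H H \<one>\<^bsub>H\<^esub> \<one>\<^bsub>H\<^esub>"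
      using ring_hom_one[OF c(1)] by (simp add: tensor_algebra_def)
    show "counit H (x \<otimes>\<^bsub>H\<^esub> y) = counit H x \<otimes>\<^bsub>K\<^esub> counit H y" if "x \<in> carrier H" "y \<in> carrier H" for x y
      using ring_hom_mult[OF c(2) that] by simp
    show "counit H \<one>\<^bsub>H\<^esub> = \<one>\<^bsub>K\<^esub>" using ring_hom_one[OF c(2)] by simp
  qed (simp_all add: A.m_assoc)
qed

lemma (in bialgebra) bialgebra_multiplication_flip: "bialgebra_multiplication K H (\<lambda>x y. y \<otimes>\<^bsub>H\<^esub> x) \<one>\<^bsub>H\<^esub>"
proof -
  interpret B: bialgebra_multiplication K H "mult H" "\<one>\<^bsub>H\<^esub>" by (rule bialgebra_multiplication_mult)
  show ?thesis
  proof (intro bialgebra_multiplication.intro coalgebra_axioms bialgebra_multiplication_axioms.intro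
      bilinear_map_swap[OF mult_bilinear])
    show "comult H (y \<otimes>\<^bsub>H\<^esub> x) = tensor_bimap K H H (\<lambda>x y. y \<otimes>\<^bsub>H\<^esub> x) (\<lambda>x y. y \<otimes>\<^bsub>H\<^esub> x) (comult H x) (comult H y)"
      if "x \<in> carrier H" "y \<in> carrier H" for x y
      unfolding B.comult_mu[OF that(2,1)]
      by (rule tensor_bimap_flip[OF vspace_H vspace_H vspace_H vspace_H vspace_H vspace_H mult_bilinear mult_bilinear
        linear_mapD(1)[OF comult_linear that(2)] linear_mapD(1)[OF comult_linear that(1)]])
    show "counit H (y \<otimes>\<^bsub>H\<^esub> x) = counit H x \<otimes>\<^bsub>K\<^esub> counit H y" if "x \<in> carrier H" "y \<in> carrier H" for x y
      using B.counit_mu[OF that(2,1)] functional_closed[OF counit_linear] that by (simp add: K.m_comm)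
  qed (simp_all add: A.m_assoc B.comult_eta B.counit_eta)
qed

context hopf_algebra
begin

text \<open>The antipode axiom for \<open>c i j\<close>, read with the comatrix formula for its
  comultiplication. Together with \<open>comatrix_antipode_l\<close>, it makes the matrix of
  antipodes the inverse of the comatrix over \<open>H\<close>.\<close>

lemma comatrix_antipode_r:
  assumes c: "comatrix K H I c" and i: "i \<in> I" and j: "j \<in> I"
  shows "(\<Oplus>\<^bsub>H\<^esub>k\<in>I. c i k \<otimes>\<^bsub>H\<^esub> antipode H (c k j)) = (if i = j then \<one>\<^bsub>H\<^esub> else \<zero>\<^bsub>H\<^esub>)"
proof -
  interpret HV: vspace K H by (rule vspace_H)
  have cc: "i \<in> I \<Longrightarrow> j \<in> I \<Longrightarrow> c i j \<in> carrier H" for i j using c unfolding comatrix_def by blast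
  have p: "(\<lambda>k. pure_tensor K H H (c i k) (c k j)) \<in> I \<rightarrow> carrier (tensor_space K H H)" using cc i j vspace_H by auto
  note b = bilinear_comp_id[OF mult_bilinear linear_map_id antipode_linear]
  have vHH: "vspace K (tensor_space K H H)" using vspace_H by simp
  have "(\<Oplus>\<^bsub>H\<^esub>k\<in>I. c i k \<otimes>\<^bsub>H\<^esub> antipode H (c k j)) =
      (\<Oplus>\<^bsub>H\<^esub>k\<in>I. tensor_lift K H (\<lambda>x y. x \<otimes>\<^bsub>H\<^esub> antipode H y) (pure_tensor K H H (c i k) (c k j)))"
    using cc i j bilinear_mapD(1)[OF b]
    by (intro HV.sum_cong) (auto simp: tensor_lift_pure_tensor[OF vspace_H vspace_H vspace_H b])
  also have "\<dots> = tensor_lift K H (\<lambda>x y. x \<otimes>\<^bsub>H\<^esub> antipode H y) (\<Oplus>\<^bsub>tensor_space K H H\<^esub>k\<in>I. pure_tensor K H H (c i k) (c k j))"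
    by (rule linear_map_finsum[OF vHH vspace_H tensor_lift_is_linear[OF vspace_H vspace_H vspace_H b] p, symmetric])
  also have "\<dots> = counit H (c i j) \<odot>\<^bsub>H\<^esub> \<one>\<^bsub>H\<^esub>"
    using antipode_r[OF cc[OF i j]] c i j unfolding comatrix_def by simp
  also have "\<dots> = (if i = j then \<one>\<^bsub>H\<^esub> else \<zero>\<^bsub>H\<^esub>)" using c i j unfolding comatrix_def by simp
  finally show ?thesis .
qed

lemma comatrix_antipode_l:
  assumes c: "comatrix K H I c" and i: "i \<in> I" and j: "j \<in> I"
  shows "(\<Oplus>\<^bsub>H\<^esub>k\<in>I. antipode H (c i k) \<otimes>\<^bsub>H\<^esub> c k j) = (if i = j then \<one>\<^bsub>H\<^esub> else \<zero>\<^bsub>H\<^esub>)"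
proof -
  interpret HV: vspace K H by (rule vspace_H)
  have cc: "i \<in> I \<Longrightarrow> j \<in> I \<Longrightarrow> c i j \<in> carrier H" for i j using c unfolding comatrix_def by blast
  have p: "(\<lambda>k. pure_tensor K H H (c i k) (c k j)) \<in> I \<rightarrow> carrier (tensor_space K H H)" using cc i j vspace_H by auto
  note b = bilinear_comp_id[OF mult_bilinear antipode_linear linear_map_id]
  have vHH: "vspace K (tensor_space K H H)" using vspace_H by simp
  have "(\<Oplus>\<^bsub>H\<^esub>k\<in>I. antipode H (c i k) \<otimes>\<^bsub>H\<^esub> c k j) =
      (\<Oplus>\<^bsub>H\<^esub>k\<in>I. tensor_lift K H (\<lambda>x y. antipode H x \<otimes>\<^bsub>H\<^esub> y) (pure_tensor K H H (c i k) (c k j)))"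
    using cc i j bilinear_mapD(1)[OF b]
    by (intro HV.sum_cong) (auto simp: tensor_lift_pure_tensor[OF vspace_H vspace_H vspace_H b])
  also have "\<dots> = tensor_lift K H (\<lambda>x y. antipode H x \<otimes>\<^bsub>H\<^esub> y) (\<Oplus>\<^bsub>tensor_space K H H\<^esub>k\<in>I. pure_tensor K H H (c i k) (c k j))"
    by (rule linear_map_finsum[OF vHH vspace_H tensor_lift_is_linear[OF vspace_H vspace_H vspace_H b] p, symmetric])
  also have "\<dots> = counit H (c i j) \<odot>\<^bsub>H\<^esub> \<one>\<^bsub>H\<^esub>"
    using antipode_l[OF cc[OF i j]] c i j unfolding comatrix_def by simp
  also have "\<dots> = (if i = j then \<one>\<^bsub>H\<^esub> else \<zero>\<^bsub>H\<^esub>)" using c i j unfolding comatrix_def by simp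
  finally show ?thesis .
qed

text \<open>
  \<open>\<Delta>(S c\<^sub>i\<^sub>j) = \<Sum>\<^sub>k S c\<^sub>k\<^sub>j \<otimes> S c\<^sub>i\<^sub>k\<close>, because both sides are inverse to the matrix \<open>(\<Delta> c\<^sub>i\<^sub>j)\<close> over \<open>H \<otimes> H\<close>.
\<close>

lemma comatrix_dual:
  assumes c: "comatrix K H I c"
  shows "comatrix K H I (\<lambda>i j. antipode H (c j i))"
proof -
  interpret B: bialgebra_multiplication K H "mult H" "\<one>\<^bsub>H\<^esub>" by (rule bialgebra_multiplication_mult)
  interpret HV: vspace K H by (rule vspace_H)
  interpret T: vspace K B.HH by (rule B.vspace_HH)
  interpret HH: vspace_pair K H H by (intro vspace_pair.intro vspace_H)
  have I: "finite I" using c unfolding comatrix_def by blast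
  have cc: "i \<in> I \<Longrightarrow> j \<in> I \<Longrightarrow> c i j \<in> carrier H" for i j using c unfolding comatrix_def by blast
  let ?S = "antipode H" and ?P = "pure_tensor K H H"
  have Sc: "i \<in> I \<Longrightarrow> j \<in> I \<Longrightarrow> ?S (c i j) \<in> carrier H" for i j by (rule linear_mapD(1)[OF antipode_linear cc])
  have one: "\<one>\<^bsub>H\<^esub> \<in> carrier H" by simp
  have P1: "?P \<one>\<^bsub>H\<^esub> \<one>\<^bsub>H\<^esub> \<in> carrier B.HH" using one vspace_H by simp
  \<comment> \<open>The claimed value of the comultiplication of the antipode of
    \<open>c i j\<close>; it will be a right inverse of the matrix of comultiplications.\<close>
  define X where "X i j = (\<Oplus>\<^bsub>B.HH\<^esub>k\<in>I. ?P (?S (c k j)) (?S (c i k)))" for i j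
  have xcl: "(\<lambda>k. ?P (?S (c k j)) (?S (c i k))) \<in> I \<rightarrow> carrier B.HH" if "i \<in> I" "j \<in> I" for i j
    using Sc that vspace_H by auto
  have pcl: "(\<lambda>k. ?P (c i k) (c k j)) \<in> I \<rightarrow> carrier B.HH" if "i \<in> I" "j \<in> I" for i j
    using cc that vspace_H by auto
  \<comment> \<open>Expanding both factors gives terms
    \<open>c_ip S(c_qj) \<otimes> c_pk S(c_kq)\<close>. Summing over \<open>k\<close> first makes
    the right leg an entry of the identity matrix, which forces \<open>p = q\<close>; the left leg
    then collapses in the same way.\<close>
  have DX: "(\<Oplus>\<^bsub>B.HH\<^esub>k\<in>I. B.bimu (comult H (c i k)) (X k j)) = (if i = j then ?P \<one>\<^bsub>H\<^esub> \<one>\<^bsub>H\<^esub> else \<zero>\<^bsub>B.HH\<^esub>)"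
    if i: "i \<in> I" and j: "j \<in> I" for i j
  proof -
    have mc: "a \<in> I \<Longrightarrow> b \<in> I \<Longrightarrow> x \<in> I \<Longrightarrow> y \<in> I \<Longrightarrow> c a b \<otimes>\<^bsub>H\<^esub> ?S (c x y) \<in> carrier H" for a b x y
      using B.mu_closed[OF cc Sc] by simp
    have pc: "a \<in> carrier H \<Longrightarrow> b \<in> carrier H \<Longrightarrow> ?P a b \<in> carrier B.HH" for a b using vspace_H by simp
    have "(\<Oplus>\<^bsub>B.HH\<^esub>k\<in>I. B.bimu (comult H (c i k)) (X k j)) =
        (\<Oplus>\<^bsub>B.HH\<^esub>k\<in>I. \<Oplus>\<^bsub>B.HH\<^esub>p\<in>I. \<Oplus>\<^bsub>B.HH\<^esub>q\<in>I. ?P (c i p \<otimes>\<^bsub>H\<^esub> ?S (c q j)) (c p k \<otimes>\<^bsub>H\<^esub> ?S (c k q)))"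
    proof (rule T.sum_cong[OF refl])
      show "(\<lambda>k. \<Oplus>\<^bsub>B.HH\<^esub>p\<in>I. \<Oplus>\<^bsub>B.HH\<^esub>q\<in>I. ?P (c i p \<otimes>\<^bsub>H\<^esub> ?S (c q j)) (c p k \<otimes>\<^bsub>H\<^esub> ?S (c k q))) \<in> I \<rightarrow> carrier B.HH"
        using i j mc by (auto intro!: T.sum_closed pc)
      fix k assume k: "k \<in> I"
      have "B.bimu (comult H (c i k)) (X k j) =
          B.bimu (\<Oplus>\<^bsub>B.HH\<^esub>p\<in>I. ?P (c i p) (c p k)) (\<Oplus>\<^bsub>B.HH\<^esub>q\<in>I. ?P (?S (c q j)) (?S (c k q)))"
        using c i k unfolding comatrix_def X_def by simp
      also have "\<dots> = (\<Oplus>\<^bsub>B.HH\<^esub>p\<in>I. \<Oplus>\<^bsub>B.HH\<^esub>q\<in>I. B.bimu (?P (c i p) (c p k)) (?P (?S (c q j)) (?S (c k q))))"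
        by (rule bilinear_finsum2[OF B.vspace_HH B.vspace_HH B.vspace_HH B.bimu_bilinear pcl[OF i k] xcl[OF k j] I I])
      also have "\<dots> = (\<Oplus>\<^bsub>B.HH\<^esub>p\<in>I. \<Oplus>\<^bsub>B.HH\<^esub>q\<in>I. ?P (c i p \<otimes>\<^bsub>H\<^esub> ?S (c q j)) (c p k \<otimes>\<^bsub>H\<^esub> ?S (c k q)))"
        using i j k cc Sc mc by (intro T.sum_cong) (auto simp: B.bimu_pure intro!: T.sum_cong T.sum_closed pc)
      finally show "B.bimu (comult H (c i k)) (X k j) =
        (\<Oplus>\<^bsub>B.HH\<^esub>p\<in>I. \<Oplus>\<^bsub>B.HH\<^esub>q\<in>I. ?P (c i p \<otimes>\<^bsub>H\<^esub> ?S (c q j)) (c p k \<otimes>\<^bsub>H\<^esub> ?S (c k q)))" .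
    qed
    also have "\<dots> = (\<Oplus>\<^bsub>B.HH\<^esub>p\<in>I. \<Oplus>\<^bsub>B.HH\<^esub>k\<in>I. \<Oplus>\<^bsub>B.HH\<^esub>q\<in>I. ?P (c i p \<otimes>\<^bsub>H\<^esub> ?S (c q j)) (c p k \<otimes>\<^bsub>H\<^esub> ?S (c k q)))"
      using i j mc by (intro T.M.finsum_swap[OF I I]) (auto intro!: T.sum_closed pc)
    also have "\<dots> = (\<Oplus>\<^bsub>B.HH\<^esub>p\<in>I. \<Oplus>\<^bsub>B.HH\<^esub>q\<in>I. \<Oplus>\<^bsub>B.HH\<^esub>k\<in>I. ?P (c i p \<otimes>\<^bsub>H\<^esub> ?S (c q j)) (c p k \<otimes>\<^bsub>H\<^esub> ?S (c k q)))"
      using i j mc by (intro T.sum_cong T.M.finsum_swap[OF I I]) (auto intro!: T.sum_closed pc)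
    also have "\<dots> = (\<Oplus>\<^bsub>B.HH\<^esub>p\<in>I. \<Oplus>\<^bsub>B.HH\<^esub>q\<in>I. if p = q then ?P (c i p \<otimes>\<^bsub>H\<^esub> ?S (c q j)) \<one>\<^bsub>H\<^esub> else \<zero>\<^bsub>B.HH\<^esub>)"
    proof -
      have "(\<Oplus>\<^bsub>B.HH\<^esub>k\<in>I. ?P (c i p \<otimes>\<^bsub>H\<^esub> ?S (c q j)) (c p k \<otimes>\<^bsub>H\<^esub> ?S (c k q))) =
          (if p = q then ?P (c i p \<otimes>\<^bsub>H\<^esub> ?S (c q j)) \<one>\<^bsub>H\<^esub> else \<zero>\<^bsub>B.HH\<^esub>)" if p: "p \<in> I" and q: "q \<in> I" for p q
      proof -
        have cl: "(\<lambda>k. c p k \<otimes>\<^bsub>H\<^esub> ?S (c k q)) \<in> I \<rightarrow> carrier H" using mc p q by auto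
        note m = mc[OF i p q j]
        have "(\<Oplus>\<^bsub>B.HH\<^esub>k\<in>I. ?P (c i p \<otimes>\<^bsub>H\<^esub> ?S (c q j)) (c p k \<otimes>\<^bsub>H\<^esub> ?S (c k q))) =
            ?P (c i p \<otimes>\<^bsub>H\<^esub> ?S (c q j)) (\<Oplus>\<^bsub>H\<^esub>k\<in>I. c p k \<otimes>\<^bsub>H\<^esub> ?S (c k q))"
          by (rule bilinear_finsum_r[OF vspace_H B.vspace_HH HH.pure_bilinear cl m, symmetric])
        then show ?thesis
          using comatrix_antipode_r[OF c p q]
            linear_map_zero[OF vspace_H B.vspace_HH bilinear_map_linear(1)[OF HH.pure_bilinear m]] by simp
      qed
      then show ?thesis
        using i j mc one by (intro T.sum_cong) (auto intro!: T.sum_closed T.sum_cong pc)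
    qed
    also have "\<dots> = (\<Oplus>\<^bsub>B.HH\<^esub>p\<in>I. ?P (c i p \<otimes>\<^bsub>H\<^esub> ?S (c p j)) \<one>\<^bsub>H\<^esub>)"
    proof (rule T.sum_cong[OF refl])
      show "(\<lambda>p. ?P (c i p \<otimes>\<^bsub>H\<^esub> ?S (c p j)) \<one>\<^bsub>H\<^esub>) \<in> I \<rightarrow> carrier B.HH" using i j mc one by (auto intro!: pc)
      fix p assume p: "p \<in> I"
      show "(\<Oplus>\<^bsub>B.HH\<^esub>q\<in>I. if p = q then ?P (c i p \<otimes>\<^bsub>H\<^esub> ?S (c q j)) \<one>\<^bsub>H\<^esub> else \<zero>\<^bsub>B.HH\<^esub>) = ?P (c i p \<otimes>\<^bsub>H\<^esub> ?S (c p j)) \<one>\<^bsub>H\<^esub>"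
        using i j p mc one by (intro T.sum_single I) (auto intro!: pc)
    qed
    also have "\<dots> = ?P (\<Oplus>\<^bsub>H\<^esub>p\<in>I. c i p \<otimes>\<^bsub>H\<^esub> ?S (c p j)) \<one>\<^bsub>H\<^esub>"
      using mc i j by (intro bilinear_finsum_l[OF vspace_H B.vspace_HH HH.pure_bilinear _ one, symmetric]) auto
    also have "\<dots> = (if i = j then ?P \<one>\<^bsub>H\<^esub> \<one>\<^bsub>H\<^esub> else \<zero>\<^bsub>B.HH\<^esub>)"
      using comatrix_antipode_r[OF c i j]
        linear_map_zero[OF vspace_H B.vspace_HH bilinear_map_linear(2)[OF HH.pure_bilinear one]] by simp
    finally show ?thesis .
  qed
  \<comment> \<open>The left inverse comes from applying the multiplicative map
    \<open>comult H\<close> to the antipode identity over \<open>H\<close>.\<close>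
  have LD: "(\<Oplus>\<^bsub>B.HH\<^esub>k\<in>I. B.bimu (comult H (?S (c i k))) (comult H (c k j))) = (if i = j then ?P \<one>\<^bsub>H\<^esub> \<one>\<^bsub>H\<^esub> else \<zero>\<^bsub>B.HH\<^esub>)"
    if i: "i \<in> I" and j: "j \<in> I" for i j
  proof -
    have cl: "(\<lambda>k. ?S (c i k) \<otimes>\<^bsub>H\<^esub> c k j) \<in> I \<rightarrow> carrier H" using i j cc Sc by auto
    have "(\<Oplus>\<^bsub>B.HH\<^esub>k\<in>I. B.bimu (comult H (?S (c i k))) (comult H (c k j))) =
        (\<Oplus>\<^bsub>B.HH\<^esub>k\<in>I. comult H (?S (c i k) \<otimes>\<^bsub>H\<^esub> c k j))"
      using i j cc Sc linear_mapD(1)[OF comult_linear] by (intro T.sum_cong) (auto simp: B.comult_mu intro!: bilinear_mapD(1)[OF B.bimu_bilinear])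
    also have "\<dots> = comult H (\<Oplus>\<^bsub>H\<^esub>k\<in>I. ?S (c i k) \<otimes>\<^bsub>H\<^esub> c k j)"
      by (rule linear_map_finsum[OF vspace_H B.vspace_HH comult_linear cl, symmetric])
    also have "\<dots> = (if i = j then ?P \<one>\<^bsub>H\<^esub> \<one>\<^bsub>H\<^esub> else \<zero>\<^bsub>B.HH\<^esub>)"
      using comatrix_antipode_l[OF c i j] B.comult_eta linear_map_zero[OF vspace_H B.vspace_HH comult_linear] by simp
    finally show ?thesis .
  qed
  have comS: "comult H (?S (c i j)) = X i j" if i: "i \<in> I" and j: "j \<in> I" for i j
    using matrix_inverse_unique[of K B.HH B.bimu "?P \<one>\<^bsub>H\<^esub> \<one>\<^bsub>H\<^esub>" I "\<lambda>i j. comult H (?S (c i j))" "\<lambda>i j. comult H (c i j)" X,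
      OF B.vspace_HH B.bimu_bilinear B.bimu_assoc P1 B.bimu_unit I
      linear_mapD(1)[OF comult_linear Sc] linear_mapD(1)[OF comult_linear cc] _ LD DX i j]
      T.sum_closed[OF xcl] unfolding X_def by blast
  show ?thesis
    unfolding comatrix_def
  proof (intro conjI ballI I)
    fix i j assume i: "i \<in> I" and j: "j \<in> I"
    show "?S (c j i) \<in> carrier H" by (rule Sc[OF j i])
    show "comult H (?S (c j i)) = (\<Oplus>\<^bsub>B.HH\<^esub>k\<in>I. ?P (?S (c k i)) (?S (c j k)))"
      unfolding comS[OF j i] X_def ..
    have cK: "counit H x \<in> carrier K" if "x \<in> carrier H" for x using functional_closed[OF counit_linear that] .
    have cl: "(\<lambda>k. ?S (c j k) \<otimes>\<^bsub>H\<^esub> c k i) \<in> I \<rightarrow> carrier H" using i j cc Sc by auto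
    \<comment> \<open>The counit of \<open>c k i\<close> is a Kronecker symbol; inserting it as a
      factor turns the value into the counit of an antipode identity.\<close>
    have "counit H (?S (c j i)) = (\<Oplus>\<^bsub>K\<^esub>k\<in>I. if i = k then counit H (?S (c j k)) else \<zero>\<^bsub>K\<^esub>)"
      using i j I cK Sc by (intro K.add.finprod_singleton[symmetric]) auto
    also have "\<dots> = (\<Oplus>\<^bsub>K\<^esub>k\<in>I. counit H (?S (c j k) \<otimes>\<^bsub>H\<^esub> c k i))"
      using i j cK cc Sc c unfolding comatrix_def by (intro K.add.finprod_cong') (auto simp: B.counit_mu)
    also have "\<dots> = counit H (\<Oplus>\<^bsub>H\<^esub>k\<in>I. ?S (c j k) \<otimes>\<^bsub>H\<^esub> c k i)"
      using linear_map_finsum[OF vspace_H HV.vspace_ground counit_linear cl] by simp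
    also have "\<dots> = (if i = j then \<one>\<^bsub>K\<^esub> else \<zero>\<^bsub>K\<^esub>)"
      using comatrix_antipode_l[OF c j i] B.counit_eta HV.functional_zero[OF counit_linear] by auto
    finally show "counit H (?S (c j i)) = (if i = j then \<one>\<^bsub>K\<^esub> else \<zero>\<^bsub>K\<^esub>)" .
  qed
qed

end

section \<open>Simple comatrices\<close>

lemma (in field) free_module_finite_basis:
  assumes "finite I"
  shows "finite_basis R (free_module R I) I (single R) (\<lambda>i x. x i)"
proof -
  interpret F: vspace R "free_module R I" by (rule vspace_free_module)
  have ev: "functional R (free_module R I) (\<lambda>x. x i)" for i
    by (rule linear_mapI) (auto dest: finsuppD(1))
  have sc: "i \<in> I \<Longrightarrow> single R i \<in> carrier (free_module R I)" for i using single_finsupp by simp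
  have exp: "(\<Oplus>\<^bsub>free_module R I\<^esub>i\<in>I. y i \<odot>\<^bsub>free_module R I\<^esub> single R i) = y" if y: "y \<in> carrier (free_module R I)" for y
  proof
    fix b
    have yc: "y i \<in> carrier R" for i using finsuppD(1) y by simp
    have cl: "(\<lambda>i. y i \<odot>\<^bsub>free_module R I\<^esub> single R i) \<in> I \<rightarrow> carrier (free_module R I)"
      by (intro Pi_I F.scale_closed yc sc)
    have "(\<Oplus>\<^bsub>free_module R I\<^esub>i\<in>I. y i \<odot>\<^bsub>free_module R I\<^esub> single R i) b = (\<Oplus>i\<in>I. y i \<otimes> single R i b)"
      using linear_map_finsum[OF F.vspace_axioms F.vspace_ground ev[of b] cl] by simp
    also have "\<dots> = (\<Oplus>i\<in>I. if b = i then y i else \<zero>)"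
      using yc by (intro add.finprod_cong') (auto simp: single_def)
    also have "\<dots> = y b"
    proof (cases "b \<in> I")
      case True
      then show ?thesis using assms yc by (intro finsum_singleton) auto
    next
      case False
      then have "(\<Oplus>i\<in>I. if b = i then y i else \<zero>) = \<zero>" by (intro add.finprod_one_eqI) auto
      then show ?thesis using False y finsuppD(2)[of y I b] by simp
    qed
    finally show "(\<Oplus>\<^bsub>free_module R I\<^esub>i\<in>I. y i \<odot>\<^bsub>free_module R I\<^esub> single R i) b = y b" .
  qed
  show ?thesis
    by (intro finite_basis.intro F.vspace_axioms finite_basis_axioms.intro assms sc ev exp) (auto simp: single_def)
qed

text \<open>The comodule with comatrix \<open>c\<close> on the concrete space \<open>K^n\<close>. A
  fixed model for every \<open>n\<close> makes simplicity a property of the comatrix alone, so that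
  a least \<open>n\<close> can be chosen.\<close>

definition coord_comodule ::
    "('k, 'x) ring_scheme \<Rightarrow> ('k, 'h, 'y) coalgebra_scheme \<Rightarrow> nat \<Rightarrow> (nat \<Rightarrow> nat \<Rightarrow> 'h) \<Rightarrow> ('k, nat \<Rightarrow> 'k, 'h) comodule"
  where "coord_comodule K H n c = as_comodule (free_module K {..<n})
    (comatrix_comodule.coaction K H (free_module K {..<n}) {..<n} (single K) (\<lambda>i x. x i) c)"

definition simple_comatrix ::
    "('k, 'x) ring_scheme \<Rightarrow> ('k, 'h, 'y) coalgebra_scheme \<Rightarrow> nat \<Rightarrow> (nat \<Rightarrow> nat \<Rightarrow> 'h) \<Rightarrow> bool"
  where "simple_comatrix K H n c \<longleftrightarrow> comatrix K H {..<n} c \<and>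
    (\<forall>U. subcomodule K H (coord_comodule K H n c) U \<longrightarrow> U = {\<lambda>_. \<zero>\<^bsub>K\<^esub>} \<or> U = finsupp K {..<n})"

context coalgebra
begin

lemma coord_comatrix_comodule:
  assumes "comatrix K H {..<n::nat} c"
  shows "comatrix_comodule K H (free_module K {..<n}) {..<n} (single K) (\<lambda>i x. x i) c"
  by (intro comatrix_comodule.intro coalgebra_axioms K.free_module_finite_basis comatrix_comodule_axioms.intro assms finite_lessThan)

lemma coord_comodule: "comatrix K H {..<n} c \<Longrightarrow> left_comodule K H (coord_comodule K H n c)"
  unfolding coord_comodule_def by (rule comatrix_comodule.comodule[OF coord_comatrix_comodule])

lemma coord_dual_act_linear:
  assumes "comatrix K H {..<n} c" "functional K H f"
  shows "linear_map K (free_module K {..<n}) (free_module K {..<n}) (dual_act K (coord_comodule K H n c) f)"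
  using left_comodule.dual_act_linear[OF coord_comodule[OF assms(1)] assms(2)]
  unfolding coord_comodule_def by simp

lemma coord_dual_act_single:
  assumes "comatrix K H {..<n} c" "functional K H f" "i < n"
  shows "dual_act K (coord_comodule K H n c) f (single K i) =
    (\<Oplus>\<^bsub>free_module K {..<n}\<^esub>j\<in>{..<n}. f (c i j) \<odot>\<^bsub>free_module K {..<n}\<^esub> single K j)"
  unfolding coord_comodule_def
  using comatrix_comodule.slice_coaction_basis[OF coord_comatrix_comodule[OF assms(1)] assms(2), of i] assms(3) by simp

lemma comatrix_reindex:
  assumes c: "comatrix K H I c" and h: "bij_betw h J I"
  shows "comatrix K H J (\<lambda>i j. c (h i) (h j))"
  unfolding comatrix_def
proof (intro conjI ballI)
  have HHv: "vspace K (tensor_space K H H)" using vspace_H by simp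
  interpret T: vspace K "tensor_space K H H" by (rule HHv)
  have inj: "inj_on h J" and im: "h ` J = I" using h by (auto simp: bij_betw_def)
  have hI: "j \<in> J \<Longrightarrow> h j \<in> I" for j using im by blast
  have cc: "i \<in> I \<Longrightarrow> j \<in> I \<Longrightarrow> c i j \<in> carrier H" for i j using c unfolding comatrix_def by blast
  show "finite J" using bij_betw_finite[OF h] c unfolding comatrix_def by blast
  fix i j assume i: "i \<in> J" and j: "j \<in> J"
  show "c (h i) (h j) \<in> carrier H" using cc hI i j by blast
  show "counit H (c (h i) (h j)) = (if i = j then \<one>\<^bsub>K\<^esub> else \<zero>\<^bsub>K\<^esub>)"
    using c hI[OF i] hI[OF j] inj i j unfolding comatrix_def by (auto simp: inj_on_eq_iff)
  have "comult H (c (h i) (h j)) = (\<Oplus>\<^bsub>tensor_space K H H\<^esub>k\<in>h ` J. pure_tensor K H H (c (h i) k) (c k (h j)))"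
    using c hI[OF i] hI[OF j] unfolding comatrix_def im by blast
  also have "\<dots> = (\<Oplus>\<^bsub>tensor_space K H H\<^esub>k\<in>J. pure_tensor K H H (c (h i) (h k)) (c (h k) (h j)))"
    using cc hI i j vspace_H by (intro T.M.finsum_reindex inj) auto
  finally show "comult H (c (h i) (h j)) =
      (\<Oplus>\<^bsub>tensor_space K H H\<^esub>k\<in>J. pure_tensor K H H (c (h i) (h k)) (c (h k) (h j)))" .
qed

lemma comatrix_one_grouplike:
  assumes "comatrix K H {..<1::nat} c"
  shows "grouplike K H (c 0 0)"
proof -
  interpret HH: vspace_pair K H H by (intro vspace_pair.intro vspace_H)
  have c: "c 0 0 \<in> carrier H" "counit H (c 0 0) = \<one>\<^bsub>K\<^esub>"
    "comult H (c 0 0) = (\<Oplus>\<^bsub>tensor_space K H H\<^esub>k\<in>{..<1}. pure_tensor K H H (c 0 k) (c k 0))"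
    using assms unfolding comatrix_def by auto
  have "{..<1::nat} = {0}" by auto
  then show ?thesis using c HH.pure_simps(1) unfolding grouplike_def by simp
qed

end

context left_comodule
begin

text \<open>The vectors \<open>e\<close> come from \<open>minimal_subcomodule\<close> over the zero
  subcomodule, and \<open>\<Theta>\<close> identifies the model on \<open>K^n\<close> with their
  span. The last conclusion, that no generating set inside \<open>P\<close> is smaller, stands for
  the statement that \<open>n\<close> is the dimension.\<close>

lemma simple_subcomodule_comatrix:
  assumes P: "subcomodule K H M P" and ne: "P \<noteq> {\<zero>\<^bsub>M\<^esub>}"
  obtains n c e where "simple_comatrix K H n c" "0 < n" "\<And>i. i < n \<Longrightarrow> e i \<in> P" "\<And>i. i < n \<Longrightarrow> e i \<noteq> \<zero>\<^bsub>M\<^esub>"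
    "\<And>f i. functional K H f \<Longrightarrow> i < n \<Longrightarrow> dual_act K M f (e i) = (\<Oplus>\<^bsub>M\<^esub>j\<in>{..<n}. f (c i j) \<odot>\<^bsub>M\<^esub> e j)"
    "\<And>T. \<lbrakk>finite T; T \<subseteq> P; linear_span K M T = linear_span K M (e ` {..<n})\<rbrakk> \<Longrightarrow> n \<le> card T"
proof -
  interpret MM: vspace K M by (rule vspace_M)
  note PS = MM.submodule_vspace[OF subcomoduleD(1)[OF P]]
  have zP: "{\<zero>\<^bsub>M\<^esub>} \<subseteq> P" using PS(2) by blast
  obtain S where S: "finite S" "S \<subseteq> P" "vspace.independent_mod K M {\<zero>\<^bsub>M\<^esub>} S"
    "subcomodule K H M (linear_span K M ({\<zero>\<^bsub>M\<^esub>} \<union> S))" "linear_span K M ({\<zero>\<^bsub>M\<^esub>} \<union> S) \<subseteq> P"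
    "linear_span K M ({\<zero>\<^bsub>M\<^esub>} \<union> S) \<noteq> {\<zero>\<^bsub>M\<^esub>}"
    "\<And>U. \<lbrakk>subcomodule K H M U; {\<zero>\<^bsub>M\<^esub>} \<subseteq> U; U \<subseteq> linear_span K M ({\<zero>\<^bsub>M\<^esub>} \<union> S)\<rbrakk> \<Longrightarrow>
      U = {\<zero>\<^bsub>M\<^esub>} \<or> U = linear_span K M ({\<zero>\<^bsub>M\<^esub>} \<union> S)"
    "\<And>T. \<lbrakk>finite T; T \<subseteq> P; linear_span K M ({\<zero>\<^bsub>M\<^esub>} \<union> T) = linear_span K M ({\<zero>\<^bsub>M\<^esub>} \<union> S)\<rbrakk> \<Longrightarrow> card S \<le> card T"
    by (rule minimal_subcomodule[OF subcomodule_zero P zP ne[symmetric]]) (rule that)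
  have SM: "S \<subseteq> carrier M" using S(2) PS(1) by blast
  note zS = MM.span_zero_Un[OF SM]
  define V where "V = linear_span K M S"
  have V: "subcomodule K H M V" "V \<subseteq> P" "V \<noteq> {\<zero>\<^bsub>M\<^esub>}" using S(4,5,6) unfolding zS V_def by blast+
  have Vmin: "U = {\<zero>\<^bsub>M\<^esub>} \<or> U = V" if "subcomodule K H M U" "U \<subseteq> V" for U
  proof -
    have "{\<zero>\<^bsub>M\<^esub>} \<subseteq> U" using MM.submodule_vspace(2)[OF subcomoduleD(1)[OF that(1)]] by blast
    then show ?thesis using S(7)[OF that(1)] that(2) unfolding zS V_def by blast
  qed
  obtain p where p': "\<forall>s\<in>S. functional K M (p s) \<and> (\<forall>x\<in>{\<zero>\<^bsub>M\<^esub>}. p s x = \<zero>\<^bsub>K\<^esub>) \<and>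
    (\<forall>t\<in>S. p s t = (if t = s then \<one>\<^bsub>K\<^esub> else \<zero>\<^bsub>K\<^esub>))"
    using MM.dual_basis[OF MM.submodule_zero SM S(3)] by (rule exE)
  have p: "\<And>s. s \<in> S \<Longrightarrow> functional K M (p s)" "\<And>s x. s \<in> S \<Longrightarrow> x \<in> {\<zero>\<^bsub>M\<^esub>} \<Longrightarrow> p s x = \<zero>\<^bsub>K\<^esub>"
      "\<And>s t. s \<in> S \<Longrightarrow> t \<in> S \<Longrightarrow> p s t = (if t = s then \<one>\<^bsub>K\<^esub> else \<zero>\<^bsub>K\<^esub>)"
    using p' by blast+
  have cm1: "comatrix K H S (\<lambda>s t. coefficient (p t) s)"
    by (rule comatrix_coefficients(1)[OF subcomodule_zero S(4,1) SM p])
  have cm2: "dual_act K M f s \<ominus>\<^bsub>M\<^esub> (\<Oplus>\<^bsub>M\<^esub>t\<in>S. f (coefficient (p t) s) \<odot>\<^bsub>M\<^esub> t) \<in> {\<zero>\<^bsub>M\<^esub>}"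
    if "functional K H f" "s \<in> S" for f s
    by (rule comatrix_coefficients(2)[OF subcomodule_zero S(4,1) SM p that])
  define n where "n = card S"
  obtain e where e: "bij_betw e {..<n} S"
    using ex_bij_betw_nat_finite[OF S(1)] unfolding n_def atLeast0LessThan by blast
  have eS: "i < n \<Longrightarrow> e i \<in> S" for i using e by (auto simp: bij_betw_def)
  have einj: "i < n \<Longrightarrow> j < n \<Longrightarrow> e i = e j \<longleftrightarrow> i = j" for i j using e by (auto simp: bij_betw_def inj_on_eq_iff)
  have eM: "i < n \<Longrightarrow> e i \<in> carrier M" for i using eS SM by blast
  have eim: "e ` {..<n} = S" using e by (simp add: bij_betw_def)
  define c where "c i j = coefficient (p (e j)) (e i)" for i j
  have c: "comatrix K H {..<n} c"
    unfolding c_def[abs_def] by (rule comatrix_reindex[OF cm1 e])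
  have cc: "i < n \<Longrightarrow> j < n \<Longrightarrow> c i j \<in> carrier H" for i j using c unfolding comatrix_def by simp
  have acts: "dual_act K M f (e i) = (\<Oplus>\<^bsub>M\<^esub>j\<in>{..<n}. f (c i j) \<odot>\<^bsub>M\<^esub> e j)" if f: "functional K H f" and i: "i < n" for f i
  proof -
    have fc: "t \<in> S \<Longrightarrow> f (coefficient (p t) (e i)) \<in> carrier K" for t
      by (rule functional_closed[OF f coefficient_closed[OF p(1) eM[OF i]]])
    have cl: "(\<lambda>t. f (coefficient (p t) (e i)) \<odot>\<^bsub>M\<^esub> t) \<in> S \<rightarrow> carrier M"
      using fc SM by (auto intro!: MM.scale_closed)
    have d: "dual_act K M f (e i) \<in> carrier M" by (rule dual_act_closed[OF f eM[OF i]])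
    have "dual_act K M f (e i) \<ominus>\<^bsub>M\<^esub> (\<Oplus>\<^bsub>M\<^esub>t\<in>S. f (coefficient (p t) (e i)) \<odot>\<^bsub>M\<^esub> t) = \<zero>\<^bsub>M\<^esub>"
      using cm2[OF f eS[OF i]] by blast
    then have "dual_act K M f (e i) = (\<Oplus>\<^bsub>M\<^esub>t\<in>S. f (coefficient (p t) (e i)) \<odot>\<^bsub>M\<^esub> t)"
      using MM.diff_eq_zero[OF d MM.sum_closed[OF cl]] by blast
    also have "\<dots> = (\<Oplus>\<^bsub>M\<^esub>j\<in>{..<n}. f (c i j) \<odot>\<^bsub>M\<^esub> e j)"
      unfolding c_def eim[symmetric]
      using e cl by (intro M.M.finsum_reindex) (auto simp: eim bij_betw_def)
    finally show ?thesis .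
  qed
  interpret F: finite_basis K "free_module K {..<n}" "{..<n}" "single K" "\<lambda>i x. x i"
    by (rule K.free_module_finite_basis) simp
  interpret C: left_comodule K H "coord_comodule K H n c" by (rule coord_comodule[OF c])
  define \<Theta> where "\<Theta> = F.extend M e"
  have \<Theta>: "linear_map K (free_module K {..<n}) M \<Theta>"
    unfolding \<Theta>_def by (rule F.extend_linear[OF vspace_M eM]) simp
  have \<Theta>s: "i < n \<Longrightarrow> \<Theta> (single K i) = e i" for i
    unfolding \<Theta>_def by (rule F.extend_basis[OF vspace_M eM]) simp_all
  \<comment> \<open>The coordinate functionals invert \<open>\<Theta>\<close>, which is therefore
    injective.\<close>
  have p\<Theta>: "p (e i) (\<Theta> x) = x i" if x: "x \<in> carrier (free_module K {..<n})" and i: "i < n" for x i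
  proof (rule F.linear_eqI[OF MM.vspace_ground linear_map_comp[OF \<Theta> p(1)[OF eS[OF i]]] F.coord_functional _ x])
    show "i \<in> {..<n}" using i by simp
    fix k assume "k \<in> {..<n}"
    then have k: "k < n" by simp
    have "p (e i) (e k) = single K k i" using p(3)[OF eS[OF i] eS[OF k]] einj[OF k i] by (auto simp: single_def)
    then show "p (e i) (\<Theta> (single K k)) = single K k i" using \<Theta>s[OF k] by simp
  qed
  have \<Theta>act: "\<Theta> (dual_act K (coord_comodule K H n c) f x) = dual_act K M f (\<Theta> x)"
    if f: "functional K H f" and x: "x \<in> carrier (free_module K {..<n})" for f x
  proof (rule F.linear_eqI[OF vspace_M linear_map_comp[OF coord_dual_act_linear[OF c f] \<Theta>]
        linear_map_comp[OF \<Theta> dual_act_linear[OF f]] _ x])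
    fix i assume "i \<in> {..<n}"
    then have i: "i < n" by simp
    have fc: "j < n \<Longrightarrow> f (c i j) \<in> carrier K" for j by (rule functional_closed[OF f cc[OF i]])
    have cl: "(\<lambda>j. f (c i j) \<odot>\<^bsub>free_module K {..<n}\<^esub> single K j) \<in> {..<n} \<rightarrow> carrier (free_module K {..<n})"
      using fc F.basis_closed by (intro Pi_I F.scale_closed) auto
    have "\<Theta> (dual_act K (coord_comodule K H n c) f (single K i)) =
        (\<Oplus>\<^bsub>M\<^esub>j\<in>{..<n}. \<Theta> (f (c i j) \<odot>\<^bsub>free_module K {..<n}\<^esub> single K j))"
      unfolding coord_dual_act_single[OF c f i]
      by (rule linear_map_finsum[OF F.vspace_axioms vspace_M \<Theta> cl])
    also have "\<dots> = (\<Oplus>\<^bsub>M\<^esub>j\<in>{..<n}. f (c i j) \<odot>\<^bsub>M\<^esub> e j)"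
    proof (rule MM.sum_cong[OF refl])
      show "(\<lambda>j. f (c i j) \<odot>\<^bsub>M\<^esub> e j) \<in> {..<n} \<rightarrow> carrier M" using fc eM by (auto intro!: MM.scale_closed)
      fix j assume "j \<in> {..<n}"
      then show "\<Theta> (f (c i j) \<odot>\<^bsub>free_module K {..<n}\<^esub> single K j) = f (c i j) \<odot>\<^bsub>M\<^esub> e j"
        using linear_mapD(3)[OF \<Theta> fc F.basis_closed] \<Theta>s by simp
    qed
    finally show "\<Theta> (dual_act K (coord_comodule K H n c) f (single K i)) = dual_act K M f (\<Theta> (single K i))"
      using acts[OF f i] \<Theta>s[OF i] by simp
  qed
  have simple: "simple_comatrix K H n c"
    unfolding simple_comatrix_def
  proof (intro conjI allI impI c)
    fix U assume U: "subcomodule K H (coord_comodule K H n c) U"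
    have Us: "submodule U K (free_module K {..<n})" using C.subcomoduleD(1)[OF U] unfolding coord_comodule_def by simp
    note UF = F.submodule_vspace[OF Us]
    \<comment> \<open>Since \<open>\<Theta>\<close> intertwines the two actions, a subcomodule
      \<open>U\<close> of the model maps onto a subcomodule of the simple comodule \<open>V\<close>.
      Each of the two possible images is then traced back to \<open>U\<close> through the
      coordinates.\<close>
    have im: "subcomodule K H M (\<Theta> ` U)"
    proof (rule subcomoduleI[OF F.submodule_image[OF vspace_M \<Theta> Us]])
      fix f y assume f: "functional K H f" and "y \<in> \<Theta> ` U"
      then obtain x where x: "x \<in> U" "y = \<Theta> x" by blast
      have "dual_act K M f y = \<Theta> (dual_act K (coord_comodule K H n c) f x)"
        unfolding x(2) using \<Theta>act[OF f, of x] x(1) UF(1) by force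
      then show "dual_act K M f y \<in> \<Theta> ` U" using C.subcomoduleD(2)[OF U f x(1)] by blast
    qed
    have "\<Theta> x \<in> V" if x: "x \<in> carrier (free_module K {..<n})" for x
    proof -
      have Vs: "submodule V K M" by (rule subcomoduleD(1)[OF V(1)])
      have "(\<Oplus>\<^bsub>M\<^esub>i\<in>{..<n}. x i \<odot>\<^bsub>M\<^esub> e i) \<in> V"
      proof (rule MM.submodule_finsum[OF Vs], rule Pi_I, rule MM.submodule_vspace(4)[OF Vs])
        fix i assume "i \<in> {..<n}"
        then show "e i \<in> V" "x i \<in> carrier K"
          using eS MM.span_superset[of S] F.coord_closed[OF _ x] unfolding V_def by blast+
      qed
      then show ?thesis unfolding \<Theta>_def F.extend_def .
    qed
    then have "\<Theta> ` U \<subseteq> V" using UF(1) by blast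
    then consider "\<Theta> ` U = {\<zero>\<^bsub>M\<^esub>}" | "\<Theta> ` U = V" using Vmin[OF im] by blast
    then show "U = {\<lambda>_. \<zero>\<^bsub>K\<^esub>} \<or> U = finsupp K {..<n}"
    proof cases
      case 1
      have "x = \<zero>\<^bsub>free_module K {..<n}\<^esub>" if x: "x \<in> U" for x
      proof (rule F.coord_zeroI)
        show xc: "x \<in> carrier (free_module K {..<n})" using x UF(1) by blast
        fix i assume "i \<in> {..<n}"
        then have i: "i < n" by simp
        have "\<Theta> x = \<zero>\<^bsub>M\<^esub>" using 1 x by blast
        then show "x i = \<zero>\<^bsub>K\<^esub>" using p\<Theta>[OF xc i] MM.functional_zero[OF p(1)[OF eS[OF i]]] by simp
      qed
      then have "U = {\<zero>\<^bsub>free_module K {..<n}\<^esub>}" using UF(2) by blast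
      then show ?thesis by simp
    next
      case 2
      have "single K i \<in> U" if "i \<in> {..<n}" for i
      proof -
        have i: "i < n" using that by simp
        have "e i \<in> V" unfolding V_def using eS[OF i] MM.span_superset[of S] by blast
        then obtain x where x: "x \<in> U" "\<Theta> x = e i" using 2 by (metis imageE)
        have xc: "x \<in> carrier (free_module K {..<n})" using x UF(1) by blast
        have "x j = single K i j" for j
        proof (cases "j < n")
          case True
          have "x j = p (e j) (e i)" using p\<Theta>[OF xc True] x(2) by simp
          then show ?thesis using p(3)[OF eS[OF True] eS[OF i]] einj[OF i True] by (auto simp: single_def)
        next
          case False
          then show ?thesis using K.finsuppD(2)[of x "{..<n}" j] xc i by (auto simp: single_def)
        qed
        then show ?thesis using x(1) by (metis ext)
      qed
      then have "U = carrier (free_module K {..<n})" by (rule F.submodule_all[OF Us])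
      then show ?thesis by simp
    qed
  qed
  have n0: "0 < n"
  proof (rule ccontr)
    assume "\<not> 0 < n"
    then have "S = {}" using S(1) n_def by simp
    then show False using V(3) MM.span_empty unfolding V_def by simp
  qed
  have e0: "e i \<noteq> \<zero>\<^bsub>M\<^esub>" if i: "i < n" for i
    using p(2)[OF eS[OF i], of "e i"] p(3)[OF eS[OF i] eS[OF i]] K.one_not_zero by auto
  have min: "n \<le> card T" if T: "finite T" "T \<subseteq> P" "linear_span K M T = linear_span K M (e ` {..<n})" for T
  proof -
    have "T \<subseteq> carrier M" using T(2) PS(1) by blast
    then have "linear_span K M ({\<zero>\<^bsub>M\<^esub>} \<union> T) = linear_span K M ({\<zero>\<^bsub>M\<^esub>} \<union> S)"
      using T(3) unfolding eim zS by (simp only: MM.span_zero_Un)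
    then show ?thesis unfolding n_def by (rule S(8)[OF T(1,2)])
  qed
  have eP: "e i \<in> P" if "i < n" for i using eS[OF that] S(2) by blast
  show thesis by (rule that[OF simple n0 eP e0 acts min])
qed

end

section \<open>Simple comodules of dimension greater than one\<close>

context coalgebra
begin

text \<open>Regard a simple subcoalgebra \<open>D\<close> that is not one-dimensional as a left
  comodule and take a simple subcomodule. If that had dimension one, its spanning vector would
  satisfy \<open>\<Delta>(v) = g \<otimes> v\<close> with \<open>g\<close> grouplike, so that
  \<open>v = \<epsilon>(v) g\<close>. Then \<open>g\<close> would lie in \<open>D\<close> and span
  it.\<close>

lemma simple_comatrix_exists:
  assumes "\<not> pointed K H"
  shows "\<exists>n c. 2 \<le> n \<and> simple_comatrix K H n c"
proof -
  interpret HH: vspace_pair K H H by (intro vspace_pair.intro vspace_H)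
  obtain D where D: "simple_subcoalgebra K H D" and nd: "\<not> one_dimensional K H D"
    using assms unfolding pointed_def by blast
  have Ds: "submodule D K H" and DD: "\<And>h. h \<in> D \<Longrightarrow> comult H h \<in> tensor_subspace K H H D D"
    and D0: "D \<noteq> {\<zero>\<^bsub>H\<^esub>}" and Dmin: "\<And>E. subcoalgebra K H E \<Longrightarrow> E \<subseteq> D \<Longrightarrow> E = {\<zero>\<^bsub>H\<^esub>} \<or> E = D"
    using D unfolding simple_subcoalgebra_def subcoalgebra_def by blast+
  note DS = HH.V.submodule_vspace[OF Ds]
  define R where "R = as_comodule H (comult H)"
  interpret R: left_comodule K H R unfolding R_def by (rule regular_comodule)
  have Rdef: "carrier R = carrier H" "dual_act K R f x = slice_l K H f (comult H x)" "zero R = zero H"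
    "finsum R = finsum H" "smult R = smult H" for f x
    unfolding R_def by simp_all
  have "subcomodule K H R D"
  proof (rule R.subcomoduleI)
    show "submodule D K R" using Ds unfolding R_def by simp
    show "dual_act K R f h \<in> D" if "functional K H f" "h \<in> D" for f h
      unfolding Rdef by (rule HH.slice_l_mem[OF that(1) DS(1) Ds DD[OF that(2)]])
  qed
  moreover have "D \<noteq> {\<zero>\<^bsub>R\<^esub>}" using D0 Rdef by simp
  ultimately obtain n c e where c: "simple_comatrix K H n c" and n: "0 < n" and e: "\<And>i. i < n \<Longrightarrow> e i \<in> D"
    "\<And>i. i < n \<Longrightarrow> e i \<noteq> \<zero>\<^bsub>R\<^esub>"
    and acts: "\<And>f i. functional K H f \<Longrightarrow> i < n \<Longrightarrow> dual_act K R f (e i) = (\<Oplus>\<^bsub>R\<^esub>j\<in>{..<n}. f (c i j) \<odot>\<^bsub>R\<^esub> e j)"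
    by (rule R.simple_subcomodule_comatrix) (rule that)
  have "n \<noteq> 1"
  proof
    assume n1: "n = 1"
    have cm: "comatrix K H {..<1} c" using c n1 unfolding simple_comatrix_def by simp
    let ?g = "c 0 0" and ?v = "e 0"
    have g: "grouplike K H ?g" by (rule comatrix_one_grouplike[OF cm])
    then have gH: "?g \<in> carrier H" unfolding grouplike_def by blast
    have vD: "?v \<in> D" and v0: "?v \<noteq> \<zero>\<^bsub>H\<^esub>" using e n Rdef by auto
    have vH: "?v \<in> carrier H" using vD DS(1) by blast
    have ev: "counit H ?v \<in> carrier K" by (rule functional_closed[OF counit_linear vH])
    have dv: "comult H ?v \<in> carrier (tensor_space K H H)" by (rule linear_mapD(1)[OF comult_linear vH])
    \<comment> \<open>Tested with functionals: contracting \<open>g \<otimes> v\<close> with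
      \<open>f\<close> on the left and the counit on the right gives
      \<open>f(g) \<epsilon>(v)\<close>, while the counit law gives \<open>f(v)\<close>.\<close>
    have "?v = counit H ?v \<odot>\<^bsub>H\<^esub> ?g"
    proof (rule HH.V.functional_ext[OF vH HH.V.scale_closed[OF ev gH]])
      fix f assume f: "functional K H f"
      have fg: "f ?g \<in> carrier K" by (rule functional_closed[OF f gH])
      have "{..<1::nat} = {0}" by auto
      then have "slice_l K H f (comult H ?v) = f ?g \<odot>\<^bsub>H\<^esub> ?v"
        using acts[OF f, of 0] n1 fg vH unfolding Rdef by simp
      moreover have "slice_r K H (counit H) (comult H ?v) = ?v"
        unfolding slice_r_def by (rule counit_r[OF vH])
      ultimately have "f ?v = counit H (f ?g \<odot>\<^bsub>H\<^esub> ?v)"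
        using slice_exchange[OF vspace_H vspace_H f counit_linear dv] by simp
      also have "\<dots> = f (counit H ?v \<odot>\<^bsub>H\<^esub> ?g)"
        using fg ev vH gH by (simp add: functional_smult[OF counit_linear] functional_smult[OF f] K.m_comm)
      finally show "f ?v = f (counit H ?v \<odot>\<^bsub>H\<^esub> ?g)" .
    qed
    moreover then have "counit H ?v \<noteq> \<zero>\<^bsub>K\<^esub>" using v0 gH by auto
    ultimately have gD: "?g \<in> D" using HH.V.submodule_smult_cancel[OF Ds ev _ gH] vD by simp
    have X: "{c i j | i j. i \<in> {..<1} \<and> j \<in> {..<1}} = {?g}" by auto
    have sub: "subcoalgebra K H (linear_span K H {?g})" using comatrix_subcoalgebra[OF cm] unfolding X .
    have "linear_span K H {?g} \<subseteq> D" using gD by (intro HH.V.span_minimal[OF Ds]) simp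
    moreover have "?g \<in> linear_span K H {?g}" using HH.V.span_superset by blast
    ultimately have "D = linear_span K H {?g}" using Dmin[OF sub] grouplike_nonzero[OF g] by blast
    then have "one_dimensional K H D"
      unfolding one_dimensional_def HH.V.span_singleton[OF gH] using gH grouplike_nonzero[OF g] by blast
    then show False using nd by blast
  qed
  then show ?thesis using c n by (intro exI[of _ n] exI[of _ c]) auto
qed

end

context hopf_algebra
begin

text \<open>
  If \<open>V\<close> is a simple comodule of minimal dimension \<open>> 1\<close>, then \<open>V\<^sup>*\<close> is simple: a proper simple
  subcomodule would be one-dimensional, with a grouplike and hence invertible coefficient, so that
  its annihilator would be a subcomodule of \<open>V\<close> of codimension one.
\<close>

lemma simple_comatrix_dual:
  assumes c: "simple_comatrix K H n c" and n: "2 \<le> n"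
    and min: "\<And>m d. 2 \<le> m \<Longrightarrow> simple_comatrix K H m d \<Longrightarrow> n \<le> m"
  shows "simple_comatrix K H n (\<lambda>i j. antipode H (c j i))"
proof -
  interpret HV: vspace K H by (rule vspace_H)
  let ?S = "antipode H" and ?F = "free_module K {..<n}"
  define c' where "c' i j = ?S (c j i)" for i j
  have cm: "comatrix K H {..<n} c" using c unfolding simple_comatrix_def by blast
  have cm': "comatrix K H {..<n} c'" unfolding c'_def[abs_def] by (rule comatrix_dual[OF cm])
  interpret F: finite_basis K ?F "{..<n}" "single K" "\<lambda>i x. x i"
    by (rule K.free_module_finite_basis) simp
  interpret C: left_comodule K H "coord_comodule K H n c" by (rule coord_comodule[OF cm])
  interpret C': left_comodule K H "coord_comodule K H n c'" by (rule coord_comodule[OF cm'])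
  have Cd: "carrier (coord_comodule K H n d) = finsupp K {..<n}" "zero (coord_comodule K H n d) = (\<lambda>_. \<zero>\<^bsub>K\<^esub>)"
    "finsum (coord_comodule K H n d) = finsum ?F" "smult (coord_comodule K H n d) = smult ?F"
    "submodule U K (coord_comodule K H n d) = submodule U K ?F" for d U
    unfolding coord_comodule_def by simp_all
  have lspan: "linear_span K (coord_comodule K H n d) T = linear_span K ?F T" for d T
    unfolding linear_span_def Cd ..
  have cc: "i < n \<Longrightarrow> j < n \<Longrightarrow> c i j \<in> carrier H" for i j using cm unfolding comatrix_def by simp
  have Sc: "i < n \<Longrightarrow> j < n \<Longrightarrow> ?S (c i j) \<in> carrier H" for i j by (rule linear_mapD(1)[OF antipode_linear cc])
  have "U = {\<lambda>_. \<zero>\<^bsub>K\<^esub>} \<or> U = finsupp K {..<n}" if U: "subcomodule K H (coord_comodule K H n c') U" for U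
  proof (rule ccontr)
    assume *: "\<not> ?thesis"
    have U0: "U \<noteq> {\<zero>\<^bsub>coord_comodule K H n c'\<^esub>}" and U1: "U \<noteq> finsupp K {..<n}" using * Cd by auto
    have Us: "submodule U K ?F" using C'.subcomoduleD(1)[OF U] Cd by simp
    note UF = F.submodule_vspace[OF Us]
    obtain m d e where d: "simple_comatrix K H m d" and m: "0 < m" and e: "\<And>i. i < m \<Longrightarrow> e i \<in> U"
      "\<And>i. i < m \<Longrightarrow> e i \<noteq> \<zero>\<^bsub>coord_comodule K H n c'\<^esub>"
      and acts: "\<And>f i. functional K H f \<Longrightarrow> i < m \<Longrightarrow> dual_act K (coord_comodule K H n c') f (e i) =
        (\<Oplus>\<^bsub>coord_comodule K H n c'\<^esub>j\<in>{..<m}. f (d i j) \<odot>\<^bsub>coord_comodule K H n c'\<^esub> e j)"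
      and mmin: "\<And>T. \<lbrakk>finite T; T \<subseteq> U; linear_span K (coord_comodule K H n c') T =
        linear_span K (coord_comodule K H n c') (e ` {..<m})\<rbrakk> \<Longrightarrow> m \<le> card T"
      by (rule C'.simple_subcomodule_comatrix[OF U U0]) (rule that)
    \<comment> \<open>If \<open>m\<close> were larger, minimality of \<open>n\<close> would give
      \<open>n \<le> m\<close>. But the span of the \<open>e i\<close> is a proper subspace of
      \<open>K^n\<close>, hence generated by fewer than \<open>n\<close> vectors, while
      \<open>m\<close> is the least number of generators.\<close>
    have "m = 1"
    proof (rule ccontr)
      assume "m \<noteq> 1"
      then have nm: "n \<le> m" using min[OF _ d] m by simp
      let ?V = "linear_span K ?F (e ` {..<m})"
      have eU: "e ` {..<m} \<subseteq> U" using e(1) by blast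
      have eF: "e ` {..<m} \<subseteq> carrier ?F" using eU UF(1) by blast
      have VU: "?V \<subseteq> U" by (rule F.span_minimal[OF Us eU])
      let ?B = "single K ` {..<n}"
      have B: "finite ?B" "?B \<subseteq> carrier ?F" "card ?B \<le> n" using F.basis_closed card_image_le[of "{..<n}" "single K"] by auto
      have Ball: "linear_span K ?F ?B = carrier ?F"
        by (rule F.submodule_all[OF F.span_submodule[OF B(2)]]) (use F.span_superset[of ?B] in blast)
      have z: "{\<zero>\<^bsub>?F\<^esub>} \<subseteq> ?V" using F.submodule_vspace(2)[OF F.span_submodule[OF eF]] by blast
      have "?V \<noteq> carrier ?F" using VU U1 UF(1) by auto
      then have "\<exists>T. finite T \<and> card T < card ?B \<and> T \<subseteq> ?V \<and> ?V = linear_span K ?F ({\<zero>\<^bsub>?F\<^esub>} \<union> T)"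
        using F.span_closed[OF eF]
        by (intro F.span_Un_finite_proper_subspace[OF B(1) F.submodule_zero B(2) F.span_submodule[OF eF] z])
          (simp_all only: F.span_zero_Un[OF B(2)] Ball not_False_eq_True)
      then obtain T where T: "finite T" "card T < card ?B" "T \<subseteq> ?V" "?V = linear_span K ?F ({\<zero>\<^bsub>?F\<^esub>} \<union> T)" by blast
      have TF: "T \<subseteq> carrier ?F" using T(3) F.span_closed[OF eF] by blast
      have "m \<le> card T"
        using T(1,3) VU T(4) F.span_zero_Un[OF TF] by (intro mmin) (auto simp: lspan)
      then show False using T(2) B(3) nm by linarith
    qed
    let ?g = "d 0 0" and ?u = "e 0"
    have g: "grouplike K H ?g" using d \<open>m = 1\<close> comatrix_one_grouplike unfolding simple_comatrix_def by simp
    then have gH: "?g \<in> carrier H" unfolding grouplike_def by blast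
    note Sg = antipode_grouplike[OF g]
    have uU: "?u \<in> U" and u0: "?u \<noteq> \<zero>\<^bsub>?F\<^esub>" using e[OF m] Cd by auto
    have uF: "?u \<in> carrier ?F" using uU UF(1) by blast
    have uK: "?u i \<in> carrier K" for i using K.finsuppD(1) uF by simp
    have actu: "dual_act K (coord_comodule K H n c') f ?u = f ?g \<odot>\<^bsub>?F\<^esub> ?u" if f: "functional K H f" for f
    proof -
      have "{..<1::nat} = {0}" by auto
      moreover have "f ?g \<odot>\<^bsub>?F\<^esub> ?u \<in> carrier ?F" by (rule F.scale_closed[OF functional_closed[OF f gH] uF])
      ultimately show ?thesis using acts[OF f m] \<open>m = 1\<close> unfolding Cd by (simp del: free_module_simps)
    qed
    \<comment> \<open>The coordinates of the statement that \<open>u\<close> is semi-invariant of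
      weight \<open>g\<close> in the dual comodule.\<close>
    have ug: "(\<Oplus>\<^bsub>H\<^esub>i\<in>{..<n}. ?u i \<odot>\<^bsub>H\<^esub> ?S (c j i)) = ?u j \<odot>\<^bsub>H\<^esub> ?g" if j: "j < n" for j
    proof -
      have cl: "(\<lambda>i. ?u i \<odot>\<^bsub>H\<^esub> ?S (c j i)) \<in> {..<n} \<rightarrow> carrier H" using uK Sc j by (intro Pi_I HV.scale_closed) auto
      show ?thesis
      proof (rule HV.functional_ext[OF HV.sum_closed[OF cl] HV.scale_closed[OF uK gH]])
        fix f assume f: "functional K H f"
        note lin = linear_map_comp[OF coord_dual_act_linear[OF cm' f] F.coord_functional[of j]]
        have lin': "linear_map K ?F (ground_algebra K) (F.extend (ground_algebra K) (\<lambda>i. f (c' i j)))"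
          using functional_closed[OF f Sc] j unfolding c'_def by (intro F.extend_linear[OF F.vspace_ground]) auto
        have "dual_act K (coord_comodule K H n c') f ?u j = F.extend (ground_algebra K) (\<lambda>i. f (c' i j)) ?u"
        proof (rule F.linear_eqI[OF F.vspace_ground lin lin' _ uF])
          show "j \<in> {..<n}" using j by simp
          fix i assume "i \<in> {..<n}"
          then have i: "i < n" by simp
          have fc: "k < n \<Longrightarrow> f (c' i k) \<in> carrier K" for k using functional_closed[OF f Sc] i unfolding c'_def by simp
          have cl: "(\<lambda>k. f (c' i k) \<odot>\<^bsub>?F\<^esub> single K k) \<in> {..<n} \<rightarrow> carrier ?F"
            using fc F.basis_closed by (intro Pi_I F.scale_closed) auto
          have "dual_act K (coord_comodule K H n c') f (single K i) j = (\<Oplus>\<^bsub>K\<^esub>k\<in>{..<n}. (f (c' i k) \<odot>\<^bsub>?F\<^esub> single K k) j)"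
            unfolding coord_dual_act_single[OF cm' f i]
            using linear_map_finsum[OF F.vspace_axioms F.vspace_ground F.coord_functional[of j] cl] j by simp
          also have "\<dots> = (\<Oplus>\<^bsub>K\<^esub>k\<in>{..<n}. if j = k then f (c' i k) else \<zero>\<^bsub>K\<^esub>)"
            using fc by (intro K.add.finprod_cong') (auto simp: single_def)
          also have "\<dots> = f (c' i j)" using fc j by (intro K.finsum_singleton) auto
          also have "\<dots> = F.extend (ground_algebra K) (\<lambda>i. f (c' i j)) (single K i)"
            using functional_closed[OF f Sc] i j unfolding c'_def by (intro F.extend_basis[OF F.vspace_ground, symmetric]) auto
          finally show "dual_act K (coord_comodule K H n c') f (single K i) j =
              F.extend (ground_algebra K) (\<lambda>i. f (c' i j)) (single K i)" .
        qed
        then have "(\<Oplus>\<^bsub>K\<^esub>i\<in>{..<n}. ?u i \<otimes>\<^bsub>K\<^esub> f (?S (c j i))) = f ?g \<otimes>\<^bsub>K\<^esub> ?u j"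
          using actu[OF f] unfolding F.extend_def c'_def by simp
        moreover have "f (\<Oplus>\<^bsub>H\<^esub>i\<in>{..<n}. ?u i \<odot>\<^bsub>H\<^esub> ?S (c j i)) = (\<Oplus>\<^bsub>K\<^esub>i\<in>{..<n}. ?u i \<otimes>\<^bsub>K\<^esub> f (?S (c j i)))"
        proof -
          have "f (\<Oplus>\<^bsub>H\<^esub>i\<in>{..<n}. ?u i \<odot>\<^bsub>H\<^esub> ?S (c j i)) = (\<Oplus>\<^bsub>K\<^esub>i\<in>{..<n}. f (?u i \<odot>\<^bsub>H\<^esub> ?S (c j i)))"
            using linear_map_finsum[OF vspace_H HV.vspace_ground f cl] by simp
          also have "\<dots> = (\<Oplus>\<^bsub>K\<^esub>i\<in>{..<n}. ?u i \<otimes>\<^bsub>K\<^esub> f (?S (c j i)))"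
            using uK Sc j functional_closed[OF f Sc] by (intro K.add.finprod_cong') (auto simp: functional_smult[OF f])
          finally show ?thesis .
        qed
        moreover have "f (?u j \<odot>\<^bsub>H\<^esub> ?g) = f ?g \<otimes>\<^bsub>K\<^esub> ?u j"
          using functional_smult[OF f uK gH] uK functional_closed[OF f gH] by (simp add: K.m_comm)
        ultimately show "f (\<Oplus>\<^bsub>H\<^esub>i\<in>{..<n}. ?u i \<odot>\<^bsub>H\<^esub> ?S (c j i)) = f (?u j \<odot>\<^bsub>H\<^esub> ?g)" by simp
      qed
    qed
    have one: "\<one>\<^bsub>H\<^esub> \<in> carrier H" by simp
    have mc: "a \<in> carrier H \<Longrightarrow> b \<in> carrier H \<Longrightarrow> a \<otimes>\<^bsub>H\<^esub> b \<in> carrier H" for a b by (rule bilinear_mapD(1)[OF mult_bilinear])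
    \<comment> \<open>Multiply the relation \<open>ug\<close> on the left by the entries
      \<open>c s j\<close> and sum over \<open>j\<close>: the antipode identity turns
      \<open>(\<Sum>_j u_j c_sj) g\<close> into \<open>u_s 1\<close>. Cancelling \<open>g\<close> on
      the right leaves its inverse, which is the antipode of \<open>g\<close>.\<close>
    have wsum: "(\<Oplus>\<^bsub>H\<^esub>j\<in>{..<n}. ?u j \<odot>\<^bsub>H\<^esub> c s j) = ?u s \<odot>\<^bsub>H\<^esub> ?S ?g" if s: "s < n" for s
    proof -
      have cl: "(\<lambda>j. ?u j \<odot>\<^bsub>H\<^esub> c s j) \<in> {..<n} \<rightarrow> carrier H" using uK cc s by (intro Pi_I HV.scale_closed) auto
      define w where "w = (\<Oplus>\<^bsub>H\<^esub>j\<in>{..<n}. ?u j \<odot>\<^bsub>H\<^esub> c s j)"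
      have w: "w \<in> carrier H" unfolding w_def by (rule HV.sum_closed[OF cl])
      have cl2: "(\<lambda>i. ?u i \<odot>\<^bsub>H\<^esub> (c s j \<otimes>\<^bsub>H\<^esub> ?S (c j i))) \<in> {..<n} \<rightarrow> carrier H" if "j < n" for j
        using uK cc Sc s that by (intro Pi_I HV.scale_closed mc) auto
      have "w \<otimes>\<^bsub>H\<^esub> ?g = (\<Oplus>\<^bsub>H\<^esub>j\<in>{..<n}. (?u j \<odot>\<^bsub>H\<^esub> c s j) \<otimes>\<^bsub>H\<^esub> ?g)"
        unfolding w_def by (rule bilinear_finsum_l[OF vspace_H vspace_H mult_bilinear cl gH])
      also have "\<dots> = (\<Oplus>\<^bsub>H\<^esub>j\<in>{..<n}. \<Oplus>\<^bsub>H\<^esub>i\<in>{..<n}. ?u i \<odot>\<^bsub>H\<^esub> (c s j \<otimes>\<^bsub>H\<^esub> ?S (c j i)))"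
      proof (rule HV.sum_cong[OF refl])
        show "(\<lambda>j. \<Oplus>\<^bsub>H\<^esub>i\<in>{..<n}. ?u i \<odot>\<^bsub>H\<^esub> (c s j \<otimes>\<^bsub>H\<^esub> ?S (c j i))) \<in> {..<n} \<rightarrow> carrier H"
          by (intro Pi_I HV.sum_closed cl2) simp
        fix j assume "j \<in> {..<n}"
        then have j: "j < n" by simp
        have cl3: "(\<lambda>i. ?u i \<odot>\<^bsub>H\<^esub> ?S (c j i)) \<in> {..<n} \<rightarrow> carrier H" using uK Sc j by (intro Pi_I HV.scale_closed) auto
        have "(?u j \<odot>\<^bsub>H\<^esub> c s j) \<otimes>\<^bsub>H\<^esub> ?g = c s j \<otimes>\<^bsub>H\<^esub> (?u j \<odot>\<^bsub>H\<^esub> ?g)"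
          using bilinear_mapD(4,5)[OF mult_bilinear uK cc[OF s j] gH] by simp
        also have "\<dots> = c s j \<otimes>\<^bsub>H\<^esub> (\<Oplus>\<^bsub>H\<^esub>i\<in>{..<n}. ?u i \<odot>\<^bsub>H\<^esub> ?S (c j i))" using ug[OF j] by simp
        also have "\<dots> = (\<Oplus>\<^bsub>H\<^esub>i\<in>{..<n}. c s j \<otimes>\<^bsub>H\<^esub> (?u i \<odot>\<^bsub>H\<^esub> ?S (c j i)))"
          by (rule bilinear_finsum_r[OF vspace_H vspace_H mult_bilinear cl3 cc[OF s j]])
        also have "\<dots> = (\<Oplus>\<^bsub>H\<^esub>i\<in>{..<n}. ?u i \<odot>\<^bsub>H\<^esub> (c s j \<otimes>\<^bsub>H\<^esub> ?S (c j i)))"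
          using bilinear_mapD(5)[OF mult_bilinear uK cc[OF s j] Sc[OF j]] by (intro HV.sum_cong cl2[OF j]) auto
        finally show "(?u j \<odot>\<^bsub>H\<^esub> c s j) \<otimes>\<^bsub>H\<^esub> ?g = (\<Oplus>\<^bsub>H\<^esub>i\<in>{..<n}. ?u i \<odot>\<^bsub>H\<^esub> (c s j \<otimes>\<^bsub>H\<^esub> ?S (c j i)))" .
      qed
      also have "\<dots> = (\<Oplus>\<^bsub>H\<^esub>i\<in>{..<n}. \<Oplus>\<^bsub>H\<^esub>j\<in>{..<n}. ?u i \<odot>\<^bsub>H\<^esub> (c s j \<otimes>\<^bsub>H\<^esub> ?S (c j i)))"
        using uK cc Sc s by (intro HV.sum_swap) (auto intro!: HV.scale_closed mc)
      also have "\<dots> = (\<Oplus>\<^bsub>H\<^esub>i\<in>{..<n}. if s = i then ?u i \<odot>\<^bsub>H\<^esub> \<one>\<^bsub>H\<^esub> else \<zero>\<^bsub>H\<^esub>)"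
      proof (rule HV.sum_cong[OF refl])
        show "(\<lambda>i. if s = i then ?u i \<odot>\<^bsub>H\<^esub> \<one>\<^bsub>H\<^esub> else \<zero>\<^bsub>H\<^esub>) \<in> {..<n} \<rightarrow> carrier H"
          using uK one HV.scale_closed by auto
        fix i assume "i \<in> {..<n}"
        then have i: "i < n" by simp
        have cl4: "(\<lambda>j. c s j \<otimes>\<^bsub>H\<^esub> ?S (c j i)) \<in> {..<n} \<rightarrow> carrier H" using cc Sc s i by (intro Pi_I mc) auto
        have "(\<Oplus>\<^bsub>H\<^esub>j\<in>{..<n}. ?u i \<odot>\<^bsub>H\<^esub> (c s j \<otimes>\<^bsub>H\<^esub> ?S (c j i))) = ?u i \<odot>\<^bsub>H\<^esub> (\<Oplus>\<^bsub>H\<^esub>j\<in>{..<n}. c s j \<otimes>\<^bsub>H\<^esub> ?S (c j i))"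
          by (rule HV.sum_smult[OF _ uK cl4, symmetric]) simp
        then show "(\<Oplus>\<^bsub>H\<^esub>j\<in>{..<n}. ?u i \<odot>\<^bsub>H\<^esub> (c s j \<otimes>\<^bsub>H\<^esub> ?S (c j i))) = (if s = i then ?u i \<odot>\<^bsub>H\<^esub> \<one>\<^bsub>H\<^esub> else \<zero>\<^bsub>H\<^esub>)"
          using comatrix_antipode_r[OF cm, of s i] s i uK by simp
      qed
      also have "\<dots> = ?u s \<odot>\<^bsub>H\<^esub> \<one>\<^bsub>H\<^esub>" using s uK one HV.scale_closed by (intro HV.sum_single) auto
      finally have wg: "w \<otimes>\<^bsub>H\<^esub> ?g = ?u s \<odot>\<^bsub>H\<^esub> \<one>\<^bsub>H\<^esub>" .
      have "w = w \<otimes>\<^bsub>H\<^esub> (?g \<otimes>\<^bsub>H\<^esub> ?S ?g)" using w Sg by simp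
      also have "\<dots> = w \<otimes>\<^bsub>H\<^esub> ?g \<otimes>\<^bsub>H\<^esub> ?S ?g" by (rule A.m_assoc[OF w gH Sg(1), symmetric])
      also have "\<dots> = ?u s \<odot>\<^bsub>H\<^esub> ?S ?g" unfolding wg using bilinear_mapD(4)[OF mult_bilinear uK one Sg(1)] Sg(1) by simp
      finally show ?thesis unfolding w_def .
    qed
    \<comment> \<open>Pairing with \<open>u\<close>: the vector \<open>u\<close> of the dual, read
      as a functional on the comodule of \<open>c\<close>. By \<open>wsum\<close> this functional is
      semi-invariant, so its kernel is a subcomodule, of codimension one because \<open>u\<close> is
      nonzero.\<close>
    define lu where "lu = F.extend (ground_algebra K) ?u"
    have l: "functional K ?F lu" unfolding lu_def using uK by (intro F.extend_linear[OF F.vspace_ground]) simp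
    have ls: "lu (single K i) = ?u i" if "i < n" for i
      unfolding lu_def using uK that by (intro F.extend_basis[OF F.vspace_ground]) auto
    have lact: "lu (dual_act K (coord_comodule K H n c) f x) = f (?S ?g) \<otimes>\<^bsub>K\<^esub> lu x"
      if f: "functional K H f" and x: "x \<in> carrier ?F" for f x
    proof -
      have fS: "f (?S ?g) \<in> carrier K" by (rule functional_closed[OF f Sg(1)])
      have l2: "functional K ?F (\<lambda>x. f (?S ?g) \<otimes>\<^bsub>K\<^esub> lu x)"
        using linear_map_scale[OF F.vspace_ground l, of "f (?S ?g)"] fS by simp
      show ?thesis
      proof (rule F.linear_eqI[OF F.vspace_ground linear_map_comp[OF coord_dual_act_linear[OF cm f] l] l2 _ x])
        fix s assume "s \<in> {..<n}"
        then have s: "s < n" by simp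
        have fc: "j < n \<Longrightarrow> f (c s j) \<in> carrier K" for j by (rule functional_closed[OF f cc[OF s]])
        have cl: "(\<lambda>j. f (c s j) \<odot>\<^bsub>?F\<^esub> single K j) \<in> {..<n} \<rightarrow> carrier ?F"
          using fc F.basis_closed by (intro Pi_I F.scale_closed) auto
        have cl2: "(\<lambda>j. ?u j \<odot>\<^bsub>H\<^esub> c s j) \<in> {..<n} \<rightarrow> carrier H" using uK cc s by (intro Pi_I HV.scale_closed) auto
        have "lu (dual_act K (coord_comodule K H n c) f (single K s)) = (\<Oplus>\<^bsub>K\<^esub>j\<in>{..<n}. lu (f (c s j) \<odot>\<^bsub>?F\<^esub> single K j))"
          unfolding coord_dual_act_single[OF cm f s]
          using linear_map_finsum[OF F.vspace_axioms F.vspace_ground l cl] by simp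
        also have "\<dots> = (\<Oplus>\<^bsub>K\<^esub>j\<in>{..<n}. f (?u j \<odot>\<^bsub>H\<^esub> c s j))"
        proof (rule K.add.finprod_cong'[OF refl])
          show "(\<lambda>j. f (?u j \<odot>\<^bsub>H\<^esub> c s j)) \<in> {..<n} \<rightarrow> carrier K" using functional_closed[OF f] cl2 by blast
          fix j assume "j \<in> {..<n}"
          then have j: "j < n" by simp
          show "lu (f (c s j) \<odot>\<^bsub>?F\<^esub> single K j) = f (?u j \<odot>\<^bsub>H\<^esub> c s j)"
            using functional_smult[OF l fc[OF j] F.basis_closed] ls[OF j] functional_smult[OF f uK cc[OF s j]] uK fc[OF j] j
            by (simp add: K.m_comm del: free_module_simps)
        qed
        also have "\<dots> = f (\<Oplus>\<^bsub>H\<^esub>j\<in>{..<n}. ?u j \<odot>\<^bsub>H\<^esub> c s j)"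
          using linear_map_finsum[OF vspace_H HV.vspace_ground f cl2] by simp
        also have "\<dots> = f (?S ?g) \<otimes>\<^bsub>K\<^esub> lu (single K s)"
          unfolding wsum[OF s] ls[OF s] using functional_smult[OF f uK Sg(1)] uK fS by (simp add: K.m_comm)
        finally show "lu (dual_act K (coord_comodule K H n c) f (single K s)) = f (?S ?g) \<otimes>\<^bsub>K\<^esub> lu (single K s)" .
      qed
    qed
    let ?W = "{x \<in> carrier ?F. lu x \<in> {\<zero>\<^bsub>ground_algebra K\<^esub>}}"
    have Ws: "submodule ?W K ?F"
      by (rule F.submodule_preimage[OF F.vspace_ground l vspace.submodule_zero[OF F.vspace_ground] F.top_submodule])
    have "subcomodule K H (coord_comodule K H n c) ?W"
    proof (rule C.subcomoduleI)
      show "submodule ?W K (coord_comodule K H n c)" using Ws Cd by simp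
      fix f x assume f: "functional K H f" and x: "x \<in> ?W"
      have xF: "x \<in> carrier ?F" using x by blast
      show "dual_act K (coord_comodule K H n c) f x \<in> ?W"
        using lact[OF f xF] x functional_closed[OF f Sg(1)] linear_mapD(1)[OF coord_dual_act_linear[OF cm f] xF] by simp
    qed
    then have W: "?W = {\<lambda>_. \<zero>\<^bsub>K\<^esub>} \<or> ?W = finsupp K {..<n}" using c unfolding simple_comatrix_def by blast
    obtain s where s: "s < n" "?u s \<noteq> \<zero>\<^bsub>K\<^esub>" using F.coord_zeroI[OF uF] u0 by auto
    have sF: "i < n \<Longrightarrow> single K i \<in> carrier ?F" for i using F.basis_closed by blast
    have "single K s \<notin> ?W" using ls[OF s(1)] s(2) by simp
    then have Wz: "?W = {\<lambda>_. \<zero>\<^bsub>K\<^esub>}" using W sF[OF s(1)] by auto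
    obtain t where t: "t < n" "t \<noteq> s" using n s(1) by (metis One_nat_def Suc_1 Suc_le_lessD less_Suc_eq_0_disj less_trans_Suc not_less_eq zero_less_one nat_neq_iff)
    \<comment> \<open>A nonzero vector in the kernel, available because \<open>n \<ge> 2\<close>
      provides a second index \<open>t\<close>. It contradicts simplicity, which has forced the
      kernel to be zero.\<close>
    define x where "x = ?u t \<odot>\<^bsub>?F\<^esub> single K s \<oplus>\<^bsub>?F\<^esub> (\<ominus>\<^bsub>K\<^esub> ?u s) \<odot>\<^bsub>?F\<^esub> single K t"
    have xF: "x \<in> carrier ?F" unfolding x_def using uK sF s t by (intro F.add_closed F.scale_closed) auto
    have "lu x = ?u t \<otimes>\<^bsub>K\<^esub> ?u s \<oplus>\<^bsub>K\<^esub> (\<ominus>\<^bsub>K\<^esub> ?u s) \<otimes>\<^bsub>K\<^esub> ?u t"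
    proof -
      have a: "?u t \<odot>\<^bsub>?F\<^esub> single K s \<in> carrier ?F" "(\<ominus>\<^bsub>K\<^esub> ?u s) \<odot>\<^bsub>?F\<^esub> single K t \<in> carrier ?F"
        using uK sF s t by (auto intro!: F.scale_closed simp del: free_module_simps)
      show ?thesis
        unfolding x_def
        using functional_add[OF l a] functional_smult[OF l uK sF[OF s(1)], of t] functional_smult[OF l _ sF[OF t(1)], of "\<ominus>\<^bsub>K\<^esub> ?u s"] ls s t uK
        by (simp del: free_module_simps)
    qed
    also have "\<dots> = \<zero>\<^bsub>K\<^esub>" using uK[of s] uK[of t] by (simp add: K.l_minus K.m_comm[of "?u t" "?u s"] K.r_neg)
    finally have "x \<in> ?W" using xF by simp
    then have "x = (\<lambda>_. \<zero>\<^bsub>K\<^esub>)" using Wz by blast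
    moreover have "x t = \<ominus>\<^bsub>K\<^esub> ?u s" unfolding x_def using t(2) uK by (simp add: single_def)
    ultimately have "\<ominus>\<^bsub>K\<^esub> ?u s = \<zero>\<^bsub>K\<^esub>" by simp
    moreover have "?u s = \<ominus>\<^bsub>K\<^esub> (\<ominus>\<^bsub>K\<^esub> ?u s)" by (rule K.minus_minus[OF uK, symmetric])
    ultimately have "?u s = \<ominus>\<^bsub>K\<^esub> \<zero>\<^bsub>K\<^esub>" by simp
    then show False using s(2) by simp
  qed
  then show ?thesis using cm' unfolding simple_comatrix_def c'_def[abs_def] by blast
qed

end

section \<open>Matrix comodule algebras\<close>

text \<open>
  The comodule algebra is \<open>End V\<close> with matrix units \<open>E\<^sub>i\<^sub>j\<close> and coaction
  \<open>E\<^sub>i\<^sub>j \<mapsto> \<Sum> d\<^sub>i\<^sub>k d'\<^sub>j\<^sub>l \<otimes> E\<^sub>k\<^sub>l\<close>, where \<open>d\<close> is the comatrix of \<open>V\<close> and \<open>d'\<close> that of the dual of \<open>V\<close>.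
  It acts on modules with basis \<open>v\<^sub>p\<^sub>q\<close>, \<open>q \<in> R\<close>, by \<open>E\<^sub>i\<^sub>j v\<^sub>p\<^sub>q = \<delta>\<^sub>j\<^sub>p v\<^sub>i\<^sub>q\<close>; both the algebra itself and \<open>V\<close> are of this form.
\<close>

locale matrix_coefficients = bialgebra_multiplication K H \<mu> \<eta>
  for K :: "('k, 'x) ring_scheme" (structure) and H :: "('k, 'h, 'y) coalgebra_scheme" (structure) and \<mu> \<eta> +
  fixes n :: nat and d d' :: "nat \<Rightarrow> nat \<Rightarrow> 'h"
  assumes comatrix_d: "comatrix K H {..<n} d" and comatrix_d': "comatrix K H {..<n} d'"
    and pairing_l: "\<lbrakk>i < n; j < n\<rbrakk> \<Longrightarrow> (\<Oplus>\<^bsub>H\<^esub>k\<in>{..<n}. \<mu> (d' i k) (d j k)) = (if i = j then \<eta> else \<zero>\<^bsub>H\<^esub>)"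
    and pairing_r: "\<lbrakk>i < n; j < n\<rbrakk> \<Longrightarrow> (\<Oplus>\<^bsub>H\<^esub>k\<in>{..<n}. \<mu> (d k i) (d' k j)) = (if i = j then \<eta> else \<zero>\<^bsub>H\<^esub>)"
begin

text \<open>The comatrix of the tensor product of \<open>V\<close> with the comodule of
  \<open>w\<close>. For \<open>w = d'\<close> it is that of the matrix algebra, and for the
  one-by-one comatrix with entry \<open>\<eta>\<close> that of \<open>V\<close> itself.\<close>

definition twist :: "('r \<Rightarrow> 'r \<Rightarrow> 'h) \<Rightarrow> nat \<times> 'r \<Rightarrow> nat \<times> 'r \<Rightarrow> 'h"
  where "twist w x y = \<mu> (d (fst x) (fst y)) (w (snd x) (snd y))"

lemma twist_comatrix: "comatrix K H R w \<Longrightarrow> comatrix K H ({..<n} \<times> R) (twist w)"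
  unfolding twist_def[abs_def] by (rule comatrix_product[OF comatrix_d])

lemma d_closed: "i < n \<Longrightarrow> j < n \<Longrightarrow> d i j \<in> carrier H"
  and d'_closed: "i < n \<Longrightarrow> j < n \<Longrightarrow> d' i j \<in> carrier H"
  using comatrix_d comatrix_d' unfolding comatrix_def by simp_all

text \<open>By associativity the two inner factors meet, and \<open>pairing_l\<close> evaluates
  their sum. This is how adjacent indices cancel in a product of two coactions.\<close>

lemma contract:
  assumes a: "a \<in> carrier H" and b: "b \<in> carrier H" and j: "j < n" and p: "p < n"
  shows "(\<Oplus>\<^bsub>H\<^esub>l\<in>{..<n}. \<mu> (\<mu> a (d' j l)) (\<mu> (d p l) b)) = (if j = p then \<mu> a b else \<zero>\<^bsub>H\<^esub>)"
proof -
  interpret HV: vspace K H by (rule vspace_H)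
  have cl: "(\<lambda>l. \<mu> (d' j l) (d p l)) \<in> {..<n} \<rightarrow> carrier H" using d_closed d'_closed j p mu_closed by auto
  have cl2: "(\<lambda>l. \<mu> (\<mu> (d' j l) (d p l)) b) \<in> {..<n} \<rightarrow> carrier H" using cl b mu_closed by blast
  have z: "\<mu> \<zero>\<^bsub>H\<^esub> b = \<zero>\<^bsub>H\<^esub>" "\<mu> a \<zero>\<^bsub>H\<^esub> = \<zero>\<^bsub>H\<^esub>"
    using linear_map_zero[OF vspace_H vspace_H bilinear_map_linear(2)[OF mu_bilinear b]]
      linear_map_zero[OF vspace_H vspace_H bilinear_map_linear(1)[OF mu_bilinear a]] .
  have "(\<Oplus>\<^bsub>H\<^esub>l\<in>{..<n}. \<mu> (\<mu> a (d' j l)) (\<mu> (d p l) b)) = (\<Oplus>\<^bsub>H\<^esub>l\<in>{..<n}. \<mu> a (\<mu> (\<mu> (d' j l) (d p l)) b))"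
    using a b j p d_closed d'_closed by (intro HV.sum_cong) (auto simp: mu_assoc mu_closed)
  also have "\<dots> = \<mu> a (\<Oplus>\<^bsub>H\<^esub>l\<in>{..<n}. \<mu> (\<mu> (d' j l) (d p l)) b)"
    by (rule bilinear_finsum_r[OF vspace_H vspace_H mu_bilinear cl2 a, symmetric])
  also have "(\<Oplus>\<^bsub>H\<^esub>l\<in>{..<n}. \<mu> (\<mu> (d' j l) (d p l)) b) = \<mu> (\<Oplus>\<^bsub>H\<^esub>l\<in>{..<n}. \<mu> (d' j l) (d p l)) b"
    by (rule bilinear_finsum_l[OF vspace_H vspace_H mu_bilinear cl b, symmetric])
  finally show ?thesis using pairing_l[OF j p] z b by (simp add: mu_unit_l)
qed

text \<open>By bilinearity it suffices to take matrix units and basis vectors. In the product of the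
  two coactions the action rule identifies the inner indices, and \<open>contract\<close> cancels
  the entries of \<open>d'\<close> and \<open>d\<close> that carry them. The case
  \<open>w = d'\<close> gives multiplicativity of the coaction on the algebra; the one-by-one
  comatrix with entry \<open>\<eta>\<close> gives compatibility of coaction and action on
  \<open>V\<close>.\<close>

lemma coaction_act:
  assumes Y: "finite_basis K Y ({..<n} \<times> {..<n}) E q" and Z: "finite_basis K Z ({..<n} \<times> R) v s"
    and w: "comatrix K H R w" and act: "bilinear_map K Y Z Z act"
    and act_basis: "\<And>i j p r. \<lbrakk>i < n; j < n; p < n; r \<in> R\<rbrakk> \<Longrightarrow> act (E (i, j)) (v (p, r)) = (if j = p then v (i, r) else \<zero>\<^bsub>Z\<^esub>)"
    and a: "a \<in> carrier Y" and z: "z \<in> carrier Z"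
  shows "comatrix_comodule.coaction K H Z ({..<n} \<times> R) v s (twist w) (act a z) =
    tensor_bimap K H Z \<mu> act (comatrix_comodule.coaction K H Y ({..<n} \<times> {..<n}) E q (twist d') a)
      (comatrix_comodule.coaction K H Z ({..<n} \<times> R) v s (twist w) z)"
proof -
  interpret A: comatrix_comodule K H Y "{..<n} \<times> {..<n}" E q "twist d'"
    by (intro comatrix_comodule.intro coalgebra_axioms Y comatrix_comodule_axioms.intro twist_comatrix comatrix_d')
  interpret Z: comatrix_comodule K H Z "{..<n} \<times> R" v s "twist w"
    by (intro comatrix_comodule.intro coalgebra_axioms Z comatrix_comodule_axioms.intro twist_comatrix w)
  interpret HZ: vspace_pair K H Z by (intro vspace_pair.intro vspace_H Z.vspace_Y)
  let ?T = "tensor_space K H Z" and ?P = "pure_tensor K H Z"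
  have R: "finite R" using w unfolding comatrix_def by blast
  have wc: "i \<in> R \<Longrightarrow> j \<in> R \<Longrightarrow> w i j \<in> carrier H" for i j using w unfolding comatrix_def by blast
  note bb = tensor_bimap_bilinear[OF vspace_H vspace_H A.vspace_Y Z.vspace_Y vspace_H Z.vspace_Y mu_bilinear act]
  note bp = tensor_bimap_pure[OF vspace_H vspace_H A.vspace_Y Z.vspace_Y vspace_H Z.vspace_Y mu_bilinear act]
  have L: "bilinear_map K Y Z ?T (\<lambda>a z. Z.coaction (act a z))"
    by (rule bilinear_map_comp[OF act linear_map_id linear_map_id Z.coaction_linear])
  have Rr: "bilinear_map K Y Z ?T (\<lambda>a z. tensor_bimap K H Z \<mu> act (A.coaction a) (Z.coaction z))"
    by (rule bilinear_comp_id[OF bb A.coaction_linear Z.coaction_linear])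
  show ?thesis
  proof (rule bilinear_eq_on_bases[OF Y Z Z.vspace_HY L Rr _ a z])
    fix x y assume "x \<in> {..<n} \<times> {..<n}" "y \<in> {..<n} \<times> R"
    then obtain i j p r where xy: "x = (i, j)" "y = (p, r)" and m: "i < n" "j < n" "p < n" "r \<in> R" by auto
    have vZ: "k < n \<Longrightarrow> t \<in> R \<Longrightarrow> v (k, t) \<in> carrier Z" for k t using Z.basis_closed by simp
    have EY: "k < n \<Longrightarrow> l < n \<Longrightarrow> E (k, l) \<in> carrier Y" for k l using A.basis_closed by simp
    have xI: "(i, j) \<in> {..<n} \<times> {..<n}" and yI: "(p, r) \<in> {..<n} \<times> R" and iI: "(i, r) \<in> {..<n} \<times> R" using m by auto
    have mc: "a \<in> carrier H \<Longrightarrow> b \<in> carrier H \<Longrightarrow> \<mu> a b \<in> carrier H" for a b by (rule mu_closed)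
    have pc: "a \<in> carrier H \<Longrightarrow> b \<in> carrier Z \<Longrightarrow> ?P a b \<in> carrier ?T" for a b by (rule HZ.pure_simps(1))
    have p0: "a \<in> carrier H \<Longrightarrow> ?P a \<zero>\<^bsub>Z\<^esub> = \<zero>\<^bsub>?T\<^esub>" for a
      using linear_map_zero[OF Z.vspace_Y Z.vspace_HY bilinear_map_linear(1)[OF HZ.pure_bilinear]] .
    have ac: "k < n \<Longrightarrow> l < n \<Longrightarrow> m' < n \<Longrightarrow> t \<in> R \<Longrightarrow> act (E (k, l)) (v (m', t)) \<in> carrier Z" for k l m' t
      by (rule bilinear_mapD(1)[OF act EY vZ])
    \<comment> \<open>The summands of the product, indexed by the matrix unit
      \<open>E (k, l)\<close> of the first factor and the basis vector \<open>v (m', t)\<close> of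
      the second.\<close>
    define F where "F k l m' t = ?P (\<mu> (\<mu> (d i k) (d' j l)) (\<mu> (d p m') (w r t))) (act (E (k, l)) (v (m', t)))" for k l m' t
    have Fc: "k < n \<Longrightarrow> l < n \<Longrightarrow> m' < n \<Longrightarrow> t \<in> R \<Longrightarrow> F k l m' t \<in> carrier ?T" for k l m' t
      unfolding F_def using m d_closed d'_closed wc by (intro pc mc ac) auto
    have "tensor_bimap K H Z \<mu> act (A.coaction (E (i, j))) (Z.coaction (v (p, r))) =
        (\<Oplus>\<^bsub>?T\<^esub>a\<in>{..<n} \<times> {..<n}. \<Oplus>\<^bsub>?T\<^esub>b\<in>{..<n} \<times> R.
          tensor_bimap K H Z \<mu> act (pure_tensor K H Y (twist d' (i, j) a) (E a)) (?P (twist w (p, r) b) (v b)))"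
      unfolding A.coaction_basis[OF xI] Z.coaction_basis[OF yI]
      by (rule bilinear_finsum2[OF A.vspace_HY Z.vspace_HY Z.vspace_HY bb A.row_closed[OF xI] Z.row_closed[OF yI] A.finite_index Z.finite_index])
    also have "\<dots> = (\<Oplus>\<^bsub>?T\<^esub>a\<in>{..<n} \<times> {..<n}. \<Oplus>\<^bsub>?T\<^esub>b\<in>{..<n} \<times> R. F (fst a) (snd a) (fst b) (snd b))"
    proof (intro HZ.T.sum_cong refl)
      show "(\<lambda>a. \<Oplus>\<^bsub>?T\<^esub>b\<in>{..<n} \<times> R. F (fst a) (snd a) (fst b) (snd b)) \<in> {..<n} \<times> {..<n} \<rightarrow> carrier ?T"
        using Fc by (intro Pi_I HZ.T.sum_closed) auto
      fix a assume a: "a \<in> {..<n} \<times> {..<n}"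
      show "(\<lambda>b. F (fst a) (snd a) (fst b) (snd b)) \<in> {..<n} \<times> R \<rightarrow> carrier ?T" using a Fc by auto
      fix b assume b: "b \<in> {..<n} \<times> R"
      show "tensor_bimap K H Z \<mu> act (pure_tensor K H Y (twist d' (i, j) a) (E a)) (?P (twist w (p, r) b) (v b)) =
          F (fst a) (snd a) (fst b) (snd b)"
        using bp[OF A.entry_closed[OF xI a] A.basis_closed[OF a] Z.entry_closed[OF yI b] Z.basis_closed[OF b]]
        by (simp add: F_def twist_def)
    qed
    also have "\<dots> = (\<Oplus>\<^bsub>?T\<^esub>a\<in>{..<n} \<times> {..<n}. \<Oplus>\<^bsub>?T\<^esub>m'\<in>{..<n}. \<Oplus>\<^bsub>?T\<^esub>t\<in>R. F (fst a) (snd a) m' t)"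
      using Fc R by (intro HZ.T.sum_cong HZ.T.M.finsum_Times[symmetric]) (auto intro!: HZ.T.sum_closed)
    also have "\<dots> = (\<Oplus>\<^bsub>?T\<^esub>k\<in>{..<n}. \<Oplus>\<^bsub>?T\<^esub>l\<in>{..<n}. \<Oplus>\<^bsub>?T\<^esub>m'\<in>{..<n}. \<Oplus>\<^bsub>?T\<^esub>t\<in>R. F k l m' t)"
      using Fc by (intro HZ.T.M.finsum_Times[symmetric]) (auto intro!: HZ.T.sum_closed)
    also have "\<dots> = (\<Oplus>\<^bsub>?T\<^esub>k\<in>{..<n}. \<Oplus>\<^bsub>?T\<^esub>l\<in>{..<n}. \<Oplus>\<^bsub>?T\<^esub>t\<in>R. \<Oplus>\<^bsub>?T\<^esub>m'\<in>{..<n}. F k l m' t)"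
      using Fc R by (intro HZ.T.sum_cong HZ.T.M.finsum_swap) (auto intro!: HZ.T.sum_closed)
    \<comment> \<open>Only the terms with \<open>m' = l\<close> survive, since
      \<open>E (k, l)\<close> kills the other basis vectors.\<close>
    also have "\<dots> = (\<Oplus>\<^bsub>?T\<^esub>k\<in>{..<n}. \<Oplus>\<^bsub>?T\<^esub>l\<in>{..<n}. \<Oplus>\<^bsub>?T\<^esub>t\<in>R. F k l l t)"
    proof -
      have "(\<Oplus>\<^bsub>?T\<^esub>m'\<in>{..<n}. F k l m' t) = F k l l t" if k: "k < n" and l: "l < n" and t: "t \<in> R" for k l t
      proof -
        have "(\<Oplus>\<^bsub>?T\<^esub>m'\<in>{..<n}. F k l m' t) = (\<Oplus>\<^bsub>?T\<^esub>m'\<in>{..<n}. if l = m' then F k l m' t else \<zero>\<^bsub>?T\<^esub>)"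
        proof (rule HZ.T.sum_cong[OF refl])
          show "(\<lambda>m'. if l = m' then F k l m' t else \<zero>\<^bsub>?T\<^esub>) \<in> {..<n} \<rightarrow> carrier ?T" using Fc k l t by auto
          fix m' assume "m' \<in> {..<n}"
          then have m': "m' < n" by simp
          have "\<mu> (\<mu> (d i k) (d' j l)) (\<mu> (d p m') (w r t)) \<in> carrier H"
            using m k l t m' d_closed d'_closed wc by (intro mc) auto
          then show "F k l m' t = (if l = m' then F k l m' t else \<zero>\<^bsub>?T\<^esub>)"
            using act_basis[OF k l m' t] p0 by (cases "l = m'") (simp_all add: F_def)
        qed
        also have "\<dots> = F k l l t" using Fc k l t by (intro HZ.T.sum_single) auto
        finally show ?thesis .
      qed
      then show ?thesis using Fc by (intro HZ.T.sum_cong) (auto intro!: HZ.T.sum_closed HZ.T.sum_cong)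
    qed
    also have "\<dots> = (\<Oplus>\<^bsub>?T\<^esub>k\<in>{..<n}. \<Oplus>\<^bsub>?T\<^esub>t\<in>R. \<Oplus>\<^bsub>?T\<^esub>l\<in>{..<n}. F k l l t)"
      using Fc R by (intro HZ.T.sum_cong HZ.T.M.finsum_swap) (auto intro!: HZ.T.sum_closed)
    \<comment> \<open>The right leg no longer depends on \<open>l\<close>, so the sum over
      \<open>l\<close> moves into the left leg, where \<open>contract\<close> applies.\<close>
    also have "\<dots> = (\<Oplus>\<^bsub>?T\<^esub>k\<in>{..<n}. \<Oplus>\<^bsub>?T\<^esub>t\<in>R. if j = p then ?P (twist w (i, r) (k, t)) (v (k, t)) else \<zero>\<^bsub>?T\<^esub>)"
    proof -
      have "(\<Oplus>\<^bsub>?T\<^esub>l\<in>{..<n}. F k l l t) = (if j = p then ?P (twist w (i, r) (k, t)) (v (k, t)) else \<zero>\<^bsub>?T\<^esub>)"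
        if k: "k < n" and t: "t \<in> R" for k t
      proof -
        have cl: "(\<lambda>l. \<mu> (\<mu> (d i k) (d' j l)) (\<mu> (d p l) (w r t))) \<in> {..<n} \<rightarrow> carrier H"
          using m k t d_closed d'_closed wc by (intro Pi_I mc) auto
        have "(\<Oplus>\<^bsub>?T\<^esub>l\<in>{..<n}. F k l l t) = (\<Oplus>\<^bsub>?T\<^esub>l\<in>{..<n}. ?P (\<mu> (\<mu> (d i k) (d' j l)) (\<mu> (d p l) (w r t))) (v (k, t)))"
          unfolding F_def using cl vZ[OF k t] act_basis k t by (intro HZ.T.sum_cong) (auto intro!: pc)
        also have "\<dots> = ?P (\<Oplus>\<^bsub>H\<^esub>l\<in>{..<n}. \<mu> (\<mu> (d i k) (d' j l)) (\<mu> (d p l) (w r t))) (v (k, t))"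
          by (rule bilinear_finsum_l[OF vspace_H Z.vspace_HY HZ.pure_bilinear cl vZ[OF k t], symmetric])
        also have "\<dots> = (if j = p then ?P (twist w (i, r) (k, t)) (v (k, t)) else \<zero>\<^bsub>?T\<^esub>)"
          using contract[OF d_closed[OF m(1) k] wc[OF m(4) t] m(2,3)]
            linear_map_zero[OF vspace_H Z.vspace_HY bilinear_map_linear(2)[OF HZ.pure_bilinear vZ[OF k t]]]
          by (simp add: twist_def)
        finally show ?thesis .
      qed
      moreover have "?P (twist w (i, r) (k, t)) (v (k, t)) \<in> carrier ?T" if "k < n" "t \<in> R" for k t
        using Z.row_closed[OF iI] that by auto
      ultimately show ?thesis by (intro HZ.T.sum_cong) (auto intro!: HZ.T.sum_closed HZ.T.sum_cong)
    qed
    also have "\<dots> = (if j = p then Z.coaction (v (i, r)) else \<zero>\<^bsub>?T\<^esub>)"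
    proof (cases "j = p")
      case True
      have rc: "?P (twist w (i, r) (k, t)) (v (k, t)) \<in> carrier ?T" if "k < n" "t \<in> R" for k t
        using Z.row_closed[OF iI] that by auto
      have "(\<Oplus>\<^bsub>?T\<^esub>k\<in>{..<n}. \<Oplus>\<^bsub>?T\<^esub>t\<in>R. ?P (twist w (i, r) (k, t)) (v (k, t))) =
          (\<Oplus>\<^bsub>?T\<^esub>a\<in>{..<n} \<times> R. ?P (twist w (i, r) (fst a, snd a)) (v (fst a, snd a)))"
        using R rc by (intro HZ.T.M.finsum_Times) auto
      then show ?thesis using True Z.coaction_basis[OF iI] by simp
    next
      case False
      have "(\<Oplus>\<^bsub>?T\<^esub>k\<in>{..<n}. \<Oplus>\<^bsub>?T\<^esub>t\<in>R. \<zero>\<^bsub>?T\<^esub>) = \<zero>\<^bsub>?T\<^esub>"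
        by (intro HZ.T.sum_zero) auto
      then show ?thesis using False by simp
    qed
    also have "\<dots> = Z.coaction (act (E (i, j)) (v (p, r)))"
      using act_basis[OF m] linear_map_zero[OF Z.vspace_Y Z.vspace_HY Z.coaction_linear] by simp
    finally show "Z.coaction (act (E x) (v y)) = tensor_bimap K H Z \<mu> act (A.coaction (E x)) (Z.coaction (v y))"
      unfolding xy by simp
  qed
qed

end

text \<open>The product \<open>star\<close> of matrix units is kept apart from the multiplication
  field of \<open>Y\<close>, which will be \<open>star\<close> or its opposite.\<close>

locale matrix_algebra = matrix_coefficients K H \<mu> \<eta> n d d' + A: finite_basis K Y "{..<n} \<times> {..<n}" E q
  for K :: "('k, 'x) ring_scheme" (structure) and H :: "('k, 'h, 'y) coalgebra_scheme" (structure) and \<mu> \<eta> n d d'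
    and Y :: "('k, 'b, 'z) module_scheme" and E q +
  fixes star :: "'b \<Rightarrow> 'b \<Rightarrow> 'b"
  assumes star_bilinear: "bilinear_map K Y Y Y star"
    and star_basis: "\<lbrakk>i < n; j < n; p < n; r < n\<rbrakk> \<Longrightarrow> star (E (i, j)) (E (p, r)) = (if j = p then E (i, r) else \<zero>\<^bsub>Y\<^esub>)"
begin

definition coaction where "coaction = comatrix_comodule.coaction K H Y ({..<n} \<times> {..<n}) E q (twist d')"

definition unit where "unit = (\<Oplus>\<^bsub>Y\<^esub>i\<in>{..<n}. E (i, i))"

lemma comatrix_comodule: "comatrix_comodule K H Y ({..<n} \<times> {..<n}) E q (twist d')"
  by (intro comatrix_comodule.intro coalgebra_axioms A.finite_basis_axioms comatrix_comodule_axioms.intro twist_comatrix comatrix_d')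

lemma vspace_Y: "vspace K Y" by (rule A.vspace_axioms)

lemma E_closed: "i < n \<Longrightarrow> j < n \<Longrightarrow> E (i, j) \<in> carrier Y"
  using A.basis_closed by simp

lemma unit_closed: "unit \<in> carrier Y"
  unfolding unit_def using E_closed by (intro A.sum_closed) auto

lemma coaction_linear: "linear_map K Y (tensor_space K H Y) coaction"
  unfolding coaction_def by (rule comatrix_comodule.coaction_linear[OF comatrix_comodule])

lemma comodule: "left_comodule K H (as_comodule Y coaction)"
  unfolding coaction_def by (rule comatrix_comodule.comodule[OF comatrix_comodule])

text \<open>Checked on matrix units and basis vectors, for any module of the given shape. It
  therefore yields both the associativity of \<open>star\<close> and the module law for
  \<open>V\<close>.\<close>

lemma action_assoc:
  assumes Z: "finite_basis K Z ({..<n} \<times> R) v s" and act: "bilinear_map K Y Z Z act"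
    and act_basis: "\<And>i j p r. \<lbrakk>i < n; j < n; p < n; r \<in> R\<rbrakk> \<Longrightarrow> act (E (i, j)) (v (p, r)) = (if j = p then v (i, r) else \<zero>\<^bsub>Z\<^esub>)"
    and a: "a \<in> carrier Y" and b: "b \<in> carrier Y" and z: "z \<in> carrier Z"
  shows "act (star a b) z = act a (act b z)"
proof -
  interpret Z: finite_basis K Z "{..<n} \<times> R" v s by fact
  have vZ: "vspace K Z" by (rule Z.vspace_axioms)
  have z0: "x \<in> carrier Y \<Longrightarrow> act x \<zero>\<^bsub>Z\<^esub> = \<zero>\<^bsub>Z\<^esub>" "y \<in> carrier Z \<Longrightarrow> act \<zero>\<^bsub>Y\<^esub> y = \<zero>\<^bsub>Z\<^esub>" for x y
    by (rule linear_map_zero[OF vZ vZ bilinear_map_linear(1)[OF act]], assumption)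
      (rule linear_map_zero[OF vspace_Y vZ bilinear_map_linear(2)[OF act]])
  show ?thesis
  proof (rule A.linear_eqI[OF vZ _ bilinear_map_linear(2)[OF act bilinear_mapD(1)[OF act b z]] _ a])
    show "linear_map K Y Z (\<lambda>a. act (star a b) z)"
      by (rule linear_map_comp[OF bilinear_map_linear(2)[OF star_bilinear b] bilinear_map_linear(2)[OF act z]])
    fix x assume x: "x \<in> {..<n} \<times> {..<n}"
    have Ex: "E x \<in> carrier Y" by (rule A.basis_closed[OF x])
    have L: "bilinear_map K Y Z Z (\<lambda>b z. act (star (E x) b) z)"
      by (rule bilinear_comp_id[OF act bilinear_map_linear(1)[OF star_bilinear Ex] linear_map_id])
    have R: "bilinear_map K Y Z Z (\<lambda>b z. act (E x) (act b z))"
      by (rule bilinear_map_comp[OF act linear_map_id linear_map_id bilinear_map_linear(1)[OF act Ex]])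
    show "act (star (E x) b) z = act (E x) (act b z)"
    proof (rule bilinear_eq_on_bases[OF A.finite_basis_axioms Z vZ L R _ b z])
      fix y t assume "y \<in> {..<n} \<times> {..<n}" "t \<in> {..<n} \<times> R"
      then obtain i j k l p r where xyt: "x = (i, j)" "y = (k, l)" "t = (p, r)"
        and m: "i < n" "j < n" "k < n" "l < n" "p < n" "r \<in> R" using x by auto
      have "v (p, r) \<in> carrier Z" using Z.basis_closed m by simp
      then show "act (star (E x) (E y)) (v t) = act (E x) (act (E y) (v t))"
        unfolding xyt using m E_closed by (simp add: star_basis act_basis z0)
    qed
  qed
qed

lemma action_unit:
  assumes Z: "finite_basis K Z ({..<n} \<times> R) v s" and act: "bilinear_map K Y Z Z act"
    and act_basis: "\<And>i j p r. \<lbrakk>i < n; j < n; p < n; r \<in> R\<rbrakk> \<Longrightarrow> act (E (i, j)) (v (p, r)) = (if j = p then v (i, r) else \<zero>\<^bsub>Z\<^esub>)"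
    and z: "z \<in> carrier Z"
  shows "act unit z = z"
proof -
  interpret Z: finite_basis K Z "{..<n} \<times> R" v s by fact
  have vZ: "vspace K Z" by (rule Z.vspace_axioms)
  show ?thesis
  proof (rule Z.linear_eqI[OF vZ bilinear_map_linear(1)[OF act unit_closed] linear_map_id _ z])
    fix t assume "t \<in> {..<n} \<times> R"
    then obtain p r where t: "t = (p, r)" "p < n" "r \<in> R" by auto
    have vt: "i < n \<Longrightarrow> v (i, r) \<in> carrier Z" for i using Z.basis_closed t by simp
    have cl: "(\<lambda>i. E (i, i)) \<in> {..<n} \<rightarrow> carrier Y" using E_closed by auto
    have "act unit (v (p, r)) = (\<Oplus>\<^bsub>Z\<^esub>i\<in>{..<n}. act (E (i, i)) (v (p, r)))"
      unfolding unit_def by (rule bilinear_finsum_l[OF vspace_Y vZ act cl vt[OF t(2)]])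
    also have "\<dots> = (\<Oplus>\<^bsub>Z\<^esub>i\<in>{..<n}. if p = i then v (i, r) else \<zero>\<^bsub>Z\<^esub>)"
      using t vt by (intro Z.sum_cong) (auto simp: act_basis)
    also have "\<dots> = v (p, r)" using t vt by (intro Z.sum_single) auto
    finally show "act unit (v t) = v t" unfolding t(1) .
  qed
qed

lemma star_closed: "a \<in> carrier Y \<Longrightarrow> b \<in> carrier Y \<Longrightarrow> star a b \<in> carrier Y"
  by (rule bilinear_mapD(1)[OF star_bilinear])

lemma star_assoc: "\<lbrakk>a \<in> carrier Y; b \<in> carrier Y; c \<in> carrier Y\<rbrakk> \<Longrightarrow> star (star a b) c = star a (star b c)"
  by (rule action_assoc[OF A.finite_basis_axioms star_bilinear]) (simp_all add: star_basis)

lemma star_unit_l: "a \<in> carrier Y \<Longrightarrow> star unit a = a"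
  by (rule action_unit[OF A.finite_basis_axioms star_bilinear]) (simp_all add: star_basis)

lemma star_unit_r:
  assumes a: "a \<in> carrier Y"
  shows "star a unit = a"
proof (rule A.linear_eqI[OF vspace_Y bilinear_map_linear(2)[OF star_bilinear unit_closed] linear_map_id _ a])
  fix x assume "x \<in> {..<n} \<times> {..<n}"
  then obtain i j where x: "x = (i, j)" "i < n" "j < n" by auto
  have cl: "(\<lambda>i. E (i, i)) \<in> {..<n} \<rightarrow> carrier Y" using E_closed by auto
  have "star (E (i, j)) unit = (\<Oplus>\<^bsub>Y\<^esub>k\<in>{..<n}. star (E (i, j)) (E (k, k)))"
    unfolding unit_def by (rule bilinear_finsum_r[OF vspace_Y vspace_Y star_bilinear cl E_closed[OF x(2,3)]])
  also have "\<dots> = (\<Oplus>\<^bsub>Y\<^esub>k\<in>{..<n}. if j = k then E (i, k) else \<zero>\<^bsub>Y\<^esub>)"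
    using x E_closed by (intro A.sum_cong) (auto simp: star_basis)
  also have "\<dots> = E (i, j)" using x E_closed by (intro A.sum_single) auto
  finally show "star (E x) unit = E x" unfolding x(1) .
qed

lemma coaction_star:
  "\<lbrakk>a \<in> carrier Y; b \<in> carrier Y\<rbrakk> \<Longrightarrow> coaction (star a b) = tensor_bimap K H Y \<mu> star (coaction a) (coaction b)"
  unfolding coaction_def
  by (rule coaction_act[OF A.finite_basis_axioms A.finite_basis_axioms comatrix_d' star_bilinear]) (simp_all add: star_basis)

text \<open>In the coaction of the sum of the \<open>E (i, i)\<close>, the coefficient of
  \<open>E (k, l)\<close> is the sum over \<open>i\<close> of the products of \<open>d i k\<close>
  and \<open>d' i l\<close>, which \<open>pairing_r\<close> evaluates.\<close>

lemma coaction_unit: "coaction unit = pure_tensor K H Y \<eta> unit"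
proof -
  interpret C: comatrix_comodule K H Y "{..<n} \<times> {..<n}" E q "twist d'" by (rule comatrix_comodule)
  interpret HY: vspace_pair K H Y by (intro vspace_pair.intro vspace_H vspace_Y)
  let ?T = "tensor_space K H Y" and ?P = "pure_tensor K H Y"
  have cl: "(\<lambda>i. E (i, i)) \<in> {..<n} \<rightarrow> carrier Y" using E_closed by auto
  have pc: "?P (\<mu> (d i k) (d' i l)) (E (k, l)) \<in> carrier ?T" if "i < n" "k < n" "l < n" for i k l
    using that d_closed d'_closed E_closed by (intro HY.pure_simps(1) mu_closed) auto
  have eta: "\<eta> \<in> carrier H" by (rule eta_closed)
  have ec: "?P \<eta> (E (k, l)) \<in> carrier ?T" if "k < n" "l < n" for k l
    using that E_closed by (intro HY.pure_simps(1) eta) auto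
  have "coaction unit = (\<Oplus>\<^bsub>?T\<^esub>i\<in>{..<n}. coaction (E (i, i)))"
    unfolding unit_def by (rule linear_map_finsum[OF vspace_Y C.vspace_HY coaction_linear cl])
  also have "\<dots> = (\<Oplus>\<^bsub>?T\<^esub>i\<in>{..<n}. \<Oplus>\<^bsub>?T\<^esub>k\<in>{..<n}. \<Oplus>\<^bsub>?T\<^esub>l\<in>{..<n}. ?P (\<mu> (d i k) (d' i l)) (E (k, l)))"
  proof (rule HY.T.sum_cong[OF refl])
    show "(\<lambda>i. \<Oplus>\<^bsub>?T\<^esub>k\<in>{..<n}. \<Oplus>\<^bsub>?T\<^esub>l\<in>{..<n}. ?P (\<mu> (d i k) (d' i l)) (E (k, l))) \<in> {..<n} \<rightarrow> carrier ?T"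
      using pc by (intro Pi_I HY.T.sum_closed) auto
    fix i assume "i \<in> {..<n}"
    then have i: "i < n" by simp
    have "coaction (E (i, i)) = (\<Oplus>\<^bsub>?T\<^esub>z\<in>{..<n} \<times> {..<n}. ?P (\<mu> (d i (fst z)) (d' i (snd z))) (E (fst z, snd z)))"
      unfolding coaction_def using C.coaction_basis[of "(i, i)"] i by (simp add: twist_def)
    also have "\<dots> = (\<Oplus>\<^bsub>?T\<^esub>k\<in>{..<n}. \<Oplus>\<^bsub>?T\<^esub>l\<in>{..<n}. ?P (\<mu> (d i k) (d' i l)) (E (k, l)))"
      using pc[OF i] by (intro HY.T.M.finsum_Times[symmetric]) auto
    finally show "coaction (E (i, i)) = (\<Oplus>\<^bsub>?T\<^esub>k\<in>{..<n}. \<Oplus>\<^bsub>?T\<^esub>l\<in>{..<n}. ?P (\<mu> (d i k) (d' i l)) (E (k, l)))" .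
  qed
  also have "\<dots> = (\<Oplus>\<^bsub>?T\<^esub>k\<in>{..<n}. \<Oplus>\<^bsub>?T\<^esub>i\<in>{..<n}. \<Oplus>\<^bsub>?T\<^esub>l\<in>{..<n}. ?P (\<mu> (d i k) (d' i l)) (E (k, l)))"
    using pc by (intro HY.T.M.finsum_swap) (auto intro!: HY.T.sum_closed)
  also have "\<dots> = (\<Oplus>\<^bsub>?T\<^esub>k\<in>{..<n}. \<Oplus>\<^bsub>?T\<^esub>l\<in>{..<n}. \<Oplus>\<^bsub>?T\<^esub>i\<in>{..<n}. ?P (\<mu> (d i k) (d' i l)) (E (k, l)))"
    using pc by (intro HY.T.sum_cong HY.T.M.finsum_swap) (auto intro!: HY.T.sum_closed)
  also have "\<dots> = (\<Oplus>\<^bsub>?T\<^esub>k\<in>{..<n}. \<Oplus>\<^bsub>?T\<^esub>l\<in>{..<n}. if k = l then ?P \<eta> (E (k, l)) else \<zero>\<^bsub>?T\<^esub>)"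
  proof -
    have "(\<Oplus>\<^bsub>?T\<^esub>i\<in>{..<n}. ?P (\<mu> (d i k) (d' i l)) (E (k, l))) = (if k = l then ?P \<eta> (E (k, l)) else \<zero>\<^bsub>?T\<^esub>)"
      if k: "k < n" and l: "l < n" for k l
    proof -
      have cl: "(\<lambda>i. \<mu> (d i k) (d' i l)) \<in> {..<n} \<rightarrow> carrier H" using k l d_closed d'_closed mu_closed by auto
      have "(\<Oplus>\<^bsub>?T\<^esub>i\<in>{..<n}. ?P (\<mu> (d i k) (d' i l)) (E (k, l))) = ?P (if k = l then \<eta> else \<zero>\<^bsub>H\<^esub>) (E (k, l))"
        unfolding pairing_r[OF k l, symmetric]
        by (rule bilinear_finsum_l[OF vspace_H C.vspace_HY HY.pure_bilinear cl E_closed[OF k l], symmetric])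
      then show ?thesis
        using linear_map_zero[OF vspace_H C.vspace_HY bilinear_map_linear(2)[OF HY.pure_bilinear E_closed[OF k l]]]
        by (cases "k = l") simp_all
    qed
    then show ?thesis using ec by (intro HY.T.sum_cong) (auto intro!: HY.T.sum_closed HY.T.sum_cong)
  qed
  also have "\<dots> = (\<Oplus>\<^bsub>?T\<^esub>k\<in>{..<n}. ?P \<eta> (E (k, k)))"
    using ec by (intro HY.T.sum_cong HY.T.sum_single) auto
  also have "\<dots> = ?P \<eta> unit"
    unfolding unit_def by (rule bilinear_finsum_r[OF vspace_Y C.vspace_HY HY.pure_bilinear cl eta, symmetric])
  finally show ?thesis .
qed

text \<open>
  A left ideal and subcomodule consists of the matrices whose rows lie in some subspace \<open>W\<close> of \<open>K\<^sup>n\<close>,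
  and \<open>W\<close> is a subcomodule for the comatrix \<open>d'\<close>.
\<close>

lemma simple_of_simple_comatrix:
  assumes simple: "simple_comatrix K H n d'" and n: "0 < n"
    and I: "subcomodule K H (as_comodule Y coaction) I" and SI: "\<And>a x. a \<in> carrier Y \<Longrightarrow> x \<in> I \<Longrightarrow> star a x \<in> I"
  shows "I = {\<zero>\<^bsub>Y\<^esub>} \<or> I = carrier Y"
proof -
  interpret C: comatrix_comodule K H Y "{..<n} \<times> {..<n}" E q "twist d'" by (rule comatrix_comodule)
  interpret HV: vspace K H by (rule vspace_H)
  interpret AC: left_comodule K H "as_comodule Y coaction" by (rule comodule)
  interpret D: left_comodule K H "coord_comodule K H n d'" by (rule coord_comodule[OF comatrix_d'])
  let ?F = "free_module K {..<n}"
  interpret F: finite_basis K ?F "{..<n}" "single K" "\<lambda>i x. x i"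
    by (rule K.free_module_finite_basis) simp
  have Is: "submodule I K Y" using AC.subcomoduleD(1)[OF I] by simp
  note IS = A.submodule_vspace[OF Is]
  have coq: "coaction = C.coaction" unfolding coaction_def ..
  have dI: "slice_l K Y f (coaction x) \<in> I" if "functional K H f" "x \<in> I" for f x
    using AC.subcomoduleD(2)[OF I that] by simp
  \<comment> \<open>Embeds \<open>K^n\<close> as the row of index 0. Left multiplication by matrix
    units moves rows among each other, so one row is enough to recover the ideal.\<close>
  define \<kappa> where "\<kappa> = F.extend Y (\<lambda>t. E (0, t))"
  have E0: "t \<in> {..<n} \<Longrightarrow> E (0, t) \<in> carrier Y" for t using E_closed n by simp
  have \<kappa>: "linear_map K ?F Y \<kappa>" unfolding \<kappa>_def by (rule F.extend_linear[OF vspace_Y E0])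
  have \<kappa>s: "t < n \<Longrightarrow> \<kappa> (single K t) = E (0, t)" for t
    unfolding \<kappa>_def by (rule F.extend_basis[OF vspace_Y E0]) simp_all
  \<comment> \<open>Expresses the action belonging to \<open>d'\<close> through the coaction of the
    algebra. The coaction on the row of index 0 carries factors \<open>d 0 k\<close>; multiplication
    by \<open>E (0, l)\<close> selects \<open>k = l\<close>, and the factor \<open>d' 0 l\<close>
    put into the functional cancels \<open>d 0 l\<close> after summing over
    \<open>l\<close>.\<close>
  have main: "\<kappa> (dual_act K (coord_comodule K H n d') f x) =
      (\<Oplus>\<^bsub>Y\<^esub>l\<in>{..<n}. star (E (0, l)) (slice_l K Y (\<lambda>h. f (\<mu> (d' 0 l) h)) (coaction (\<kappa> x))))"
    if f: "functional K H f" and x: "x \<in> carrier ?F" for f x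
  proof -
    have fl: "functional K H (\<lambda>h. f (\<mu> (d' 0 l) h))" if "l < n" for l
      by (rule linear_map_comp[OF bilinear_map_linear(1)[OF mu_bilinear d'_closed[OF n that]] f])
    define G where "G l x = star (E (0, l)) (slice_l K Y (\<lambda>h. f (\<mu> (d' 0 l) h)) (coaction (\<kappa> x)))" for l x
    have Gl: "linear_map K ?F Y (G l)" if "l < n" for l
      unfolding G_def[abs_def]
      by (rule linear_map_comp[OF linear_map_comp[OF linear_map_comp[OF \<kappa> coaction_linear] slice_l_linear[OF vspace_H vspace_Y fl[OF that]]]
        bilinear_map_linear(1)[OF star_bilinear E_closed[OF n that]]])
    have sumlin: "linear_map K ?F Y (\<lambda>x. \<Oplus>\<^bsub>Y\<^esub>l\<in>L. G l x)" if "finite L" "L \<subseteq> {..<n}" for L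
      using that
    proof (induct L rule: finite_induct)
      case empty
      show ?case by (rule linear_mapI) simp_all
    next
      case (insert l L)
      have lin: "linear_map K ?F Y (\<lambda>x. G l x \<oplus>\<^bsub>Y\<^esub> (\<Oplus>\<^bsub>Y\<^esub>l\<in>L. G l x))"
        using insert by (intro linear_map_sum[OF vspace_Y Gl]) auto
      show ?case
      proof (rule linear_map_cong[OF F.vspace_axioms lin])
        fix x assume x: "x \<in> carrier ?F"
        have "(\<lambda>l. G l x) \<in> L \<rightarrow> carrier Y" "G l x \<in> carrier Y"
          using linear_mapD(1)[OF Gl x] insert by auto
        then show "G l x \<oplus>\<^bsub>Y\<^esub> (\<Oplus>\<^bsub>Y\<^esub>l\<in>L. G l x) = (\<Oplus>\<^bsub>Y\<^esub>l\<in>insert l L. G l x)"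
          using insert by (intro A.sum_insert[symmetric]) auto
      qed
    qed
    show ?thesis
      unfolding G_def[symmetric]
    proof (rule F.linear_eqI[OF vspace_Y linear_map_comp[OF coord_dual_act_linear[OF comatrix_d' f] \<kappa>] sumlin _ x])
      show "finite {..<n}" "{..<n} \<subseteq> {..<n}" by simp_all
      fix s assume "s \<in> {..<n}"
      then have s: "s < n" by simp
      have f'c: "f (d' s t) \<in> carrier K" if "t < n" for t by (rule functional_closed[OF f d'_closed[OF s that]])
      have hc: "\<mu> (d' 0 l) (\<mu> (d 0 k) (d' s t)) \<in> carrier H" if "l < n" "k < n" "t < n" for l k t
        using that n s d_closed d'_closed by (intro mu_closed) auto
      have fhc: "f (\<mu> (d' 0 l) (\<mu> (d 0 k) (d' s t))) \<in> carrier K" if "l < n" "k < n" "t < n" for l k t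
        by (rule functional_closed[OF f hc[OF that]])
      have "\<kappa> (dual_act K (coord_comodule K H n d') f (single K s)) =
          (\<Oplus>\<^bsub>Y\<^esub>t\<in>{..<n}. \<kappa> (f (d' s t) \<odot>\<^bsub>?F\<^esub> single K t))"
        unfolding coord_dual_act_single[OF comatrix_d' f s]
        using f'c F.basis_closed by (intro linear_map_finsum[OF F.vspace_axioms vspace_Y \<kappa>] Pi_I F.scale_closed) auto
      also have "\<dots> = (\<Oplus>\<^bsub>Y\<^esub>t\<in>{..<n}. f (d' s t) \<odot>\<^bsub>Y\<^esub> E (0, t))"
        using f'c E0 \<kappa>s linear_mapD(3)[OF \<kappa> f'c F.basis_closed] by (intro A.sum_cong) (auto intro!: A.scale_closed simp del: free_module_simps)
      finally have 1: "\<kappa> (dual_act K (coord_comodule K H n d') f (single K s)) = (\<Oplus>\<^bsub>Y\<^esub>t\<in>{..<n}. f (d' s t) \<odot>\<^bsub>Y\<^esub> E (0, t))" .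
      have G: "G l (single K s) = (\<Oplus>\<^bsub>Y\<^esub>t\<in>{..<n}. f (\<mu> (d' 0 l) (\<mu> (d 0 l) (d' s t))) \<odot>\<^bsub>Y\<^esub> E (0, t))" if l: "l < n" for l
      proof -
        let ?c = "\<lambda>k t. f (\<mu> (d' 0 l) (\<mu> (d 0 k) (d' s t)))"
        have sI: "(0, s) \<in> {..<n} \<times> {..<n}" using s n by simp
        have cY: "(\<lambda>z. ?c (fst z) (snd z) \<odot>\<^bsub>Y\<^esub> E z) \<in> {..<n} \<times> {..<n} \<rightarrow> carrier Y"
          using fhc[OF l] E_closed by (auto intro!: A.scale_closed)
        have sc: "star (E (0, l)) (E (k, t)) \<in> carrier Y" if "k < n" "t < n" for k t
          using that l n by (intro star_closed E_closed)
        have "G l (single K s) = star (E (0, l)) (\<Oplus>\<^bsub>Y\<^esub>z\<in>{..<n} \<times> {..<n}. ?c (fst z) (snd z) \<odot>\<^bsub>Y\<^esub> E z)"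
          unfolding G_def \<kappa>s[OF s] coq C.slice_coaction_basis[OF fl[OF l] sI] by (simp add: twist_def)
        also have "\<dots> = (\<Oplus>\<^bsub>Y\<^esub>z\<in>{..<n} \<times> {..<n}. star (E (0, l)) (?c (fst z) (snd z) \<odot>\<^bsub>Y\<^esub> E z))"
          by (rule bilinear_finsum_r[OF vspace_Y vspace_Y star_bilinear cY E_closed[OF n l]])
        also have "\<dots> = (\<Oplus>\<^bsub>Y\<^esub>z\<in>{..<n} \<times> {..<n}. ?c (fst z) (snd z) \<odot>\<^bsub>Y\<^esub> star (E (0, l)) (E (fst z, snd z)))"
          using fhc[OF l] sc bilinear_mapD(5)[OF star_bilinear _ E_closed[OF n l]] E_closed
          by (intro A.sum_cong) (auto intro!: A.scale_closed)
        also have "\<dots> = (\<Oplus>\<^bsub>Y\<^esub>k\<in>{..<n}. \<Oplus>\<^bsub>Y\<^esub>t\<in>{..<n}. ?c k t \<odot>\<^bsub>Y\<^esub> star (E (0, l)) (E (k, t)))"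
          using fhc[OF l] sc by (intro A.M.finsum_Times[symmetric]) (auto intro!: A.scale_closed)
        also have "\<dots> = (\<Oplus>\<^bsub>Y\<^esub>t\<in>{..<n}. \<Oplus>\<^bsub>Y\<^esub>k\<in>{..<n}. ?c k t \<odot>\<^bsub>Y\<^esub> star (E (0, l)) (E (k, t)))"
          using fhc[OF l] sc by (intro A.M.finsum_swap) (auto intro!: A.scale_closed)
        also have "\<dots> = (\<Oplus>\<^bsub>Y\<^esub>t\<in>{..<n}. \<Oplus>\<^bsub>Y\<^esub>k\<in>{..<n}. if l = k then ?c k t \<odot>\<^bsub>Y\<^esub> E (0, t) else \<zero>\<^bsub>Y\<^esub>)"
          using fhc[OF l] E0 star_basis[OF n l] by (intro A.sum_cong) (auto intro!: A.scale_closed A.sum_closed A.sum_cong)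
        also have "\<dots> = (\<Oplus>\<^bsub>Y\<^esub>t\<in>{..<n}. ?c l t \<odot>\<^bsub>Y\<^esub> E (0, t))"
          using fhc[OF l] E0 l by (intro A.sum_cong A.sum_single) (auto intro!: A.scale_closed)
        finally show ?thesis .
      qed
      have "(\<Oplus>\<^bsub>Y\<^esub>l\<in>{..<n}. G l (single K s)) =
          (\<Oplus>\<^bsub>Y\<^esub>l\<in>{..<n}. \<Oplus>\<^bsub>Y\<^esub>t\<in>{..<n}. f (\<mu> (d' 0 l) (\<mu> (d 0 l) (d' s t))) \<odot>\<^bsub>Y\<^esub> E (0, t))"
        using fhc E0 by (intro A.sum_cong) (auto simp: G intro!: A.scale_closed A.sum_closed)
      also have "\<dots> = (\<Oplus>\<^bsub>Y\<^esub>t\<in>{..<n}. \<Oplus>\<^bsub>Y\<^esub>l\<in>{..<n}. f (\<mu> (d' 0 l) (\<mu> (d 0 l) (d' s t))) \<odot>\<^bsub>Y\<^esub> E (0, t))"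
        using fhc E0 by (intro A.M.finsum_swap) (auto intro!: A.scale_closed)
      also have "\<dots> = (\<Oplus>\<^bsub>Y\<^esub>t\<in>{..<n}. f (d' s t) \<odot>\<^bsub>Y\<^esub> E (0, t))"
      proof (rule A.sum_cong[OF refl])
        show "(\<lambda>t. f (d' s t) \<odot>\<^bsub>Y\<^esub> E (0, t)) \<in> {..<n} \<rightarrow> carrier Y" using f'c E0 by (auto intro!: A.scale_closed)
        fix t assume "t \<in> {..<n}"
        then have t: "t < n" by simp
        have lin: "linear_map K H Y (\<lambda>h. f h \<odot>\<^bsub>Y\<^esub> E (0, t))"
          by (rule linear_map_comp[OF f bilinear_map_linear(2)[OF bilinear_map_smult[OF vspace_Y] E_closed[OF n t]]])
        have cl: "(\<lambda>l. \<mu> (d' 0 l) (\<mu> (d 0 l) (d' s t))) \<in> {..<n} \<rightarrow> carrier H" using hc t by auto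
        have "(\<Oplus>\<^bsub>Y\<^esub>l\<in>{..<n}. f (\<mu> (d' 0 l) (\<mu> (d 0 l) (d' s t))) \<odot>\<^bsub>Y\<^esub> E (0, t)) =
            f (\<Oplus>\<^bsub>H\<^esub>l\<in>{..<n}. \<mu> (d' 0 l) (\<mu> (d 0 l) (d' s t))) \<odot>\<^bsub>Y\<^esub> E (0, t)"
          by (rule linear_map_finsum[OF vspace_H vspace_Y lin cl, symmetric])
        also have "(\<Oplus>\<^bsub>H\<^esub>l\<in>{..<n}. \<mu> (d' 0 l) (\<mu> (d 0 l) (d' s t))) =
            (\<Oplus>\<^bsub>H\<^esub>l\<in>{..<n}. \<mu> (\<mu> \<eta> (d' 0 l)) (\<mu> (d 0 l) (d' s t)))"
          using cl n d'_closed by (intro HV.sum_cong) (auto simp: mu_unit_l)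
        also have "\<dots> = d' s t" using contract[OF eta_closed d'_closed[OF s t] n n] d'_closed[OF s t] by (simp add: mu_unit_l)
        finally show "(\<Oplus>\<^bsub>Y\<^esub>l\<in>{..<n}. f (\<mu> (d' 0 l) (\<mu> (d 0 l) (d' s t))) \<odot>\<^bsub>Y\<^esub> E (0, t)) = f (d' s t) \<odot>\<^bsub>Y\<^esub> E (0, t)" .
      qed
      finally show "\<kappa> (dual_act K (coord_comodule K H n d') f (single K s)) = (\<Oplus>\<^bsub>Y\<^esub>l\<in>{..<n}. G l (single K s))"
        using 1 by simp
    qed
  qed
  \<comment> \<open>The vectors whose row matrix lies in \<open>I\<close>. By \<open>main\<close>
    they form a subcomodule, to which simplicity of \<open>d'\<close> applies.\<close>
  let ?W = "{x \<in> carrier ?F. \<kappa> x \<in> I}"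
  have Ws: "submodule ?W K ?F" by (rule F.submodule_preimage[OF vspace_Y \<kappa> Is F.top_submodule])
  have "subcomodule K H (coord_comodule K H n d') ?W"
  proof (rule D.subcomoduleI)
    show "submodule ?W K (coord_comodule K H n d')" using Ws unfolding coord_comodule_def by simp
    fix f x assume f: "functional K H f" and x: "x \<in> ?W"
    then have xF: "x \<in> carrier ?F" and xI: "\<kappa> x \<in> I" by auto
    have "(\<Oplus>\<^bsub>Y\<^esub>l\<in>{..<n}. star (E (0, l)) (slice_l K Y (\<lambda>h. f (\<mu> (d' 0 l) h)) (coaction (\<kappa> x)))) \<in> I"
    proof (rule A.submodule_finsum[OF Is], rule Pi_I)
      fix l assume "l \<in> {..<n}"
      then have l: "l < n" by simp
      have "functional K H (\<lambda>h. f (\<mu> (d' 0 l) h))"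
        by (rule linear_map_comp[OF bilinear_map_linear(1)[OF mu_bilinear d'_closed[OF n l]] f])
      then show "star (E (0, l)) (slice_l K Y (\<lambda>h. f (\<mu> (d' 0 l) h)) (coaction (\<kappa> x))) \<in> I"
        using dI xI by (intro SI E_closed[OF n l])
    qed
    then show "dual_act K (coord_comodule K H n d') f x \<in> ?W"
      using main[OF f xF] linear_mapD(1)[OF coord_dual_act_linear[OF comatrix_d' f] xF] by simp
  qed
  then consider "?W = {\<lambda>_. \<zero>\<^bsub>K\<^esub>}" | "?W = finsupp K {..<n}" using simple unfolding simple_comatrix_def by blast
  then show ?thesis
  proof cases
    case 1
    have "a = \<zero>\<^bsub>Y\<^esub>" if a: "a \<in> I" for a
    proof (rule A.coord_zeroI)
      show aY: "a \<in> carrier Y" using a IS(1) by blast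
      fix z assume "z \<in> {..<n} \<times> {..<n}"
      then obtain i t where z: "z = (i, t)" "i < n" "t < n" by auto
      have qa: "s < n \<Longrightarrow> q (i, s) a \<in> carrier K" for s using A.coord_closed[OF _ aY] z by simp
      \<comment> \<open>Row \<open>i\<close> of \<open>a\<close>. Left multiplication by
        \<open>E (0, i)\<close> moves it to the row of index 0 and erases the others.\<close>
      define r where "r s = (if s < n then q (i, s) a else \<zero>\<^bsub>K\<^esub>)" for s
      have rF: "r \<in> carrier ?F" unfolding r_def free_module_simps by (rule K.finsupp_finiteI) (use qa in auto)
      have "star (E (0, i)) a = \<kappa> r"
      proof -
        have eq: "linear_map K Y Y (\<lambda>a. F.extend Y (\<lambda>s. E (0, s)) (\<lambda>s. if s < n then q (i, s) a else \<zero>\<^bsub>K\<^esub>))"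
        proof -
          have "linear_map K Y ?F (\<lambda>a s. if s < n then q (i, s) a else \<zero>\<^bsub>K\<^esub>)"
          proof (rule linear_mapI)
            show "(\<lambda>s. if s < n then q (i, s) a else \<zero>\<^bsub>K\<^esub>) \<in> carrier ?F" if "a \<in> carrier Y" for a
              unfolding free_module_simps by (rule K.finsupp_finiteI) (use A.coord_closed[OF _ that] z in auto)
          qed (use z in \<open>auto simp: functional_add[OF A.coord_functional] functional_smult[OF A.coord_functional]\<close>)
          then show ?thesis by (rule linear_map_comp[OF _ F.extend_linear[OF vspace_Y E0]])
        qed
        have "star (E (0, i)) a = F.extend Y (\<lambda>s. E (0, s)) (\<lambda>s. if s < n then q (i, s) a else \<zero>\<^bsub>K\<^esub>)"
        proof (rule A.linear_eqI[OF vspace_Y bilinear_map_linear(1)[OF star_bilinear E_closed[OF n z(2)]] eq _ aY])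
          fix y assume "y \<in> {..<n} \<times> {..<n}"
          then obtain k l where y: "y = (k, l)" "k < n" "l < n" by auto
          have co: "q (i, s) (E (k, l)) = (if i = k \<and> s = l then \<one>\<^bsub>K\<^esub> else \<zero>\<^bsub>K\<^esub>)" if "s < n" for s
            using A.coord_basis[of "(i, s)" "(k, l)"] z y that by simp
          have "F.extend Y (\<lambda>s. E (0, s)) (\<lambda>s. if s < n then q (i, s) (E (k, l)) else \<zero>\<^bsub>K\<^esub>) =
              (\<Oplus>\<^bsub>Y\<^esub>s\<in>{..<n}. if l = s then (if i = k then E (0, s) else \<zero>\<^bsub>Y\<^esub>) else \<zero>\<^bsub>Y\<^esub>)"
            unfolding F.extend_def using co E0 by (intro A.sum_cong) auto
          also have "\<dots> = (if i = k then E (0, l) else \<zero>\<^bsub>Y\<^esub>)" using y E0 by (intro A.sum_single) auto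
          also have "\<dots> = star (E (0, i)) (E (k, l))" using star_basis[OF n z(2) y(2,3)] by simp
          finally show "star (E (0, i)) (E y) = F.extend Y (\<lambda>s. E (0, s)) (\<lambda>s. if s < n then q (i, s) (E y) else \<zero>\<^bsub>K\<^esub>)"
            unfolding y(1) by simp
        qed
        then show ?thesis unfolding \<kappa>_def r_def .
      qed
      moreover have "star (E (0, i)) a \<in> I" by (rule SI[OF E_closed[OF n z(2)] a])
      ultimately have "r \<in> ?W" using rF by simp
      then have "r = (\<lambda>_. \<zero>\<^bsub>K\<^esub>)" using 1 by blast
      then show "q z a = \<zero>\<^bsub>K\<^esub>" using z r_def by (metis)
    qed
    then show ?thesis using IS(2) by blast
  next
    case 2
    \<comment> \<open>The whole row of index 0 lies in \<open>I\<close>, and \<open>E (i, 0)\<close>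
      moves it to row \<open>i\<close>.\<close>
    have "E z \<in> I" if zI: "z \<in> {..<n} \<times> {..<n}" for z
    proof -
      obtain i t where z: "z = (i, t)" "i < n" "t < n" using zI by auto
      have "single K t \<in> ?W" using 2 F.basis_closed[of t] z by simp
      then have "E (0, t) \<in> I" using \<kappa>s[OF z(3)] by simp
      then have "star (E (i, 0)) (E (0, t)) \<in> I" by (rule SI[OF E_closed[OF z(2) n]])
      then show ?thesis using star_basis[OF z(2) n n z(3)] z(1) by simp
    qed
    then show ?thesis using A.submodule_all[OF Is] by blast
  qed
qed

end

section \<open>Assembling algebras with a coaction\<close>

lemma finsupp_as_comodule [simp]: "finsupp (as_comodule Y \<rho>) B = finsupp Y B"
  by (simp add: finsupp_def)

lemma (in coalgebra) assoc_algebra_as_comodule: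
  assumes Y: "vspace K Y" and b: "bilinear_map K Y Y Y (mult Y)" and one: "\<one>\<^bsub>Y\<^esub> \<in> carrier Y"
    and assoc: "\<And>x y z. \<lbrakk>x \<in> carrier Y; y \<in> carrier Y; z \<in> carrier Y\<rbrakk> \<Longrightarrow> x \<otimes>\<^bsub>Y\<^esub> y \<otimes>\<^bsub>Y\<^esub> z = x \<otimes>\<^bsub>Y\<^esub> (y \<otimes>\<^bsub>Y\<^esub> z)"
    and unit: "\<And>x. x \<in> carrier Y \<Longrightarrow> \<one>\<^bsub>Y\<^esub> \<otimes>\<^bsub>Y\<^esub> x = x" "\<And>x. x \<in> carrier Y \<Longrightarrow> x \<otimes>\<^bsub>Y\<^esub> \<one>\<^bsub>Y\<^esub> = x"
  shows "assoc_algebra K (as_comodule Y \<rho>)"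
proof -
  let ?A = "as_comodule Y \<rho>"
  have vA: "vspace K ?A" using Y by simp
  note mb = bilinear_mapD[OF b]
  have "ring ?A"
  proof (rule ringI)
    show "abelian_group ?A" using module.axioms(2)[OF vspace.axioms(2)[OF vA]] .
    show "monoid ?A" by (rule monoidI) (simp_all add: one mb assoc unit)
  qed (simp_all add: mb)
  then show ?thesis
    using b by (intro assoc_algebra.intro vspace.axioms[OF vA] assoc_algebra_axioms.intro) (simp_all add: bilinear_map_def)
qed

lemma algebra_hom_as_comodule:
  assumes "linear_map K Y (tensor_space K H Y) \<rho>"
    and "\<And>x y. \<lbrakk>x \<in> carrier Y; y \<in> carrier Y\<rbrakk> \<Longrightarrow> \<rho> (x \<otimes>\<^bsub>Y\<^esub> y) = tensor_bimap K H Y (mult H) (mult Y) (\<rho> x) (\<rho> y)"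
    and "\<rho> \<one>\<^bsub>Y\<^esub> = pure_tensor K H Y \<one>\<^bsub>H\<^esub> \<one>\<^bsub>Y\<^esub>"
  shows "algebra_hom K (as_comodule Y \<rho>) (tensor_algebra K H (as_comodule Y \<rho>)) \<rho>"
proof -
  have "linear_map K Y (tensor_algebra K H (as_comodule Y \<rho>)) \<rho>"
    using assms(1) by (simp add: tensor_algebra_def linear_map_def)
  moreover have "\<rho> \<in> ring_hom (as_comodule Y \<rho>) (tensor_algebra K H (as_comodule Y \<rho>))"
    using linear_mapD[OF assms(1)] assms(2,3) by (intro ring_hom_memI) (simp_all add: tensor_algebra_def)
  ultimately show ?thesis by (simp add: algebra_hom_def)
qed

context matrix_algebra
begin

text \<open>Every vector is annihilated by some nonzero matrix, so \<open>V\<close> is not free if its dimension exceeds one.\<close>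

lemma not_free:
  assumes n: "2 \<le> n" and Z: "finite_basis K Z ({..<n} \<times> {()}) v s" and act: "bilinear_map K Y Z Z act"
    and act_basis: "\<And>i j p r. \<lbrakk>i < n; j < n; p < n\<rbrakk> \<Longrightarrow> act (E (i, j)) (v (p, r)) = (if j = p then v (i, r) else \<zero>\<^bsub>Z\<^esub>)"
  shows "\<not> free_left_module (as_comodule Y \<rho>) (as_comodule Z \<rho>') act"
proof
  interpret Z: finite_basis K Z "{..<n} \<times> {()}" v s by fact
  assume "free_left_module (as_comodule Y \<rho>) (as_comodule Z \<rho>') act"
  then obtain B where B: "B \<subseteq> carrier Z"
    and ex: "\<And>m. m \<in> carrier Z \<Longrightarrow> \<exists>!c. c \<in> finsupp Y B \<and> m = (\<Oplus>\<^bsub>Z\<^esub>b\<in>{b. c b \<noteq> \<zero>\<^bsub>Y\<^esub>}. act (c b) b)"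
    unfolding free_left_module_def by auto
  have n0: "0 < n" and n1: "1 < n" using n by auto
  have vZ: "i < n \<Longrightarrow> v (i, ()) \<in> carrier Z" for i using Z.basis_closed by simp
  \<comment> \<open>The module is nonzero, so a supposed basis has an element
    \<open>b\<close>.\<close>
  have "v (0, ()) \<noteq> \<zero>\<^bsub>Z\<^esub>"
    using Z.functional_zero[OF Z.coord_functional[of "(0, ())"]] Z.coord_basis[of "(0, ())" "(0, ())"] n0 by auto
  moreover obtain c where "c \<in> finsupp Y B" "v (0, ()) = (\<Oplus>\<^bsub>Z\<^esub>b\<in>{b. c b \<noteq> \<zero>\<^bsub>Y\<^esub>}. act (c b) b)"
    using ex[OF vZ[OF n0]] by blast
  ultimately have "{b. c b \<noteq> \<zero>\<^bsub>Y\<^esub>} \<noteq> {}" by (metis Z.M.finsum_empty)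
  then obtain b where b: "b \<in> B" using \<open>c \<in> finsupp Y B\<close> unfolding finsupp_def by blast
  have bZ: "b \<in> carrier Z" using b B by blast
  have actE: "act (E (i, j)) z = s (j, ()) z \<odot>\<^bsub>Z\<^esub> v (i, ())" if i: "i < n" and j: "j < n" and z: "z \<in> carrier Z" for i j z
  proof (rule Z.linear_eqI[OF Z.vspace_axioms bilinear_map_linear(1)[OF act E_closed[OF i j]] _ _ z])
    show "linear_map K Z Z (\<lambda>z. s (j, ()) z \<odot>\<^bsub>Z\<^esub> v (i, ()))"
      by (rule linear_map_comp[OF Z.coord_functional bilinear_map_linear(2)[OF bilinear_map_smult[OF Z.vspace_axioms] vZ[OF i]]])
        (use j in simp)
    fix t assume "t \<in> {..<n} \<times> {()}"
    then obtain p where t: "t = (p, ())" "p < n" by auto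
    have "s (j, ()) (v (p, ())) = (if j = p then \<one>\<^bsub>K\<^esub> else \<zero>\<^bsub>K\<^esub>)"
      using Z.coord_basis[of "(j, ())" "(p, ())"] j t by simp
    then show "act (E (i, j)) (v t) = s (j, ()) (v t) \<odot>\<^bsub>Z\<^esub> v (i, ())"
      unfolding t(1) using act_basis[OF i j t(2), of "()"] vZ[OF i] by simp
  qed
  have co: "q (i, j) (E (k, l)) = (if i = k \<and> j = l then \<one>\<^bsub>K\<^esub> else \<zero>\<^bsub>K\<^esub>)" if "i < n" "j < n" "k < n" "l < n" for i j k l
    using A.coord_basis[of "(i, j)" "(k, l)"] that by simp
  have qz: "q (i, j) \<zero>\<^bsub>Y\<^esub> = \<zero>\<^bsub>K\<^esub>" if "i < n" "j < n" for i j
    using A.functional_zero[OF A.coord_functional[of "(i, j)"]] that by simp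
  \<comment> \<open>With two coordinates \<open>x\<close> and \<open>y\<close> of \<open>b\<close>,
    the matrix whose only entries are \<open>y\<close> and \<open>-x\<close>, in one row, kills
    \<open>b\<close>; if the first coordinate is zero, \<open>E (0, 0)\<close> already does.\<close>
  have "\<exists>a\<in>carrier Y. a \<noteq> \<zero>\<^bsub>Y\<^esub> \<and> act a b = \<zero>\<^bsub>Z\<^esub>"
  proof (cases "s (0, ()) b = \<zero>\<^bsub>K\<^esub>")
    case True
    have "E (0, 0) \<noteq> \<zero>\<^bsub>Y\<^esub>" using co[OF n0 n0 n0 n0] qz[OF n0 n0] by auto
    moreover have "act (E (0, 0)) b = \<zero>\<^bsub>Z\<^esub>" using actE[OF n0 n0 bZ] True vZ[OF n0] by simp
    ultimately show ?thesis using E_closed[OF n0 n0] by blast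
  next
    case False
    define x y where "x = s (0, ()) b" and "y = s (1, ()) b"
    have xy: "x \<in> carrier K" "y \<in> carrier K" unfolding x_def y_def using Z.coord_closed[OF _ bZ] n0 n1 by auto
    define a where "a = y \<odot>\<^bsub>Y\<^esub> E (0, 0) \<oplus>\<^bsub>Y\<^esub> (\<ominus>\<^bsub>K\<^esub> x) \<odot>\<^bsub>Y\<^esub> E (0, 1)"
    have mx: "\<ominus>\<^bsub>K\<^esub> x \<in> carrier K" using xy by simp
    have cl: "y \<odot>\<^bsub>Y\<^esub> E (0, 0) \<in> carrier Y" "(\<ominus>\<^bsub>K\<^esub> x) \<odot>\<^bsub>Y\<^esub> E (0, 1) \<in> carrier Y"
      by (rule A.scale_closed[OF xy(2) E_closed[OF n0 n0]], rule A.scale_closed[OF mx E_closed[OF n0 n1]])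
    have aY: "a \<in> carrier Y" unfolding a_def by (rule A.add_closed[OF cl])
    have q01: "functional K Y (q (0, 1))" using A.coord_functional n0 n1 by simp
    have "q (0, 1) a = \<ominus>\<^bsub>K\<^esub> x"
      unfolding a_def using functional_add[OF q01 cl] functional_smult[OF q01 xy(2) E_closed[OF n0 n0]]
        functional_smult[OF q01 mx E_closed[OF n0 n1]] co[OF n0 n1 n0 n0] co[OF n0 n1 n0 n1] xy by simp
    moreover have "\<ominus>\<^bsub>K\<^esub> x \<noteq> \<zero>\<^bsub>K\<^esub>"
    proof
      assume "\<ominus>\<^bsub>K\<^esub> x = \<zero>\<^bsub>K\<^esub>"
      moreover have "x = \<ominus>\<^bsub>K\<^esub> (\<ominus>\<^bsub>K\<^esub> x)" by (rule K.minus_minus[OF xy(1), symmetric])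
      ultimately have "x = \<ominus>\<^bsub>K\<^esub> \<zero>\<^bsub>K\<^esub>" by simp
      then show False using False unfolding x_def by simp
    qed
    ultimately have "a \<noteq> \<zero>\<^bsub>Y\<^esub>" using qz[OF n0 n1] by auto
    moreover have "act a b = \<zero>\<^bsub>Z\<^esub>"
    proof -
      have "act a b = y \<odot>\<^bsub>Z\<^esub> (x \<odot>\<^bsub>Z\<^esub> v (0, ())) \<oplus>\<^bsub>Z\<^esub> (\<ominus>\<^bsub>K\<^esub> x) \<odot>\<^bsub>Z\<^esub> (y \<odot>\<^bsub>Z\<^esub> v (0, ()))"
        unfolding a_def
        using bilinear_mapD(2)[OF act cl bZ] bilinear_mapD(4)[OF act xy(2) E_closed[OF n0 n0] bZ]
          bilinear_mapD(4)[OF act mx E_closed[OF n0 n1] bZ] actE[OF n0 n0 bZ] actE[OF n0 n1 bZ]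
        unfolding x_def y_def by simp
      also have "\<dots> = (y \<otimes>\<^bsub>K\<^esub> x \<oplus>\<^bsub>K\<^esub> (\<ominus>\<^bsub>K\<^esub> x) \<otimes>\<^bsub>K\<^esub> y) \<odot>\<^bsub>Z\<^esub> v (0, ())"
        using xy mx vZ[OF n0] by (simp add: Z.add_scale Z.scale_scale)
      also have "y \<otimes>\<^bsub>K\<^esub> x \<oplus>\<^bsub>K\<^esub> (\<ominus>\<^bsub>K\<^esub> x) \<otimes>\<^bsub>K\<^esub> y = \<zero>\<^bsub>K\<^esub>"
        using xy by (simp add: K.l_minus K.m_comm[of x y] K.r_neg)
      finally show ?thesis using vZ[OF n0] by simp
    qed
    ultimately show ?thesis using aY by blast
  qed
  then obtain a where a: "a \<in> carrier Y" "a \<noteq> \<zero>\<^bsub>Y\<^esub>" "act a b = \<zero>\<^bsub>Z\<^esub>" by blast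
  \<comment> \<open>The zero vector now has two expansions in the supposed basis, the trivial one
    and this one.\<close>
  let ?c = "\<lambda>x. if x = b then a else \<zero>\<^bsub>Y\<^esub>"
  define P where "P c \<longleftrightarrow> c \<in> finsupp Y B \<and> \<zero>\<^bsub>Z\<^esub> = (\<Oplus>\<^bsub>Z\<^esub>x\<in>{x. c x \<noteq> \<zero>\<^bsub>Y\<^esub>}. act (c x) x)" for c
  have ex1: "\<exists>!c. P c" unfolding P_def by (rule ex[OF Z.M.zero_closed])
  have "?c \<in> finsupp Y B" using a b by (auto simp: finsupp_def)
  moreover have "{x. ?c x \<noteq> \<zero>\<^bsub>Y\<^esub>} = {b}" using a by auto
  then have "\<zero>\<^bsub>Z\<^esub> = (\<Oplus>\<^bsub>Z\<^esub>x\<in>{x. ?c x \<noteq> \<zero>\<^bsub>Y\<^esub>}. act (?c x) x)" using a by simp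
  ultimately have Pc: "P ?c" unfolding P_def by (intro conjI)
  have "P (\<lambda>_. \<zero>\<^bsub>Y\<^esub>)" unfolding P_def by (simp add: finsupp_def)
  then have "?c = (\<lambda>_. \<zero>\<^bsub>Y\<^esub>)" using ex1 Pc by (metis (no_types, lifting))
  then show False using a(2) by metis
qed

end

text \<open>An infinite type contains a copy of its own square, so the coordinates can be packed one
  at a time into a single value of type \<open>'a\<close>.\<close>

lemma exists_inj_finsupp:
  assumes inf: "infinite (UNIV :: 'a set)" and \<iota>: "inj_on (\<iota> :: 'k \<Rightarrow> 'a) (carrier K)" and J: "finite J"
  shows "\<exists>\<phi> :: ('j \<Rightarrow> 'k) \<Rightarrow> 'a. inj_on \<phi> (finsupp K (J :: 'j set))"
  using J
proof (induct J rule: finite_induct)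
  case empty
  have "inj_on \<phi> (finsupp K {})" for \<phi> :: "('j \<Rightarrow> 'k) \<Rightarrow> 'a" by (auto simp: finsupp_def inj_on_def fun_eq_iff)
  then show ?case by blast
next
  case (insert j J)
  obtain \<phi> :: "('j \<Rightarrow> 'k) \<Rightarrow> 'a" where \<phi>: "inj_on \<phi> (finsupp K J)" using insert by blast
  obtain pair :: "'a \<times> 'a \<Rightarrow> 'a" where "bij_betw pair (UNIV \<times> UNIV) UNIV"
    using card_of_Times_same_infinite[OF inf] card_of_ordIso by blast
  then have pair: "inj pair" by (simp add: bij_betw_def)
  have r: "x(j := \<zero>\<^bsub>K\<^esub>) \<in> finsupp K J" "x j \<in> carrier K" if "x \<in> finsupp K (insert j J)" for x
  proof -
    have "{b. (x(j := \<zero>\<^bsub>K\<^esub>)) b \<noteq> \<zero>\<^bsub>K\<^esub>} \<subseteq> {b. x b \<noteq> \<zero>\<^bsub>K\<^esub>}" by auto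
    moreover have "finite {b. x b \<noteq> \<zero>\<^bsub>K\<^esub>}" using that by (simp add: finsupp_def)
    ultimately have "finite {b. (x(j := \<zero>\<^bsub>K\<^esub>)) b \<noteq> \<zero>\<^bsub>K\<^esub>}" by (rule finite_subset)
    then show "x(j := \<zero>\<^bsub>K\<^esub>) \<in> finsupp K J" "x j \<in> carrier K"
      using that insert(2) by (auto simp: finsupp_def)
  qed
  have "inj_on (\<lambda>x. pair (\<iota> (x j), \<phi> (x(j := \<zero>\<^bsub>K\<^esub>)))) (finsupp K (insert j J))"
  proof (rule inj_onI)
    fix x y assume x: "x \<in> finsupp K (insert j J)" and y: "y \<in> finsupp K (insert j J)"
      and eq: "pair (\<iota> (x j), \<phi> (x(j := \<zero>\<^bsub>K\<^esub>))) = pair (\<iota> (y j), \<phi> (y(j := \<zero>\<^bsub>K\<^esub>)))"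
    then have "\<iota> (x j) = \<iota> (y j)" "\<phi> (x(j := \<zero>\<^bsub>K\<^esub>)) = \<phi> (y(j := \<zero>\<^bsub>K\<^esub>))" using pair by (auto dest: injD)
    then have "x j = y j" "x(j := \<zero>\<^bsub>K\<^esub>) = y(j := \<zero>\<^bsub>K\<^esub>)"
      using inj_onD[OF \<iota>] inj_onD[OF \<phi>] r[OF x] r[OF y] by blast+
    then show "x = y" by (metis fun_upd_triv fun_upd_upd)
  qed
  then show ?case by blast
qed

text \<open>Carries the vector space structure along the injection, by computing in \<open>X\<close>
  and encoding the result. This is how the algebra and the module obtain carriers in prescribed
  types.\<close>

lemma finite_basis_transport:
  fixes \<phi> :: "'c \<Rightarrow> 'a"
  assumes X: "finite_basis K X J e p" and \<phi>: "inj_on \<phi> (carrier X)"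
  shows "\<exists>(Y :: ('k, 'a) module) e' p'. finite_basis K Y J e' p'"
proof -
  interpret X: finite_basis K X J e p by fact
  define \<psi> where "\<psi> = inv_into (carrier X) \<phi>"
  have \<psi>: "x \<in> carrier X \<Longrightarrow> \<psi> (\<phi> x) = x" for x unfolding \<psi>_def using inv_into_f_f[OF \<phi>] by simp
  define Y :: "('k, 'a) module" where "Y = \<lparr>carrier = \<phi> ` carrier X, mult = undefined, one = undefined,
    zero = \<phi> \<zero>\<^bsub>X\<^esub>, add = (\<lambda>a b. \<phi> (\<psi> a \<oplus>\<^bsub>X\<^esub> \<psi> b)), smult = (\<lambda>c a. \<phi> (c \<odot>\<^bsub>X\<^esub> \<psi> a))\<rparr>"
  have Ys: "carrier Y = \<phi> ` carrier X" "\<zero>\<^bsub>Y\<^esub> = \<phi> \<zero>\<^bsub>X\<^esub>" "\<And>a b. a \<oplus>\<^bsub>Y\<^esub> b = \<phi> (\<psi> a \<oplus>\<^bsub>X\<^esub> \<psi> b)"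
    "\<And>c a. c \<odot>\<^bsub>Y\<^esub> a = \<phi> (c \<odot>\<^bsub>X\<^esub> \<psi> a)" unfolding Y_def by simp_all
  have "abelian_group Y"
  proof (rule abelian_groupI)
    fix x assume "x \<in> carrier Y"
    then obtain a where a: "a \<in> carrier X" "x = \<phi> a" unfolding Ys by blast
    have "\<phi> (\<ominus>\<^bsub>X\<^esub> a) \<oplus>\<^bsub>Y\<^esub> x = \<zero>\<^bsub>Y\<^esub>" using a by (simp add: Ys \<psi> X.left_neg)
    then show "\<exists>y\<in>carrier Y. y \<oplus>\<^bsub>Y\<^esub> x = \<zero>\<^bsub>Y\<^esub>" using a unfolding Ys by blast
  qed (auto simp: Ys \<psi> X.add_ac)
  then have "module K Y"
    by (intro moduleI) (auto simp: Ys \<psi> X.K.is_cring X.add_scale X.scale_add X.scale_scale)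
  then have vY: "vspace K Y" by (intro vspace.intro X.K.field_axioms)
  have lin: "linear_map K X Y \<phi>" by (rule linear_mapI) (auto simp: Ys \<psi>)
  have "finite_basis K Y J (\<lambda>i. \<phi> (e i)) (\<lambda>i y. p i (\<psi> y))"
  proof (intro finite_basis.intro vY finite_basis_axioms.intro X.finite_index)
    fix i assume i: "i \<in> J"
    show "\<phi> (e i) \<in> carrier Y" using X.basis_closed[OF i] unfolding Ys by blast
    show "functional K Y (\<lambda>y. p i (\<psi> y))"
      by (rule linear_mapI)
        (auto simp: Ys \<psi> functional_add[OF X.coord_functional[OF i]] functional_smult[OF X.coord_functional[OF i]] X.coord_closed[OF i])
    fix j assume "j \<in> J"
    then show "p i (\<psi> (\<phi> (e j))) = (if i = j then \<one>\<^bsub>K\<^esub> else \<zero>\<^bsub>K\<^esub>)"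
      using X.coord_basis[OF i] X.basis_closed by (simp add: \<psi>)
  next
    fix y assume "y \<in> carrier Y"
    then obtain a where a: "a \<in> carrier X" "y = \<phi> a" unfolding Ys by blast
    have cl: "(\<lambda>i. p i a \<odot>\<^bsub>X\<^esub> e i) \<in> J \<rightarrow> carrier X" using a X.basis_closed X.coord_closed by auto
    have "\<phi> a = \<phi> (\<Oplus>\<^bsub>X\<^esub>i\<in>J. p i a \<odot>\<^bsub>X\<^esub> e i)" using X.expansion[OF a(1)] by simp
    also have "\<dots> = (\<Oplus>\<^bsub>Y\<^esub>i\<in>J. \<phi> (p i a \<odot>\<^bsub>X\<^esub> e i))"
      by (rule linear_map_finsum[OF X.vspace_axioms vY lin cl])
    also have "\<dots> = (\<Oplus>\<^bsub>Y\<^esub>i\<in>J. p i (\<psi> y) \<odot>\<^bsub>Y\<^esub> \<phi> (e i))"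
      using a X.basis_closed X.coord_closed by (intro vspace.sum_cong[OF vY]) (auto simp: Ys \<psi>)
    finally show "(\<Oplus>\<^bsub>Y\<^esub>i\<in>J. p i (\<psi> y) \<odot>\<^bsub>Y\<^esub> \<phi> (e i)) = y" using a by simp
  qed
  then show ?thesis by blast
qed

lemma exists_finite_basis:
  assumes K: "field K" and inf: "infinite (UNIV :: 'a set)" and \<iota>: "inj_on (\<iota> :: 'k \<Rightarrow> 'a) (carrier K)"
    and J: "finite (J :: 'j set)"
  shows "\<exists>(Y :: ('k, 'a) module) e p. finite_basis K Y J e p"
proof -
  obtain \<phi> :: "('j \<Rightarrow> 'k) \<Rightarrow> 'a" where "inj_on \<phi> (carrier (free_module K J))"
    using exists_inj_finsupp[OF inf \<iota> J] by auto
  then show ?thesis by (rule finite_basis_transport[OF field.free_module_finite_basis[OF K J]])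
qed

lemma finite_basis_update:
  fixes Y :: "('k, 'a) module"
  assumes "finite_basis K Y J e p"
  shows "finite_basis K (Y\<lparr>mult := m, one := u\<rparr>) J e p"
proof -
  interpret Y: finite_basis K Y J e p by fact
  let ?Y = "Y\<lparr>mult := m, one := u\<rparr>"
  have "abelian_group ?Y"
    by (rule abelian_groupI) (auto simp: Y.add_ac intro!: bexI[where x="\<ominus>\<^bsub>Y\<^esub> x" for x] Y.left_neg)
  then have "module K ?Y"
    by (intro moduleI) (auto simp: Y.K.is_cring Y.add_scale Y.scale_add Y.scale_scale)
  then have v: "vspace K ?Y" by (intro vspace.intro Y.K.field_axioms)
  have fs: "finsum ?Y = finsum Y" by (simp add: finsum_def finprod_def fun_eq_iff)
  show ?thesis
    by (intro finite_basis.intro v finite_basis_axioms.intro)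
      (use Y.finite_index Y.basis_closed Y.coord_functional Y.coord_basis Y.expansion in \<open>simp_all add: fs linear_map_def\<close>)
qed

context matrix_coefficients
begin

lemma comatrix_unit: "comatrix K H {()} (\<lambda>_ _. \<eta>)"
proof -
  interpret HH: vspace_pair K H H by (intro vspace_pair.intro vspace_H)
  show ?thesis unfolding comatrix_def using eta_closed counit_eta comult_eta HH.pure_simps(1) by simp
qed

text \<open>
  The multiplication of the algebra record is the product of matrix units or its opposite,
  according to \<open>opp\<close>.
\<close>

lemma exists_matrix_algebra_module:
  fixes \<iota> :: "'k \<Rightarrow> 'a" and \<kappa> :: "'k \<Rightarrow> 'm" and opp :: "('a \<Rightarrow> 'a \<Rightarrow> 'a) \<Rightarrow> 'a \<Rightarrow> 'a \<Rightarrow> 'a"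
  assumes "infinite (UNIV :: 'a set)" "inj_on \<iota> (carrier K)" "infinite (UNIV :: 'm set)" "inj_on \<kappa> (carrier K)"
  shows "\<exists>(Y :: ('k, 'a) module) E q star (Z :: ('k, 'm) module) v s act.
    matrix_algebra K H \<mu> \<eta> n d d' Y E q star \<and> mult Y = opp star \<and> one Y = matrix_algebra.unit n Y E \<and>
    finite_basis K Z ({..<n} \<times> {()}) v s \<and> bilinear_map K Y Z Z act \<and>
    (\<forall>i j p r. i < n \<longrightarrow> j < n \<longrightarrow> p < n \<longrightarrow> act (E (i, j)) (v (p, r)) = (if j = p then v (i, r) else \<zero>\<^bsub>Z\<^esub>))"
proof -
  obtain Y :: "('k, 'a) module" and E q where Y: "finite_basis K Y ({..<n} \<times> {..<n}) E q"
    using exists_finite_basis[OF K.field_axioms assms(1,2)] by (metis finite_SigmaI finite_lessThan)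
  interpret Y: finite_basis K Y "{..<n} \<times> {..<n}" E q by fact
  have "\<exists>star. bilinear_map K Y Y Y star \<and> (\<forall>x\<in>{..<n} \<times> {..<n}. \<forall>y\<in>{..<n} \<times> {..<n}.
      star (E x) (E y) = (if snd x = fst y then E (fst x, snd y) else \<zero>\<^bsub>Y\<^esub>))"
    by (rule bilinear_extension[OF Y Y Y.vspace_axioms]) (use Y.basis_closed in auto)
  then obtain star where star: "bilinear_map K Y Y Y star"
    "\<forall>x\<in>{..<n} \<times> {..<n}. \<forall>y\<in>{..<n} \<times> {..<n}. star (E x) (E y) = (if snd x = fst y then E (fst x, snd y) else \<zero>\<^bsub>Y\<^esub>)"
    by (elim exE conjE)
  \<comment> \<open>The unit is computed in \<open>Y\<close> first, since it becomes a field of the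
    new record; finite sums are the same in both records.\<close>
  define u where "u = (\<Oplus>\<^bsub>Y\<^esub>i\<in>{..<n}. E (i, i))"
  define Y' where "Y' = Y\<lparr>mult := opp star, one := u\<rparr>"
  have Y's: "carrier Y' = carrier Y" "zero Y' = zero Y" "add Y' = add Y" "smult Y' = smult Y" "mult Y' = opp star" "one Y' = u"
    unfolding Y'_def by simp_all
  have fs: "finsum Y' = finsum Y" by (simp add: finsum_def finprod_def fun_eq_iff Y's)
  have Y': "finite_basis K Y' ({..<n} \<times> {..<n}) E q" unfolding Y'_def by (rule finite_basis_update[OF Y])
  interpret M: matrix_algebra K H \<mu> \<eta> n d d' Y' E q star
  proof (intro matrix_algebra.intro matrix_algebra_axioms.intro matrix_coefficients_axioms Y')
    show "bilinear_map K Y' Y' Y' star" using star(1) by (simp add: bilinear_map_def linear_map_def Y's)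
    show "star (E (i, j)) (E (p, r)) = (if j = p then E (i, r) else \<zero>\<^bsub>Y'\<^esub>)" if "i < n" "j < n" "p < n" "r < n" for i j p r
      using star(2) that by (simp add: Y's)
  qed
  obtain Z :: "('k, 'm) module" and v s where Z: "finite_basis K Z ({..<n} \<times> {()}) v s"
    using exists_finite_basis[OF K.field_axioms assms(3,4), of "{..<n} \<times> {()}"] by auto
  interpret Z: finite_basis K Z "{..<n} \<times> {()}" v s by fact
  have "\<exists>act. bilinear_map K Y' Z Z act \<and> (\<forall>x\<in>{..<n} \<times> {..<n}. \<forall>y\<in>{..<n} \<times> {()}.
      act (E x) (v y) = (if snd x = fst y then v (fst x, snd y) else \<zero>\<^bsub>Z\<^esub>))"
    by (rule bilinear_extension[OF Y' Z Z.vspace_axioms]) (use Z.basis_closed in auto)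
  then obtain act where act: "bilinear_map K Y' Z Z act"
    "\<forall>x\<in>{..<n} \<times> {..<n}. \<forall>y\<in>{..<n} \<times> {()}. act (E x) (v y) = (if snd x = fst y then v (fst x, snd y) else \<zero>\<^bsub>Z\<^esub>)"
    by (elim exE conjE)
  have "one Y' = M.unit" unfolding M.unit_def Y's fs u_def ..
  moreover have "\<forall>i j p r. i < n \<longrightarrow> j < n \<longrightarrow> p < n \<longrightarrow> act (E (i, j)) (v (p, r)) = (if j = p then v (i, r) else \<zero>\<^bsub>Z\<^esub>)"
    using act(2) by simp
  ultimately show ?thesis using M.matrix_algebra_axioms Y's(5) Z act(1) by (intro exI conjI)
qed

end

section \<open>Counterexamples when the Hopf algebra is not pointed\<close>

context hopf_algebra
begin

text \<open>The least dimension above one is taken over all simple comatrices at once, which is the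
  minimality that \<open>simple_comatrix_dual\<close> asks for.\<close>

lemma exists_dual_simple_comatrices:
  assumes "\<not> pointed K H"
  shows "\<exists>n c. 2 \<le> n \<and> comatrix K H {..<n} c \<and> comatrix K H {..<n} (\<lambda>i j. antipode H (c j i)) \<and>
    simple_comatrix K H n c \<and> simple_comatrix K H n (\<lambda>i j. antipode H (c j i))"
proof -
  let ?P = "\<lambda>n. 2 \<le> n \<and> (\<exists>c. simple_comatrix K H n c)"
  define n where "n = (LEAST n. ?P n)"
  have "\<exists>n. ?P n" using simple_comatrix_exists[OF assms] by blast
  then have "?P n" unfolding n_def by (rule LeastI_ex)
  then obtain c where c: "2 \<le> n" "simple_comatrix K H n c" by blast
  have min: "n \<le> m" if "2 \<le> m" "simple_comatrix K H m d" for m d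
    unfolding n_def by (rule Least_le) (use that in blast)
  have "simple_comatrix K H n (\<lambda>i j. antipode H (c j i))" by (rule simple_comatrix_dual[OF c(2,1) min])
  moreover have "comatrix K H {..<n} c" using c(2) unfolding simple_comatrix_def by (rule conjunct1)
  ultimately show ?thesis using c comatrix_dual by (intro exI conjI)
qed

text \<open>The counit recovers \<open>c\<close> from \<open>c 1\<close>, so the scalars embed into
  \<open>H\<close>. The injections from \<open>H\<close> into the carrier types thus give the
  injections from \<open>K\<close> that coordinates require.\<close>

lemma scalar_embedding:
  assumes "inj_on \<iota> (carrier H)"
  shows "inj_on (\<lambda>c. \<iota> (c \<odot>\<^bsub>H\<^esub> \<one>\<^bsub>H\<^esub>)) (carrier K)"
proof (rule inj_onI)
  interpret B: bialgebra_multiplication K H "mult H" "\<one>\<^bsub>H\<^esub>" by (rule bialgebra_multiplication_mult)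
  have cl: "c \<odot>\<^bsub>H\<^esub> \<one>\<^bsub>H\<^esub> \<in> carrier H" if "c \<in> carrier K" for c
    using that by simp
  have ce: "counit H (c \<odot>\<^bsub>H\<^esub> \<one>\<^bsub>H\<^esub>) = c" if "c \<in> carrier K" for c
    using functional_smult[OF counit_linear that B.eta_closed] B.counit_eta that by simp
  fix x y assume xy: "x \<in> carrier K" "y \<in> carrier K" and "\<iota> (x \<odot>\<^bsub>H\<^esub> \<one>\<^bsub>H\<^esub>) = \<iota> (y \<odot>\<^bsub>H\<^esub> \<one>\<^bsub>H\<^esub>)"
  then have "x \<odot>\<^bsub>H\<^esub> \<one>\<^bsub>H\<^esub> = y \<odot>\<^bsub>H\<^esub> \<one>\<^bsub>H\<^esub>" using inj_onD[OF assms] cl by blast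
  then show "x = y" using ce[OF xy(1)] ce[OF xy(2)] by metis
qed

text \<open>Here \<open>d\<close> is the dual comatrix and \<open>d' = c\<close>. The two pairings
  become the antipode identities \<open>c S(c) = 1\<close> and \<open>S(c) c = 1\<close>, and
  simplicity of the algebra reduces to simplicity of \<open>c\<close>. The module is the comodule of
  \<open>d\<close>, on which the matrix units act.\<close>

lemma not_pointed_left:
  fixes \<iota> :: "'h \<Rightarrow> 'a" and \<kappa> :: "'h \<Rightarrow> 'm"
  assumes np: "\<not> pointed K H"
    and "infinite (UNIV :: 'a set)" "inj_on \<iota> (carrier H)" "infinite (UNIV :: 'm set)" "inj_on \<kappa> (carrier H)"
  shows "\<exists>(A :: ('k, 'a, 'h) comodule) (M :: ('k, 'm, 'h) comodule) act.
    left_comodule_algebra K H A \<and> left_H_simple K H A \<and> left_relative_hopf_module K H A M act \<and> \<not> free_left_module A M act"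
proof -
  obtain n c where n: "2 \<le> n" and c: "comatrix K H {..<n} c" and c': "comatrix K H {..<n} (\<lambda>i j. antipode H (c j i))"
    and simple: "simple_comatrix K H n c" using exists_dual_simple_comatrices[OF np] by blast
  interpret MC: matrix_coefficients K H "mult H" "\<one>\<^bsub>H\<^esub>" n "\<lambda>i j. antipode H (c j i)" c
  proof (intro matrix_coefficients.intro bialgebra_multiplication_mult matrix_coefficients_axioms.intro c c')
    show "(\<Oplus>\<^bsub>H\<^esub>k\<in>{..<n}. c i k \<otimes>\<^bsub>H\<^esub> antipode H (c k j)) = (if i = j then \<one>\<^bsub>H\<^esub> else \<zero>\<^bsub>H\<^esub>)" if "i < n" "j < n" for i j
      using comatrix_antipode_r[OF c] that by simp
    show "(\<Oplus>\<^bsub>H\<^esub>k\<in>{..<n}. antipode H (c i k) \<otimes>\<^bsub>H\<^esub> c k j) = (if i = j then \<one>\<^bsub>H\<^esub> else \<zero>\<^bsub>H\<^esub>)" if "i < n" "j < n" for i j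
      using comatrix_antipode_l[OF c] that by simp
  qed
  obtain Y :: "('k, 'a) module" and E q star and Z :: "('k, 'm) module" and v s act
    where MA: "matrix_algebra K H (mult H) \<one>\<^bsub>H\<^esub> n (\<lambda>i j. antipode H (c j i)) c Y E q star"
      and mY: "mult Y = star" and oY: "one Y = matrix_algebra.unit n Y E"
      and Z: "finite_basis K Z ({..<n} \<times> {()}) v s" and act: "bilinear_map K Y Z Z act"
      and act_basis: "\<And>i j p r. \<lbrakk>i < n; j < n; p < n\<rbrakk> \<Longrightarrow> act (E (i, j)) (v (p, r)) = (if j = p then v (i, r) else \<zero>\<^bsub>Z\<^esub>)"
    using MC.exists_matrix_algebra_module[OF assms(2) scalar_embedding[OF assms(3)] assms(4) scalar_embedding[OF assms(5)],
        where opp = "\<lambda>f. f"] by blast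
  interpret MA: matrix_algebra K H "mult H" "\<one>\<^bsub>H\<^esub>" n "\<lambda>i j. antipode H (c j i)" c Y E q star by (rule MA)
  let ?A = "as_comodule Y MA.coaction"
  have alg: "assoc_algebra K ?A"
    by (rule assoc_algebra_as_comodule[OF MA.vspace_Y])
      (simp_all add: mY oY MA.star_bilinear MA.unit_closed MA.star_assoc MA.star_unit_l MA.star_unit_r)
  have hom: "algebra_hom K ?A (tensor_algebra K H ?A) MA.coaction"
    by (rule algebra_hom_as_comodule[OF MA.coaction_linear]) (simp_all add: mY oY MA.coaction_star MA.coaction_unit)
  have A: "left_comodule_algebra K H ?A"
    by (intro left_comodule_algebra.intro bialgebra_axioms MA.comodule alg left_comodule_algebra_axioms.intro) (simp add: hom)
  have n0: "0 < n" using n by simp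
  have Asimple: "left_H_simple K H ?A"
    unfolding left_H_simple_def
  proof (intro conjI allI impI)
    have "E (0, 0) \<noteq> \<zero>\<^bsub>Y\<^esub>"
      using MA.A.functional_zero[OF MA.A.coord_functional[of "(0, 0)"]] MA.A.coord_basis[of "(0, 0)" "(0, 0)"] n0 by auto
    then show "carrier ?A \<noteq> {\<zero>\<^bsub>?A\<^esub>}" using MA.E_closed[OF n0 n0] by auto
    fix I assume "left_ideal ?A I \<and> subcomodule K H ?A I"
    then show "I = {\<zero>\<^bsub>?A\<^esub>} \<or> I = carrier ?A"
      using MA.simple_of_simple_comatrix[OF simple n0, of I] by (simp add: left_ideal_def mY)
  qed
  let ?\<rho> = "comatrix_comodule.coaction K H Z ({..<n} \<times> {()}) v s (MC.twist (\<lambda>_ _. \<one>\<^bsub>H\<^esub>))"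
  let ?M = "as_comodule Z ?\<rho>"
  have ZC: "comatrix_comodule K H Z ({..<n} \<times> {()}) v s (MC.twist (\<lambda>_ _. \<one>\<^bsub>H\<^esub>))"
    by (intro comatrix_comodule.intro coalgebra_axioms Z comatrix_comodule_axioms.intro MC.twist_comatrix MC.comatrix_unit)
  have M: "left_comodule K H ?M" by (rule comatrix_comodule.comodule[OF ZC])
  have ab: "\<And>i j p r. \<lbrakk>i < n; j < n; p < n; r \<in> {()}\<rbrakk> \<Longrightarrow> act (E (i, j)) (v (p, r)) = (if j = p then v (i, r) else \<zero>\<^bsub>Z\<^esub>)"
    using act_basis by blast
  have "left_relative_hopf_module K H ?A ?M act"
  proof (intro left_relative_hopf_module.intro A M left_relative_hopf_module_axioms.intro)
    show "bilinear_map K ?A ?M ?M act" using act by (simp add: bilinear_map_def)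
    show "act \<one>\<^bsub>?A\<^esub> m = m" if "m \<in> carrier ?M" for m
      using MA.action_unit[OF Z act ab] that by (simp add: oY)
    show "act (a \<otimes>\<^bsub>?A\<^esub> b) m = act a (act b m)" if "a \<in> carrier ?A" "b \<in> carrier ?A" "m \<in> carrier ?M" for a b m
      using MA.action_assoc[OF Z act ab] that by (simp add: mY)
    show "coact ?M (act a m) = tensor_bimap K H ?M (mult H) act (coact ?A a) (coact ?M m)"
      if "a \<in> carrier ?A" "m \<in> carrier ?M" for a m
      using MC.coaction_act[OF MA.A.finite_basis_axioms Z MC.comatrix_unit act ab] that by (simp add: MA.coaction_def)
  qed
  moreover have "\<not> free_left_module ?A ?M act" by (rule MA.not_free[OF n Z act act_basis])
  ultimately show ?thesis using A Asimple by blast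
qed

text \<open>For the opposite product the pairings again become the two antipode identities when
  \<open>d = c\<close> and \<open>d'\<close> is the dual comatrix. The other assignment would
  involve products such as \<open>S(c_kj) c_ik\<close>, summed over \<open>k\<close>, about which
  the antipode axioms say nothing. Hence simplicity of the algebra comes from simplicity of the dual
  comatrix on this side.\<close>

lemma not_pointed_right:
  fixes \<iota> :: "'h \<Rightarrow> 'a" and \<kappa> :: "'h \<Rightarrow> 'm"
  assumes np: "\<not> pointed K H"
    and "infinite (UNIV :: 'a set)" "inj_on \<iota> (carrier H)" "infinite (UNIV :: 'm set)" "inj_on \<kappa> (carrier H)"
  shows "\<exists>(A :: ('k, 'a, 'h) comodule) (M :: ('k, 'm, 'h) comodule) act.
    left_comodule_algebra K H A \<and> right_H_simple K H A \<and> right_relative_hopf_module K H A M act \<and> \<not> free_right_module A M act"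
proof -
  obtain n c where n: "2 \<le> n" and c: "comatrix K H {..<n} c" and c': "comatrix K H {..<n} (\<lambda>i j. antipode H (c j i))"
    and simple: "simple_comatrix K H n (\<lambda>i j. antipode H (c j i))" using exists_dual_simple_comatrices[OF np] by blast
  interpret MC: matrix_coefficients K H "\<lambda>x y. y \<otimes>\<^bsub>H\<^esub> x" "\<one>\<^bsub>H\<^esub>" n c "\<lambda>i j. antipode H (c j i)"
  proof (intro matrix_coefficients.intro bialgebra_multiplication_flip matrix_coefficients_axioms.intro c c')
    show "(\<Oplus>\<^bsub>H\<^esub>k\<in>{..<n}. c j k \<otimes>\<^bsub>H\<^esub> antipode H (c k i)) = (if i = j then \<one>\<^bsub>H\<^esub> else \<zero>\<^bsub>H\<^esub>)" if "i < n" "j < n" for i j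
      using comatrix_antipode_r[OF c, of j i] that by auto
    show "(\<Oplus>\<^bsub>H\<^esub>k\<in>{..<n}. antipode H (c j k) \<otimes>\<^bsub>H\<^esub> c k i) = (if i = j then \<one>\<^bsub>H\<^esub> else \<zero>\<^bsub>H\<^esub>)" if "i < n" "j < n" for i j
      using comatrix_antipode_l[OF c, of j i] that by auto
  qed
  obtain Y :: "('k, 'a) module" and E q star and Z :: "('k, 'm) module" and v s act
    where MA: "matrix_algebra K H (\<lambda>x y. y \<otimes>\<^bsub>H\<^esub> x) \<one>\<^bsub>H\<^esub> n c (\<lambda>i j. antipode H (c j i)) Y E q star"
      and mY: "mult Y = (\<lambda>x y. star y x)" and oY: "one Y = matrix_algebra.unit n Y E"
      and Z: "finite_basis K Z ({..<n} \<times> {()}) v s" and act: "bilinear_map K Y Z Z act"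
      and act_basis: "\<And>i j p r. \<lbrakk>i < n; j < n; p < n\<rbrakk> \<Longrightarrow> act (E (i, j)) (v (p, r)) = (if j = p then v (i, r) else \<zero>\<^bsub>Z\<^esub>)"
    using MC.exists_matrix_algebra_module[OF assms(2) scalar_embedding[OF assms(3)] assms(4) scalar_embedding[OF assms(5)],
        where opp = "\<lambda>f x y. f y x"] by blast
  interpret MA: matrix_algebra K H "\<lambda>x y. y \<otimes>\<^bsub>H\<^esub> x" "\<one>\<^bsub>H\<^esub>" n c "\<lambda>i j. antipode H (c j i)" Y E q star by (rule MA)
  let ?A = "as_comodule Y MA.coaction"
  have alg: "assoc_algebra K ?A"
    by (rule assoc_algebra_as_comodule[OF MA.vspace_Y])
      (simp_all add: mY oY bilinear_map_swap[OF MA.star_bilinear] MA.unit_closed MA.star_assoc MA.star_unit_l MA.star_unit_r)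
  note co = linear_mapD(1)[OF MA.coaction_linear]
  have hom: "algebra_hom K ?A (tensor_algebra K H ?A) MA.coaction"
  proof (rule algebra_hom_as_comodule[OF MA.coaction_linear])
    show "MA.coaction (x \<otimes>\<^bsub>Y\<^esub> y) = tensor_bimap K H Y (mult H) (mult Y) (MA.coaction x) (MA.coaction y)"
      if "x \<in> carrier Y" "y \<in> carrier Y" for x y
      unfolding mY MA.coaction_star[OF that(2,1)]
      by (rule tensor_bimap_flip[OF vspace_H vspace_H MA.vspace_Y MA.vspace_Y vspace_H MA.vspace_Y
        MC.mu_bilinear MA.star_bilinear co[OF that(2)] co[OF that(1)]])
  qed (simp add: oY MA.coaction_unit)
  have A: "left_comodule_algebra K H ?A"
    by (intro left_comodule_algebra.intro bialgebra_axioms MA.comodule alg left_comodule_algebra_axioms.intro) (simp add: hom)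
  have n0: "0 < n" using n by simp
  have Asimple: "right_H_simple K H ?A"
    unfolding right_H_simple_def
  proof (intro conjI allI impI)
    have "E (0, 0) \<noteq> \<zero>\<^bsub>Y\<^esub>"
      using MA.A.functional_zero[OF MA.A.coord_functional[of "(0, 0)"]] MA.A.coord_basis[of "(0, 0)" "(0, 0)"] n0 by auto
    then show "carrier ?A \<noteq> {\<zero>\<^bsub>?A\<^esub>}" using MA.E_closed[OF n0 n0] by auto
    fix I assume "right_ideal ?A I \<and> subcomodule K H ?A I"
    then show "I = {\<zero>\<^bsub>?A\<^esub>} \<or> I = carrier ?A"
      using MA.simple_of_simple_comatrix[OF simple n0, of I] by (simp add: right_ideal_def mY)
  qed
  let ?\<rho> = "comatrix_comodule.coaction K H Z ({..<n} \<times> {()}) v s (MC.twist (\<lambda>_ _. \<one>\<^bsub>H\<^esub>))"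
  let ?M = "as_comodule Z ?\<rho>"
  have ZC: "comatrix_comodule K H Z ({..<n} \<times> {()}) v s (MC.twist (\<lambda>_ _. \<one>\<^bsub>H\<^esub>))"
    by (intro comatrix_comodule.intro coalgebra_axioms Z comatrix_comodule_axioms.intro MC.twist_comatrix MC.comatrix_unit)
  have M: "left_comodule K H ?M" by (rule comatrix_comodule.comodule[OF ZC])
  note vZ = comatrix_comodule.vspace_Y[OF ZC]
  note coZ = linear_mapD(1)[OF comatrix_comodule.coaction_linear[OF ZC]]
  have ab: "\<And>i j p r. \<lbrakk>i < n; j < n; p < n; r \<in> {()}\<rbrakk> \<Longrightarrow> act (E (i, j)) (v (p, r)) = (if j = p then v (i, r) else \<zero>\<^bsub>Z\<^esub>)"
    using act_basis by blast
  have "right_relative_hopf_module K H ?A ?M (\<lambda>m a. act a m)"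
  proof (intro right_relative_hopf_module.intro A M right_relative_hopf_module_axioms.intro)
    show "bilinear_map K ?M ?A ?M (\<lambda>m a. act a m)" using act by (simp add: bilinear_map_def)
    show "act \<one>\<^bsub>?A\<^esub> m = m" if "m \<in> carrier ?M" for m
      using MA.action_unit[OF Z act ab] that by (simp add: oY)
    show "act (a \<otimes>\<^bsub>?A\<^esub> b) m = act b (act a m)" if "a \<in> carrier ?A" "b \<in> carrier ?A" "m \<in> carrier ?M" for a b m
      using MA.action_assoc[OF Z act ab] that by (simp add: mY)
    show "coact ?M (act a m) = tensor_bimap K H ?M (mult H) (\<lambda>m a. act a m) (coact ?M m) (coact ?A a)"
      if "a \<in> carrier ?A" "m \<in> carrier ?M" for a m
    proof -
      have a: "a \<in> carrier Y" and m: "m \<in> carrier Z" using that by simp_all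
      have "?\<rho> (act a m) = tensor_bimap K H Z (\<lambda>x y. y \<otimes>\<^bsub>H\<^esub> x) act (MA.coaction a) (?\<rho> m)"
        unfolding MA.coaction_def by (rule MC.coaction_act[OF MA.A.finite_basis_axioms Z MC.comatrix_unit act ab a m])
      also have "\<dots> = tensor_bimap K H Z (mult H) (\<lambda>m a. act a m) (?\<rho> m) (MA.coaction a)"
        by (rule tensor_bimap_flip[OF vspace_H vspace_H MA.vspace_Y vZ vspace_H vZ MC.mu_bilinear act co[OF a] coZ[OF m]])
      finally show ?thesis by simp
    qed
  qed
  moreover have "\<not> free_right_module ?A ?M (\<lambda>m a. act a m)"
    using MA.not_free[OF n Z act act_basis] unfolding free_left_module_def free_right_module_def .
  ultimately show ?thesis using A Asimple by blast
qed

end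

theorem theorem5p5:
  fixes K :: "('k, 'x) ring_scheme"
    and H :: "('k, 'h, 'y) hopf_algebra_scheme"
    and \<iota> :: "'h \<Rightarrow> 'a"
    and \<kappa> :: "'h \<Rightarrow> 'm"
  assumes "hopf_algebra K H"
    and "infinite (UNIV :: 'a set)" and "inj_on \<iota> (carrier H)"
    and "infinite (UNIV :: 'm set)" and "inj_on \<kappa> (carrier H)"
  shows
    "(pointed K H \<longleftrightarrow>
       (\<forall>A :: ('k, 'a, 'h) comodule. left_comodule_algebra K H A \<and> left_H_simple K H A \<longrightarrow>
         (\<forall>(M :: ('k, 'm, 'h) comodule) act. left_relative_hopf_module K H A M act \<longrightarrow>
           free_left_module A M act))) \<and>
     (pointed K H \<longleftrightarrow>
       (\<forall>A :: ('k, 'a, 'h) comodule. left_comodule_algebra K H A \<and> right_H_simple K H A \<longrightarrow>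
         (\<forall>(M :: ('k, 'm, 'h) comodule) act. right_relative_hopf_module K H A M act \<longrightarrow>
           free_right_module A M act)))"
proof (intro conjI iffI)
  show "pointed K H" if "\<forall>A :: ('k, 'a, 'h) comodule. left_comodule_algebra K H A \<and> left_H_simple K H A \<longrightarrow>
         (\<forall>(M :: ('k, 'm, 'h) comodule) act. left_relative_hopf_module K H A M act \<longrightarrow> free_left_module A M act)"
    using hopf_algebra.not_pointed_left[OF assms(1) _ assms(2-5)] that by blast
  show "pointed K H" if "\<forall>A :: ('k, 'a, 'h) comodule. left_comodule_algebra K H A \<and> right_H_simple K H A \<longrightarrow>
         (\<forall>(M :: ('k, 'm, 'h) comodule) act. right_relative_hopf_module K H A M act \<longrightarrow> free_right_module A M act)"
    using hopf_algebra.not_pointed_right[OF assms(1) _ assms(2-5)] that by blast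
qed (use pointed_imp_free_left[OF assms(1)] pointed_imp_free_right[OF assms(1)] in blast)+

end
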